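(* Let $M$ be a smooth manifold of positive dimension with a volume form $\boldsymbol\rho=\rho(x)|Dx|$, let $\lambda\in\mathbb R$ with $\lambda\neq\frac12$, and let $n\ge 1$. Consider the family of regular $\mathrm{sdiff}_{\boldsymbol\rho}(M)$-equivariant pencil liftings $\widehat\Pi_\lambda$ of $\mathcal D^{(n)}_\lambda(M)$ given by $$\widehat\Pi_\lambda(\Delta)=A(\widehat w)\widehat P_\lambda(\Delta)+B(\widehat w)\big(\widehat P_\lambda(\Delta)\big)^*+C(\widehat w)\big(\widehat P_\lambda(\Delta)\big)(1)+D(\widehat w)\big(\widehat P_\lambda(\Delta)\big)^*(1),\qquad(\dagger)$$ where $A(\widehat w)=1-b(\widehat w-\lambda)$, $B(\widehat w)=(-1)^nb(\widehat w-\lambda)$, $C(\widehat w)=\sum_{k=1}^nc_k(\widehat w-\lambda)^k$, $D(\widehat w)=\sum_{k=1}^nd_k(\widehat w-\lambda)^k$ and $b,c_k,d_k\in\mathbb R$ are arbitrary. Then: 1. The family $(\dagger)$ contains the distinguished pencil lifting $$\widehat\Pi^{\rm disting}_\lambda(\Delta)=\frac{\widehat w+\lambda-1}{2\lambda-1}\,\widehat P_\lambda(\Delta)+(-1)^n\frac{\lambda-\widehat w}{2\lambda-1}\,\big(\widehat P_\lambda(\Delta)\big)^*,$$ and it is self-adjoint if $n$ is even and anti-self-adjoint if $n$ is odd, i.e. $\big(\widehat\Pi^{\rm disting}_\lambda(\Delta)\big)^*=(-1)^n\widehat\Pi^{\rm disting}_\lambda(\Delta)$ for all $\Delta\in\mathcal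 D^{(n)}_\lambda(M)$. Suppose in addition $n\ge2$. Then: 2. The map from $\mathcal D^{(n)}_\lambda(M)$ to $\mathcal D^{(n)}(\widehat M)$ modulo $\mathcal V^{(n-2)}(M)$ induced by $\widehat\Pi^{\rm disting}_\lambda$ does not depend on the volume form $\boldsymbol\rho$; in other words, the terms of $\widehat\Pi^{\rm disting}_\lambda(\Delta)$ with spatial derivatives of order $n$ and $n-1$ do not depend on the choice of volume form. 3. This induced map to $\mathcal D^{(n)}(\widehat M)$ modulo $\mathcal V^{(n-2)}(M)$ is $\mathrm{diff}(M)$-equivariant. 4. If a pencil lifting from the family $(\dagger)$ induces a $\mathrm{diff}(M)$-equivariant map to $\mathcal D^{(n)}(\widehat M)$ modulo $\mathcal V^{(n-2)}(M)$, then this induced map coincides with the one induced by $\widehat\Pi^{\rm disting}_\lambda$.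
   Context: Densities. $\mathcal F_\lambda(M)$ is the space of smooth densities $s(x)|Dx|^\lambda$ of weight $\lambda$ on $M$; $\mathcal F(M)=\bigoplus_\lambda\mathcal F_\lambda(M)$ is the (commutative) algebra of densities. The weight operator is $\widehat w(\boldsymbol s)=\lambda\boldsymbol s$ for $\boldsymbol s\in\mathcal F_\lambda(M)$. Operators. $\mathcal D^{(n)}_\lambda(M)$ is the space of linear differential operators of order $\le n$ from $\mathcal F_\lambda(M)$ to $\mathcal F_\lambda(M)$. $\mathcal D^{(n)}(\widehat M)$ is the space of weight-zero (preserving each $\mathcal F_\mu(M)$) differential operators of order $\le n$ on the algebra $\mathcal F(M)$: order $0$ means multiplication by a density, and $L$ has order $\le n+1$ if $[L,\boldsymbol s]$ has order $\le n$ for every density $\boldsymbol s$. Locally these are polynomials in $\partial_i$ and $\widehat w$ of total degree $\le n$ with coefficients functions of $x$. An operator $\widehat\Delta$ on $\mathcal F(M)$ is identified with the pencil $\{\widehat\Delta|_{\widehat w=\mu}\}_\mu$ of its restrictions to $\mathcal F_\mu(M)$. Vertical operators. An operator on $\mathcal F(M)$ is vertical if it commutes with multiplication by every function on $M$; weight-zero vertical operators are $\sum_i\widehat w^ic_i(x)$. $\mathcal V^{(0)}(M)$ is the space of vertical operators, and inductively $\widehat\Delta\in\mathcal V^{(k)}(M)$ if $[\widehat\Delta,f]\in\mathcal V^{(k-1)}(M)$ for every function $f$ on $M$ (i.e. spatial order $\le k$ with vertical coefficients). "$\mathcal D^{(n)}(\widehat M)$ modulo $\mathcal V^{(n-2)}(M)$"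 is the quotient of $\mathcal D^{(n)}(\widehat M)$ by its intersection with $\mathcal V^{(n-2)}(M)$. Pencil liftings. A pencil lifting of $\mathcal D^{(n)}_\lambda(M)$ is a linear map $\widehat\Pi$ from $\mathcal D^{(n)}_\lambda(M)$ to weight-zero operators on $\mathcal F(M)$ with $\widehat\Pi(\Delta)|_{\widehat w=\lambda}=\Delta$; it is regular if it takes values in $\mathcal D^{(n)}(\widehat M)$. For a Lie algebra $\mathcal G$ of vector fields, a map $\widehat\Pi$ is $\mathcal G$-equivariant if $\mathrm{ad}_{\mathbf K}(\widehat\Pi(\Delta))=\widehat\Pi(\mathrm{ad}_{\mathbf K}\Delta)$ for all $\mathbf K\in\mathcal G$, where $\mathrm{ad}_{\mathbf K}$ is the commutator with the Lie derivative $\mathcal L_{\mathbf K}$ on densities (and the induced action on quotients). $\mathrm{diff}(M)$ is the Lie algebra of all vector fields on $M$; $\mathrm{sdiff}_{\boldsymbol\rho}(M)$ that of vector fields with $\mathcal L_{\mathbf X}\boldsymbol\rho=0$. Adjoint. For compactly supported densities $\boldsymbol s_i=s_i|Dx|^{\lambda_i}$, $\langle\boldsymbol s_1,\boldsymbol s_2\rangle=\int_Ms_1s_2|Dx|$ if $\lambda_1+\lambda_2=1$ and $0$ otherwise; $^*$ denotes the adjoint for this pairing. In particular $\partial_i^*=-\partial_i$, $\widehat w^*=1-\widehat w$. The lifting $\widehat P_\lambda$. $\widehat P_\lambda(\Delta)|_{\widehat w=\mu}=\boldsymbol\rho^{\mu-\lambda}\circ\Delta\circ\boldsymbol\rho^{\lambda-\mu}$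 for all $\mu$; locally, for $\Delta=\sum_kS^{i_1\dots i_k}\partial_{i_1}\cdots\partial_{i_k}$, $\widehat P_\lambda(\Delta)=\sum_kS^{i_1\dots i_k}(\partial_{i_1}+(\widehat w-\lambda)\Gamma_{i_1})\cdots(\partial_{i_k}+(\widehat w-\lambda)\Gamma_{i_k})$ with $\Gamma_i=-\partial_i\log\rho$. The expressions $(\cdot)(1)$ denote the function obtained by applying the operator to the constant function $1\in\mathcal F_0(M)$, acting by multiplication. *)

theory Defs
  imports
    "HOL-Analysis.Analysis"
    "HOL-Library.Function_Algebras"
    "HOL-Library.Poly_Mapping"
begin

section \<open>Smooth functions on open subsets of Euclidean space\<close>

definition partial :: "'d::finite \<Rightarrow> (real^'d \<Rightarrow> 'b::real_normed_vector) \<Rightarrow> real^'d \<Rightarrow> 'b" where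
  "partial i f x = frechet_derivative f (at x) (axis i 1)"

fun partials :: "'d::finite list \<Rightarrow> (real^'d \<Rightarrow> 'b::real_normed_vector) \<Rightarrow> real^'d \<Rightarrow> 'b" where
  "partials [] f = f"
| "partials (i # I) f = partial i (partials I f)"

primrec Ck_on :: "nat \<Rightarrow> (real^'d::finite) set \<Rightarrow> (real^'d \<Rightarrow> 'b::real_normed_vector) \<Rightarrow> bool" where
  "Ck_on 0 U f \<longleftrightarrow> continuous_on U f"
| "Ck_on (Suc k) U f \<longleftrightarrow>
     (\<forall>x\<in>U. f differentiable (at x)) \<and> (\<forall>i. Ck_on k U (partial i f))"

definition smooth_on :: "(real^'d::finite) set \<Rightarrow> (real^'d \<Rightarrow> 'b::real_normed_vector) \<Rightarrow> bool" where
  "smooth_on U f \<longleftrightarrow> (\<forall>k. Ck_on k U f)"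


section \<open>Smooth manifolds\<close>

text \<open>A chart is a domain together with a coordinate map; values of the coordinate map outside
  the domain are irrelevant. The dimension of the manifold is the cardinality of the
  (finite, nonempty) index type \<open>'d\<close>, hence positive.\<close>

type_synonym ('a, 'd) chart = "'a set \<times> ('a \<Rightarrow> real^'d)"

definition chart_dom :: "('a, 'd::finite) chart \<Rightarrow> 'a set" where
  "chart_dom \<kappa> = fst \<kappa>"

definition coord :: "('a, 'd::finite) chart \<Rightarrow> 'a \<Rightarrow> real^'d" where
  "coord \<kappa> = snd \<kappa>"

definition target :: "('a, 'd::finite) chart \<Rightarrow> (real^'d) set" where
  "target \<kappa> = coord \<kappa> ` chart_dom \<kappa>"

definition transition :: "('a, 'd::finite) chart \<Rightarrow> ('a, 'd) chart \<Rightarrow> real^'d \<Rightarrow> real^'d" where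
  "transition \<kappa> \<kappa>' = coord \<kappa>' \<circ> inv_into (chart_dom \<kappa>) (coord \<kappa>)"

definition overlap :: "('a, 'd::finite) chart \<Rightarrow> ('a, 'd) chart \<Rightarrow> (real^'d) set" where
  "overlap \<kappa> \<kappa>' = coord \<kappa> ` (chart_dom \<kappa> \<inter> chart_dom \<kappa>')"

definition jacobian :: "('a, 'd::finite) chart \<Rightarrow> ('a, 'd) chart \<Rightarrow> real^'d \<Rightarrow> real" where
  "jacobian \<kappa> \<kappa>' x = det (matrix (frechet_derivative (transition \<kappa> \<kappa>') (at x)))"

definition smooth_manifold :: "'a topology \<Rightarrow> ('a, 'd::finite) chart set \<Rightarrow> bool" where
  "smooth_manifold T A \<longleftrightarrow>
     Hausdorff_space T \<and> second_countable T \<and> (\<Union>\<kappa>\<in>A. chart_dom \<kappa>) = topspace T \<and>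
     (\<forall>\<kappa>\<in>A. openin T (chart_dom \<kappa>) \<and> open (target \<kappa>) \<and>
        homeomorphic_map (subtopology T (chart_dom \<kappa>)) (top_of_set (target \<kappa>)) (coord \<kappa>)) \<and>
     (\<forall>\<kappa>\<in>A. \<forall>\<kappa>'\<in>A. smooth_on (overlap \<kappa> \<kappa>') (transition \<kappa> \<kappa>'))"


section \<open>Densities and the algebra of densities\<close>

text \<open>A density \<open>s(x)|Dx|^\<mu>\<close> is given by its coefficient functions \<open>s \<kappa> x\<close>, where \<open>x\<close> ranges over
  the coordinates of the chart \<open>\<kappa>\<close>. Coefficients are put to zero outside the atlas and outside
  the chart targets, so that densities are determined by their values as HOL functions.
  In particular \<open>densities A 0\<close> is the algebra of smooth functions on the manifold.\<close>

type_synonym ('a, 'd) density = "('a, 'd) chart \<Rightarrow> real^'d \<Rightarrow> real"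

definition densities :: "('a, 'd::finite) chart set \<Rightarrow> real \<Rightarrow> ('a, 'd) density set" where
  "densities A \<mu> = {s.
     (\<forall>\<kappa>\<in>A. smooth_on (target \<kappa>) (s \<kappa>)) \<and>
     (\<forall>\<kappa>\<in>A. \<forall>\<kappa>'\<in>A. \<forall>x\<in>overlap \<kappa> \<kappa>'.
        s \<kappa> x = \<bar>jacobian \<kappa> \<kappa>' x\<bar> powr \<mu> * s \<kappa>' (transition \<kappa> \<kappa>' x)) \<and>
     (\<forall>\<kappa> x. \<kappa> \<notin> A \<or> x \<notin> target \<kappa> \<longrightarrow> s \<kappa> x = 0)}"

definition volume_form :: "('a, 'd::finite) chart set \<Rightarrow> ('a, 'd) density \<Rightarrow> bool" where
  "volume_form A \<rho> \<longleftrightarrow> \<rho> \<in> densities A 1 \<and> (\<forall>\<kappa>\<in>A. \<forall>x\<in>target \<kappa>. \<rho> \<kappa> x > 0)"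

text \<open>Since \<open>0 powr a = 0\<close>, this vanishes wherever \<open>\<rho>\<close> does.\<close>

definition density_powr :: "('a, 'd::finite) density \<Rightarrow> real \<Rightarrow> ('a, 'd) density" where
  "density_powr \<rho> a = (\<lambda>\<kappa> x. \<rho> \<kappa> x powr a)"

definition one_density :: "('a, 'd::finite) chart set \<Rightarrow> ('a, 'd) density" where
  "one_density A = (\<lambda>\<kappa> x. if \<kappa> \<in> A \<and> x \<in> target \<kappa> then 1 else 0)"

text \<open>Finitely supported families indexed by the weight; the product of \<^typ>\<open>real \<Rightarrow>\<^sub>0 ('a, 'd) density\<close>
  is the convolution over the weights of the pointwise product of coefficients, which is the product
  of densities.\<close>

type_synonym ('a, 'd) densum = "real \<Rightarrow>\<^sub>0 ('a, 'd) density"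

definition density_algebra :: "('a, 'd::finite) chart set \<Rightarrow> ('a, 'd) densum set" where
  "density_algebra A = {s. \<forall>\<mu>. Poly_Mapping.lookup s \<mu> \<in> densities A \<mu>}"


section \<open>Integration and the pairing\<close>

definition supp :: "'a topology \<Rightarrow> ('a, 'd::finite) chart set \<Rightarrow> ('a, 'd) density \<Rightarrow> 'a set" where
  "supp T A s = T closure_of {p. \<exists>\<kappa>\<in>A. p \<in> chart_dom \<kappa> \<and> s \<kappa> (coord \<kappa> p) \<noteq> 0}"

text \<open>The integral of a compactly supported density of weight 1: decompose it into
  a finite sum of densities compactly supported in chart domains (for instance by a partition of
  unity) and integrate each summand in its chart. The value does not depend on the decomposition.\<close>

definition density_integral :: "'a topology \<Rightarrow> ('a, 'd::finite) chart set \<Rightarrow> ('a, 'd) density \<Rightarrow> real" where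
  "density_integral T A s = (THE r. \<exists>ds :: (('a, 'd) chart \<times> ('a, 'd) density) list.
     (\<forall>(\<kappa>, e)\<in>set ds. \<kappa> \<in> A \<and> e \<in> densities A 1 \<and>
        compactin T (supp T A e) \<and> supp T A e \<subseteq> chart_dom \<kappa>) \<and>
     s = (\<Sum>(\<kappa>, e)\<leftarrow>ds. e) \<and>
     r = (\<Sum>(\<kappa>, e)\<leftarrow>ds. integral (target \<kappa>) (e \<kappa>)))"

definition compact_density_algebra ::
  "'a topology \<Rightarrow> ('a, 'd::finite) chart set \<Rightarrow> ('a, 'd) densum set" where
  "compact_density_algebra T A =
     {s \<in> density_algebra A. \<forall>\<mu>. compactin T (supp T A (Poly_Mapping.lookup s \<mu>))}"

text \<open>Only components of complementary weights \<open>\<mu>\<close> and \<open>1 - \<mu>\<close> are paired.\<close>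

definition pairing ::
  "'a topology \<Rightarrow> ('a, 'd::finite) chart set \<Rightarrow> ('a, 'd) densum \<Rightarrow> ('a, 'd) densum \<Rightarrow> real" where
  "pairing T A s t =
     (\<Sum>\<mu>\<in>Poly_Mapping.keys s. density_integral T A (Poly_Mapping.lookup s \<mu> * Poly_Mapping.lookup t (1 - \<mu>)))"


section \<open>Operators on the algebra of densities\<close>

text \<open>Operators are HOL functions of which only the restriction to the relevant carrier
  (\<^const>\<open>density_algebra\<close> or \<^const>\<open>densities\<close>) is meaningful; equality of operators is
  therefore equality on the carrier.\<close>

type_synonym ('a, 'd) operator = "('a, 'd) densum \<Rightarrow> ('a, 'd) densum"

definition op_eq ::
  "('a, 'd::finite) chart set \<Rightarrow> ('a, 'd) operator \<Rightarrow> ('a, 'd) operator \<Rightarrow> bool" where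
  "op_eq A L L' \<longleftrightarrow> (\<forall>s\<in>density_algebra A. L s = L' s)"

definition scale_density :: "real \<Rightarrow> ('a, 'd::finite) density \<Rightarrow> ('a, 'd) density" where
  "scale_density r s = (\<lambda>\<kappa> x. r * s \<kappa> x)"

text \<open>\<open>weight_fun a\<close> is the operator \<open>a(w)\<close>, \<open>w\<close> being the weight operator, i.e. multiplication by
  \<open>a \<mu>\<close> on densities of weight \<open>\<mu>\<close>. For constant \<open>a\<close> it is the scalar multiplication.\<close>

definition weight_fun :: "(real \<Rightarrow> real) \<Rightarrow> ('a, 'd::finite) operator" where
  "weight_fun a s = Poly_Mapping.mapp (\<lambda>\<mu>. scale_density (a \<mu>)) s"

definition linear_operators :: "('a, 'd::finite) chart set \<Rightarrow> ('a, 'd) operator set" where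
  "linear_operators A = {L.
     (\<forall>s\<in>density_algebra A. L s \<in> density_algebra A) \<and>
     (\<forall>s\<in>density_algebra A. \<forall>t\<in>density_algebra A. L (s + t) = L s + L t) \<and>
     (\<forall>s\<in>density_algebra A. \<forall>r. L (weight_fun (\<lambda>_. r) s) = weight_fun (\<lambda>_. r) (L s))}"

definition weight_zero_operators :: "('a, 'd::finite) chart set \<Rightarrow> ('a, 'd) operator set" where
  "weight_zero_operators A = {L \<in> linear_operators A.
     \<forall>\<mu>. \<forall>d\<in>densities A \<mu>. \<exists>e\<in>densities A \<mu>. L (Poly_Mapping.single \<mu> d) = Poly_Mapping.single \<mu> e}"

definition restrict_weight ::
  "('a, 'd::finite) operator \<Rightarrow> real \<Rightarrow> ('a, 'd) density \<Rightarrow> ('a, 'd) density" where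
  "restrict_weight L \<mu> d = Poly_Mapping.lookup (L (Poly_Mapping.single \<mu> d)) \<mu>"

definition of_pencil :: "(real \<Rightarrow> ('a, 'd::finite) density \<Rightarrow> ('a, 'd) density) \<Rightarrow> ('a, 'd) operator" where
  "of_pencil D s = Poly_Mapping.mapp D s"

definition comm_mult :: "('a, 'd::finite) operator \<Rightarrow> ('a, 'd) densum \<Rightarrow> ('a, 'd) operator" where
  "comm_mult L s = (\<lambda>t. L (s * t) - s * L t)"

primrec order_le :: "('a, 'd::finite) chart set \<Rightarrow> nat \<Rightarrow> ('a, 'd) operator \<Rightarrow> bool" where
  "order_le A 0 L \<longleftrightarrow> (\<exists>s\<in>density_algebra A. op_eq A L (\<lambda>t. s * t))"
| "order_le A (Suc n) L \<longleftrightarrow> (\<forall>s\<in>density_algebra A. order_le A n (comm_mult L s))"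

text \<open>In every chart, a polynomial of total degree at most \<open>n\<close> in the partial derivatives and in the
  weight operator.\<close>

definition locally_polynomial ::
  "('a, 'd::finite) chart set \<Rightarrow> nat \<Rightarrow> ('a, 'd) operator \<Rightarrow> bool" where
  "locally_polynomial A n L \<longleftrightarrow> (\<forall>\<kappa>\<in>A. \<exists>S :: nat \<Rightarrow> 'd list \<Rightarrow> real^'d \<Rightarrow> real.
     (\<forall>j I. smooth_on (target \<kappa>) (S j I)) \<and>
     (\<forall>\<mu>. \<forall>d\<in>densities A \<mu>. \<forall>x\<in>target \<kappa>. restrict_weight L \<mu> d \<kappa> x =
        (\<Sum>(j, I)\<in>{(j, I). j + length I \<le> n}. S j I x * \<mu> ^ j * partials I (d \<kappa>) x)))"

text \<open>The commutator condition alone does not imply polynomiality in the weight: for a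
  \<open>\<rat>\<close>-linear but not \<open>\<real>\<close>-linear \<open>a\<close>, the operator \<open>weight_fun a\<close> satisfies \<open>order_le A 1\<close>.
  Such operators are excluded by \<^const>\<open>locally_polynomial\<close>.\<close>

definition hat_diff_ops :: "('a, 'd::finite) chart set \<Rightarrow> nat \<Rightarrow> ('a, 'd) operator set" where
  "hat_diff_ops A n =
     {L \<in> weight_zero_operators A. order_le A n L \<and> locally_polynomial A n L}"

primrec vertical_order :: "('a, 'd::finite) chart set \<Rightarrow> nat \<Rightarrow> ('a, 'd) operator \<Rightarrow> bool" where
  "vertical_order A 0 L \<longleftrightarrow>
     (\<forall>f\<in>densities A 0. op_eq A (comm_mult L (Poly_Mapping.single 0 f)) (\<lambda>_. 0))"
| "vertical_order A (Suc k) L \<longleftrightarrow>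
     (\<forall>f\<in>densities A 0. vertical_order A k (comm_mult L (Poly_Mapping.single 0 f)))"

definition vertical_ops :: "('a, 'd::finite) chart set \<Rightarrow> nat \<Rightarrow> ('a, 'd) operator set" where
  "vertical_ops A k = {L \<in> linear_operators A. vertical_order A k L}"

text \<open>Equality of the classes of \<open>L\<close> and \<open>L'\<close> in the quotient of \<open>hat_diff_ops A n\<close> by its
  intersection with \<open>vertical_ops A k\<close>.\<close>

definition eq_modulo_vertical ::
  "('a, 'd::finite) chart set \<Rightarrow> nat \<Rightarrow> nat \<Rightarrow> ('a, 'd) operator \<Rightarrow> ('a, 'd) operator \<Rightarrow> bool" where
  "eq_modulo_vertical A n k L L' \<longleftrightarrow>
     L \<in> hat_diff_ops A n \<and> L' \<in> hat_diff_ops A n \<and>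
     (\<lambda>s. L s - L' s) \<in> hat_diff_ops A n \<inter> vertical_ops A k"

text \<open>The pairing on compactly supported densities determines the adjoint among differential
  operators, as these are local.\<close>

definition adjoint_op ::
  "'a topology \<Rightarrow> ('a, 'd::finite) chart set \<Rightarrow> ('a, 'd) operator \<Rightarrow> ('a, 'd) operator" where
  "adjoint_op T A L = (SOME L'. (\<exists>m. L' \<in> hat_diff_ops A m) \<and>
     (\<forall>s\<in>compact_density_algebra T A. \<forall>t\<in>compact_density_algebra T A.
        pairing T A (L s) t = pairing T A s (L' t)))"


section \<open>Differential operators on densities of fixed weight\<close>

definition diff_ops ::
  "('a, 'd::finite) chart set \<Rightarrow> nat \<Rightarrow> real \<Rightarrow> (('a, 'd) density \<Rightarrow> ('a, 'd) density) set" where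
  "diff_ops A n \<mu> = {D.
     (\<forall>d\<in>densities A \<mu>. D d \<in> densities A \<mu>) \<and>
     (\<forall>\<kappa>\<in>A. \<exists>S :: 'd list \<Rightarrow> real^'d \<Rightarrow> real.
        (\<forall>I. smooth_on (target \<kappa>) (S I)) \<and>
        (\<forall>d\<in>densities A \<mu>. \<forall>x\<in>target \<kappa>.
           D d \<kappa> x = (\<Sum>I | length I \<le> n. S I x * partials I (d \<kappa>) x)))}"


section \<open>Vector fields and Lie derivatives\<close>

type_synonym ('a, 'd) vfield = "('a, 'd) chart \<Rightarrow> real^'d \<Rightarrow> real^'d"

definition vector_fields :: "('a, 'd::finite) chart set \<Rightarrow> ('a, 'd) vfield set" where
  "vector_fields A = {K.
     (\<forall>\<kappa>\<in>A. smooth_on (target \<kappa>) (K \<kappa>)) \<and>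
     (\<forall>\<kappa>\<in>A. \<forall>\<kappa>'\<in>A. \<forall>x\<in>overlap \<kappa> \<kappa>'.
        K \<kappa>' (transition \<kappa> \<kappa>' x) = frechet_derivative (transition \<kappa> \<kappa>') (at x) (K \<kappa> x))}"

definition lie_density ::
  "('a, 'd::finite) chart set \<Rightarrow> ('a, 'd) vfield \<Rightarrow> real \<Rightarrow> ('a, 'd) density \<Rightarrow> ('a, 'd) density" where
  "lie_density A K \<mu> d = (\<lambda>\<kappa> x. if \<kappa> \<in> A \<and> x \<in> target \<kappa>
     then (\<Sum>i\<in>UNIV. K \<kappa> x $ i * partial i (d \<kappa>) x)
          + \<mu> * (\<Sum>i\<in>UNIV. partial i (\<lambda>y. K \<kappa> y $ i) x) * d \<kappa> x
     else 0)"

definition lie_op :: "('a, 'd::finite) chart set \<Rightarrow> ('a, 'd) vfield \<Rightarrow> ('a, 'd) operator" where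
  "lie_op A K = of_pencil (lie_density A K)"

definition ad_op ::
  "('a, 'd::finite) chart set \<Rightarrow> ('a, 'd) vfield \<Rightarrow> ('a, 'd) operator \<Rightarrow> ('a, 'd) operator" where
  "ad_op A K L = (\<lambda>s. lie_op A K (L s) - L (lie_op A K s))"

definition ad_weight ::
  "('a, 'd::finite) chart set \<Rightarrow> ('a, 'd) vfield \<Rightarrow> real \<Rightarrow>
     (('a, 'd) density \<Rightarrow> ('a, 'd) density) \<Rightarrow> ('a, 'd) density \<Rightarrow> ('a, 'd) density" where
  "ad_weight A K \<mu> D = (\<lambda>d. lie_density A K \<mu> (D d) - D (lie_density A K \<mu> d))"

definition sdiff :: "('a, 'd::finite) chart set \<Rightarrow> ('a, 'd) density \<Rightarrow> ('a, 'd) vfield set" where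
  "sdiff A \<rho> = {K \<in> vector_fields A. lie_density A K 1 \<rho> = 0}"


section \<open>Pencil liftings\<close>

type_synonym ('a, 'd) lifting = "(('a, 'd) density \<Rightarrow> ('a, 'd) density) \<Rightarrow> ('a, 'd) operator"

text \<open>Linearity is stated for operators given up to equality on their carriers; it includes that
  the value depends only on the restriction of \<open>D\<close> to \<^term>\<open>densities A lam\<close>.\<close>

definition pencil_lifting ::
  "('a, 'd::finite) chart set \<Rightarrow> nat \<Rightarrow> real \<Rightarrow> ('a, 'd) lifting \<Rightarrow> bool" where
  "pencil_lifting A n lam \<Phi> \<longleftrightarrow>
     (\<forall>D\<in>diff_ops A n lam. \<Phi> D \<in> weight_zero_operators A \<and>
        (\<forall>d\<in>densities A lam. restrict_weight (\<Phi> D) lam d = D d)) \<and>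
     (\<forall>D1\<in>diff_ops A n lam. \<forall>D2\<in>diff_ops A n lam. \<forall>D3\<in>diff_ops A n lam. \<forall>r.
        (\<forall>d\<in>densities A lam. D3 d = scale_density r (D1 d) + D2 d) \<longrightarrow>
        op_eq A (\<Phi> D3) (\<lambda>s. weight_fun (\<lambda>_. r) (\<Phi> D1 s) + \<Phi> D2 s))"

definition regular_lifting ::
  "('a, 'd::finite) chart set \<Rightarrow> nat \<Rightarrow> real \<Rightarrow> ('a, 'd) lifting \<Rightarrow> bool" where
  "regular_lifting A n lam \<Phi> \<longleftrightarrow>
     pencil_lifting A n lam \<Phi> \<and> (\<forall>D\<in>diff_ops A n lam. \<Phi> D \<in> hat_diff_ops A n)"

definition equivariant ::
  "('a, 'd::finite) chart set \<Rightarrow> nat \<Rightarrow> real \<Rightarrow> ('a, 'd) vfield set \<Rightarrow> ('a, 'd) lifting \<Rightarrow> bool" where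
  "equivariant A n lam G \<Phi> \<longleftrightarrow>
     (\<forall>K\<in>G. \<forall>D\<in>diff_ops A n lam. op_eq A (ad_op A K (\<Phi> D)) (\<Phi> (ad_weight A K lam D)))"

definition equivariant_modulo_vertical ::
  "('a, 'd::finite) chart set \<Rightarrow> nat \<Rightarrow> nat \<Rightarrow> real \<Rightarrow> ('a, 'd) vfield set \<Rightarrow> ('a, 'd) lifting \<Rightarrow> bool" where
  "equivariant_modulo_vertical A n k lam G \<Phi> \<longleftrightarrow>
     (\<forall>K\<in>G. \<forall>D\<in>diff_ops A n lam.
        eq_modulo_vertical A n k (ad_op A K (\<Phi> D)) (\<Phi> (ad_weight A K lam D)))"

definition same_modulo_vertical ::
  "('a, 'd::finite) chart set \<Rightarrow> nat \<Rightarrow> nat \<Rightarrow> real \<Rightarrow> ('a, 'd) lifting \<Rightarrow> ('a, 'd) lifting \<Rightarrow> bool" where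
  "same_modulo_vertical A n k lam \<Phi> \<Psi> \<longleftrightarrow>
     (\<forall>D\<in>diff_ops A n lam. eq_modulo_vertical A n k (\<Phi> D) (\<Psi> D))"

definition P_lift :: "('a, 'd::finite) density \<Rightarrow> real \<Rightarrow> ('a, 'd) lifting" where
  "P_lift \<rho> lam D =
     of_pencil (\<lambda>\<mu> d. density_powr \<rho> (\<mu> - lam) * D (density_powr \<rho> (lam - \<mu>) * d))"

definition value_at_one ::
  "('a, 'd::finite) chart set \<Rightarrow> ('a, 'd) operator \<Rightarrow> ('a, 'd) densum" where
  "value_at_one A L = L (Poly_Mapping.single 0 (one_density A))"

definition family_lift ::
  "'a topology \<Rightarrow> ('a, 'd::finite) chart set \<Rightarrow> ('a, 'd) density \<Rightarrow> real \<Rightarrow> nat \<Rightarrow>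
     real \<Rightarrow> (nat \<Rightarrow> real) \<Rightarrow> (nat \<Rightarrow> real) \<Rightarrow> ('a, 'd) lifting" where
  "family_lift T A \<rho> lam n b c d D = (\<lambda>s.
     weight_fun (\<lambda>\<mu>. 1 - b * (\<mu> - lam)) (P_lift \<rho> lam D s)
     + weight_fun (\<lambda>\<mu>. (-1) ^ n * b * (\<mu> - lam)) (adjoint_op T A (P_lift \<rho> lam D) s)
     + weight_fun (\<lambda>\<mu>. \<Sum>k=1..n. c k * (\<mu> - lam) ^ k)
         (value_at_one A (P_lift \<rho> lam D) * s)
     + weight_fun (\<lambda>\<mu>. \<Sum>k=1..n. d k * (\<mu> - lam) ^ k)
         (value_at_one A (adjoint_op T A (P_lift \<rho> lam D)) * s))"

definition disting_lift ::
  "'a topology \<Rightarrow> ('a, 'd::finite) chart set \<Rightarrow> ('a, 'd) density \<Rightarrow> real \<Rightarrow> nat \<Rightarrow> ('a, 'd) lifting" where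
  "disting_lift T A \<rho> lam n D = (\<lambda>s.
     weight_fun (\<lambda>\<mu>. (\<mu> + lam - 1) / (2 * lam - 1)) (P_lift \<rho> lam D s)
     + weight_fun (\<lambda>\<mu>. (-1) ^ n * ((lam - \<mu>) / (2 * lam - 1)))
         (adjoint_op T A (P_lift \<rho> lam D) s))"

end

theory Submission
  imports Defs
begin

text \<open>The volume form identifies densities of every weight with functions, so that an operator on the
  algebra of densities becomes a pencil of operators on functions. The lifting of \<open>\<Delta>\<close> by \<open>\<rho>\<close> becomes a
  constant pencil \<open>E\<close>, its adjoint becomes the constant pencil \<open>E'\<close> of the adjoint with respect to
  \<open>\<integral> f g \<rho>\<close>, and \<open>E - (-1)\<^sup>n E'\<close> has order at most \<open>n - 1\<close>.

  For the Lie derivative along \<open>K\<close> the pencil of \<open>L\<^sub>K\<close> at weight \<open>\<mu>\<close> is \<open>K + \<mu> h\<close> with \<open>h = div K\<close>. The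
  equivariance defect of the distinguished lifting is therefore
  \<open>(\<mu> - \<lambda>) (\<mu> + \<lambda> - 1) / (2 \<lambda> - 1)\<close> times \<open>[h, E - (-1)\<^sup>n E']\<close>, of order at most \<open>n - 2\<close>. For a general
  member of the family the defect is \<open>(\<lambda> - \<mu>) (1 + b (2 \<lambda> - 1)) [E, h]\<close> up to order \<open>n - 2\<close>; taking
  \<open>E = K\<^sup>n\<close> with \<open>K h \<noteq> 0\<close> and commuting \<open>n - 1\<close> more times with \<open>h\<close> forces \<open>b = -1 / (2 \<lambda> - 1)\<close>.

  Replacing \<open>\<rho>\<close> by \<open>\<gamma> \<rho>\<close> conjugates the pencils \<open>E\<close> and \<open>E'\<close> by \<open>\<gamma>\<close> to the powers \<open>\<mu> - \<lambda>\<close> and \<open>\<mu> + \<lambda> - 1\<close>.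
  As \<open>\<gamma>\<^sup>a E \<gamma>\<^sup>-\<^sup>a = E - a [E, ln \<gamma>]\<close> up to order \<open>n - 2\<close>, the distinguished lifting changes by a multiple of
  \<open>[E - (-1)\<^sup>n E', ln \<gamma>]\<close>, again of order at most \<open>n - 2\<close>.\<close>

section \<open>Calculus of smooth functions\<close>

text \<open>The coefficients of the distinguished lifting interpolate linearly:
  \<open>(\<mu> + lam - 1) / (2 * lam - 1)\<close> is 1 at \<open>lam\<close> and 0 at
  \<open>1 - lam\<close>, and the other one, up to sign, the reverse. The pencil is
  \<open>\<Delta>\<close> at \<open>lam\<close> and \<open>(-1)\<^sup>n\<close> times its adjoint at
  \<open>1 - lam\<close>, the weight complementary to \<open>lam\<close> in the pairing; the two
  weights coincide only for \<open>lam = 1 / 2\<close>, and both are roots of the equivariance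
  defect. Two obstacles shape the proof. Integrals and adjoints are given by a description and a
  choice. So the integral has to be shown independent of the decomposition, by change of variables
  and partitions of unity, and the adjoint has to be built from local formulas and shown unique, by
  integrals of nonnegative test functions. Next, the quotient asks for total degree at most
  \<open>n\<close> in derivatives and weight together, while a linear factor in the weight times an
  operator of order \<open>n\<close> has degree \<open>n + 1\<close>; the lower order of
  \<open>E - (-1)\<^sup>n E'\<close> restores the bound. Verticality, in contrast, can be tested
  weight by weight.\<close>

lemma partial_eqI:
  assumes "(f has_derivative f') (at x)"
  shows "partial i f x = f' (axis i 1)"
  using frechet_derivative_at[OF assms] by (simp add: partial_def)

lemma partial_cong_open:
  assumes "open U" "x \<in> U" "\<And>y. y \<in> U \<Longrightarrow> f y = g y"
  shows "partial i f x = partial i g x"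
proof -
  have "(f has_derivative D) (at x) \<longleftrightarrow> (g has_derivative D) (at x)" for D
    using has_derivative_transform_within_open[OF _ assms(1,2), of f D UNIV g]
      has_derivative_transform_within_open[OF _ assms(1,2), of g D UNIV f] assms(3) by auto
  then show ?thesis by (simp add: partial_def frechet_derivative_def)
qed

lemma differentiable_cong_open:
  assumes "open U" "x \<in> U" "\<And>y. y \<in> U \<Longrightarrow> f y = g y" "f differentiable (at x)"
  shows "g differentiable (at x)"
  using has_derivative_transform_within_open[OF _ assms(1,2), of f _ UNIV g] assms(3,4)
  unfolding differentiable_def by auto

lemma Ck_on_cong:
  assumes "open U" "\<And>x. x \<in> U \<Longrightarrow> f x = g x" "Ck_on k U f"
  shows "Ck_on k U g"
  using assms
proof (induction k arbitrary: f g)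
  case 0 then show ?case using continuous_on_cong by auto
next
  case (Suc k)
  have "g differentiable (at x)" if "x \<in> U" for x
    using differentiable_cong_open[OF Suc.prems(1) that] Suc.prems that by auto
  moreover have "Ck_on k U (partial i g)" for i
    using Suc.IH[of "partial i f" "partial i g"] partial_cong_open[OF Suc.prems(1)] Suc.prems
    by (metis Ck_on.simps(2))
  ultimately show ?case by simp
qed

lemma Ck_on_Suc_D: "Ck_on (Suc k) U f \<Longrightarrow> Ck_on k U f"
proof (induction k arbitrary: f)
  case 0
  then show ?case
    by (auto intro!: differentiable_imp_continuous_on differentiable_at_imp_differentiable_on)
next
  case (Suc k) then show ?case by (metis Ck_on.simps(2))
qed

lemma Ck_on_subset: "Ck_on k U f \<Longrightarrow> V \<subseteq> U \<Longrightarrow> Ck_on k V f"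
  by (induction k arbitrary: f) (auto intro: continuous_on_subset)

text \<open>Smoothness is local: the derivatives in \<open>Ck_on\<close> are taken at points of the
  whole space, never within the set, so openness matters only for continuity in the base
  case.\<close>

lemma Ck_on_Un:
  assumes "open U" "open V" "Ck_on k U f" "Ck_on k V f" shows "Ck_on k (U \<union> V) f"
  using assms by (induction k arbitrary: f) (auto intro: continuous_on_open_Un)

lemma partial_linear:
  assumes "bounded_linear T" "f differentiable (at x)"
  shows "partial i (\<lambda>y. T (f y)) x = T (partial i f x)"
proof -
  have "(f has_derivative frechet_derivative f (at x)) (at x)"
    using assms(2) by (simp add: frechet_derivative_works)
  from partial_eqI[OF bounded_linear.has_derivative[OF assms(1) this]]
  show ?thesis by (simp add: partial_def)
qed

lemma differentiable_linear:
  assumes "bounded_linear T" "f differentiable (at x)"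
  shows "(\<lambda>y. T (f y)) differentiable (at x)"
  using assms bounded_linear.has_derivative unfolding differentiable_def by blast

lemma Ck_on_linear:
  assumes "open U" "bounded_linear T" "Ck_on k U f"
  shows "Ck_on k U (\<lambda>x. T (f x))"
  using assms(3)
proof (induction k arbitrary: f)
  case 0
  then show ?case using assms(2) bounded_linear.continuous_on by auto
next
  case (Suc k)
  have "Ck_on k U (partial i (\<lambda>x. T (f x)))" for i
    using Suc.IH[of "partial i f"] Suc.prems
    by (auto intro!: Ck_on_cong[OF assms(1), of "\<lambda>x. T (partial i f x)"] simp: partial_linear[OF assms(2)])
  then show ?case using Suc.prems differentiable_linear[OF assms(2)] by auto
qed

lemma partial_add:
  assumes "f differentiable (at x)" "g differentiable (at x)"
  shows "partial i (\<lambda>x. f x + g x) x = partial i f x + partial i g x"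
  using assms unfolding frechet_derivative_works
  by (subst partial_eqI[OF has_derivative_add]) (auto simp: partial_def)

lemma Ck_on_add:
  assumes "open U" "Ck_on k U f" "Ck_on k U g"
  shows "Ck_on k U (\<lambda>x. f x + g x)"
  using assms(2,3)
proof (induction k arbitrary: f g)
  case 0 then show ?case by (auto intro: continuous_on_add)
next
  case (Suc k)
  have "Ck_on k U (partial i (\<lambda>x. f x + g x))" for i
    using Suc.IH[of "partial i f" "partial i g"] Suc.prems
    by (auto intro!: Ck_on_cong[OF assms(1), of "\<lambda>x. partial i f x + partial i g x"] simp: partial_add)
  then show ?case using Suc.prems by auto
qed

lemma partial_mult:
  fixes f g :: "real^'d::finite \<Rightarrow> real"
  assumes "f differentiable (at x)" "g differentiable (at x)"
  shows "partial i (\<lambda>x. f x * g x) x = f x * partial i g x + partial i f x * g x"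
  using assms unfolding frechet_derivative_works
  by (subst partial_eqI[OF has_derivative_mult]) (auto simp: partial_def)

lemma Ck_on_mult:
  fixes f g :: "real^'d::finite \<Rightarrow> real"
  assumes "open U" "Ck_on k U f" "Ck_on k U g"
  shows "Ck_on k U (\<lambda>x. f x * g x)"
  using assms(2,3)
proof (induction k arbitrary: f g)
  case 0 then show ?case by (auto intro: continuous_on_mult)
next
  case (Suc k)
  have "Ck_on k U (partial i (\<lambda>x. f x * g x))" for i
  proof (rule Ck_on_cong[OF assms(1), of "\<lambda>x. f x * partial i g x + partial i f x * g x"])
    \<comment> \<open>Each Leibniz term keeps one factor undifferentiated; that factor has to be
      lowered from order \<open>Suc k\<close> to \<open>k\<close> before the induction hypothesis
      applies.\<close>
    show "Ck_on k U (\<lambda>x. f x * partial i g x + partial i f x * g x)"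
      using Suc.prems Ck_on_Suc_D[of k U f] Ck_on_Suc_D[of k U g]
      by (intro Ck_on_add[OF assms(1)] Suc.IH) auto
  qed (use Suc.prems in \<open>auto simp: partial_mult\<close>)
  then show ?case using Suc.prems by auto
qed

lemma partial_const [simp]: "partial i (\<lambda>x. c) = (\<lambda>x. 0)"
  by (rule ext, subst partial_eqI[OF has_derivative_const]) simp

lemma Ck_on_const: "Ck_on k U (\<lambda>x. c)"
  by (induction k arbitrary: c) auto

lemma smooth_on_const [simp]: "smooth_on U (\<lambda>x. c)"
  by (simp add: smooth_on_def Ck_on_const)

lemma smooth_on_cong: "open U \<Longrightarrow> (\<And>x. x \<in> U \<Longrightarrow> f x = g x) \<Longrightarrow> smooth_on U f \<Longrightarrow> smooth_on U g"
  using Ck_on_cong unfolding smooth_on_def by blast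

lemma smooth_on_subset: "smooth_on U f \<Longrightarrow> V \<subseteq> U \<Longrightarrow> smooth_on V f"
  using Ck_on_subset unfolding smooth_on_def by blast

lemma smooth_on_Un:
  "open U \<Longrightarrow> open V \<Longrightarrow> smooth_on U f \<Longrightarrow> smooth_on V f \<Longrightarrow> smooth_on (U \<union> V) f"
  using Ck_on_Un unfolding smooth_on_def by blast

lemma smooth_on_add:
  "open U \<Longrightarrow> smooth_on U f \<Longrightarrow> smooth_on U g \<Longrightarrow> smooth_on U (\<lambda>x. f x + g x)"
  using Ck_on_add unfolding smooth_on_def by blast

lemma smooth_on_mult:
  fixes f g :: "real^'d::finite \<Rightarrow> real"
  shows "open U \<Longrightarrow> smooth_on U f \<Longrightarrow> smooth_on U g \<Longrightarrow> smooth_on U (\<lambda>x. f x * g x)"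
  using Ck_on_mult unfolding smooth_on_def by blast

lemma smooth_on_linear:
  "open U \<Longrightarrow> bounded_linear T \<Longrightarrow> smooth_on U f \<Longrightarrow> smooth_on U (\<lambda>x. T (f x))"
  using Ck_on_linear unfolding smooth_on_def by blast

lemma smooth_on_cmult:
  fixes f :: "real^'d::finite \<Rightarrow> real"
  shows "open U \<Longrightarrow> smooth_on U f \<Longrightarrow> smooth_on U (\<lambda>x. c * f x)"
  by (simp add: smooth_on_mult)

lemma smooth_on_minus:
  fixes f :: "real^'d::finite \<Rightarrow> real"
  shows "open U \<Longrightarrow> smooth_on U f \<Longrightarrow> smooth_on U (\<lambda>x. - f x)"
  using smooth_on_cmult[of U f "-1"] by simp

lemma smooth_on_diff:
  fixes f g :: "real^'d::finite \<Rightarrow> real"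
  shows "open U \<Longrightarrow> smooth_on U f \<Longrightarrow> smooth_on U g \<Longrightarrow> smooth_on U (\<lambda>x. f x - g x)"
  using smooth_on_add[of U f "\<lambda>x. - g x"] smooth_on_minus[of U g] by simp

lemma smooth_on_sum:
  assumes "open U" "\<And>a. a \<in> B \<Longrightarrow> smooth_on U (f a)"
  shows "smooth_on U (\<lambda>x. \<Sum>a\<in>B. f a x)"
  using assms(2) by (induction B rule: infinite_finite_induct) (auto intro: smooth_on_add[OF assms(1)])

lemma smooth_on_nth: "open U \<Longrightarrow> smooth_on U f \<Longrightarrow> smooth_on U (\<lambda>x. f x $ i)"
  by (intro smooth_on_linear[of U "\<lambda>v. v $ i"] bounded_linear_vec_nth)

lemma smooth_on_vecI:
  fixes f :: "real^'d::finite \<Rightarrow> real^'e::finite"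
  assumes "open U" "\<And>i. smooth_on U (\<lambda>x. f x $ i)"
  shows "smooth_on U f"
proof -
  have "smooth_on U (\<lambda>x. \<Sum>i\<in>UNIV. (f x $ i) *\<^sub>R axis i (1::real))"
    by (intro smooth_on_sum assms(1) smooth_on_linear[OF assms(1) bounded_linear_scaleR_left] assms(2))
  moreover have "(\<Sum>i\<in>UNIV. (v $ i) *\<^sub>R axis i (1::real)) = v" for v :: "real^'e"
    using basis_expansion[of v] by (simp add: vector_scalar_mult_def scalar_mult_eq_scaleR)
  ultimately show ?thesis by simp
qed

lemma smooth_on_partial: "smooth_on U f \<Longrightarrow> smooth_on U (partial i f)"
  unfolding smooth_on_def by (metis Ck_on.simps(2))

lemma smooth_on_partials: "smooth_on U f \<Longrightarrow> smooth_on U (partials I f)"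
  by (induction I) (auto intro: smooth_on_partial)

lemma smooth_on_differentiable: "smooth_on U f \<Longrightarrow> x \<in> U \<Longrightarrow> f differentiable (at x)"
  unfolding smooth_on_def by (metis Ck_on.simps(2))

lemma smooth_on_continuous: "smooth_on U f \<Longrightarrow> continuous_on U f"
  unfolding smooth_on_def by (metis Ck_on.simps(1))

lemma frechet_derivative_partial:
  assumes "f differentiable (at x)"
  shows "frechet_derivative f (at x) v = (\<Sum>i\<in>UNIV. (v $ i) *\<^sub>R partial i f x)"
proof -
  interpret linear "frechet_derivative f (at x)"
    using assms linear_frechet_derivative by blast
  have "v = (\<Sum>i\<in>UNIV. (v $ i) *\<^sub>R axis i (1::real))"
    using basis_expansion[of v] by (simp add: vector_scalar_mult_def scalar_mult_eq_scaleR)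
  then have "frechet_derivative f (at x) v = frechet_derivative f (at x) (\<Sum>i\<in>UNIV. (v $ i) *\<^sub>R axis i (1::real))"
    by simp
  then show ?thesis by (simp add: sum scale partial_def)
qed

lemma partial_compose:
  fixes f :: "real^'d::finite \<Rightarrow> real" and \<tau> :: "real^'e::finite \<Rightarrow> real^'d"
  assumes "\<tau> differentiable (at x)" "f differentiable (at (\<tau> x))"
  shows "partial i (\<lambda>y. f (\<tau> y)) x = (\<Sum>j\<in>UNIV. (partial i \<tau> x $ j) * partial j f (\<tau> x))"
proof -
  have "partial i (\<lambda>y. f (\<tau> y)) x = frechet_derivative f (at (\<tau> x)) (partial i \<tau> x)"
    using partial_eqI[OF has_derivative_compose[of \<tau> "frechet_derivative \<tau> (at x)" x UNIV f "frechet_derivative f (at (\<tau> x))"]]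
      assms by (simp add: frechet_derivative_works partial_def)
  then show ?thesis using frechet_derivative_partial[OF assms(2)] by simp
qed

lemma Ck_on_sum:
  assumes "open U" "\<And>a. a \<in> B \<Longrightarrow> Ck_on k U (f a)"
  shows "Ck_on k U (\<lambda>x. \<Sum>a\<in>B. f a x)"
  using assms(2) by (induction B rule: infinite_finite_induct) (auto intro: Ck_on_add[OF assms(1)] Ck_on_const)

text \<open>The induction varies only the outer function: by the chain rule the derivatives of the
  composite are sums of smooth coefficients times some \<open>partial j f\<close>, composed with the
  unchanged \<open>\<tau>\<close>.\<close>

lemma smooth_on_compose:
  fixes f :: "real^'d::finite \<Rightarrow> real" and \<tau> :: "real^'e::finite \<Rightarrow> real^'d"
  assumes "open U" "smooth_on V f" "smooth_on U \<tau>" "\<tau> ` U \<subseteq> V"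
  shows "smooth_on U (\<lambda>x. f (\<tau> x))"
proof -
  have "Ck_on k U (\<lambda>x. f (\<tau> x))" for k
    using assms(2)
  proof (induction k arbitrary: f)
    case 0
    then show ?case
      using continuous_on_compose2[OF smooth_on_continuous smooth_on_continuous[OF assms(3)] assms(4)] by auto
  next
    case (Suc k)
    have d: "(\<lambda>x. f (\<tau> x)) differentiable (at x)" if "x \<in> U" for x
      using differentiable_chain_at[of \<tau> x f] smooth_on_differentiable[OF assms(3) that]
        smooth_on_differentiable[OF Suc.prems, of "\<tau> x"] assms(4) that by (auto simp: o_def)
    have "Ck_on k U (partial i (\<lambda>x. f (\<tau> x)))" for i
    proof (rule Ck_on_cong[OF assms(1)])
      show "Ck_on k U (\<lambda>x. \<Sum>j\<in>UNIV. (partial i \<tau> x $ j) * partial j f (\<tau> x))"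
        using Suc.IH[OF smooth_on_partial[OF Suc.prems]]
          smooth_on_nth[OF assms(1) smooth_on_partial[OF assms(3), of i]]
        by (intro Ck_on_sum Ck_on_mult assms(1)) (auto simp: smooth_on_def)
      show "(\<Sum>j\<in>UNIV. (partial i \<tau> x $ j) * partial j f (\<tau> x)) = partial i (\<lambda>x. f (\<tau> x)) x" if "x \<in> U" for x
        using partial_compose[OF smooth_on_differentiable[OF assms(3) that]
            smooth_on_differentiable[OF Suc.prems, of "\<tau> x"]] assms(4) that by auto
    qed
    then show ?case using d by simp
  qed
  then show ?thesis by (simp add: smooth_on_def)
qed

lemma partial_scalar_compose:
  assumes "f differentiable (at x)" "(g has_real_derivative g') (at (f x))"
  shows "partial i (\<lambda>y. g (f y)) x = g' * partial i f x"
    and "(\<lambda>y. g (f y)) differentiable (at x)"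
proof -
  have *: "((\<lambda>y. g (f y)) has_derivative (\<lambda>v. g' * frechet_derivative f (at x) v)) (at x)"
    using has_derivative_compose[of f "frechet_derivative f (at x)" x UNIV g "\<lambda>v. g' * v"] assms
    by (simp add: frechet_derivative_works has_field_derivative_def)
  show "partial i (\<lambda>y. g (f y)) x = g' * partial i f x"
    using partial_eqI[OF *] by (simp add: partial_def)
  show "(\<lambda>y. g (f y)) differentiable (at x)" using * differentiable_def by blast
qed

text \<open>It is enough that the derivatives of \<open>g\<close> stay in the linear span of the family \<open>G\<close>.\<close>

lemma smooth_on_scalar_family:
  fixes f :: "real^'d::finite \<Rightarrow> real" and G :: "'i \<Rightarrow> real \<Rightarrow> real"
  assumes "open U" "smooth_on U f" "f ` U \<subseteq> J"
    and deriv: "\<And>a t. t \<in> J \<Longrightarrow> (G a has_real_derivative (c a * G (p a) t + d a * G (q a) t)) (at t)"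
  shows "smooth_on U (\<lambda>x. G a (f x))"
proof -
  have dd: "(\<lambda>x. G a (f x)) differentiable (at x)"
    "partial i (\<lambda>x. G a (f x)) x = (c a * G (p a) (f x) + d a * G (q a) (f x)) * partial i f x"
    if "x \<in> U" for x a i
    using partial_scalar_compose[OF smooth_on_differentiable[OF assms(2) that] deriv[of "f x" a]] assms(3) that by auto
  have "Ck_on k U (\<lambda>x. G a (f x))" for k
  proof (induction k arbitrary: a)
    case 0
    then show ?case using dd
      by (auto intro!: differentiable_imp_continuous_on differentiable_at_imp_differentiable_on)
  next
    case (Suc k)
    have "Ck_on k U (partial i (\<lambda>x. G a (f x)))" for i
    proof (rule Ck_on_cong[OF assms(1)])
      show "Ck_on k U (\<lambda>x. (c a * G (p a) (f x) + d a * G (q a) (f x)) * partial i f x)"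
        using smooth_on_partial[OF assms(2), of i] Suc.IH
        by (intro Ck_on_mult Ck_on_add assms(1) Ck_on_const) (auto simp: smooth_on_def)
    qed (simp add: dd)
    then show ?case using dd by simp
  qed
  then show ?thesis by (simp add: smooth_on_def)
qed

lemma smooth_on_powr:
  fixes f :: "real^'d::finite \<Rightarrow> real"
  assumes "open U" "smooth_on U f" "\<And>x. x \<in> U \<Longrightarrow> f x > 0"
  shows "smooth_on U (\<lambda>x. f x powr a)"
  by (rule smooth_on_scalar_family[where G = "\<lambda>a t. t powr a" and J = "{0<..}" and c = "\<lambda>a. a"
        and d = "\<lambda>_. 0" and p = "\<lambda>a. a - 1" and q = "\<lambda>a. a", OF assms(1,2)])
    (use assms(3) in \<open>auto intro!: derivative_eq_intros\<close>)

lemma smooth_on_inverse: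
  fixes f :: "real^'d::finite \<Rightarrow> real"
  assumes "open U" "smooth_on U f" "\<And>x. x \<in> U \<Longrightarrow> f x > 0"
  shows "smooth_on U (\<lambda>x. inverse (f x))"
  using smooth_on_cong[OF assms(1) _ smooth_on_powr[OF assms, of "-1"], of "\<lambda>x. inverse (f x)"] assms(3)
  by (simp add: powr_minus less_imp_le)

text \<open>The derivative of \<open>ln\<close> is a power, so \<open>ln\<close> is adjoined to the
  family of powers. The Boolean in the index tells \<open>ln\<close> from a power, and every
  differentiation leads into the branch of powers.\<close>

lemma smooth_on_ln:
  fixes f :: "real^'d::finite \<Rightarrow> real"
  assumes "open U" "smooth_on U f" "\<And>x. x \<in> U \<Longrightarrow> f x > 0"
  shows "smooth_on U (\<lambda>x. ln (f x))"
proof -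
  have *: "((if a then ln else (\<lambda>t. t powr r)) has_real_derivative
       (if a then 1 else r) * (if False then ln else (\<lambda>t. t powr (if a then -1 else r - 1))) t
       + 0 * (if a then ln else (\<lambda>t. t powr r)) t) (at t)"
    if "t > 0" for t a and r :: real
    using that by (cases a) (auto intro!: derivative_eq_intros simp: powr_minus field_simps)
  have "smooth_on U (\<lambda>x. (\<lambda>(a, r). if a then ln else (\<lambda>t. t powr r)) (True, 0) (f x))"
    by (rule smooth_on_scalar_family[where J = "{0<..}" and c = "\<lambda>(a, r). if a then 1 else r"
        and d = "\<lambda>_. 0" and p = "\<lambda>(a, r). (False, if a then -1 else r - 1)" and q = "\<lambda>a. a", OF assms(1,2)])
      (use assms(3) * in \<open>auto split: prod.splits\<close>)
  then show ?thesis by simp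
qed

lemma partial_powr:
  fixes f :: "real^'d::finite \<Rightarrow> real"
  assumes "f differentiable (at x)" "f x > 0"
  shows "partial i (\<lambda>y. f y powr a) x = a * f x powr a * partial i (\<lambda>y. ln (f y)) x"
proof -
  have "partial i (\<lambda>y. f y powr a) x = a * f x powr (a - 1) * partial i f x"
    by (rule partial_scalar_compose[OF assms(1)]) (use assms(2) in \<open>auto intro!: derivative_eq_intros\<close>)
  moreover have "partial i (\<lambda>y. ln (f y)) x = inverse (f x) * partial i f x"
    by (rule partial_scalar_compose[OF assms(1)]) (use assms(2) in \<open>auto intro!: derivative_eq_intros simp: field_simps\<close>)
  ultimately show ?thesis using assms(2) by (simp add: powr_diff divide_inverse)
qed

section \<open>Symmetry of second derivatives\<close>

text \<open>Two applications of the mean value theorem: first along \<open>i\<close>, to the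
  increment in direction \<open>j\<close>, and then along \<open>j\<close>, to the resulting
  derivative. The second difference on the left is symmetric in \<open>i\<close> and
  \<open>j\<close>, and this is what the symmetry of mixed derivatives rests on.\<close>

lemma partial_commute_approx:
  fixes f :: "real^'d::finite \<Rightarrow> real"
  assumes f: "smooth_on U f" and "cball x e \<subseteq> U" "0 < h" "2 * h < e"
  shows "\<exists>y. dist x y \<le> 2 * h \<and>
    f (x + h *\<^sub>R axis i 1 + h *\<^sub>R axis j 1) - f (x + h *\<^sub>R axis i 1) - f (x + h *\<^sub>R axis j 1) + f x
      = h * h * partial j (partial i f) y"
proof -
  have inU: "x + s *\<^sub>R axis i 1 + t *\<^sub>R axis j 1 \<in> U \<and> dist x (x + s *\<^sub>R axis i 1 + t *\<^sub>R axis j 1) \<le> 2 * h"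
    if "0 \<le> s" "s \<le> h" "0 \<le> t" "t \<le> h" for s t
  proof -
    have "dist x (x + s *\<^sub>R axis i 1 + t *\<^sub>R axis j 1) \<le> norm (s *\<^sub>R axis i (1::real) :: real^'d) + norm (t *\<^sub>R axis j (1::real) :: real^'d)"
      using norm_triangle_ineq[of "s *\<^sub>R axis i (1::real) :: real^'d" "t *\<^sub>R axis j (1::real)"]
      by (subst dist_commute) (simp add: dist_norm)
    also have "\<dots> \<le> 2 * h" using that by (simp add: norm_axis_1)
    finally show ?thesis using assms(2,4) by (auto simp: subset_iff)
  qed
  have line: "((\<lambda>s. g (z + s *\<^sub>R axis k 1)) has_real_derivative partial k g (z + s *\<^sub>R axis k 1)) (at s)"
    if "g differentiable (at (z + s *\<^sub>R axis k 1))" for g :: "real^'d \<Rightarrow> real" and z s k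
  proof -
    have "((\<lambda>s. z + s *\<^sub>R axis k (1::real)) has_derivative (\<lambda>t. t *\<^sub>R axis k 1)) (at s)"
      by (auto intro!: derivative_eq_intros)
    from has_derivative_compose[OF this, of g "frechet_derivative g (at (z + s *\<^sub>R axis k 1))"] that
    have "((\<lambda>s. g (z + s *\<^sub>R axis k 1)) has_derivative (\<lambda>t. frechet_derivative g (at (z + s *\<^sub>R axis k 1)) (t *\<^sub>R axis k 1))) (at s)"
      by (simp add: frechet_derivative_works)
    moreover have "frechet_derivative g (at (z + s *\<^sub>R axis k 1)) (t *\<^sub>R axis k 1) = partial k g (z + s *\<^sub>R axis k 1) * t" for t
      using linear_cmul[OF linear_frechet_derivative[OF that]] by (simp add: partial_def)
    ultimately show ?thesis by (simp add: has_field_derivative_def)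
  qed
  let ?\<phi> = "\<lambda>s. f (x + h *\<^sub>R axis j 1 + s *\<^sub>R axis i 1) - f (x + s *\<^sub>R axis i 1)"
  have "\<exists>\<xi>. 0 < \<xi> \<and> \<xi> < h \<and> ?\<phi> h - ?\<phi> 0 = (h - 0) * (partial i f (x + h *\<^sub>R axis j 1 + \<xi> *\<^sub>R axis i 1) - partial i f (x + \<xi> *\<^sub>R axis i 1))"
  proof (rule MVT2[OF \<open>0 < h\<close>])
    fix s assume s: "0 \<le> s" "s \<le> h"
    show "(?\<phi> has_real_derivative partial i f (x + h *\<^sub>R axis j 1 + s *\<^sub>R axis i 1) - partial i f (x + s *\<^sub>R axis i 1)) (at s)"
      using inU[of s h] inU[of s 0] s assms(3)
      by (intro DERIV_diff line smooth_on_differentiable[OF f]) (auto simp: algebra_simps)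
  qed
  then obtain \<xi> where \<xi>: "0 < \<xi>" "\<xi> < h" and 1: "?\<phi> h - ?\<phi> 0 =
     h * (partial i f (x + h *\<^sub>R axis j 1 + \<xi> *\<^sub>R axis i 1) - partial i f (x + \<xi> *\<^sub>R axis i 1))" by auto
  let ?\<psi> = "\<lambda>t. partial i f ((x + \<xi> *\<^sub>R axis i 1) + t *\<^sub>R axis j 1)"
  have "\<exists>\<eta>. 0 < \<eta> \<and> \<eta> < h \<and> ?\<psi> h - ?\<psi> 0 = (h - 0) * partial j (partial i f) ((x + \<xi> *\<^sub>R axis i 1) + \<eta> *\<^sub>R axis j 1)"
    by (rule MVT2[OF \<open>0 < h\<close>]) (use inU \<xi> in \<open>auto intro!: line smooth_on_differentiable[OF smooth_on_partial[OF f]]\<close>)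
  then obtain \<eta> where \<eta>: "0 < \<eta>" "\<eta> < h" and 2: "?\<psi> h - ?\<psi> 0 = h * partial j (partial i f) ((x + \<xi> *\<^sub>R axis i 1) + \<eta> *\<^sub>R axis j 1)"
    by auto
  have "?\<phi> h - ?\<phi> 0 = h * (?\<psi> h - ?\<psi> 0)" using 1 by (simp add: algebra_simps)
  with 2 have "?\<phi> h - ?\<phi> 0 = h * h * partial j (partial i f) ((x + \<xi> *\<^sub>R axis i 1) + \<eta> *\<^sub>R axis j 1)" by simp
  then show ?thesis
    using inU[of \<xi> \<eta>] \<xi> \<eta>
    by (intro exI[of _ "(x + \<xi> *\<^sub>R axis i 1) + \<eta> *\<^sub>R axis j 1"]) (auto simp: algebra_simps)
qed

text \<open>Both mixed derivatives, taken at points near \<open>x\<close>, equal the same second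
  difference divided by \<open>h * h\<close>. If their values at \<open>x\<close> differed,
  continuity would keep them apart, each within half the distance from its own value.\<close>

lemma partial_commute:
  fixes f :: "real^'d::finite \<Rightarrow> real"
  assumes "open U" "smooth_on U f" "x \<in> U"
  shows "partial i (partial j f) x = partial j (partial i f) x"
proof (rule ccontr)
  assume ne: "partial i (partial j f) x \<noteq> partial j (partial i f) x"
  define \<epsilon> where "\<epsilon> = \<bar>partial i (partial j f) x - partial j (partial i f) x\<bar> / 2"
  have "\<epsilon> > 0" using ne by (simp add: \<epsilon>_def)
  obtain e where e: "e > 0" "cball x e \<subseteq> U" using assms open_contains_cball by blast
  have "isCont (partial a (partial b f)) x" for a b
    using smooth_on_continuous[OF smooth_on_partial[OF smooth_on_partial[OF assms(2)]]] assms
    by (simp add: continuous_on_eq_continuous_at)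
  then have "\<exists>\<delta>>0. \<forall>y. dist y x < \<delta> \<longrightarrow> dist (partial a (partial b f) y) (partial a (partial b f) x) < \<epsilon>" for a b
    using \<open>\<epsilon> > 0\<close> unfolding continuous_at_eps_delta by blast
  then obtain \<delta>1 \<delta>2 where d: "\<delta>1 > 0" "\<delta>2 > 0"
    and 1: "\<And>y. dist y x < \<delta>1 \<Longrightarrow> dist (partial i (partial j f) y) (partial i (partial j f) x) < \<epsilon>"
    and 2: "\<And>y. dist y x < \<delta>2 \<Longrightarrow> dist (partial j (partial i f) y) (partial j (partial i f) x) < \<epsilon>"
    by metis
  define h where "h = min e (min \<delta>1 \<delta>2) / 4"
  have h: "0 < h" "2 * h < e" "2 * h < \<delta>1" "2 * h < \<delta>2" using d e by (auto simp: h_def min_def)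
  obtain y where y: "dist x y \<le> 2 * h" "f (x + h *\<^sub>R axis i 1 + h *\<^sub>R axis j 1) - f (x + h *\<^sub>R axis i 1) - f (x + h *\<^sub>R axis j 1) + f x
      = h * h * partial j (partial i f) y"
    using partial_commute_approx[OF assms(2) e(2) h(1,2)] by blast
  obtain z where z: "dist x z \<le> 2 * h" "f (x + h *\<^sub>R axis j 1 + h *\<^sub>R axis i 1) - f (x + h *\<^sub>R axis j 1) - f (x + h *\<^sub>R axis i 1) + f x
      = h * h * partial i (partial j f) z"
    using partial_commute_approx[OF assms(2) e(2) h(1,2)] by blast
  have "h * h * partial j (partial i f) y = h * h * partial i (partial j f) z"
    using y(2) z(2) by (simp add: algebra_simps)
  then have "partial j (partial i f) y = partial i (partial j f) z" using h(1) by simp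
  moreover have "dist (partial j (partial i f) y) (partial j (partial i f) x) < \<epsilon>"
    "dist (partial i (partial j f) z) (partial i (partial j f) x) < \<epsilon>"
    using y(1) z(1) h 1[of z] 2[of y] by (auto simp: dist_commute)
  ultimately show False unfolding \<epsilon>_def dist_real_def by (smt (verit) field_sum_of_halves)
qed

section \<open>Flat functions and bump functions\<close>

text \<open>The case \<open>k = 0\<close> is the classical \<open>exp (- 1 / t)\<close>. The
  additional powers of \<open>inverse t\<close> are those that differentiation produces; with them
  the family is closed under derivatives and \<open>smooth_on_scalar_family\<close> applies.\<close>

definition flat_exp :: "nat \<Rightarrow> real \<Rightarrow> real" where
  "flat_exp k t = (if t > 0 then inverse t ^ k * exp (- inverse t) else 0)"

lemma flat_exp_nonneg: "flat_exp k t \<ge> 0" by (simp add: flat_exp_def)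

lemma flat_exp_tendsto_0: "(flat_exp k \<longlongrightarrow> 0) (at 0)"
proof -
  have "((\<lambda>u::real. u ^ k * exp (- u)) \<longlongrightarrow> 0) at_top"
    using tendsto_power_div_exp_0[of k] by (simp add: exp_minus divide_inverse)
  then have "((\<lambda>t. inverse t ^ k * exp (- inverse t)) \<longlongrightarrow> 0) (at_right (0::real))"
    by (rule filterlim_compose[OF _ filterlim_inverse_at_top_right])
  then have "(flat_exp k \<longlongrightarrow> 0) (at_right 0)"
    by (rule Lim_transform_eventually) (auto simp: flat_exp_def eventually_at_right_less intro: eventually_mono[OF eventually_at_right_less[of 0]])
  moreover have "(flat_exp k \<longlongrightarrow> 0) (at_left 0)"
    by (rule Lim_transform_eventually[OF tendsto_const])
      (auto simp: flat_exp_def eventually_at_filter)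
  ultimately show ?thesis by (simp add: filterlim_split_at)
qed

lemma flat_exp_deriv:
  "(flat_exp k has_real_derivative (- real k * flat_exp (Suc k) t + 1 * flat_exp (k + 2) t)) (at t)"
proof -
  consider "t > 0" | "t < 0" | "t = 0" by linarith
  then show ?thesis
  proof cases
    case 1
    have "((\<lambda>t. inverse t ^ k * exp (- inverse t)) has_real_derivative (- real k * flat_exp (Suc k) t + 1 * flat_exp (k + 2) t)) (at t)"
    proof (cases k)
      case (Suc m)
      have "inverse t * (inverse t * inverse t ^ (m - 1)) * real m = inverse t ^ Suc m * real m"
        by (cases m) auto
      then show ?thesis using 1
        by (auto intro!: derivative_eq_intros simp: Suc flat_exp_def algebra_simps power2_eq_square)
    qed (use 1 in \<open>auto intro!: derivative_eq_intros simp: flat_exp_def power2_eq_square\<close>)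
    then show ?thesis
      by (rule has_field_derivative_transform_within_open[of _ _ _ "{0<..}"]) (use 1 in \<open>auto simp: flat_exp_def\<close>)
  next
    case 2
    have "((\<lambda>t. 0) has_real_derivative (- real k * flat_exp (Suc k) t + 1 * flat_exp (k + 2) t)) (at t)"
      using 2 by (simp add: flat_exp_def)
    then show ?thesis
      by (rule has_field_derivative_transform_within_open[of _ _ _ "{..<0}"]) (use 2 in \<open>auto simp: flat_exp_def\<close>)
  next
    case 3
    \<comment> \<open>The difference quotient of \<open>flat_exp k\<close> at 0 is
      \<open>flat_exp (Suc k)\<close>, which tends to 0.\<close>
    have "((\<lambda>h. (flat_exp k (0 + h) - flat_exp k 0) / h) \<longlongrightarrow> 0) (at 0)"
      using flat_exp_tendsto_0[of "Suc k"]
      by (rule Lim_transform_eventually) (auto simp: flat_exp_def divide_inverse)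
    then show ?thesis using 3 by (simp add: DERIV_def flat_exp_def)
  qed
qed

lemma smooth_on_flat_exp:
  fixes f :: "real^'d::finite \<Rightarrow> real"
  assumes "open U" "smooth_on U f"
  shows "smooth_on U (\<lambda>x. flat_exp k (f x))"
  by (rule smooth_on_scalar_family[where J = UNIV and c = "\<lambda>k. - real k" and d = "\<lambda>_. 1"
        and p = Suc and q = "\<lambda>k. k + 2", OF assms]) (use flat_exp_deriv in auto)

lemma partial_nth: "partial j (\<lambda>y::real^'d::finite. y $ i) x = (if i = j then 1 else 0)"
proof -
  have "((\<lambda>y::real^'d. y $ i) has_derivative (\<lambda>y. y $ i)) (at x)"
    by (rule bounded_linear_imp_has_derivative[OF bounded_linear_vec_nth])
  from partial_eqI[OF this, of j] show ?thesis by (simp add: axis_def)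
qed

lemma smooth_on_coordinate: "smooth_on U (\<lambda>y::real^'d::finite. y $ i)"
proof -
  have "Ck_on k U (\<lambda>y::real^'d. y $ i)" for k
  proof (cases k)
    case 0 then show ?thesis by (auto intro!: continuous_intros)
  next
    case (Suc m)
    have "Ck_on m U (partial j (\<lambda>y::real^'d. y $ i))" for j
      using Ck_on_const[of m U "if i = j then 1 else 0"] by (simp only: partial_nth[abs_def])
    moreover have "(\<lambda>y::real^'d. y $ i) differentiable (at x)" for x
      using bounded_linear_imp_differentiable[OF bounded_linear_vec_nth] by blast
    ultimately show ?thesis using Suc by simp
  qed
  then show ?thesis by (simp add: smooth_on_def)
qed

text \<open>The quotient \<open>u / (u + v)\<close> of flat functions of the squared distance:
  \<open>u\<close> is positive exactly inside the ball of radius \<open>2 * r\<close> and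
  \<open>v\<close> exactly outside the closed ball of radius \<open>r\<close>, so the denominator
  never vanishes.\<close>

lemma smooth_bump:
  fixes p :: "real^'d::finite"
  assumes "r > 0"
  obtains b :: "real^'d \<Rightarrow> real" where "smooth_on UNIV b" "\<And>x. 0 \<le> b x"
    "\<And>x. x \<in> ball p r \<Longrightarrow> b x = 1" "\<And>x. x \<notin> ball p (2 * r) \<Longrightarrow> b x = 0"
proof
  define q where "q = (\<lambda>x::real^'d. (\<Sum>i\<in>UNIV. (x $ i - p $ i) * (x $ i - p $ i)))"
  have q: "q x = (dist p x)\<^sup>2" for x
    by (subst dist_commute) (simp add: q_def dist_norm norm_vec_def L2_set_def sum_nonneg power2_eq_square)
  have sq: "smooth_on UNIV q"
    unfolding q_def by (intro smooth_on_sum smooth_on_mult smooth_on_diff smooth_on_coordinate) auto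
  define u where "u = (\<lambda>x. flat_exp 0 (4 * r\<^sup>2 - q x))"
  define v where "v = (\<lambda>x. flat_exp 0 (q x - r\<^sup>2))"
  have su: "smooth_on UNIV u" "smooth_on UNIV v" unfolding u_def v_def
    by (intro smooth_on_flat_exp smooth_on_diff sq smooth_on_const open_UNIV)+
  have pos: "u x + v x > 0" for x
  proof (cases "q x < 4 * r\<^sup>2")
    case True
    then have "u x > 0" by (simp add: u_def flat_exp_def)
    then show ?thesis using flat_exp_nonneg[of 0 "q x - r\<^sup>2"] by (simp add: v_def)
  next
    case False
    then have "q x > r\<^sup>2" using assms zero_less_power[of r 2] by linarith
    then have "v x > 0" by (simp add: v_def flat_exp_def)
    then show ?thesis using flat_exp_nonneg[of 0 "4 * r\<^sup>2 - q x"] by (simp add: u_def)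
  qed
  let ?b = "\<lambda>x. u x * inverse (u x + v x)"
  show "smooth_on UNIV ?b"
    using pos by (intro smooth_on_mult smooth_on_inverse smooth_on_add su) auto
  show "0 \<le> ?b x" for x using pos[of x] flat_exp_nonneg by (simp add: u_def less_imp_le)
  show "?b x = 1" if "x \<in> ball p r" for x
  proof -
    have "q x < r\<^sup>2" using that assms by (simp add: q power_strict_mono)
    then have "v x = 0" by (simp add: v_def flat_exp_def)
    then show ?thesis using pos[of x] by simp
  qed
  show "?b x = 0" if "x \<notin> ball p (2 * r)" for x
  proof -
    have "(2 * r)\<^sup>2 \<le> q x" using that assms unfolding q by (intro power_mono) auto
    then show ?thesis by (simp add: u_def flat_exp_def)
  qed
qed

section \<open>Change of variables and integration by parts\<close>

text \<open>The change of variables theorem of the library needs a well-ordered index type; a copy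
  of the index type carries such an order.\<close>

typedef 'd ranked = "UNIV :: 'd set" ..

instance ranked :: (finite) finite
proof
  have "(UNIV :: 'a ranked set) = range Abs_ranked" by (metis Abs_ranked_cases surjI)
  then show "finite (UNIV :: 'a ranked set)" by (metis finite finite_imageI)
qed

instantiation ranked :: (finite) wellorder
begin

definition less_eq_ranked :: "'a ranked \<Rightarrow> 'a ranked \<Rightarrow> bool" where
  "x \<le> y \<longleftrightarrow> to_nat (Rep_ranked x) \<le> to_nat (Rep_ranked y)"

definition less_ranked :: "'a ranked \<Rightarrow> 'a ranked \<Rightarrow> bool" where
  "x < y \<longleftrightarrow> to_nat (Rep_ranked x) < to_nat (Rep_ranked y)"

instance
proof
  fix P :: "'a ranked \<Rightarrow> bool" and a
  assume step: "\<And>x. (\<And>y. y < x \<Longrightarrow> P y) \<Longrightarrow> P x"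
  show "P a"
  proof (induction "to_nat (Rep_ranked a)" arbitrary: a rule: less_induct)
    case less
    show ?case by (rule step, rule less) (simp add: less_ranked_def)
  qed
qed (auto simp: less_eq_ranked_def less_ranked_def Rep_ranked_inject)

end

definition of_ranked :: "real^('d::finite) ranked \<Rightarrow> real^'d" where
  "of_ranked v = (\<chi> i. v $ Abs_ranked i)"

definition to_ranked :: "real^('d::finite) \<Rightarrow> real^('d ranked)" where
  "to_ranked v = (\<chi> i. v $ Rep_ranked i)"

lemma to_of_ranked [simp]: "to_ranked (of_ranked v) = v" "of_ranked (to_ranked w) = w"
  by (auto simp: to_ranked_def of_ranked_def vec_eq_iff Rep_ranked_inverse Abs_ranked_inverse)

lemma bounded_linear_to_ranked: "bounded_linear to_ranked" "bounded_linear of_ranked"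
  by (auto simp: to_ranked_def of_ranked_def vec_eq_iff intro!: linearI linear_conv_bounded_linear[THEN iffD1])

lemma to_ranked_image: "to_ranked ` S = of_ranked -` S" "of_ranked ` S' = to_ranked -` S'"
  by (force simp: image_iff)+

lemma bij_ranked: "bij (Rep_ranked :: 'd ranked \<Rightarrow> 'd)" "bij (Abs_ranked :: 'd \<Rightarrow> 'd ranked)"
  by (auto intro!: o_bij[where g = Abs_ranked] o_bij[where g = Rep_ranked] simp: o_def Rep_ranked_inverse Abs_ranked_inverse)

lemma of_ranked_cbox:
  fixes u v :: "real^('d::finite) ranked" and u' v' :: "real^'d"
  shows "of_ranked ` cbox u v = cbox (of_ranked u) (of_ranked v)"
  "to_ranked ` cbox u' v' = cbox (to_ranked u') (to_ranked v')"
proof -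
  have 1: "(\<forall>i. u $ i \<le> x $ Rep_ranked i \<and> x $ Rep_ranked i \<le> v $ i) \<longleftrightarrow>
      (\<forall>i. u $ Abs_ranked i \<le> x $ i \<and> x $ i \<le> v $ Abs_ranked i)" for x :: "real^'d"
    by (metis Abs_ranked_inverse Rep_ranked_inverse UNIV_I)
  have 2: "(\<forall>i. u' $ i \<le> x $ Abs_ranked i \<and> x $ Abs_ranked i \<le> v' $ i) \<longleftrightarrow>
      (\<forall>i. u' $ Rep_ranked i \<le> x $ i \<and> x $ i \<le> v' $ Rep_ranked i)" for x :: "real^('d ranked)"
    by (metis Abs_ranked_inverse Rep_ranked_inverse UNIV_I)
  show "of_ranked ` cbox u v = cbox (of_ranked u) (of_ranked v)"
    unfolding to_ranked_image using 1 by (simp add: set_eq_iff mem_box_cart to_ranked_def of_ranked_def)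
  show "to_ranked ` cbox u' v' = cbox (to_ranked u') (to_ranked v')"
    unfolding to_ranked_image using 2 by (simp add: set_eq_iff mem_box_cart to_ranked_def of_ranked_def)
qed

lemma content_of_ranked_cbox: "measure lborel (of_ranked ` cbox u v) = measure lborel (cbox u v)"
proof -
  have "cbox (of_ranked u) (of_ranked v) = {} \<longleftrightarrow> cbox u v = {}"
    by (metis image_is_empty of_ranked_cbox(1))
  moreover have "(\<Prod>i\<in>UNIV. of_ranked v $ i - of_ranked u $ i) = (\<Prod>i\<in>UNIV. v $ i - u $ i)"
    by (simp add: of_ranked_def prod.reindex_bij_betw[OF bij_ranked(2), of "\<lambda>i. v $ i - u $ i"])
  ultimately show ?thesis by (simp add: of_ranked_cbox content_cbox_if_cart)
qed

text \<open>\<open>has_integral_twiddle\<close> works on boxes, whence the bounded support: the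
  integral is restricted to a box that contains it, and relabelling the coordinates carries boxes to
  boxes of the same content.\<close>

lemma has_integral_of_ranked:
  fixes f :: "real^'d::finite \<Rightarrow> real"
  assumes "(f has_integral I) UNIV" "bounded B" "\<And>x. x \<notin> B \<Longrightarrow> f x = 0"
  shows "((\<lambda>y. f (of_ranked y)) has_integral I) UNIV"
proof -
  obtain a where a: "B \<subseteq> cbox (-a) a" using bounded_subset_cbox_symmetric[OF assms(2)] by blast
  have 1: "(f has_integral I) (cbox (-a) a)"
  proof -
    have "(\<lambda>x. if x \<in> cbox (-a) a then f x else 0) = f" using a assms(3) by fastforce
    then show ?thesis using assms(1) has_integral_restrict_UNIV[of "cbox (-a) a" f I] by simp
  qed
  have "((\<lambda>y. f (of_ranked y)) has_integral (1 / 1) *\<^sub>R I) (to_ranked ` cbox (-a) a)"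
  proof (rule has_integral_twiddle)
    show "continuous (at y) (of_ranked :: real^'d ranked \<Rightarrow> real^'d)" for y by (rule linear_continuous_at[OF bounded_linear_to_ranked(2)])
    show "\<exists>w z. of_ranked ` cbox u v = cbox w z" for u v :: "real^'d ranked" using of_ranked_cbox by metis
    show "\<exists>w z. to_ranked ` cbox u v = cbox w z" for u v :: "real^'d" using of_ranked_cbox by metis
    show "measure lborel (of_ranked ` cbox u v) = 1 * measure lborel (cbox u v)" for u v :: "real^'d ranked"
      by (simp add: content_of_ranked_cbox)
  qed (use 1 in simp_all)
  then have "((\<lambda>y. f (of_ranked y)) has_integral I) (to_ranked ` cbox (-a) a)" by simp
  then show ?thesis
    by (rule has_integral_on_superset) (use a assms(3) in \<open>auto simp: to_ranked_image\<close>)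
qed

lemma has_integral_to_ranked:
  fixes f :: "real^('d::finite) ranked \<Rightarrow> real"
  assumes "(f has_integral I) UNIV" "bounded B" "\<And>x. x \<notin> B \<Longrightarrow> f x = 0"
  shows "((\<lambda>y. f (to_ranked y)) has_integral I) UNIV"
proof -
  obtain a where a: "B \<subseteq> cbox (-a) a" using bounded_subset_cbox_symmetric[OF assms(2)] by blast
  have 1: "(f has_integral I) (cbox (-a) a)"
  proof -
    have "(\<lambda>x. if x \<in> cbox (-a) a then f x else 0) = f" using a assms(3) by fastforce
    then show ?thesis using assms(1) has_integral_restrict_UNIV[of "cbox (-a) a" f I] by simp
  qed
  have "measure lborel (to_ranked ` cbox u v) = measure lborel (cbox u v)" for u v :: "real^'d"
    by (metis content_of_ranked_cbox of_ranked_cbox(1,2) to_of_ranked(2))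
  note cont = this
  have "((\<lambda>y. f (to_ranked y)) has_integral (1 / 1) *\<^sub>R I) (of_ranked ` cbox (-a) a)"
  proof (rule has_integral_twiddle)
    show "continuous (at y) (to_ranked :: real^'d \<Rightarrow> real^'d ranked)" for y by (rule linear_continuous_at[OF bounded_linear_to_ranked(1)])
    show "\<exists>w z. to_ranked ` cbox u v = cbox w z" for u v :: "real^'d" using of_ranked_cbox by metis
    show "\<exists>w z. of_ranked ` cbox u v = cbox w z" for u v :: "real^'d ranked" using of_ranked_cbox by metis
    show "measure lborel (to_ranked ` cbox u v) = 1 * measure lborel (cbox u v)" for u v :: "real^'d"
      by (simp add: cont)
  qed (use 1 in simp_all)
  then have "((\<lambda>y. f (to_ranked y)) has_integral I) (of_ranked ` cbox (-a) a)" by simp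
  then show ?thesis
    by (rule has_integral_on_superset) (use a assms(3) in \<open>auto simp: to_ranked_image\<close>)
qed

text \<open>Conjugation by the relabelling is a bijection between the permutations of the two index
  types and preserves the sign, so the two Leibniz sums agree term by term.\<close>

lemma det_ranked:
  fixes L :: "real^('d::finite) \<Rightarrow> real^'d"
  shows "det (matrix (\<lambda>v. to_ranked (L (of_ranked v)))) = det (matrix L)"
proof -
  have of_ranked_axis: "of_ranked (axis j (1::real)) = axis (Rep_ranked j) 1" for j :: "'d ranked"
    by (auto simp: of_ranked_def axis_def vec_eq_iff Rep_ranked_inverse Abs_ranked_inverse)
  have m: "matrix (\<lambda>v. to_ranked (L (of_ranked v))) $ i $ j = matrix L $ Rep_ranked i $ Rep_ranked j" for i j
    by (simp add: matrix_def of_ranked_axis to_ranked_def)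
  let ?P = "\<lambda>p. map_permutation UNIV (Rep_ranked :: 'd ranked \<Rightarrow> 'd) p"
  let ?Q = "\<lambda>p. map_permutation UNIV (Abs_ranked :: 'd \<Rightarrow> 'd ranked) p"
  have P: "?P p = Rep_ranked \<circ> p \<circ> Abs_ranked" and Q: "?Q q = Abs_ranked \<circ> q \<circ> Rep_ranked" for p q
  proof -
    have "inv (Rep_ranked :: 'd ranked \<Rightarrow> 'd) = Abs_ranked" "inv (Abs_ranked :: 'd \<Rightarrow> 'd ranked) = Rep_ranked"
      by (rule inv_equality; simp add: Rep_ranked_inverse Abs_ranked_inverse)+
    then show "?P p = Rep_ranked \<circ> p \<circ> Abs_ranked" "?Q q = Abs_ranked \<circ> q \<circ> Rep_ranked"
      using bij_ranked[where 'd = 'd] by (simp_all add: map_permutation_def restrict_id_def fun_eq_iff bij_def)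
  qed
  have "det (matrix (\<lambda>v. to_ranked (L (of_ranked v)))) =
    (\<Sum>p | p permutes UNIV. of_int (sign p) * (\<Prod>i\<in>UNIV. matrix L $ Rep_ranked i $ Rep_ranked (p i)))"
    by (simp add: det_def m)
  also have "\<dots> = (\<Sum>p | p permutes UNIV. of_int (sign p) * (\<Prod>i\<in>UNIV. matrix L $ i $ p i))"
  proof (rule sum.reindex_bij_witness[where j = ?P and i = ?Q])
    fix p :: "'d ranked \<Rightarrow> 'd ranked" assume p: "p \<in> {p. p permutes UNIV}"
    show "?Q (?P p) = p" by (auto simp: P Q fun_eq_iff Rep_ranked_inverse Abs_ranked_inverse)
    show "?P p \<in> {p. p permutes UNIV}"
      using map_permutation_permutes[OF bij_ranked(1)] p by auto
    have "(\<Prod>i\<in>UNIV. matrix L $ i $ ?P p i) = (\<Prod>i\<in>UNIV. matrix L $ Rep_ranked i $ ?P p (Rep_ranked i))"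
      by (simp add: prod.reindex_bij_betw[OF bij_ranked(1), of "\<lambda>i. matrix L $ i $ ?P p i"])
    then show "of_int (sign (?P p)) * (\<Prod>i\<in>UNIV. matrix L $ i $ ?P p i) =
       of_int (sign p) * (\<Prod>i\<in>UNIV. matrix L $ Rep_ranked i $ Rep_ranked (p i))"
      using sign_map_permutation[of "Rep_ranked :: 'd ranked \<Rightarrow> 'd" UNIV p] p bij_ranked(1)[where 'd='d]
      by (simp add: P bij_def Rep_ranked_inverse)
  next
    fix p :: "'d \<Rightarrow> 'd" assume p: "p \<in> {p. p permutes UNIV}"
    show "?P (?Q p) = p" by (auto simp: P Q fun_eq_iff Rep_ranked_inverse Abs_ranked_inverse)
    show "?Q p \<in> {p. p permutes UNIV}"
      using map_permutation_permutes[OF bij_ranked(2)] p by auto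
  qed
  finally show ?thesis by (simp add: det_def)
qed

lemma integrable_compact_support:
  fixes f :: "real^'d::finite \<Rightarrow> real"
  assumes "continuous_on UNIV f" "bounded B" "\<And>x. x \<notin> B \<Longrightarrow> f x = 0"
  shows "f absolutely_integrable_on UNIV" "f integrable_on UNIV"
proof -
  obtain a where a: "B \<subseteq> cbox (-a) a" using bounded_subset_cbox_symmetric[OF assms(2)] by blast
  have "f absolutely_integrable_on cbox (-a) a"
    by (rule absolutely_integrable_continuous) (use assms(1) continuous_on_subset in blast)
  then have "(\<lambda>x. if x \<in> cbox (-a) a then f x else 0) absolutely_integrable_on UNIV"
    by (simp add: absolutely_integrable_restrict_UNIV)
  moreover have "(\<lambda>x. if x \<in> cbox (-a) a then f x else 0) = f" using a assms(3) by fastforce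
  ultimately show 1: "f absolutely_integrable_on UNIV" by simp
  then show "f integrable_on UNIV" using absolutely_integrable_on_def by blast
qed

lemma integral_eq_UNIV:
  fixes f :: "real^'d::finite \<Rightarrow> real"
  assumes "\<And>x. x \<notin> S \<Longrightarrow> f x = 0"
  shows "integral S f = integral UNIV f"
proof -
  have "(\<lambda>x. if x \<in> S then f x else 0) = f" using assms by fastforce
  then show ?thesis using integral_restrict_UNIV[of S f] by simp
qed

text \<open>The sets \<open>B\<close> and \<open>B'\<close> bound the supports of the two
  integrands; each integral has to be carried across the relabelling of coordinates, which is done
  for bounded supports.\<close>

lemma integral_change_of_variables_finite:
  fixes f :: "real^'d::finite \<Rightarrow> real" and g :: "real^'d \<Rightarrow> real^'d"
  assumes S: "open S" and g: "\<And>x. x \<in> S \<Longrightarrow> (g has_derivative g' x) (at x)" and inj: "inj_on g S"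
    and f: "f absolutely_integrable_on UNIV" "bounded B" "\<And>x. x \<notin> B \<Longrightarrow> f x = 0"
    and B': "bounded B'" "\<And>x. x \<in> S - B' \<Longrightarrow> f (g x) = 0" and fS: "\<And>x. x \<notin> g ` S \<Longrightarrow> f x = 0"
  shows "integral UNIV f = integral UNIV (\<lambda>x. if x \<in> S then \<bar>det (matrix (g' x))\<bar> * f (g x) else 0)"
proof -
  define S1 where "S1 = to_ranked ` S"
  define g1 where "g1 = (\<lambda>y. to_ranked (g (of_ranked y)))"
  define g1' where "g1' = (\<lambda>y v. to_ranked (g' (of_ranked y) (of_ranked v)))"
  \<comment> \<open>The change of variables is applied to functions with values in some
    \<open>real^'n\<close>; the scalar integrand is put into \<open>real^1\<close>, and its only
    component is read off again at the end.\<close>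
  define f1 where "f1 = (\<lambda>y. (f (of_ranked y)) *\<^sub>R axis (1::1) (1::real))"
  have "open S1" unfolding S1_def to_ranked_image(1)
    by (rule open_vimage) (use S bounded_linear_to_ranked(2) in \<open>auto intro: linear_continuous_on\<close>)
  have dg: "(g1 has_derivative g1' y) (at y within S1)" if "y \<in> S1" for y
  proof -
    have "of_ranked y \<in> S" using that by (auto simp: S1_def)
    have "(of_ranked has_derivative of_ranked) (at y)"
      by (rule bounded_linear_imp_has_derivative[OF bounded_linear_to_ranked(2)])
    from has_derivative_compose[OF this g[OF \<open>of_ranked y \<in> S\<close>]]
    have "(g1 has_derivative g1' y) (at y)"
      unfolding g1_def g1'_def by (rule bounded_linear.has_derivative[OF bounded_linear_to_ranked(1)])
    then show ?thesis by (rule has_derivative_at_withinI)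
  qed
  have inj1: "inj_on g1 S1"
    using inj by (auto simp: inj_on_def g1_def S1_def) (metis to_of_ranked(2))
  have im: "g1 ` S1 = to_ranked ` (g ` S)"
    by (auto simp: g1_def S1_def image_image)
  have zero1: "f1 y = 0" if "y \<notin> g1 ` S1" for y
    using fS[of "of_ranked y"] that by (auto simp: f1_def im to_ranked_image)
  have "bounded (of_ranked -` B)"
    using bounded_linear_image[OF f(2) bounded_linear_to_ranked(1)] by (simp add: to_ranked_image)
  have uniqf: "((\<lambda>y. f (of_ranked y)) has_integral integral UNIV f) UNIV"
    using f set_lebesgue_integral_eq_integral(1) by (intro has_integral_of_ranked[OF _ f(2,3)]) auto
  \<comment> \<open>The change of variables asks for absolute integrability, so the absolute value
    is carried across the relabelling as well.\<close>
  have "(\<lambda>x. \<bar>f x\<bar>) integrable_on UNIV"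
    using absolutely_integrable_on_def[THEN iffD1, OF f(1)] by simp
  then have "(\<lambda>y. \<bar>f (of_ranked y)\<bar>) integrable_on UNIV"
    using has_integral_of_ranked[of "\<lambda>x. \<bar>f x\<bar>", OF integrable_integral f(2)] f(3) by auto
  then have "(\<lambda>y. f (of_ranked y)) absolutely_integrable_on UNIV"
    using uniqf by (intro absolutely_integrable_on_def[THEN iffD2]) auto
  from absolutely_integrable_linear[OF this, of "\<lambda>t. t *\<^sub>R axis (1::1) (1::real)"]
  have "f1 absolutely_integrable_on UNIV"
    by (simp add: f1_def o_def bounded_linear_scaleR_left)
  moreover have "(\<lambda>y. if y \<in> g1 ` S1 then f1 y else 0) = f1" using zero1 by fastforce
  ultimately have abs1: "f1 absolutely_integrable_on g1 ` S1"
    using absolutely_integrable_restrict_UNIV[of "g1 ` S1" f1] by simp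
  have meas: "S1 \<in> sets lebesgue" using \<open>open S1\<close> by auto
  have cv: "(\<lambda>y. \<bar>det (matrix (g1' y))\<bar> *\<^sub>R f1 (g1 y)) absolutely_integrable_on S1"
     "integral S1 (\<lambda>y. \<bar>det (matrix (g1' y))\<bar> *\<^sub>R f1 (g1 y)) = integral (g1 ` S1) f1"
    using has_absolute_integral_change_of_variables[OF meas dg inj1, of f1 "integral (g1 ` S1) f1"] abs1 by auto
  let ?h = "\<lambda>y. if y \<in> S1 then \<bar>det (matrix (g1' y))\<bar> * f (g (of_ranked y)) else 0"
  have "integral UNIV f = integral UNIV (\<lambda>y. f (of_ranked y))" using uniqf by (simp add: integral_unique)
  also have "\<dots> = integral (g1 ` S1) (\<lambda>y. f1 y $ 1)"
    using zero1 by (subst integral_eq_UNIV) (auto simp: f1_def)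
  also have "\<dots> = integral S1 (\<lambda>y. (\<bar>det (matrix (g1' y))\<bar> *\<^sub>R f1 (g1 y)) $ 1)"
    using cv abs1 by (subst (1 2) integral_component_eq_cart) (auto simp: absolutely_integrable_on_def)
  also have "\<dots> = integral UNIV ?h"
    by (subst integral_restrict_UNIV[symmetric]) (simp add: f1_def g1_def if_distrib cong: if_cong)
  finally have 1: "integral UNIV f = integral UNIV ?h" .
  have "(\<lambda>y. (\<bar>det (matrix (g1' y))\<bar> *\<^sub>R f1 (g1 y)) $ 1) integrable_on S1"
    using cv(1) integrable_component[of "\<lambda>y. \<bar>det (matrix (g1' y))\<bar> *\<^sub>R f1 (g1 y)" S1 "axis 1 1"]
    by (auto simp: absolutely_integrable_on_def inner_axis inner_real_def)
  then have hint: "?h integrable_on UNIV"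
    by (subst (asm) integrable_restrict_UNIV[symmetric]) (simp add: f1_def g1_def if_distrib cong: if_cong)
  have hb: "bounded (to_ranked ` B')" using bounded_linear_image[OF B'(1) bounded_linear_to_ranked(1)] .
  have hz: "?h y = 0" if "y \<notin> to_ranked ` B'" for y
    using B'(2)[of "of_ranked y"] that by (auto simp: S1_def to_ranked_image)
  have "((\<lambda>x. ?h (to_ranked x)) has_integral integral UNIV ?h) UNIV"
    by (rule has_integral_to_ranked[OF integrable_integral[OF hint] hb hz])
  moreover have "det (matrix (\<lambda>v. to_ranked (g' x (of_ranked v)))) = det (matrix (g' x))" for x
    by (rule det_ranked)
  then have "(\<lambda>x. ?h (to_ranked x)) = (\<lambda>x. if x \<in> S then \<bar>det (matrix (g' x))\<bar> * f (g x) else 0)"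
    by (auto simp: S1_def g1'_def to_ranked_image fun_eq_iff)
  ultimately show ?thesis using 1 by (simp add: integral_unique)
qed

section \<open>Translation invariance and integration by parts\<close>

lemma has_integral_translate:
  fixes f :: "real^'d::finite \<Rightarrow> real"
  assumes "(f has_integral I) UNIV" "bounded B" "\<And>x. x \<notin> B \<Longrightarrow> f x = 0"
  shows "((\<lambda>x. f (x + c)) has_integral I) UNIV"
proof -
  obtain a where a: "B \<subseteq> cbox (-a) a" using bounded_subset_cbox_symmetric[OF assms(2)] by blast
  have "(\<lambda>x. if x \<in> cbox (-a) a then f x else 0) = f" using a assms(3) by fastforce
  then have "(f has_integral I) (cbox (-a) a)"
    using assms(1) has_integral_restrict_UNIV[of "cbox (-a) a" f I] by simp
  from has_integral_affinity[OF this, of 1 c]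
  have "((\<lambda>x. f (x + c)) has_integral I) ((\<lambda>x. x - c) ` cbox (-a) a)" by simp
  then show ?thesis
  proof (rule has_integral_on_superset)
    show "f (x + c) = 0" if "x \<notin> (\<lambda>x. x - c) ` cbox (-a) a" for x
      using that a assms(3)[of "x + c"] by (metis (no_types, lifting) add_diff_cancel image_eqI subsetD)
  qed simp
qed

lemma partial_zero_outside:
  fixes f :: "real^'d::finite \<Rightarrow> real"
  assumes "closed K" "\<And>x. x \<notin> K \<Longrightarrow> f x = 0" "x \<notin> K"
  shows "partial i f x = 0"
  using partial_cong_open[of "- K" x f "\<lambda>_. 0"] assms by auto

text \<open>By translation invariance the difference quotients have integral zero. They converge
  pointwise to the partial derivative, and dominated convergence passes to the limit.\<close>

lemma integral_partial_eq_0: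
  fixes f :: "real^'d::finite \<Rightarrow> real"
  assumes f: "smooth_on UNIV f" and K: "compact K" "\<And>x. x \<notin> K \<Longrightarrow> f x = 0"
  shows "integral UNIV (partial i f) = 0"
proof -
  obtain R where "\<And>x. x \<in> K \<Longrightarrow> norm x \<le> R" using compact_imp_bounded[OF K(1)] unfolding bounded_iff by auto
  then have R: "K \<subseteq> cball 0 R" by auto
  have p0: "partial i f x = 0" if "x \<notin> K" for x
    using partial_zero_outside[OF compact_imp_closed[OF K(1)] K(2) that] .
  have "bounded (partial i f ` K)"
    using smooth_on_continuous[OF smooth_on_partial[OF f]] K(1)
    by (intro compact_imp_bounded compact_continuous_image) (auto intro: continuous_on_subset)
  then obtain M where M: "M > 0" "\<And>x. x \<in> K \<Longrightarrow> \<bar>partial i f x\<bar> \<le> M"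
    unfolding bounded_pos by auto
  then have M': "\<bar>partial i f x\<bar> \<le> M" for x using p0[of x] by (cases "x \<in> K") auto
  let ?e = "axis i (1::real) :: real^'d"
  define D where "D = (\<lambda>k::nat. \<lambda>x. (f (x + inverse (real (Suc k)) *\<^sub>R ?e) - f x) / inverse (real (Suc k)))"
  have line: "((\<lambda>s. f (x + s *\<^sub>R ?e)) has_real_derivative partial i f (x + s *\<^sub>R ?e)) (at s)" for x s
  proof -
    have d: "f differentiable (at (x + s *\<^sub>R ?e))" using smooth_on_differentiable[OF f] by simp
    have "((\<lambda>s. x + s *\<^sub>R ?e) has_derivative (\<lambda>t. t *\<^sub>R ?e)) (at s)"
      by (auto intro!: derivative_eq_intros)
    from has_derivative_compose[OF this, of f "frechet_derivative f (at (x + s *\<^sub>R ?e))"] d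
    have "((\<lambda>s. f (x + s *\<^sub>R ?e)) has_derivative (\<lambda>t. frechet_derivative f (at (x + s *\<^sub>R ?e)) (t *\<^sub>R ?e))) (at s)"
      by (simp add: frechet_derivative_works)
    moreover have "frechet_derivative f (at (x + s *\<^sub>R ?e)) (t *\<^sub>R ?e) = partial i f (x + s *\<^sub>R ?e) * t" for t
      using linear_cmul[OF linear_frechet_derivative[OF d]] by (simp add: partial_def)
    ultimately show ?thesis by (simp add: has_field_derivative_def)
  qed
  \<comment> \<open>The increments are at most 1 and \<open>K\<close> lies in the ball of radius
    \<open>R\<close>, so every quotient vanishes outside radius \<open>R + 1\<close>; inside, the
    mean value theorem bounds it by \<open>M\<close>.\<close>
  have Dbound: "norm (D k x) \<le> (if x \<in> cball 0 (R + 1) then M else 0)" for k x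
  proof (cases "x \<in> cball 0 (R + 1)")
    case True
    have "\<exists>z>0. z < inverse (real (Suc k)) \<and> f (x + inverse (real (Suc k)) *\<^sub>R ?e) - f (x + 0 *\<^sub>R ?e)
        = (inverse (real (Suc k)) - 0) * partial i f (x + z *\<^sub>R ?e)"
      by (rule MVT2) (use line in auto)
    then obtain z where "D k x = partial i f (x + z *\<^sub>R ?e)" by (auto simp: D_def)
    then show ?thesis using M' True by simp
  next
    case False
    let ?h = "inverse (real (Suc k))"
    have "norm (?h *\<^sub>R ?e) \<le> 1" by (simp add: norm_axis_1 inverse_le_1_iff)
    then have "norm x \<le> norm (x + ?h *\<^sub>R ?e) + 1"
      using norm_triangle_ineq4[of "x + ?h *\<^sub>R ?e" "?h *\<^sub>R ?e"] by simp
    then have "x \<notin> K \<and> x + ?h *\<^sub>R ?e \<notin> K"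
      using False R by (auto simp: subset_iff)
    then show ?thesis using False K(2) by (simp add: D_def)
  qed
  have contf: "continuous_on UNIV f" using smooth_on_continuous[OF f] .
  have fint: "(f has_integral integral UNIV f) UNIV"
    using integrable_compact_support(2)[OF contf compact_imp_bounded[OF K(1)] K(2)] by (simp add: integrable_integral)
  have D0: "(D k has_integral 0) UNIV" for k
    using has_integral_divide[OF has_integral_diff[OF has_integral_translate[OF fint compact_imp_bounded[OF K(1)] K(2)] fint]]
    by (simp add: D_def)
  have lim: "(\<lambda>k. D k x) \<longlonglongrightarrow> partial i f x" for x
  proof -
    have "((\<lambda>h. (f (x + h *\<^sub>R ?e) - f x) / h) \<longlongrightarrow> partial i f x) (at 0)"
      using line[of x 0] by (simp add: DERIV_def)
    moreover have "filterlim (\<lambda>k. inverse (real (Suc k))) (at 0) sequentially"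
      using LIMSEQ_inverse_real_of_nat by (auto simp: filterlim_at)
    ultimately show ?thesis unfolding D_def by (rule filterlim_compose)
  qed
  have "((\<lambda>x. if x \<in> cball 0 (R + 1) then M else 0) :: real^'d \<Rightarrow> real) integrable_on UNIV"
    using lmeasurable_cball[of "0::real^'d" "R + 1"]
    by (subst integrable_restrict_UNIV) (auto intro: integrable_on_const)
  then have "(\<lambda>k. integral UNIV (D k)) \<longlonglongrightarrow> integral UNIV (partial i f)"
    using D0 by (intro dominated_convergence(2)[where h = "\<lambda>x. if x \<in> cball 0 (R + 1) then M else 0"] Dbound lim)
      (auto simp: integrable_on_def)
  moreover have "integral UNIV (D k) = 0" for k using D0 integral_unique by blast
  ultimately show ?thesis by (simp add: LIMSEQ_const_iff)
qed

text \<open>The whole space is covered by \<open>U\<close> and the open complement of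
  \<open>K\<close>, and on the latter the function is constant.\<close>

lemma smooth_on_extend_zero:
  fixes f :: "real^'d::finite \<Rightarrow> real"
  assumes "open U" "smooth_on U f" "closed K" "K \<subseteq> U" "\<And>x. x \<notin> K \<Longrightarrow> f x = 0"
  shows "smooth_on UNIV f"
proof -
  have "smooth_on (- K) f"
    using smooth_on_cong[of "- K" "\<lambda>_. 0" f] assms(3,5) by auto
  then have "smooth_on (U \<union> - K) f" using assms by (intro smooth_on_Un) auto
  moreover have "U \<union> - K = UNIV" using assms(4) by auto
  ultimately show ?thesis by simp
qed

lemma partials_zero_outside:
  fixes f :: "real^'d::finite \<Rightarrow> real"
  assumes "closed K" "\<And>x. x \<notin> K \<Longrightarrow> f x = 0" "x \<notin> K"
  shows "partials I f x = 0"
  using assms(3) by (induction I arbitrary: x) (auto intro!: assms(2) partial_zero_outside[OF assms(1)])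

text \<open>Compact support of one factor is enough: the products inherit it from \<open>f\<close>
  and are therefore smooth on the whole space, although \<open>g\<close> is smooth only on
  \<open>U\<close>.\<close>

lemma integration_by_parts:
  fixes f g :: "real^'d::finite \<Rightarrow> real"
  assumes "open U" "smooth_on U f" "smooth_on U g" "compact K" "K \<subseteq> U" "\<And>x. x \<notin> K \<Longrightarrow> f x = 0"
  shows "integral UNIV (\<lambda>x. partial i f x * g x) = - integral UNIV (\<lambda>x. f x * partial i g x)"
proof -
  have cl: "closed K" using compact_imp_closed assms(4) by blast
  have z: "partial i f x = 0" if "x \<notin> K" for x using partial_zero_outside[OF cl assms(6) that] .
  have s: "smooth_on UNIV (\<lambda>x. f x * g x)" "smooth_on UNIV (\<lambda>x. partial i f x * g x)"
    "smooth_on UNIV (\<lambda>x. f x * partial i g x)"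
    using assms z by (auto intro!: smooth_on_extend_zero[OF assms(1) _ cl assms(5)] smooth_on_mult smooth_on_partial)
  have int: "(\<lambda>x. partial i f x * g x) integrable_on UNIV" "(\<lambda>x. f x * partial i g x) integrable_on UNIV"
    using s[THEN smooth_on_continuous] z assms(6) compact_imp_bounded[OF assms(4)]
    by (auto intro!: integrable_compact_support(2)[of _ K])
  have "partial i (\<lambda>x. f x * g x) x = partial i f x * g x + f x * partial i g x" for x
  proof (cases "x \<in> U")
    case True
    then show ?thesis
      using partial_mult[OF smooth_on_differentiable[OF assms(2) True] smooth_on_differentiable[OF assms(3) True], of i]
      by simp
  next
    case False
    then have "x \<notin> K" using assms(5) by auto
    then show ?thesis using z assms(6) partial_zero_outside[OF cl, of "\<lambda>x. f x * g x"] by simp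
  qed
  then have "partial i (\<lambda>x. f x * g x) = (\<lambda>x. partial i f x * g x + f x * partial i g x)" by blast
  moreover have "integral UNIV (partial i (\<lambda>x. f x * g x)) = 0"
    using integral_partial_eq_0[OF s(1) assms(4), of i] assms(6) by simp
  ultimately have "integral UNIV (\<lambda>x. partial i f x * g x + f x * partial i g x) = 0" by simp
  then show ?thesis using integral_add[OF int] by simp
qed

text \<open>The derivatives are moved one at a time, the outermost first, so they arrive at
  \<open>g\<close> in reversed order.\<close>

lemma integration_by_parts_list:
  fixes f g :: "real^'d::finite \<Rightarrow> real"
  assumes "open U" "smooth_on U f" "smooth_on U g" "compact K" "K \<subseteq> U" "\<And>x. x \<notin> K \<Longrightarrow> f x = 0"
  shows "integral UNIV (\<lambda>x. partials I f x * g x) = (-1) ^ length I * integral UNIV (\<lambda>x. f x * partials (rev I) g x)"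
  using assms(3)
proof (induction I arbitrary: g)
  case (Cons i I)
  have *: "partials (J @ [i]) g = partials J (partial i g)" for J by (induction J) auto
  have "integral UNIV (\<lambda>x. partials (i # I) f x * g x) = - integral UNIV (\<lambda>x. partials I f x * partial i g x)"
    using assms(4-6) partials_zero_outside[OF compact_imp_closed[OF assms(4)] assms(6)]
    by (simp add: integration_by_parts[OF assms(1) smooth_on_partials[OF assms(2)] Cons.prems assms(4,5)])
  then show ?case using Cons.IH[OF smooth_on_partial[OF Cons.prems]] by (simp add: *)
qed simp

section \<open>Functions and integration on manifolds\<close>

text \<open>Charts are pairs, and variables ranging over them should not be split.\<close>

declare split_paired_All [simp del] split_paired_Ex [simp del]

locale volume_manifold =
  fixes T :: "'a topology" and A :: "('a, 'd::finite) chart set" and \<rho> :: "('a, 'd) density"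
  assumes manifold: "smooth_manifold T A" and volume: "volume_form A \<rho>"
begin

section \<open>Charts and transition maps\<close>

definition pt :: "('a, 'd) chart \<Rightarrow> real^'d \<Rightarrow> 'a" where
  "pt \<kappa> x = inv_into (chart_dom \<kappa>) (coord \<kappa>) x"

lemma chart_facts:
  assumes "\<kappa> \<in> A"
  shows openin_chart: "openin T (chart_dom \<kappa>)" and open_target: "open (target \<kappa>)"
    and chart_homeo: "homeomorphic_map (subtopology T (chart_dom \<kappa>)) (top_of_set (target \<kappa>)) (coord \<kappa>)"
  using manifold assms by (auto simp: smooth_manifold_def)

lemma chart_topspace: "\<kappa> \<in> A \<Longrightarrow> chart_dom \<kappa> \<subseteq> topspace T"
  using openin_chart openin_subset by blast

lemma topspace_chart: "p \<in> topspace T \<Longrightarrow> \<exists>\<kappa>\<in>A. p \<in> chart_dom \<kappa>"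
  using manifold by (auto simp: smooth_manifold_def)

lemma hausdorff: "Hausdorff_space T"
  using manifold by (simp add: smooth_manifold_def)

lemma inj_coord: "\<kappa> \<in> A \<Longrightarrow> inj_on (coord \<kappa>) (chart_dom \<kappa>)"
  using homeomorphic_imp_injective_map[OF chart_homeo] chart_topspace by (simp add: inf.absorb2)

lemma pt_coord [simp]: "\<kappa> \<in> A \<Longrightarrow> p \<in> chart_dom \<kappa> \<Longrightarrow> pt \<kappa> (coord \<kappa> p) = p"
  by (simp add: pt_def inj_coord)

lemma coord_target [simp]: "p \<in> chart_dom \<kappa> \<Longrightarrow> coord \<kappa> p \<in> target \<kappa>"
  by (simp add: target_def)

lemma pt_dom [simp]: "x \<in> target \<kappa> \<Longrightarrow> pt \<kappa> x \<in> chart_dom \<kappa>"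
  and coord_pt [simp]: "x \<in> target \<kappa> \<Longrightarrow> coord \<kappa> (pt \<kappa> x) = x"
  by (auto simp: pt_def target_def inv_into_into f_inv_into_f)

lemma transition_pt: "transition \<kappa> \<kappa>' x = coord \<kappa>' (pt \<kappa> x)"
  by (simp add: transition_def pt_def)

lemma overlap_iff: "\<kappa> \<in> A \<Longrightarrow> x \<in> overlap \<kappa> \<kappa>' \<longleftrightarrow> x \<in> target \<kappa> \<and> pt \<kappa> x \<in> chart_dom \<kappa>'"
  by (auto simp: overlap_def) (metis IntI coord_pt imageI pt_dom)

lemma overlap_target: "overlap \<kappa> \<kappa>' \<subseteq> target \<kappa>"
  by (auto simp: overlap_def)

lemma transition_overlap:
  assumes "\<kappa> \<in> A" "\<kappa>' \<in> A" "x \<in> overlap \<kappa> \<kappa>'"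
  shows "transition \<kappa> \<kappa>' x \<in> overlap \<kappa>' \<kappa>" "pt \<kappa>' (transition \<kappa> \<kappa>' x) = pt \<kappa> x"
    "transition \<kappa>' \<kappa> (transition \<kappa> \<kappa>' x) = x" "transition \<kappa> \<kappa>' x \<in> target \<kappa>'"
  using assms by (auto simp: overlap_iff transition_pt)

lemma transition_image:
  assumes "\<kappa> \<in> A" "\<kappa>' \<in> A"
  shows "transition \<kappa> \<kappa>' ` overlap \<kappa> \<kappa>' = overlap \<kappa>' \<kappa>"
  using transition_overlap[OF assms] transition_overlap[OF assms(2,1)] by (auto simp: image_iff) metis

lemma transition_into:
  assumes "\<kappa> \<in> A" "\<kappa>' \<in> A" shows "transition \<kappa> \<kappa>' ` overlap \<kappa> \<kappa>' \<subseteq> target \<kappa>'"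
  using transition_image[OF assms] overlap_target by metis

lemma inj_transition:
  assumes "\<kappa> \<in> A" "\<kappa>' \<in> A"
  shows "inj_on (transition \<kappa> \<kappa>') (overlap \<kappa> \<kappa>')"
  by (rule inj_on_inverseI[of _ "transition \<kappa>' \<kappa>"]) (use transition_overlap[OF assms] in auto)

lemma open_coord_image:
  assumes "\<kappa> \<in> A" "openin T W"
  shows "open (coord \<kappa> ` (chart_dom \<kappa> \<inter> W))"
proof -
  have "openin (subtopology T (chart_dom \<kappa>)) (chart_dom \<kappa> \<inter> W)"
    using assms(2) by (auto simp: openin_subtopology_alt Int_commute)
  then have "openin (top_of_set (target \<kappa>)) (coord \<kappa> ` (chart_dom \<kappa> \<inter> W))"
    using homeomorphic_imp_open_map[OF chart_homeo[OF assms(1)]] by (simp add: open_map_def)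
  then show ?thesis using open_target[OF assms(1)] openin_open_trans by blast
qed

lemma open_overlap: "\<kappa> \<in> A \<Longrightarrow> \<kappa>' \<in> A \<Longrightarrow> open (overlap \<kappa> \<kappa>')"
  unfolding overlap_def by (intro open_coord_image openin_chart)

lemma openin_pt_image:
  assumes "\<kappa> \<in> A" "open V"
  shows "openin T {p \<in> chart_dom \<kappa>. coord \<kappa> p \<in> V}"
proof -
  have "openin (top_of_set (target \<kappa>)) (target \<kappa> \<inter> V)"
    using assms(2) by (auto simp: openin_open)
  then have "openin (subtopology T (chart_dom \<kappa>)) {p \<in> topspace (subtopology T (chart_dom \<kappa>)). coord \<kappa> p \<in> target \<kappa> \<inter> V}"
    using homeomorphic_imp_continuous_map[OF chart_homeo[OF assms(1)]] openin_continuous_map_preimage by blast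
  moreover have "{p \<in> topspace (subtopology T (chart_dom \<kappa>)). coord \<kappa> p \<in> target \<kappa> \<inter> V} = {p \<in> chart_dom \<kappa>. coord \<kappa> p \<in> V}"
    using chart_topspace[OF assms(1)] by auto
  ultimately show ?thesis
    using openin_chart[OF assms(1)] openin_trans_full by fastforce
qed

lemma compactin_pt_image:
  assumes "\<kappa> \<in> A" "compact C" "C \<subseteq> target \<kappa>"
  shows "compactin T (pt \<kappa> ` C)"
proof -
  have "compactin (top_of_set (target \<kappa>)) C"
    using assms(2,3) by (simp add: compactin_subtopology)
  moreover have "C = coord \<kappa> ` (pt \<kappa> ` C)"
    using assms(3) by (force simp: image_image)
  moreover have "pt \<kappa> ` C \<subseteq> chart_dom \<kappa>" using assms(3) by auto
  ultimately have "compactin (subtopology T (chart_dom \<kappa>)) (pt \<kappa> ` C)"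
    using homeomorphic_map_compactness[OF chart_homeo[OF assms(1)], of "pt \<kappa> ` C"] chart_topspace[OF assms(1)] by auto
  then show ?thesis by (simp add: compactin_subtopology)
qed

lemma compact_coord_image:
  assumes "\<kappa> \<in> A" "compactin T K" "K \<subseteq> chart_dom \<kappa>"
  shows "compact (coord \<kappa> ` K)"
proof -
  have "compactin (subtopology T (chart_dom \<kappa>)) K"
    using assms(2,3) by (simp add: compactin_subtopology)
  then have "compactin (top_of_set (target \<kappa>)) (coord \<kappa> ` K)"
    using image_compactin homeomorphic_imp_continuous_map[OF chart_homeo[OF assms(1)]] by blast
  then show ?thesis by (simp add: compactin_subtopology)
qed

lemma smooth_transition: "\<kappa> \<in> A \<Longrightarrow> \<kappa>' \<in> A \<Longrightarrow> smooth_on (overlap \<kappa> \<kappa>') (transition \<kappa> \<kappa>')"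
  using manifold by (auto simp: smooth_manifold_def)

lemma has_derivative_transition:
  "\<kappa> \<in> A \<Longrightarrow> \<kappa>' \<in> A \<Longrightarrow> x \<in> overlap \<kappa> \<kappa>' \<Longrightarrow>
    (transition \<kappa> \<kappa>' has_derivative frechet_derivative (transition \<kappa> \<kappa>') (at x)) (at x)"
  using smooth_on_differentiable[OF smooth_transition] by (simp add: frechet_derivative_works)

section \<open>Densities of a given weight\<close>

lemma densitiesD:
  assumes "s \<in> densities A \<mu>"
  shows density_smooth: "\<kappa> \<in> A \<Longrightarrow> smooth_on (target \<kappa>) (s \<kappa>)"
    and density_transition: "\<kappa> \<in> A \<Longrightarrow> \<kappa>' \<in> A \<Longrightarrow> x \<in> overlap \<kappa> \<kappa>' \<Longrightarrow>
      s \<kappa> x = \<bar>jacobian \<kappa> \<kappa>' x\<bar> powr \<mu> * s \<kappa>' (transition \<kappa> \<kappa>' x)"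
    and density_zero: "\<kappa> \<notin> A \<or> x \<notin> target \<kappa> \<Longrightarrow> s \<kappa> x = 0"
  using assms unfolding densities_def by blast+

lemma rho_density: "\<rho> \<in> densities A 1" and rho_pos: "\<kappa> \<in> A \<Longrightarrow> x \<in> target \<kappa> \<Longrightarrow> \<rho> \<kappa> x > 0"
  using volume by (auto simp: volume_form_def)

text \<open>A vanishing Jacobian would make the positive number \<open>\<rho> \<kappa> x\<close>
  zero through the transformation law of weight 1.\<close>

lemma jacobian_nonzero:
  assumes "\<kappa> \<in> A" "\<kappa>' \<in> A" "x \<in> overlap \<kappa> \<kappa>'"
  shows "jacobian \<kappa> \<kappa>' x \<noteq> 0"
  using density_transition[OF rho_density assms] rho_pos[OF assms(1), of x] overlap_target assms(3) by fastforce

lemma zero_density: "0 \<in> densities A \<mu>"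
  by (simp add: densities_def zero_fun_def)

lemma add_density:
  assumes "s \<in> densities A \<mu>" "t \<in> densities A \<mu>"
  shows "s + t \<in> densities A \<mu>"
  unfolding densities_def
proof (intro CollectI conjI ballI allI impI)
  fix \<kappa> assume "\<kappa> \<in> A"
  then show "smooth_on (target \<kappa>) ((s + t) \<kappa>)"
    using densitiesD(1)[OF assms(1)] densitiesD(1)[OF assms(2)] open_target
    by (simp add: plus_fun_def smooth_on_add)
qed (use densitiesD(2,3)[OF assms(1)] densitiesD(2,3)[OF assms(2)] in \<open>auto simp: algebra_simps\<close>)

lemma mult_density:
  assumes "s \<in> densities A \<mu>" "t \<in> densities A \<nu>"
  shows "s * t \<in> densities A (\<mu> + \<nu>)"
  unfolding densities_def
proof (intro CollectI conjI ballI allI impI)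
  fix \<kappa> assume "\<kappa> \<in> A"
  then show "smooth_on (target \<kappa>) ((s * t) \<kappa>)"
    using densitiesD(1)[OF assms(1)] densitiesD(1)[OF assms(2)] open_target
    by (simp add: times_fun_def smooth_on_mult)
qed (use densitiesD(2,3)[OF assms(1)] densitiesD(2,3)[OF assms(2)] in \<open>auto simp: powr_add algebra_simps\<close>)

lemma scale_density_in:
  assumes "s \<in> densities A \<mu>"
  shows "scale_density r s \<in> densities A \<mu>"
  unfolding densities_def
proof (intro CollectI conjI ballI allI impI)
  fix \<kappa> assume "\<kappa> \<in> A"
  then show "smooth_on (target \<kappa>) (scale_density r s \<kappa>)"
    using densitiesD(1)[OF assms(1)] open_target by (simp add: scale_density_def smooth_on_cmult)
qed (use densitiesD(2,3)[OF assms(1)] in \<open>auto simp: scale_density_def\<close>)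

lemma minus_density: "s \<in> densities A \<mu> \<Longrightarrow> - s \<in> densities A \<mu>"
  using scale_density_in[of s \<mu> "-1"] by (simp add: scale_density_def fun_Compl_def)

lemma diff_density: "s \<in> densities A \<mu> \<Longrightarrow> t \<in> densities A \<mu> \<Longrightarrow> s - t \<in> densities A \<mu>"
  using add_density[of s \<mu> "-t"] minus_density by simp

lemma rho_powr_density: "density_powr \<rho> a \<in> densities A a"
  unfolding densities_def
proof (intro CollectI conjI ballI allI impI)
  fix \<kappa> assume "\<kappa> \<in> A"
  then show "smooth_on (target \<kappa>) (density_powr \<rho> a \<kappa>)"
    using densitiesD(1)[OF rho_density] open_target rho_pos by (simp add: density_powr_def smooth_on_powr)
next
  fix \<kappa> \<kappa>' x assume *: "\<kappa> \<in> A" "\<kappa>' \<in> A" "x \<in> overlap \<kappa> \<kappa>'"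
  then have "\<rho> \<kappa>' (transition \<kappa> \<kappa>' x) > 0" using transition_overlap rho_pos by blast
  then show "density_powr \<rho> a \<kappa> x = \<bar>jacobian \<kappa> \<kappa>' x\<bar> powr a * density_powr \<rho> a \<kappa>' (transition \<kappa> \<kappa>' x)"
    using density_transition[OF rho_density *] by (simp add: density_powr_def powr_mult)
qed (use densitiesD(3)[OF rho_density] in \<open>auto simp: density_powr_def\<close>)

abbreviation "Fun \<equiv> densities A 0"

text \<open>Since \<open>0 powr 0 = 0\<close>, the Jacobian factor of weight zero equals 1 only
  because the Jacobian does not vanish.\<close>

lemma fun_transition:
  "f \<in> Fun \<Longrightarrow> \<kappa> \<in> A \<Longrightarrow> \<kappa>' \<in> A \<Longrightarrow> x \<in> overlap \<kappa> \<kappa>' \<Longrightarrow> f \<kappa> x = f \<kappa>' (transition \<kappa> \<kappa>' x)"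
  using density_transition[of f 0] jacobian_nonzero by simp

lemma funI:
  assumes "\<And>\<kappa>. \<kappa> \<in> A \<Longrightarrow> smooth_on (target \<kappa>) (f \<kappa>)"
    and "\<And>\<kappa> \<kappa>' x. \<kappa> \<in> A \<Longrightarrow> \<kappa>' \<in> A \<Longrightarrow> x \<in> overlap \<kappa> \<kappa>' \<Longrightarrow> f \<kappa> x = f \<kappa>' (transition \<kappa> \<kappa>' x)"
    and "\<And>\<kappa> x. \<kappa> \<notin> A \<or> x \<notin> target \<kappa> \<Longrightarrow> f \<kappa> x = 0"
  shows "f \<in> Fun"
  using assms jacobian_nonzero by (auto simp: densities_def)

lemma one_eq_rho_powr: "density_powr \<rho> 0 = one_density A"
proof (intro ext)
  fix \<kappa> x
  show "density_powr \<rho> 0 \<kappa> x = one_density A \<kappa> x"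
    using rho_pos[of \<kappa> x] densitiesD(3)[OF rho_density, of \<kappa> x]
    by (cases "\<kappa> \<in> A \<and> x \<in> target \<kappa>") (auto simp: density_powr_def one_density_def)
qed

lemma one_density_in: "one_density A \<in> Fun"
  using rho_powr_density[of 0] by (simp add: one_eq_rho_powr)

lemma density_one_mult [simp]: "s \<in> densities A \<mu> \<Longrightarrow> one_density A * s = s"
proof (intro ext)
  fix \<kappa> x assume "s \<in> densities A \<mu>"
  from densitiesD(3)[OF this, of \<kappa> x] show "(one_density A * s) \<kappa> x = s \<kappa> x"
    by (cases "\<kappa> \<in> A \<and> x \<in> target \<kappa>") (auto simp: one_density_def)
qed

lemma rho_powr_mult: "density_powr \<rho> a * density_powr \<rho> b = density_powr \<rho> (a + b)"
  by (simp add: fun_eq_iff density_powr_def powr_add)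

lemma rho_powr_cancel:
  assumes "s \<in> densities A \<mu>"
  shows "density_powr \<rho> a * (density_powr \<rho> (- a) * s) = s"
  using assms by (simp add: mult.assoc[symmetric] rho_powr_mult one_eq_rho_powr)

section \<open>Functions given by their values at points, and extension by zero\<close>

definition fn :: "('a \<Rightarrow> real) \<Rightarrow> ('a, 'd) density" where
  "fn F = (\<lambda>\<kappa> x. if \<kappa> \<in> A \<and> x \<in> target \<kappa> then F (pt \<kappa> x) else 0)"

lemma fn_in:
  assumes "\<And>\<kappa>. \<kappa> \<in> A \<Longrightarrow> smooth_on (target \<kappa>) (\<lambda>x. F (pt \<kappa> x))"
  shows "fn F \<in> Fun"
proof (rule funI)
  show "smooth_on (target \<kappa>) (fn F \<kappa>)" if "\<kappa> \<in> A" for \<kappa>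
    using smooth_on_cong[OF open_target[OF that] _ assms[OF that], of "fn F \<kappa>"] that by (simp add: fn_def)
  show "fn F \<kappa> x = fn F \<kappa>' (transition \<kappa> \<kappa>' x)" if "\<kappa> \<in> A" "\<kappa>' \<in> A" "x \<in> overlap \<kappa> \<kappa>'" for \<kappa> \<kappa>' x
    using that transition_overlap[OF that] overlap_target[of \<kappa> \<kappa>'] by (auto simp: fn_def)
  show "fn F \<kappa> x = 0" if "\<kappa> \<notin> A \<or> x \<notin> target \<kappa>" for \<kappa> x using that by (auto simp: fn_def)
qed

text \<open>The target of another chart is covered by the overlap, where the function is
  \<open>\<sigma>\<close> composed with a transition map, and by the part away from the image of
  \<open>C\<close>, where it is zero. The latter is open because compact subsets of a Hausdorff
  space are closed.\<close>

lemma extend_fun: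
  assumes "\<kappa> \<in> A" "smooth_on (target \<kappa>) \<sigma>" "compact C" "C \<subseteq> target \<kappa>"
    "\<And>x. x \<in> target \<kappa> \<Longrightarrow> x \<notin> C \<Longrightarrow> \<sigma> x = 0"
  shows "fn (\<lambda>p. if p \<in> chart_dom \<kappa> then \<sigma> (coord \<kappa> p) else 0) \<in> Fun" (is "fn ?F \<in> Fun")
proof (rule fn_in)
  fix \<kappa>' assume k': "\<kappa>' \<in> A"
  have "compactin T (pt \<kappa> ` C)" using compactin_pt_image assms by blast
  then have "closedin T (pt \<kappa> ` C)" using compactin_imp_closedin hausdorff by blast
  then have "openin T (topspace T - pt \<kappa> ` C)" by blast
  then have o: "open (coord \<kappa>' ` (chart_dom \<kappa>' \<inter> (topspace T - pt \<kappa> ` C)))" (is "open ?O")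
    using open_coord_image k' by blast
  have "smooth_on (overlap \<kappa>' \<kappa>) (\<lambda>x. ?F (pt \<kappa>' x))"
  proof (rule smooth_on_cong[OF open_overlap[OF k' assms(1)]])
    show "smooth_on (overlap \<kappa>' \<kappa>) (\<lambda>x. \<sigma> (transition \<kappa>' \<kappa> x))"
      by (rule smooth_on_compose[OF open_overlap[OF k' assms(1)] assms(2) smooth_transition[OF k' assms(1)]
            transition_into[OF k' assms(1)]])
    show "\<sigma> (transition \<kappa>' \<kappa> x) = ?F (pt \<kappa>' x)" if "x \<in> overlap \<kappa>' \<kappa>" for x
      using that k' by (simp add: overlap_iff transition_pt)
  qed
  moreover have "smooth_on ?O (\<lambda>x. ?F (pt \<kappa>' x))"
  proof (rule smooth_on_cong[OF o])
    show "0 = ?F (pt \<kappa>' x)" if xO: "x \<in> ?O" for x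
    proof -
      obtain p where p: "x = coord \<kappa>' p" "p \<in> chart_dom \<kappa>'" "p \<notin> pt \<kappa> ` C" using xO by blast
      have "coord \<kappa> p \<notin> C" if "p \<in> chart_dom \<kappa>" using p(3) that assms(1) by (metis image_eqI pt_coord)
      then show ?thesis using p assms k' by auto
    qed
  qed simp
  ultimately have "smooth_on (overlap \<kappa>' \<kappa> \<union> ?O) (\<lambda>x. ?F (pt \<kappa>' x))"
    using smooth_on_Un open_overlap assms(1) k' o by blast
  moreover have "target \<kappa>' \<subseteq> overlap \<kappa>' \<kappa> \<union> ?O"
  proof
    fix x assume x: "x \<in> target \<kappa>'"
    show "x \<in> overlap \<kappa>' \<kappa> \<union> ?O"
    proof (cases "pt \<kappa>' x \<in> chart_dom \<kappa>")
      case True then show ?thesis using x k' by (simp add: overlap_iff)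
    next
      case False
      then have "pt \<kappa>' x \<notin> pt \<kappa> ` C" using assms(4) by (auto simp: subset_iff)
      then have "coord \<kappa>' (pt \<kappa>' x) \<in> ?O" using x k' chart_topspace by (intro imageI) (auto simp: subset_iff)
      then show ?thesis using x by simp
    qed
  qed
  ultimately show "smooth_on (target \<kappa>') (\<lambda>x. ?F (pt \<kappa>' x))" using smooth_on_subset by blast
qed

section \<open>Compact supports, bumps and partitions of unity\<close>

definition cpt :: "('a, 'd) density \<Rightarrow> bool" where "cpt s \<longleftrightarrow> compactin T (supp T A s)"

lemma suppI:
  assumes "\<kappa> \<in> A" "x \<in> target \<kappa>" "s \<kappa> x \<noteq> 0" shows "pt \<kappa> x \<in> supp T A s"
proof -
  have "pt \<kappa> x \<in> {p. \<exists>\<kappa>\<in>A. p \<in> chart_dom \<kappa> \<and> s \<kappa> (coord \<kappa> p) \<noteq> 0}" using assms by force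
  moreover have "{p. \<exists>\<kappa>\<in>A. p \<in> chart_dom \<kappa> \<and> s \<kappa> (coord \<kappa> p) \<noteq> 0} \<subseteq> topspace T"
    using chart_topspace by auto
  ultimately show ?thesis unfolding supp_def using closure_of_subset by blast
qed

lemma supp_subset:
  assumes "closedin T K" "\<And>\<kappa> x. \<kappa> \<in> A \<Longrightarrow> x \<in> target \<kappa> \<Longrightarrow> s \<kappa> x \<noteq> 0 \<Longrightarrow> pt \<kappa> x \<in> K"
  shows "supp T A s \<subseteq> K"
  unfolding supp_def
proof (rule closure_of_minimal[OF _ assms(1)])
  show "{p. \<exists>\<kappa>\<in>A. p \<in> chart_dom \<kappa> \<and> s \<kappa> (coord \<kappa> p) \<noteq> 0} \<subseteq> K"
    using assms(2)[of _ "coord _ _"] by force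
qed

text \<open>In a Hausdorff space the compact set \<open>K\<close> is closed, so it contains the
  closure that defines the support.\<close>

lemma cptI:
  assumes "compactin T K" "\<And>\<kappa> x. \<kappa> \<in> A \<Longrightarrow> x \<in> target \<kappa> \<Longrightarrow> s \<kappa> x \<noteq> 0 \<Longrightarrow> pt \<kappa> x \<in> K"
  shows "cpt s" "supp T A s \<subseteq> K"
proof -
  have "closedin T K" using assms(1) hausdorff compactin_imp_closedin by blast
  then show "supp T A s \<subseteq> K" using supp_subset assms(2) by blast
  then show "cpt s" unfolding cpt_def
    using closed_compactin[OF assms(1)] by (simp add: supp_def)
qed

lemma cpt_smaller:
  assumes "cpt s" "\<And>\<kappa> x. \<kappa> \<in> A \<Longrightarrow> x \<in> target \<kappa> \<Longrightarrow> pt \<kappa> x \<notin> supp T A s \<Longrightarrow> t \<kappa> x = 0"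
  shows "cpt t" "supp T A t \<subseteq> supp T A s"
  using cptI[of "supp T A s" t] assms unfolding cpt_def by blast+

lemma cpt_mult: "cpt s \<Longrightarrow> cpt (s * t)" "cpt s \<Longrightarrow> supp T A (s * t) \<subseteq> supp T A s"
  "cpt s \<Longrightarrow> cpt (t * s)" "cpt s \<Longrightarrow> supp T A (t * s) \<subseteq> supp T A s"
proof -
  assume c: "cpt s"
  have z: "s \<kappa> x = 0" if "\<kappa> \<in> A" "x \<in> target \<kappa>" "pt \<kappa> x \<notin> supp T A s" for \<kappa> x
    using suppI[OF that(1,2), of s] that(3) by blast
  have 1: "(s * t) \<kappa> x = 0" and 2: "(t * s) \<kappa> x = 0" if "\<kappa> \<in> A" "x \<in> target \<kappa>" "pt \<kappa> x \<notin> supp T A s" for \<kappa> x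
    using z[OF that] by simp_all
  show "cpt (s * t)" "supp T A (s * t) \<subseteq> supp T A s" by (rule cpt_smaller[OF c 1]; assumption)+
  show "cpt (t * s)" "supp T A (t * s) \<subseteq> supp T A s" by (rule cpt_smaller[OF c 2]; assumption)+
qed

lemma cpt_add:
  assumes "cpt s" "cpt t" shows "cpt (s + t)"
proof (rule cptI)
  show "compactin T (supp T A s \<union> supp T A t)" using assms by (simp add: cpt_def compactin_Un)
  show "pt \<kappa> x \<in> supp T A s \<union> supp T A t" if "\<kappa> \<in> A" "x \<in> target \<kappa>" "(s + t) \<kappa> x \<noteq> 0" for \<kappa> x
    using that suppI[OF that(1,2), of s] suppI[OF that(1,2), of t] by (cases "s \<kappa> x = 0") auto
qed

lemma cpt_0: "cpt 0"
  by (rule cptI(1)[of "{}"]) auto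

text \<open>A Euclidean bump carried over by the chart. The open set \<open>N\<close>, on which it
  equals 1, serves for covers and for comparing germs; the compact set \<open>K\<close> confines the
  support to the chart and to \<open>W\<close>.\<close>

lemma exists_bump:
  assumes "\<kappa> \<in> A" "p \<in> chart_dom \<kappa>" "openin T W" "p \<in> W"
  obtains \<phi> N K where "\<phi> \<in> Fun" "openin T N" "p \<in> N" "N \<subseteq> K" "compactin T K" "K \<subseteq> chart_dom \<kappa> \<inter> W"
    "\<And>\<kappa>' x. \<phi> \<kappa>' x \<ge> 0" "\<And>\<kappa>' x. \<kappa>' \<in> A \<Longrightarrow> x \<in> target \<kappa>' \<Longrightarrow> pt \<kappa>' x \<in> N \<Longrightarrow> \<phi> \<kappa>' x = 1"
    "\<And>\<kappa>' x. \<kappa>' \<in> A \<Longrightarrow> x \<in> target \<kappa>' \<Longrightarrow> \<phi> \<kappa>' x \<noteq> 0 \<Longrightarrow> pt \<kappa>' x \<in> K"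
proof -
  let ?V = "coord \<kappa> ` (chart_dom \<kappa> \<inter> W)"
  have "open ?V" "coord \<kappa> p \<in> ?V" using open_coord_image assms by auto
  then obtain e where e: "e > 0" "cball (coord \<kappa> p) e \<subseteq> ?V" using open_contains_cball by meson
  define r where "r = e / 2"
  have r: "r > 0" "cball (coord \<kappa> p) (2 * r) \<subseteq> ?V" using e by (auto simp: r_def)
  obtain b :: "real^'d \<Rightarrow> real" where b: "smooth_on UNIV b" "\<And>x. 0 \<le> b x"
    "\<And>x. x \<in> ball (coord \<kappa> p) r \<Longrightarrow> b x = 1" "\<And>x. x \<notin> ball (coord \<kappa> p) (2 * r) \<Longrightarrow> b x = 0"
    using smooth_bump[OF r(1)] by metis
  let ?C = "cball (coord \<kappa> p) (2 * r)"
  have VT: "?V \<subseteq> target \<kappa>" by auto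
  define \<phi> where "\<phi> = fn (\<lambda>q. if q \<in> chart_dom \<kappa> then b (coord \<kappa> q) else 0)"
  have 1: "\<phi> \<in> Fun" unfolding \<phi>_def
  proof (rule extend_fun[OF assms(1)])
    show "?C \<subseteq> target \<kappa>" using r VT by blast
    show "b x = 0" if "x \<notin> ?C" for x using b(4)[of x] that by auto
  qed (use b(1) in \<open>auto intro: smooth_on_subset\<close>)
  let ?N = "{q \<in> chart_dom \<kappa>. coord \<kappa> q \<in> ball (coord \<kappa> p) r}"
  have CV: "?C \<subseteq> ?V" by (rule r(2))
  have K: "q \<in> pt \<kappa> ` ?C" if "q \<in> chart_dom \<kappa>" "coord \<kappa> q \<in> ?C" for q
    using that assms(1) by (metis image_eqI pt_coord)
  show thesis
  proof (rule that[OF 1, of ?N "pt \<kappa> ` ?C"])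
    show "openin T ?N" using openin_pt_image assms(1) by blast
    show "p \<in> ?N" using assms r by simp
    show "?N \<subseteq> pt \<kappa> ` ?C"
    proof
      fix q assume "q \<in> ?N" then show "q \<in> pt \<kappa> ` ?C" using r(1) by (intro K) auto
    qed
    show "compactin T (pt \<kappa> ` ?C)" using compactin_pt_image[OF assms(1)] CV VT by (meson compact_cball order_trans)
    show "pt \<kappa> ` ?C \<subseteq> chart_dom \<kappa> \<inter> W" using CV assms(1) by fastforce
    show "\<phi> \<kappa>' x \<ge> 0" for \<kappa>' x using b(2) by (simp add: \<phi>_def fn_def)
    show "\<phi> \<kappa>' x = 1" if "\<kappa>' \<in> A" "x \<in> target \<kappa>'" "pt \<kappa>' x \<in> ?N" for \<kappa>' x
      using that b(3) by (simp add: \<phi>_def fn_def)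
    show "pt \<kappa>' x \<in> pt \<kappa> ` ?C" if "\<kappa>' \<in> A" "x \<in> target \<kappa>'" "\<phi> \<kappa>' x \<noteq> 0" for \<kappa>' x
    proof (rule K)
      show "pt \<kappa>' x \<in> chart_dom \<kappa>" using that by (auto simp: \<phi>_def fn_def split: if_splits)
      then have "b (coord \<kappa> (pt \<kappa>' x)) \<noteq> 0" using that by (auto simp: \<phi>_def fn_def)
      then show "coord \<kappa> (pt \<kappa>' x) \<in> ?C" using b(4) ball_subset_cball by blast
    qed
  qed
qed

text \<open>A member of a partition of unity, paired with a chart that contains its support. The
  analogous \<open>chart_piece\<close> below is a summand in the decompositions of
  \<open>density_integral\<close>.\<close>

definition chart_cut :: "('a, 'd) chart \<times> ('a, 'd) density \<Rightarrow> bool" where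
  "chart_cut c \<longleftrightarrow> fst c \<in> A \<and> snd c \<in> Fun \<and> cpt (snd c) \<and> supp T A (snd c) \<subseteq> chart_dom (fst c)"

text \<open>\<open>\<chi>\<^sub>j = \<phi>\<^sub>j (1 - \<phi>\<^sub>1) \<dots> (1 - \<phi>\<^sub>j\<^sub>-\<^sub>1)\<close>, which needs no division.\<close>

lemma partition_of_bumps:
  assumes "\<forall>c\<in>set bs. chart_cut c"
  shows "\<exists>cs. (\<forall>c\<in>set cs. chart_cut c) \<and>
    (\<forall>\<kappa>\<in>A. \<forall>x\<in>target \<kappa>. 1 - (\<Sum>c\<leftarrow>cs. snd c \<kappa> x) = (\<Prod>c\<leftarrow>bs. 1 - snd c \<kappa> x))"
  using assms
proof (induction bs)
  case Nil
  show ?case by (rule exI[of _ "[]"]) simp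
next
  case (Cons b bs)
  then obtain cs where cs: "\<forall>c\<in>set cs. chart_cut c"
    "\<forall>\<kappa>\<in>A. \<forall>x\<in>target \<kappa>. 1 - (\<Sum>c\<leftarrow>cs. snd c \<kappa> x) = (\<Prod>c\<leftarrow>bs. 1 - snd c \<kappa> x)" by auto
  have b: "chart_cut b" using Cons.prems by simp
  define ds where "ds = b # map (\<lambda>c. (fst c, (one_density A - snd b) * snd c)) cs"
  have "chart_cut (fst c, (one_density A - snd b) * snd c)" if "c \<in> set cs" for c
    using mult_density[of "one_density A - snd b" 0 "snd c" 0] b cs(1) that cpt_mult(3,4)[of "snd c"] one_density_in
    unfolding chart_cut_def by (force intro: diff_density)
  then have "\<forall>c\<in>set ds. chart_cut c" using b by (auto simp: ds_def)
  moreover have "1 - (\<Sum>c\<leftarrow>ds. snd c \<kappa> x) = (\<Prod>c\<leftarrow>b # bs. 1 - snd c \<kappa> x)" if "\<kappa> \<in> A" "x \<in> target \<kappa>" for \<kappa> x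
  proof -
    have "(\<Sum>c\<leftarrow>ds. snd c \<kappa> x) = snd b \<kappa> x + (1 - snd b \<kappa> x) * (\<Sum>c\<leftarrow>cs. snd c \<kappa> x)"
      using that by (simp add: ds_def o_def one_density_def sum_list_const_mult)
    then show ?thesis using cs(2) that by (simp add: algebra_simps) (simp add: algebra_simps flip: cs(2)[rule_format, OF that])
  qed
  ultimately show ?case by blast
qed

text \<open>By compactness, finitely many of the sets on which some bump equals 1 cover
  \<open>K\<close>. At a point of \<open>K\<close> one factor of the product of the
  \<open>1 - \<phi>\<close> vanishes, and that product is 1 minus the sum of the cuts.\<close>

lemma partition_of_unity:
  assumes "compactin T K"
  obtains cs where "\<forall>c\<in>set cs. chart_cut c"
    "\<And>\<kappa> x. \<kappa> \<in> A \<Longrightarrow> x \<in> target \<kappa> \<Longrightarrow> pt \<kappa> x \<in> K \<Longrightarrow> (\<Sum>c\<leftarrow>cs. snd c \<kappa> x) = 1"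
proof -
  have "\<exists>c N. chart_cut c \<and> openin T N \<and> p \<in> N \<and> (\<forall>\<kappa>\<in>A. \<forall>x\<in>target \<kappa>. pt \<kappa> x \<in> N \<longrightarrow> snd c \<kappa> x = 1)" if "p \<in> K" for p
  proof -
    have "p \<in> topspace T" using that assms compactin_subset_topspace by blast
    then obtain \<kappa> where k: "\<kappa> \<in> A" "p \<in> chart_dom \<kappa>" using topspace_chart by blast
    obtain \<phi> N K' where f: "\<phi> \<in> Fun" "openin T N" "p \<in> N" "N \<subseteq> K'" "compactin T K'" "K' \<subseteq> chart_dom \<kappa> \<inter> chart_dom \<kappa>"
      "\<And>\<kappa>' x. \<kappa>' \<in> A \<Longrightarrow> x \<in> target \<kappa>' \<Longrightarrow> pt \<kappa>' x \<in> N \<Longrightarrow> \<phi> \<kappa>' x = 1"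
      "\<And>\<kappa>' x. \<kappa>' \<in> A \<Longrightarrow> x \<in> target \<kappa>' \<Longrightarrow> \<phi> \<kappa>' x \<noteq> 0 \<Longrightarrow> pt \<kappa>' x \<in> K'"
      using exists_bump[OF k openin_chart[OF k(1)] k(2)] by metis
    have "chart_cut (\<kappa>, \<phi>)"
      using cptI[OF f(5,8)] f(1,6) k(1) by (auto simp: chart_cut_def)
    then show ?thesis using f by (intro exI[of _ "(\<kappa>, \<phi>)"] exI[of _ N]) auto
  qed
  then obtain c N where cN: "\<And>p. p \<in> K \<Longrightarrow> chart_cut (c p)" "\<And>p. p \<in> K \<Longrightarrow> openin T (N p)" "\<And>p. p \<in> K \<Longrightarrow> p \<in> N p"
    "\<And>p \<kappa> x. p \<in> K \<Longrightarrow> \<kappa> \<in> A \<Longrightarrow> x \<in> target \<kappa> \<Longrightarrow> pt \<kappa> x \<in> N p \<Longrightarrow> snd (c p) \<kappa> x = 1" by metis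
  obtain F where F: "finite F" "F \<subseteq> N ` K" "K \<subseteq> \<Union>F"
    using compactinD[OF assms, of "N ` K"] cN(2,3) by blast
  obtain P where P: "finite P" "P \<subseteq> K" "F = N ` P" using finite_subset_image[OF F(1,2)] by blast
  obtain ps where ps: "set ps = P" using finite_list[OF P(1)] by blast
  have "\<forall>b\<in>set (map c ps). chart_cut b" using ps P(2) cN(1) by auto
  then obtain cs where cs: "\<forall>b\<in>set cs. chart_cut b"
    "\<forall>\<kappa>\<in>A. \<forall>x\<in>target \<kappa>. 1 - (\<Sum>b\<leftarrow>cs. snd b \<kappa> x) = (\<Prod>b\<leftarrow>map c ps. 1 - snd b \<kappa> x)"
    using partition_of_bumps by blast
  show thesis
  proof (rule that[OF cs(1)])
    fix \<kappa> x assume k: "\<kappa> \<in> A" "x \<in> target \<kappa>" "pt \<kappa> x \<in> K"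
    then obtain p where p: "p \<in> P" "pt \<kappa> x \<in> N p" using F(3) P(3) by blast
    then have "snd (c p) \<kappa> x = 1" using cN(4) P(2) k by blast
    then have "0 \<in> set (map (\<lambda>b. 1 - snd b \<kappa> x) (map c ps))" using p(1) ps by force
    then have "(\<Prod>b\<leftarrow>map c ps. 1 - snd b \<kappa> x) = 0" by (simp only: prod_list_zero_iff)
    then show "(\<Sum>b\<leftarrow>cs. snd b \<kappa> x) = 1" using cs(2)[rule_format, OF k(1,2)] by linarith
  qed
qed

section \<open>The integral of a density of weight 1\<close>

definition chart_piece :: "('a, 'd) chart \<times> ('a, 'd) density \<Rightarrow> bool" where
  "chart_piece c \<longleftrightarrow> fst c \<in> A \<and> snd c \<in> densities A 1 \<and> cpt (snd c) \<and> supp T A (snd c) \<subseteq> chart_dom (fst c)"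

definition chart_integral :: "('a, 'd) chart \<times> ('a, 'd) density \<Rightarrow> real" where
  "chart_integral c = integral UNIV (snd c (fst c))"

lemma integral_target: "s \<in> densities A \<mu> \<Longrightarrow> integral (target \<kappa>) (s \<kappa>) = integral UNIV (s \<kappa>)"
  by (rule integral_eq_UNIV) (simp add: density_zero)

lemma chart_support:
  assumes "\<kappa> \<in> A" "s \<in> densities A \<mu>" "cpt s" "supp T A s \<subseteq> chart_dom \<kappa>"
  obtains C where "compact C" "C \<subseteq> target \<kappa>" "\<And>x. x \<notin> C \<Longrightarrow> s \<kappa> x = 0" "C = coord \<kappa> ` supp T A s"
proof
  let ?C = "coord \<kappa> ` supp T A s"
  show "compact ?C" using compact_coord_image assms by (simp add: cpt_def)
  show "?C \<subseteq> target \<kappa>" using assms(4) by (auto simp: target_def)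
  show "s \<kappa> x = 0" if "x \<notin> ?C" for x
  proof (rule ccontr)
    assume *: "s \<kappa> x \<noteq> 0"
    then have "x \<in> target \<kappa>" using density_zero[OF assms(2)] by blast
    then show False using suppI[of \<kappa> x s] * that assms(1) by (metis coord_pt image_eqI)
  qed
qed simp

lemma piece_smooth_UNIV:
  assumes "\<kappa> \<in> A" "s \<in> densities A \<mu>" "cpt s" "supp T A s \<subseteq> chart_dom \<kappa>"
  shows "smooth_on UNIV (s \<kappa>)" "s \<kappa> absolutely_integrable_on UNIV" "s \<kappa> integrable_on UNIV"
proof -
  obtain C where C: "compact C" "C \<subseteq> target \<kappa>" "\<And>x. x \<notin> C \<Longrightarrow> s \<kappa> x = 0"
    using chart_support[OF assms] by metis
  show 1: "smooth_on UNIV (s \<kappa>)"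
    using smooth_on_extend_zero[OF open_target[OF assms(1)] density_smooth[OF assms(2,1)] compact_imp_closed[OF C(1)] C(2,3)] .
  show "s \<kappa> absolutely_integrable_on UNIV" "s \<kappa> integrable_on UNIV"
    using integrable_compact_support[OF smooth_on_continuous[OF 1] compact_imp_bounded[OF C(1)] C(3)] by auto
qed

text \<open>The factor in the transformation law of weight 1 is exactly the Jacobian factor of the
  change of variables.\<close>

lemma chart_integral_change:
  assumes "\<kappa> \<in> A" "\<kappa>' \<in> A" "s \<in> densities A 1" "cpt s" "supp T A s \<subseteq> chart_dom \<kappa>" "supp T A s \<subseteq> chart_dom \<kappa>'"
  shows "integral UNIV (s \<kappa>) = integral UNIV (s \<kappa>')"
proof -
  obtain C where C: "compact C" "C \<subseteq> target \<kappa>" "\<And>x. x \<notin> C \<Longrightarrow> s \<kappa> x = 0" "C = coord \<kappa> ` supp T A s"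
    using chart_support[OF assms(1,3,4,5)] by metis
  obtain C' where C': "compact C'" "C' \<subseteq> target \<kappa>'" "\<And>x. x \<notin> C' \<Longrightarrow> s \<kappa>' x = 0" "C' = coord \<kappa>' ` supp T A s"
    using chart_support[OF assms(2,3,4,6)] by metis
  have sub: "C \<subseteq> overlap \<kappa> \<kappa>'" "C' \<subseteq> overlap \<kappa>' \<kappa>" unfolding C(4) C'(4) overlap_def using assms(5,6) by auto
  have tr: "s \<kappa> x = \<bar>jacobian \<kappa> \<kappa>' x\<bar> * s \<kappa>' (transition \<kappa> \<kappa>' x)" if "x \<in> overlap \<kappa> \<kappa>'" for x
    using density_transition[OF assms(3,1,2) that] by (simp add: powr_one_gt_zero_iff)
  have "integral UNIV (s \<kappa>') = integral UNIV (\<lambda>x. if x \<in> overlap \<kappa> \<kappa>' then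
      \<bar>det (matrix (frechet_derivative (transition \<kappa> \<kappa>') (at x)))\<bar> * s \<kappa>' (transition \<kappa> \<kappa>' x) else 0)"
  proof (rule integral_change_of_variables_finite[OF open_overlap[OF assms(1,2)] has_derivative_transition[OF assms(1,2)]
        inj_transition[OF assms(1,2)] piece_smooth_UNIV(2)[OF assms(2,3,4,6)] compact_imp_bounded[OF C'(1)] C'(3)
        compact_imp_bounded[OF C(1)]])
    show "s \<kappa>' x = 0" if "x \<notin> transition \<kappa> \<kappa>' ` overlap \<kappa> \<kappa>'" for x
      using that sub C'(3) unfolding transition_image[OF assms(1,2)] by blast
    show "s \<kappa>' (transition \<kappa> \<kappa>' x) = 0" if "x \<in> overlap \<kappa> \<kappa>' - C" for x
      using that tr[of x] C(3)[of x] jacobian_nonzero[OF assms(1,2), of x] by simp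
  qed
  also have "\<dots> = integral UNIV (s \<kappa>)"
  proof (rule arg_cong[where f = "integral UNIV"], rule ext)
    show "(if x \<in> overlap \<kappa> \<kappa>' then
      \<bar>det (matrix (frechet_derivative (transition \<kappa> \<kappa>') (at x)))\<bar> * s \<kappa>' (transition \<kappa> \<kappa>' x) else 0) = s \<kappa> x" for x
      using tr[of x] C(3)[of x] sub(1) by (auto simp: jacobian_def)
  qed
  finally show ?thesis by simp
qed

lemma sum_list_density [simp]: "sum_list ss \<kappa> x = (\<Sum>s\<leftarrow>ss. s \<kappa> x)" for ss :: "('a, 'd) density list"
  by (induction ss) auto

lemma integral_sum_list:
  assumes "\<And>s. s \<in> set ss \<Longrightarrow> (f s :: real^'d \<Rightarrow> real) integrable_on UNIV"
  shows "integral UNIV (\<lambda>x. \<Sum>s\<leftarrow>ss. f s x) = (\<Sum>s\<leftarrow>ss. integral UNIV (f s))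
     \<and> (\<lambda>x. \<Sum>s\<leftarrow>ss. f s x) integrable_on UNIV"
  using assms by (induction ss) (auto simp: integral_add integrable_add integrable_0)

lemma sum_list_swap: "(\<Sum>a\<leftarrow>as. \<Sum>b\<leftarrow>bs. h a b) = (\<Sum>b\<leftarrow>bs. \<Sum>a\<leftarrow>as. h a b :: real)"
  by (induction as) (auto simp: sum_list_addf)

text \<open>The product is supported in the chart of the cut and in that of the piece, so it may be
  integrated in either.\<close>

lemma cut_mult_piece:
  assumes "chart_cut c" "chart_piece e"
  shows "chart_piece (fst c, snd c * snd e)" "chart_piece (fst e, snd c * snd e)"
    "chart_integral (fst c, snd c * snd e) = chart_integral (fst e, snd c * snd e)"
proof -
  have d: "snd c * snd e \<in> densities A 1" "cpt (snd c * snd e)"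
    "supp T A (snd c * snd e) \<subseteq> chart_dom (fst c)" "supp T A (snd c * snd e) \<subseteq> chart_dom (fst e)"
    using mult_density[of "snd c" 0 "snd e" 1] cpt_mult(1,2)[of "snd c" "snd e"] cpt_mult(3,4)[of "snd e" "snd c"] assms
    unfolding chart_cut_def chart_piece_def by auto
  then show "chart_piece (fst c, snd c * snd e)" "chart_piece (fst e, snd c * snd e)"
    using assms by (auto simp: chart_cut_def chart_piece_def)
  show "chart_integral (fst c, snd c * snd e) = chart_integral (fst e, snd c * snd e)"
    using chart_integral_change[OF _ _ d] assms unfolding chart_integral_def chart_cut_def chart_piece_def fst_conv snd_conv
    by blast
qed

lemma piece_integrable: "chart_piece e \<Longrightarrow> snd e (fst e) integrable_on UNIV"
  using piece_smooth_UNIV(3) unfolding chart_piece_def by blast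

lemma cut_mult_integrable:
  assumes "chart_cut c" "chart_piece e"
  shows "(snd c * snd e) (fst c) integrable_on UNIV" "(snd c * snd e) (fst e) integrable_on UNIV"
  using cut_mult_piece(1,2)[OF assms, THEN piece_integrable] by (simp_all only: fst_conv snd_conv)

text \<open>This makes the integral well defined. A partition of unity on the union of the supports
  splits every piece, and each product is integrated in the chart of the cut instead of the chart of
  the piece. For a fixed cut all products then live in the same chart, where they add up to zero
  pointwise.\<close>

lemma pieces_sum_zero:
  assumes es: "\<forall>e\<in>set es. chart_piece e" and z: "(\<Sum>e\<leftarrow>es. snd e) = 0"
  shows "(\<Sum>e\<leftarrow>es. chart_integral e) = 0"
proof -
  define K where "K = (\<Union>e\<in>set es. supp T A (snd e))"
  have "compactin T K" unfolding K_def
    using es by (intro compactin_Union) (auto simp: chart_piece_def cpt_def)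
  then obtain cs where cs: "\<forall>c\<in>set cs. chart_cut c"
    "\<And>\<kappa> x. \<kappa> \<in> A \<Longrightarrow> x \<in> target \<kappa> \<Longrightarrow> pt \<kappa> x \<in> K \<Longrightarrow> (\<Sum>c\<leftarrow>cs. snd c \<kappa> x) = 1"
    using partition_of_unity by blast
  have split: "chart_integral e = (\<Sum>c\<leftarrow>cs. chart_integral (fst c, snd c * snd e))" if e: "e \<in> set es" for e
  proof -
    have ce: "chart_piece e" using es e by blast
    have "snd e (fst e) x = (\<Sum>c\<leftarrow>cs. (snd c * snd e) (fst e) x)" for x
    proof (cases "snd e (fst e) x = 0")
      case False
      then have "x \<in> target (fst e)" using ce density_zero unfolding chart_piece_def by blast
      moreover have "pt (fst e) x \<in> K"
        using suppI[of "fst e" x "snd e"] False calculation ce e unfolding K_def chart_piece_def by blast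
      ultimately have "(\<Sum>c\<leftarrow>cs. snd c (fst e) x) = 1" using cs(2) ce by (simp add: chart_piece_def)
      then show ?thesis by (simp add: sum_list_mult_const)
    qed simp
    then have "chart_integral e = integral UNIV (\<lambda>x. \<Sum>c\<leftarrow>cs. (snd c * snd e) (fst e) x)"
      unfolding chart_integral_def by (metis ext)
    also have "\<dots> = (\<Sum>c\<leftarrow>cs. integral UNIV ((snd c * snd e) (fst e)))"
      using integral_sum_list[of cs "\<lambda>c. (snd c * snd e) (fst e)"] cut_mult_integrable(2)[OF _ ce] cs(1) by blast
    also have "\<dots> = (\<Sum>c\<leftarrow>cs. chart_integral (fst e, snd c * snd e))"
      by (simp only: chart_integral_def fst_conv snd_conv)
    also have "\<dots> = (\<Sum>c\<leftarrow>cs. chart_integral (fst c, snd c * snd e))"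
      using cut_mult_piece(3)[OF _ ce] cs(1) by (intro arg_cong[where f = sum_list] map_cong) auto
    finally show ?thesis .
  qed
  have "(\<Sum>e\<leftarrow>es. chart_integral e) = (\<Sum>e\<leftarrow>es. \<Sum>c\<leftarrow>cs. chart_integral (fst c, snd c * snd e))"
    using split by (intro arg_cong[where f = sum_list] map_cong) auto
  also have "\<dots> = (\<Sum>c\<leftarrow>cs. \<Sum>e\<leftarrow>es. chart_integral (fst c, snd c * snd e))" by (rule sum_list_swap)
  also have "\<dots> = (\<Sum>c\<leftarrow>cs. 0)"
  proof (intro arg_cong[where f = sum_list] map_cong refl)
    fix c assume c: "c \<in> set cs"
    have "(\<Sum>e\<leftarrow>es. chart_integral (fst c, snd c * snd e)) = integral UNIV (\<lambda>x. \<Sum>e\<leftarrow>es. (snd c * snd e) (fst c) x)"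
      using integral_sum_list[of es "\<lambda>e. (snd c * snd e) (fst c)"] cut_mult_integrable(1) cs(1) es c
      unfolding chart_integral_def fst_conv snd_conv by metis
    also have "\<dots> = integral UNIV (\<lambda>x::real^'d. 0)"
    proof (rule integral_cong)
      fix x
      have "(\<Sum>e\<leftarrow>es. snd e) (fst c) x = 0" using z by simp
      then show "(\<Sum>e\<leftarrow>es. (snd c * snd e) (fst c) x) = 0" by (simp add: sum_list_const_mult o_def)
    qed
    finally show "(\<Sum>e\<leftarrow>es. chart_integral (fst c, snd c * snd e)) = 0" by simp
  qed
  finally show ?thesis by simp
qed

text \<open>For two decompositions of the same density, the pieces of one together with the
  negatives of the other sum to zero; \<open>pieces_sum_zero\<close> thus gives uniqueness in the
  description.\<close>

lemma density_integral_eq: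
  assumes es: "\<forall>e\<in>set es. chart_piece e" and s: "s = (\<Sum>e\<leftarrow>es. snd e)"
  shows "density_integral T A s = (\<Sum>e\<leftarrow>es. chart_integral e)"
proof -
  have conv: "(\<forall>(\<kappa>, e)\<in>set ds. \<kappa> \<in> A \<and> e \<in> densities A 1 \<and> compactin T (supp T A e) \<and> supp T A e \<subseteq> chart_dom \<kappa>)
      \<longleftrightarrow> (\<forall>e\<in>set ds. chart_piece e)" for ds
    by (simp add: case_prod_unfold chart_piece_def cpt_def)
  have int: "(\<Sum>(\<kappa>, e)\<leftarrow>ds. integral (target \<kappa>) (e \<kappa>)) = (\<Sum>e\<leftarrow>ds. chart_integral e)" if "\<forall>e\<in>set ds. chart_piece e" for ds
    using that by (intro arg_cong[where f = sum_list] map_cong) (auto simp: chart_integral_def chart_piece_def integral_target)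
  have snd: "(\<Sum>(\<kappa>, e)\<leftarrow>ds. e) = (\<Sum>e\<leftarrow>ds. snd e)" for ds :: "(('a, 'd) chart \<times> ('a, 'd) density) list"
    by (simp add: case_prod_unfold)
  show ?thesis unfolding density_integral_def conv snd
  proof (rule the_equality)
    show "\<exists>ds. (\<forall>e\<in>set ds. chart_piece e) \<and> s = (\<Sum>e\<leftarrow>ds. snd e) \<and>
       (\<Sum>e\<leftarrow>es. chart_integral e) = (\<Sum>(\<kappa>, e)\<leftarrow>ds. integral (target \<kappa>) (e \<kappa>))"
      using es s int[OF es] by (intro exI[of _ es]) simp
  next
    fix r assume "\<exists>ds. (\<forall>e\<in>set ds. chart_piece e) \<and> s = (\<Sum>e\<leftarrow>ds. snd e) \<and> r = (\<Sum>(\<kappa>, e)\<leftarrow>ds. integral (target \<kappa>) (e \<kappa>))"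
    then obtain ds where ds: "\<forall>e\<in>set ds. chart_piece e" "s = (\<Sum>e\<leftarrow>ds. snd e)" "r = (\<Sum>e\<leftarrow>ds. chart_integral e)"
      using int by auto
    define ns where "ns = map (\<lambda>e. (fst e, scale_density (-1) (snd e))) ds"
    have sc: "scale_density (-1) u = - u" for u :: "('a, 'd) density" by (simp add: scale_density_def fun_eq_iff)
    have "chart_piece (fst e, - snd e)" if "chart_piece e" for e
      using that minus_density[of "snd e" 1] cpt_smaller[of "snd e" "- snd e"] suppI[of _ _ "snd e"]
      unfolding chart_piece_def by fastforce
    then have 1: "\<forall>e\<in>set (es @ ns). chart_piece e" using es ds(1) by (auto simp: ns_def sc)
    have "(\<Sum>e\<leftarrow>ns. snd e) = - (\<Sum>e\<leftarrow>ds. snd e)"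
      by (simp add: ns_def sc o_def uminus_sum_list_map)
    then have 2: "(\<Sum>e\<leftarrow>es @ ns. snd e) = 0" using s ds(2) by simp
    have "(\<Sum>e\<leftarrow>ns. chart_integral e) = (\<Sum>e\<leftarrow>ds. - chart_integral e)"
      by (simp add: ns_def sc o_def chart_integral_def fun_Compl_def)
    also have "\<dots> = - (\<Sum>e\<leftarrow>ds. chart_integral e)" by (simp add: uminus_sum_list_map o_def)
    finally show "r = (\<Sum>e\<leftarrow>es. chart_integral e)" using pieces_sum_zero[OF 1 2] ds(3) by simp
  qed
qed

lemma exists_pieces:
  assumes "s \<in> densities A 1" "cpt s"
  obtains es where "\<forall>e\<in>set es. chart_piece e" "s = (\<Sum>e\<leftarrow>es. snd e)"
proof -
  obtain cs where cs: "\<forall>c\<in>set cs. chart_cut c"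
    "\<And>\<kappa> x. \<kappa> \<in> A \<Longrightarrow> x \<in> target \<kappa> \<Longrightarrow> pt \<kappa> x \<in> supp T A s \<Longrightarrow> (\<Sum>c\<leftarrow>cs. snd c \<kappa> x) = 1"
    using partition_of_unity assms(2) unfolding cpt_def by blast
  show thesis
  proof (rule that[of "map (\<lambda>c. (fst c, snd c * s)) cs"])
    have "chart_piece (fst c, snd c * s)" if "chart_cut c" for c
      using that mult_density[of "snd c" 0 s 1] assms(1) cpt_mult(1,2)[of "snd c" s]
      unfolding chart_cut_def chart_piece_def by auto
    then show "\<forall>e\<in>set (map (\<lambda>c. (fst c, snd c * s)) cs). chart_piece e" using cs(1) by auto
    show "s = (\<Sum>e\<leftarrow>map (\<lambda>c. (fst c, snd c * s)) cs. snd e)"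
    proof (intro ext)
      fix \<kappa> x
      show "s \<kappa> x = (\<Sum>e\<leftarrow>map (\<lambda>c. (fst c, snd c * s)) cs. snd e) \<kappa> x"
      proof (cases "s \<kappa> x = 0")
        case False
        then have k: "\<kappa> \<in> A" "x \<in> target \<kappa>" using density_zero[OF assms(1)] by blast+
        then show ?thesis using cs(2)[OF k suppI[of \<kappa> x s, OF k False]] by (simp add: o_def sum_list_mult_const)
      qed (simp add: o_def)
    qed
  qed
qed

lemma density_integral_add:
  assumes "s \<in> densities A 1" "cpt s" "t \<in> densities A 1" "cpt t"
  shows "density_integral T A (s + t) = density_integral T A s + density_integral T A t"
proof -
  obtain es where es: "\<forall>e\<in>set es. chart_piece e" "s = (\<Sum>e\<leftarrow>es. snd e)" using exists_pieces assms by metis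
  obtain ds where ds: "\<forall>e\<in>set ds. chart_piece e" "t = (\<Sum>e\<leftarrow>ds. snd e)" using exists_pieces assms by metis
  have "s + t = (\<Sum>e\<leftarrow>es @ ds. snd e)" "\<forall>e\<in>set (es @ ds). chart_piece e" using es ds by auto
  from density_integral_eq[OF this(2,1)] density_integral_eq[OF es] density_integral_eq[OF ds]
  show ?thesis by simp
qed

lemma density_integral_chart:
  assumes "\<kappa> \<in> A" "s \<in> densities A 1" "cpt s" "supp T A s \<subseteq> chart_dom \<kappa>"
  shows "density_integral T A s = integral UNIV (s \<kappa>)"
  using density_integral_eq[of "[(\<kappa>, s)]" s] assms by (simp add: chart_piece_def chart_integral_def)

lemma density_integral_0: "density_integral T A 0 = 0"
  using density_integral_eq[of "[]" 0] by simp

lemma density_integral_sum_list: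
  assumes "\<And>s. s \<in> set ss \<Longrightarrow> s \<in> densities A 1 \<and> cpt s"
  shows "density_integral T A (sum_list ss) = (\<Sum>s\<leftarrow>ss. density_integral T A s)"
proof -
  have "sum_list ss \<in> densities A 1 \<and> cpt (sum_list ss)" if "\<forall>s\<in>set ss. s \<in> densities A 1 \<and> cpt s" for ss
    using that by (induction ss) (auto simp: add_density cpt_add zero_density cpt_0)
  then show ?thesis using assms
    by (induction ss) (auto simp: density_integral_0 density_integral_add)
qed

end

section \<open>Differential operators on functions\<close>

text \<open>The index \<open>k\<close> of \<open>ldo\<close>, and of \<open>DO\<close> below, bounds the order strictly: the only operator
  with index 0 is zero.\<close>

type_synonym 'd lop = "(real^'d \<Rightarrow> real) \<Rightarrow> real^'d \<Rightarrow> real"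

text \<open>Multi-indices are lists, so an operator need not determine its coefficients. Nothing is
  said about functions that are not smooth on \<open>U\<close> or about points outside
  \<open>U\<close>.\<close>

definition ldo_rep :: "(real^'d::finite) set \<Rightarrow> nat \<Rightarrow> 'd lop \<Rightarrow> ('d list \<Rightarrow> real^'d \<Rightarrow> real) \<Rightarrow> bool" where
  "ldo_rep U k L S \<longleftrightarrow> (\<forall>I. smooth_on U (S I)) \<and>
     (\<forall>f. smooth_on U f \<longrightarrow> (\<forall>x\<in>U. L f x = (\<Sum>I | length I < k. S I x * partials I f x)))"

definition ldo :: "(real^'d::finite) set \<Rightarrow> nat \<Rightarrow> 'd lop \<Rightarrow> bool" where
  "ldo U k L \<longleftrightarrow> (\<exists>S. ldo_rep U k L S)"

lemma ldo_repD:
  assumes "ldo_rep U k L S"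
  shows "smooth_on U (S I)"
    and "smooth_on U f \<Longrightarrow> x \<in> U \<Longrightarrow> L f x = (\<Sum>I | length I < k. S I x * partials I f x)"
  using assms by (auto simp: ldo_rep_def)

lemma finite_lists_less [simp]: "finite {I :: 'd::finite list. length I < k}"
  using finite_lists_length_le[of "UNIV :: 'd set" k] by (rule finite_subset[rotated]) auto

lemma ldo_cong:
  assumes "ldo U k L" "\<And>f x. smooth_on U f \<Longrightarrow> x \<in> U \<Longrightarrow> L' f x = L f x"
  shows "ldo U k L'"
  using assms unfolding ldo_def ldo_rep_def by (elim exE conjE) (rule_tac x=S in exI, simp)

lemma ldo_0: "ldo U k (\<lambda>f x. 0)"
  unfolding ldo_def ldo_rep_def by (intro exI[of _ "\<lambda>_ _. 0"]) simp

lemma ldo_at_0: "ldo U 0 L \<longleftrightarrow> (\<forall>f x. smooth_on U f \<longrightarrow> x \<in> U \<longrightarrow> L f x = 0)"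
  unfolding ldo_def ldo_rep_def by (auto intro!: exI[of _ "\<lambda>_ _. 0"])

lemma ldo_term:
  assumes "smooth_on U a" "length I < k"
  shows "ldo U k (\<lambda>f x. a x * partials I f x)"
  unfolding ldo_def ldo_rep_def
proof (intro exI[of _ "\<lambda>J. if J = I then a else (\<lambda>_. 0)"] conjI allI impI ballI)
  show "a x * partials I f x = (\<Sum>J | length J < k. (if J = I then a else (\<lambda>_. 0)) x * partials J f x)" for f x
  proof -
    have "(\<Sum>J | length J < k. (if J = I then a else (\<lambda>_. 0)) x * partials J f x) =
       (\<Sum>J | length J < k. if J = I then a x * partials I f x else 0)"
      by (rule sum.cong) auto
    then show ?thesis using assms(2) by (simp add: sum.delta)
  qed
qed (use assms(1) in auto)

lemma ldo_intro:
  assumes "\<And>I. smooth_on U (S I)"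
    "\<And>f x. smooth_on U f \<Longrightarrow> x \<in> U \<Longrightarrow> L f x = (\<Sum>I | length I < k. S I x * partials I f x)"
  shows "ldo U k L"
  using assms unfolding ldo_def ldo_rep_def by (intro exI[of _ S]) auto

lemma ldo_add:
  assumes "open U" "ldo U k L" "ldo U k L'"
  shows "ldo U k (\<lambda>f x. L f x + L' f x)"
proof -
  obtain S where S0: "ldo_rep U k L S" using assms(2) unfolding ldo_def by blast
  note S = ldo_repD[OF S0]
  obtain S' where S'0: "ldo_rep U k L' S'" using assms(3) unfolding ldo_def by blast
  note S' = ldo_repD[OF S'0]
  show ?thesis
    by (rule ldo_intro[of U "\<lambda>I x. S I x + S' I x"])
      (simp_all add: S S' smooth_on_add[OF assms(1)] distrib_right sum.distrib)
qed

lemma ldo_sum: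
  assumes "open U" "\<And>a. a \<in> B \<Longrightarrow> ldo U k (L a)"
  shows "ldo U k (\<lambda>f x. \<Sum>a\<in>B. L a f x)"
  using assms(2) by (induction B rule: infinite_finite_induct) (auto intro: ldo_0 ldo_add[OF assms(1)])

lemma ldo_mult:
  assumes "open U" "ldo U k L" "smooth_on U a"
  shows "ldo U k (\<lambda>f x. a x * L f x)"
proof -
  obtain S where S0: "ldo_rep U k L S" using assms(2) unfolding ldo_def by blast
  note S = ldo_repD[OF S0]
  show ?thesis
    by (rule ldo_intro[of U "\<lambda>I x. a x * S I x"])
      (simp_all add: S smooth_on_mult[OF assms(1,3)] mult.assoc sum_distrib_left)
qed

lemma ldo_cmult: "open U \<Longrightarrow> ldo U k L \<Longrightarrow> ldo U k (\<lambda>f x. c * L f x)"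
  using ldo_mult[of U k L "\<lambda>_. c"] by simp

lemma ldo_diff:
  assumes "open U" "ldo U k L" "ldo U k L'"
  shows "ldo U k (\<lambda>f x. L f x - L' f x)"
  using ldo_add[OF assms(1,2) ldo_cmult[OF assms(1,3), of "-1"]] by simp

lemma ldo_mono:
  assumes "open U" "ldo U k L" "k \<le> k'" shows "ldo U k' L"
proof -
  obtain S where S0: "ldo_rep U k L S" using assms(2) unfolding ldo_def by blast
  note S = ldo_repD[OF S0]
  have "ldo U k' (\<lambda>f x. \<Sum>I | length I < k. S I x * partials I f x)"
    using assms(3) S(1) by (intro ldo_sum assms(1) ldo_term) auto
  then show ?thesis by (rule ldo_cong) (rule S(2))
qed

lemma ldo_smooth:
  assumes "open U" "ldo U k L" "smooth_on U f" shows "smooth_on U (L f)"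
proof -
  obtain S where S0: "ldo_rep U k L S" using assms(2) unfolding ldo_def by blast
  note S = ldo_repD[OF S0]
  have "smooth_on U (\<lambda>x. \<Sum>I | length I < k. S I x * partials I f x)"
    by (intro smooth_on_sum smooth_on_mult assms(1) S(1) smooth_on_partials assms(3))
  then show ?thesis by (rule smooth_on_cong[OF assms(1), rotated]) (simp add: S(2)[OF assms(3)])
qed

lemma partials_add:
  fixes f g :: "real^'d::finite \<Rightarrow> real"
  assumes "open U" "smooth_on U f" "smooth_on U g" "x \<in> U"
  shows "partials I (\<lambda>x. f x + g x) x = partials I f x + partials I g x"
  using assms(4)
proof (induction I arbitrary: x)
  case (Cons i I)
  have "partials (i # I) (\<lambda>x. f x + g x) x = partial i (\<lambda>x. partials I f x + partials I g x) x"
    unfolding partials.simps by (rule partial_cong_open[OF assms(1) Cons.prems Cons.IH])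
  then show ?case
    using partial_add[OF smooth_on_differentiable[OF smooth_on_partials[OF assms(2)] Cons.prems]
        smooth_on_differentiable[OF smooth_on_partials[OF assms(3)] Cons.prems]] by simp
qed simp

lemma partials_cmult:
  fixes f :: "real^'d::finite \<Rightarrow> real"
  assumes "open U" "smooth_on U f" "x \<in> U"
  shows "partials I (\<lambda>x. c * f x) x = c * partials I f x"
  using assms(3)
proof (induction I arbitrary: x)
  case (Cons i I)
  have "partials (i # I) (\<lambda>x. c * f x) x = partial i (\<lambda>x. c * partials I f x) x"
    unfolding partials.simps by (rule partial_cong_open[OF assms(1) Cons.prems Cons.IH])
  then show ?case
    using partial_linear[OF bounded_linear_mult_right, of "partials I f" x i c]
      smooth_on_differentiable[OF smooth_on_partials[OF assms(2)] Cons.prems] by simp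
qed simp

lemma partials_cong_open:
  assumes "open U" "x \<in> U" "\<And>y. y \<in> U \<Longrightarrow> f y = g y"
  shows "partials I f x = partials I g x"
  using assms(2)
proof (induction I arbitrary: x)
  case (Cons i I)
  show ?case unfolding partials.simps by (rule partial_cong_open[OF assms(1) Cons.prems Cons.IH])
qed (simp add: assms(3))

lemma ldo_linear:
  assumes "open U" "ldo U k L" "smooth_on U f" "x \<in> U"
  shows "L (\<lambda>y. c * f y) x = c * L f x"
    and "smooth_on U g \<Longrightarrow> L (\<lambda>y. f y + g y) x = L f x + L g x"
    and "smooth_on U g \<Longrightarrow> (\<And>y. y \<in> U \<Longrightarrow> f y = g y) \<Longrightarrow> L f x = L g x"
proof -
  obtain S where S0: "ldo_rep U k L S" using assms(2) unfolding ldo_def by blast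
  note S = ldo_repD(2)[OF S0]
  show "L (\<lambda>y. c * f y) x = c * L f x"
    unfolding S[OF smooth_on_cmult[OF assms(1,3)] assms(4)] S[OF assms(3,4)] partials_cmult[OF assms(1,3,4)]
    by (simp add: sum_distrib_left algebra_simps)
  assume g: "smooth_on U g"
  show "L (\<lambda>y. f y + g y) x = L f x + L g x"
    unfolding S[OF smooth_on_add[OF assms(1,3) g] assms(4)] S[OF assms(3,4)] S[OF g assms(4)]
      partials_add[OF assms(1,3) g assms(4)]
    by (simp add: sum.distrib algebra_simps)
  assume "\<And>y. y \<in> U \<Longrightarrow> f y = g y"
  from partials_cong_open[OF assms(1,4) this] show "L f x = L g x"
    unfolding S[OF assms(3,4)] S[OF g assms(4)] by simp
qed

lemma ldo_sum_arg:
  assumes "open U" "ldo U k L" "finite B" "\<And>b. b \<in> B \<Longrightarrow> smooth_on U (f b)" "x \<in> U"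
  shows "L (\<lambda>y. \<Sum>b\<in>B. f b y) x = (\<Sum>b\<in>B. L (f b) x)"
  using assms(3,4)
proof (induction B)
  case empty
  then show ?case using ldo_linear(1)[OF assms(1,2) smooth_on_const assms(5), of 0 0] by simp
next
  case (insert b B)
  then show ?case using ldo_linear(2)[OF assms(1,2) _ assms(5), of "f b" "\<lambda>y. \<Sum>b\<in>B. f b y"]
    by (simp add: smooth_on_sum[OF assms(1)])
qed

lemma partial_sum:
  fixes f :: "'b \<Rightarrow> real^'d::finite \<Rightarrow> real"
  assumes "\<And>b. b \<in> B \<Longrightarrow> f b differentiable (at x)"
  shows "partial i (\<lambda>y. \<Sum>b\<in>B. f b y) x = (\<Sum>b\<in>B. partial i (f b) x) \<and> (\<lambda>y. \<Sum>b\<in>B. f b y) differentiable (at x)"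
  using assms by (induction B rule: infinite_finite_induct) (auto simp: partial_add)

lemma partial_diff:
  fixes f g :: "real^'d::finite \<Rightarrow> real"
  assumes "f differentiable (at x)" "g differentiable (at x)"
  shows "partial i (\<lambda>x. f x - g x) x = partial i f x - partial i g x"
  using assms unfolding frechet_derivative_works
  by (subst partial_eqI[OF has_derivative_diff]) (auto simp: partial_def)

lemma ldo_partial_expand:
  assumes "open U" "ldo U k L"
    and S: "\<And>I. smooth_on U (S I)"
      "\<And>f x. smooth_on U f \<Longrightarrow> x \<in> U \<Longrightarrow> L f x = (\<Sum>I | length I < k. S I x * partials I f x)"
    and "smooth_on U f" "x \<in> U"
  shows "partial i (L f) x = (\<Sum>I | length I < k. S I x * partial i (partials I f) x + partial i (S I) x * partials I f x)"
proof -
  have d: "S I differentiable (at x)" "partials I f differentiable (at x)" for I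
    using smooth_on_differentiable[OF S(1) assms(6)] smooth_on_differentiable[OF smooth_on_partials[OF assms(5)] assms(6)] by auto
  have "partial i (L f) x = partial i (\<lambda>x. \<Sum>I | length I < k. S I x * partials I f x) x"
    by (rule partial_cong_open[OF assms(1,6)]) (rule S(2)[OF assms(5)])
  also have "\<dots> = (\<Sum>I | length I < k. partial i (\<lambda>x. S I x * partials I f x) x)"
    using partial_sum[of "{I. length I < k}" "\<lambda>I x. S I x * partials I f x" x i] d by auto
  finally show ?thesis by (simp add: partial_mult[OF d])
qed

lemma ldo_partial:
  assumes "open U" "ldo U k L"
  shows "ldo U (Suc k) (\<lambda>f. partial i (L f))"
proof -
  obtain S where S0: "ldo_rep U k L S" using assms(2) unfolding ldo_def by blast
  note S = ldo_repD[OF S0]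
  have "ldo U (Suc k) (\<lambda>f x. \<Sum>I | length I < k. S I x * partials (i # I) f x + partial i (S I) x * partials I f x)"
    by (intro ldo_sum ldo_add ldo_term assms(1) S(1) smooth_on_partial) auto
  then show ?thesis
    by (rule ldo_cong) (simp add: ldo_partial_expand[OF assms S])
qed

lemma ldo_partial_0: "open U \<Longrightarrow> ldo U 0 L \<Longrightarrow> ldo U 0 (\<lambda>f. partial i (L f))"
  unfolding ldo_at_0 using partial_cong_open[of U _ "L _" "\<lambda>_. 0"] by simp

lemma partials_snoc: "partials (I @ [i]) f = partials I (partial i f)"
  by (induction I) auto

text \<open>For \<open>k = 0\<close> the truncated \<open>k - 1\<close> is again 0; \<open>L\<close>
  then vanishes on smooth functions, so the statement still holds.\<close>

lemma ldo_pre_partial: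
  assumes "open U" "ldo U (k - 1) L"
  shows "ldo U k (\<lambda>f. L (partial i f))"
proof (cases k)
  case 0
  then show ?thesis using assms(2) smooth_on_partial by (auto simp: ldo_at_0)
next
  case (Suc m)
  then have "ldo U m L" using assms(2) by simp
  then obtain S where S0: "ldo_rep U m L S" unfolding ldo_def by blast
  note S = ldo_repD[OF S0]
  have "ldo U k (\<lambda>f x. \<Sum>I | length I < m. S I x * partials (I @ [i]) f x)"
    by (intro ldo_sum ldo_term assms(1) S(1)) (auto simp: Suc)
  then show ?thesis by (rule ldo_cong) (simp add: S(2) smooth_on_partial partials_snoc)
qed

lemma partials_partial_commute:
  fixes f :: "real^'d::finite \<Rightarrow> real"
  assumes "open U" "smooth_on U f" "x \<in> U"
  shows "partials I (partial i f) x = partial i (partials I f) x"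
  using assms(3)
proof (induction I arbitrary: x)
  case (Cons j I)
  have "partials (j # I) (partial i f) x = partial j (partial i (partials I f)) x"
    unfolding partials.simps by (rule partial_cong_open[OF assms(1) Cons.prems Cons.IH])
  then show ?case using partial_commute[OF assms(1) smooth_on_partials[OF assms(2)] Cons.prems] by simp
qed simp

lemma partials_rev:
  fixes f :: "real^'d::finite \<Rightarrow> real"
  assumes "open U" "smooth_on U f" "x \<in> U"
  shows "partials (rev I) f x = partials I f x"
  using assms(3)
proof (induction I arbitrary: x)
  case (Cons i I)
  have "partials (rev (i # I)) f x = partial i (partials (rev I) f) x"
    by (simp add: partials_snoc partials_partial_commute[OF assms(1,2) Cons.prems])
  also have "\<dots> = partials (i # I) f x"
    unfolding partials.simps by (rule partial_cong_open[OF assms(1) Cons.prems Cons.IH])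
  finally show ?case .
qed simp

text \<open>Partial derivatives commute with each other, so the commutator differentiates only the
  coefficients and the order does not rise.\<close>

lemma ldo_commutator_partial:
  assumes "open U" "ldo U k L"
  shows "ldo U k (\<lambda>f x. partial i (L f) x - L (partial i f) x)"
proof -
  obtain S where S0: "ldo_rep U k L S" using assms(2) unfolding ldo_def by blast
  note S = ldo_repD[OF S0]
  have "ldo U k (\<lambda>f x. \<Sum>I | length I < k. partial i (S I) x * partials I f x)"
    by (intro ldo_sum ldo_term assms(1) S(1) smooth_on_partial) auto
  then show ?thesis
    by (rule ldo_cong)
      (simp add: ldo_partial_expand[OF assms S] S(2) smooth_on_partial partials_partial_commute[OF assms(1)] sum_subtractf[symmetric])
qed

text \<open>Since the bound is strict, \<open>length I\<close> means that one order is lost. In the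
  induction the commutator for \<open>i # I\<close> is \<open>partial i\<close> of the one for
  \<open>I\<close>, plus \<open>partial i g\<close> times \<open>partials I\<close>.\<close>

lemma ldo_partials_commutator:
  fixes g :: "real^'d::finite \<Rightarrow> real"
  assumes "open U" "smooth_on U g"
  shows "ldo U (length I) (\<lambda>f x. partials I (\<lambda>y. g y * f y) x - g x * partials I f x)"
proof (induction I)
  case Nil show ?case by (simp add: ldo_0)
next
  case (Cons i I)
  let ?C = "\<lambda>f x. partials I (\<lambda>y. g y * f y) x - g x * partials I f x"
  have "ldo U (length (i # I)) (\<lambda>f x. partial i (?C f) x + partial i g x * partials I f x)"
    using ldo_partial[OF assms(1) Cons] by (intro ldo_add assms(1) ldo_term smooth_on_partial assms(2)) auto
  then show ?case
  proof (rule ldo_cong)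
    fix f :: "real^'d \<Rightarrow> real" and x assume f: "smooth_on U f" "x \<in> U"
    note d = smooth_on_differentiable[OF assms(2) f(2)] smooth_on_differentiable[OF smooth_on_partials[OF f(1)] f(2)]
       smooth_on_differentiable[OF smooth_on_partials[OF smooth_on_mult[OF assms(1,2) f(1)]] f(2)]
    have "partial i (\<lambda>x. partials I (\<lambda>y. g y * f y) x - g x * partials I f x) x =
      partial i (partials I (\<lambda>y. g y * f y)) x - (g x * partial i (partials I f) x + partial i g x * partials I f x)"
      using d by (simp add: partial_diff partial_mult)
    then show "partials (i # I) (\<lambda>y. g y * f y) x - g x * partials (i # I) f x = partial i (?C f) x + partial i g x * partials I f x"
      by simp
  qed
qed

lemma ldo_commutator_mult:
  assumes "open U" "ldo U k L" "smooth_on U g"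
  shows "ldo U (k - 1) (\<lambda>f x. L (\<lambda>y. g y * f y) x - g x * L f x)"
proof -
  obtain S where S0: "ldo_rep U k L S" using assms(2) unfolding ldo_def by blast
  note S = ldo_repD[OF S0]
  have "ldo U (k - 1) (\<lambda>f x. \<Sum>I | length I < k. S I x * (partials I (\<lambda>y. g y * f y) x - g x * partials I f x))"
    by (intro ldo_sum assms(1) ldo_mult S(1) ldo_mono[OF assms(1) ldo_partials_commutator[OF assms(1,3)]]) auto
  then show ?thesis
    by (rule ldo_cong) (simp add: S(2) S(2)[OF smooth_on_mult[OF assms(1,3)]] right_diff_distrib sum_distrib_left sum_subtractf mult.left_commute)
qed

lemma ldo_mult_pre:
  assumes "open U" "ldo U k L" "smooth_on U g"
  shows "ldo U k (\<lambda>f. L (\<lambda>y. g y * f y))"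
  using ldo_add[OF assms(1) ldo_mult[OF assms] ldo_mono[OF assms(1) ldo_commutator_mult[OF assms], of k]]
  by (rule ldo_cong) auto

text \<open>Summed over \<open>i\<close>, the commutator is \<open>K i\<close> times that of
  \<open>partial i\<close> with \<open>L\<close>, minus the commutator of \<open>L\<close> with the
  function \<open>K i\<close> followed by a derivative. The first part keeps the order, and in the
  second the order lost to the function pays for the derivative.\<close>

lemma ldo_commutator_field:
  fixes K :: "real^'d::finite \<Rightarrow> real^'d"
  assumes "open U" "ldo U k L" "smooth_on U K"
  shows "ldo U k (\<lambda>f x. (\<Sum>i\<in>UNIV. K x $ i * partial i (L f) x) - L (\<lambda>y. \<Sum>i\<in>UNIV. K y $ i * partial i f y) x)"
proof -
  have K: "smooth_on U (\<lambda>x. K x $ i)" for i using smooth_on_nth assms by blast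
  let ?C = "\<lambda>i f x. L (\<lambda>y. K y $ i * f y) x - K x $ i * L f x"
  have "ldo U k (\<lambda>f x. \<Sum>i\<in>UNIV. K x $ i * (partial i (L f) x - L (partial i f) x) - ?C i (partial i f) x)"
    by (intro ldo_sum ldo_diff ldo_mult assms(1) K ldo_commutator_partial assms(2)
        ldo_pre_partial[OF assms(1) ldo_commutator_mult[OF assms(1,2) K]])
  then show ?thesis
  proof (rule ldo_cong)
    fix f :: "real^'d \<Rightarrow> real" and x assume f: "smooth_on U f" "x \<in> U"
    have "L (\<lambda>y. \<Sum>i\<in>UNIV. K y $ i * partial i f y) x = (\<Sum>i\<in>UNIV. L (\<lambda>y. K y $ i * partial i f y) x)"
      by (rule ldo_sum_arg[OF assms(1,2) _ _ f(2)]) (auto intro: smooth_on_mult[OF assms(1) K] smooth_on_partial f)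
    then show "(\<Sum>i\<in>UNIV. K x $ i * partial i (L f) x) - L (\<lambda>y. \<Sum>i\<in>UNIV. K y $ i * partial i f y) x =
      (\<Sum>i\<in>UNIV. K x $ i * (partial i (L f) x - L (partial i f) x) - ?C i (partial i f) x)"
      by (simp add: algebra_simps sum_subtractf)
  qed
qed

lemma ldo_field:
  fixes K :: "real^'d::finite \<Rightarrow> real^'d"
  assumes "open U" "smooth_on U K"
  shows "ldo U 2 (\<lambda>f x. \<Sum>i\<in>UNIV. K x $ i * partial i f x)"
  using ldo_sum[OF assms(1), of UNIV 2 "\<lambda>i f x. K x $ i * partials [i] f x"]
    ldo_term[of U _ "[_]" 2] smooth_on_nth[OF assms] by simp

section \<open>Conjugation by powers of a positive function\<close>

text \<open>Conjugation by \<open>r powr a\<close> turns \<open>partial i\<close> into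
  \<open>partial i\<close> minus multiplication by \<open>a * partial i (ln r)\<close>; this is the
  recursion by which conjugated derivatives are expanded.\<close>

lemma powr_conjugation:
  fixes r f :: "real^'d::finite \<Rightarrow> real"
  assumes "open U" "smooth_on U r" "\<And>x. x \<in> U \<Longrightarrow> r x > 0" "smooth_on U f" "x \<in> U"
  shows "r x powr a * partials (i # I) (\<lambda>y. r y powr (- a) * f y) x =
    partial i (\<lambda>z. r z powr a * partials I (\<lambda>y. r y powr (- a) * f y) z) x
    - a * partial i (\<lambda>y. ln (r y)) x * (r x powr a * partials I (\<lambda>y. r y powr (- a) * f y) x)"
proof -
  let ?h = "partials I (\<lambda>y. r y powr (- a) * f y)"
  have h: "?h differentiable (at x)"
    by (intro smooth_on_differentiable[OF smooth_on_partials assms(5)] smooth_on_mult assms smooth_on_powr)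
  have p: "(\<lambda>z. r z powr a) differentiable (at x)"
    by (intro smooth_on_differentiable[OF smooth_on_powr[OF assms(1-3)] assms(5)])
  have "partial i (\<lambda>z. r z powr a * ?h z) x = r x powr a * partial i ?h x + partial i (\<lambda>z. r z powr a) x * ?h x"
    by (rule partial_mult[OF p h])
  also have "partial i (\<lambda>z. r z powr a) x = a * r x powr a * partial i (\<lambda>y. ln (r y)) x"
    by (rule partial_powr[OF smooth_on_differentiable[OF assms(2,5)] assms(3)[OF assms(5)]])
  finally show ?thesis by (simp add: algebra_simps)
qed

lemma powr_inverse_cancel: "(r::real) > 0 \<Longrightarrow> r powr a * (r powr (- a) * t) = t"
  by (simp add: mult.assoc[symmetric] flip: powr_add)

lemma ldo_powr_conjugation:
  fixes r :: "real^'d::finite \<Rightarrow> real"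
  assumes "open U" "smooth_on U r" "\<And>x. x \<in> U \<Longrightarrow> r x > 0" "ldo U k L"
  shows "ldo U k (\<lambda>f x. r x powr a * L (\<lambda>y. r y powr (- a) * f y) x)"
  by (intro ldo_mult ldo_mult_pre assms smooth_on_powr)

lemma partials_conjugation_first_order:
  fixes r :: "real^'d::finite \<Rightarrow> real"
  assumes "open U" "smooth_on U r" "\<And>x. x \<in> U \<Longrightarrow> r x > 0"
  shows "ldo U (length I) (\<lambda>f x. r x powr a * partials I (\<lambda>y. r y powr (- a) * f y) x - partials I f x)"
proof -
  have "ldo U (length I) (\<lambda>f x. r x powr a * (partials I (\<lambda>y. r y powr (- a) * f y) x - r x powr (- a) * partials I f x))"
    by (intro ldo_mult ldo_partials_commutator assms smooth_on_powr)
  then show ?thesis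
    by (rule ldo_cong) (simp add: right_diff_distrib powr_inverse_cancel assms(3))
qed

text \<open>Up to two orders less, conjugation subtracts \<open>a\<close> times the commutator with
  \<open>ln r\<close>. Let \<open>Y I\<close> be the conjugated derivative minus
  \<open>partials I\<close>, and \<open>X I\<close> the whole expression. Then
  \<open>X (i # I)\<close> is \<open>partial i (X I)\<close> minus
  \<open>a * partial i (ln r)\<close> times \<open>Y I\<close>, and \<open>Y I\<close> has already
  lost one order.\<close>

lemma partials_conjugation_second_order:
  fixes r :: "real^'d::finite \<Rightarrow> real"
  assumes "open U" "smooth_on U r" "\<And>x. x \<in> U \<Longrightarrow> r x > 0"
  shows "ldo U (length I - 1) (\<lambda>f x. (r x powr a * partials I (\<lambda>y. r y powr (- a) * f y) x - partials I f x)
    + a * (partials I (\<lambda>y. ln (r y) * f y) x - ln (r x) * partials I f x))"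
proof (induction I)
  case Nil
  show ?case unfolding list.size diff_0_eq_0 ldo_at_0 using assms(3) by (simp add: powr_inverse_cancel)
next
  case (Cons i I)
  let ?W = "\<lambda>J f x. r x powr a * partials J (\<lambda>y. r y powr (- a) * f y) x"
  let ?Y = "\<lambda>J f x. ?W J f x - partials J f x"
  let ?C = "\<lambda>J f x. partials J (\<lambda>y. ln (r y) * f y) x - ln (r x) * partials J f x"
  let ?X = "\<lambda>J f x. ?Y J f x + a * ?C J f x"
  have l: "smooth_on U (\<lambda>x. ln (r x))" by (rule smooth_on_ln[OF assms])
  \<comment> \<open>For \<open>I = []\<close> the truncated bound \<open>length I - 1\<close> is 0.
    The operator is then zero, and its derivative is again zero instead of having index 1.\<close>
  have "ldo U (length I) (\<lambda>f. partial i (?X I f))"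
  proof (cases I)
    case Nil
    have "ldo U 0 (?X I)" using Cons Nil by simp
    then show ?thesis using ldo_partial_0[OF assms(1)] Nil by fastforce
  next
    case (Cons j J)
    then show ?thesis using ldo_partial[OF assms(1) Cons.IH, of i] by simp
  qed
  moreover have "ldo U (length I) (\<lambda>f x. (a * partial i (\<lambda>y. ln (r y)) x) * ?Y I f x)"
    by (intro ldo_mult[OF assms(1)] partials_conjugation_first_order assms smooth_on_cmult smooth_on_partial l)
  ultimately have "ldo U (length (i # I) - 1) (\<lambda>f x. partial i (?X I f) x - (a * partial i (\<lambda>y. ln (r y)) x) * ?Y I f x)"
    using ldo_diff[OF assms(1)] by fastforce
  then show ?case
  proof (rule ldo_cong)
    fix f :: "real^'d \<Rightarrow> real" and x assume f: "smooth_on U f" "x \<in> U"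
    have sm1: "smooth_on U (?W I f)"
      by (intro smooth_on_mult smooth_on_partials smooth_on_powr assms f l)
    note sm = sm1 smooth_on_partials[OF f(1), of I] smooth_on_partials[OF smooth_on_mult[OF assms(1) l f(1)], of I]
    note d = sm[THEN smooth_on_differentiable, OF f(2)] smooth_on_differentiable[OF l f(2)]
    have sY: "smooth_on U (?Y I f)" by (intro smooth_on_diff sm assms(1))
    have sC: "smooth_on U (?C I f)" by (intro smooth_on_diff smooth_on_mult sm l assms(1))
    note d2 = sY[THEN smooth_on_differentiable, OF f(2)] smooth_on_cmult[OF assms(1) sC, THEN smooth_on_differentiable, OF f(2)]
      sC[THEN smooth_on_differentiable, OF f(2)]
    have "partial i (?X I f) x = partial i (?Y I f) x + partial i (\<lambda>x. a * ?C I f x) x"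
      by (rule partial_add[OF d2(1,2)])
    also have "partial i (\<lambda>x. a * ?C I f x) x = a * partial i (?C I f) x"
      by (rule partial_linear[OF bounded_linear_mult_right d2(3)])
    also have "partial i (?C I f) x = partials (i # I) (\<lambda>y. ln (r y) * f y) x - (ln (r x) * partials (i # I) f x + partial i (\<lambda>y. ln (r y)) x * partials I f x)"
      using d by (subst partial_diff) (auto simp: partial_mult)
    also have "partial i (?Y I f) x = partial i (?W I f) x - partials (i # I) f x"
      using d by (subst partial_diff) auto
    finally have X: "partial i (?X I f) x = partial i (?W I f) x - partials (i # I) f x
      + a * (partials (i # I) (\<lambda>y. ln (r y) * f y) x - (ln (r x) * partials (i # I) f x + partial i (\<lambda>y. ln (r y)) x * partials I f x))" .
    show "?Y (i # I) f x + a * ?C (i # I) f x = partial i (?X I f) x - (a * partial i (\<lambda>y. ln (r y)) x) * ?Y I f x"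
      by (subst powr_conjugation[OF assms f], assumption) (unfold X, simp add: algebra_simps)
  qed
qed

lemma ldo_conjugation_second_order:
  fixes r :: "real^'d::finite \<Rightarrow> real"
  assumes "open U" "smooth_on U r" "\<And>x. x \<in> U \<Longrightarrow> r x > 0" "ldo U k L"
  shows "ldo U (k - 2) (\<lambda>f x. (r x powr a * L (\<lambda>y. r y powr (- a) * f y) x - L f x)
    + a * (L (\<lambda>y. ln (r y) * f y) x - ln (r x) * L f x))"
proof -
  obtain S where S0: "ldo_rep U k L S" using assms(4) unfolding ldo_def by blast
  note S = ldo_repD[OF S0]
  have "ldo U (k - 2) (\<lambda>f x. \<Sum>I | length I < k. S I x *
    ((r x powr a * partials I (\<lambda>y. r y powr (- a) * f y) x - partials I f x)
    + a * (partials I (\<lambda>y. ln (r y) * f y) x - ln (r x) * partials I f x)))"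
    by (intro ldo_sum ldo_mult assms(1) S(1) ldo_mono[OF assms(1) partials_conjugation_second_order[OF assms(1-3)]]) auto
  then show ?thesis
  proof (rule ldo_cong)
    fix f :: "real^'d \<Rightarrow> real" and x assume f: "smooth_on U f" "x \<in> U"
    have l: "smooth_on U (\<lambda>x. ln (r x))" by (rule smooth_on_ln[OF assms(1-3)])
    have q: "smooth_on U (\<lambda>x. r x powr (- a))" by (rule smooth_on_powr[OF assms(1-3)])
    note e = S(2)[OF smooth_on_mult[OF assms(1) q f(1)] f(2)] S(2)[OF smooth_on_mult[OF assms(1) l f(1)] f(2)] S(2)[OF f]
    show "(r x powr a * L (\<lambda>y. r y powr (- a) * f y) x - L f x) + a * (L (\<lambda>y. ln (r y) * f y) x - ln (r x) * L f x)
      = (\<Sum>I | length I < k. S I x * ((r x powr a * partials I (\<lambda>y. r y powr (- a) * f y) x - partials I f x)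
    + a * (partials I (\<lambda>y. ln (r y) * f y) x - ln (r x) * partials I f x)))"
      unfolding e by (simp add: sum_distrib_left sum.distrib sum_subtractf algebra_simps)
  qed
qed

section \<open>Pencils that are polynomial in the weight\<close>

text \<open>Unlike in \<open>ldo\<close>, the bound \<open>n\<close> is not strict, in accordance
  with \<open>locally_polynomial\<close>; it counts derivatives and powers of the weight
  together.\<close>

definition pldo :: "(real^'d::finite) set \<Rightarrow> nat \<Rightarrow> (real \<Rightarrow> 'd lop) \<Rightarrow> bool" where
  "pldo U n L \<longleftrightarrow> (\<exists>S :: nat \<Rightarrow> 'd list \<Rightarrow> real^'d \<Rightarrow> real. (\<forall>j I. smooth_on U (S j I)) \<and>
     (\<forall>\<mu> f x. smooth_on U f \<longrightarrow> x \<in> U \<longrightarrow>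
        L \<mu> f x = (\<Sum>(j, I)\<in>{(j, I). j + length I \<le> n}. S j I x * \<mu> ^ j * partials I f x)))"

lemma finite_pldo_index [simp]: "finite {(j, I :: 'd::finite list). j + length I \<le> n}"
  by (rule finite_subset[of _ "{..n} \<times> {I. length I < Suc n}"]) auto

lemma pldo_cong:
  assumes "pldo U n L" "\<And>\<mu> f x. smooth_on U f \<Longrightarrow> x \<in> U \<Longrightarrow> L' \<mu> f x = L \<mu> f x"
  shows "pldo U n L'"
  using assms(1) unfolding pldo_def by (elim exE conjE) (rule_tac x = S in exI, simp add: assms(2))

lemma pldo_0: "pldo U n (\<lambda>\<mu> f x. 0)"
  unfolding pldo_def by (intro exI[of _ "\<lambda>_ _ _. 0"]) simp

lemma pldo_term:
  assumes "smooth_on U a" "j + length I \<le> n"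
  shows "pldo U n (\<lambda>\<mu> f x. a x * \<mu> ^ j * partials I f x)"
  unfolding pldo_def
proof (intro exI[of _ "\<lambda>i J. if (i, J) = (j, I) then a else (\<lambda>_. 0)"] conjI allI impI)
  fix \<mu> f x
  have "(\<Sum>(i, J)\<in>{(j, I). j + length I \<le> n}. (if (i, J) = (j, I) then a else (\<lambda>_. 0)) x * \<mu> ^ i * partials J f x) =
     (\<Sum>q\<in>{(j, I). j + length I \<le> n}. if q = (j, I) then a x * \<mu> ^ j * partials I f x else 0)"
    by (rule sum.cong) (auto split: if_splits)
  then show "a x * \<mu> ^ j * partials I f x = (\<Sum>(i, J)\<in>{(j, I). j + length I \<le> n}. (if (i, J) = (j, I) then a else (\<lambda>_. 0)) x * \<mu> ^ i * partials J f x)"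
    using assms(2) by (simp add: sum.delta)
qed (use assms(1) in auto)

lemma pldo_add:
  assumes "open U" "pldo U n L" "pldo U n L'"
  shows "pldo U n (\<lambda>\<mu> f x. L \<mu> f x + L' \<mu> f x)"
proof -
  obtain S where S: "\<forall>j I. smooth_on U (S j I)" "\<forall>\<mu> f x. smooth_on U f \<longrightarrow> x \<in> U \<longrightarrow>
        L \<mu> f x = (\<Sum>(j, I)\<in>{(j, I). j + length I \<le> n}. S j I x * \<mu> ^ j * partials I f x)"
    using assms(2) unfolding pldo_def by (elim exE conjE)
  obtain S' where S': "\<forall>j I. smooth_on U (S' j I)" "\<forall>\<mu> f x. smooth_on U f \<longrightarrow> x \<in> U \<longrightarrow>
        L' \<mu> f x = (\<Sum>(j, I)\<in>{(j, I). j + length I \<le> n}. S' j I x * \<mu> ^ j * partials I f x)"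
    using assms(3) unfolding pldo_def by (elim exE conjE)
  show ?thesis unfolding pldo_def
    by (rule exI[of _ "\<lambda>j I x. S j I x + S' j I x"])
      (simp add: S S' smooth_on_add[OF assms(1)] distrib_right sum.distrib case_prod_unfold)
qed

lemma pldo_sum:
  assumes "open U" "\<And>a. a \<in> B \<Longrightarrow> pldo U n (L a)"
  shows "pldo U n (\<lambda>\<mu> f x. \<Sum>a\<in>B. L a \<mu> f x)"
  using assms(2) by (induction B rule: infinite_finite_induct) (auto intro: pldo_0 pldo_add[OF assms(1)])

lemma pldo_sum_terms:
  assumes "open U" "finite B" "\<And>q. q \<in> B \<Longrightarrow> smooth_on U (a q)" "\<And>q. q \<in> B \<Longrightarrow> j q + length (I q) \<le> n"
  shows "pldo U n (\<lambda>\<mu> f x. \<Sum>q\<in>B. a q x * \<mu> ^ j q * partials (I q) f x)"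
  by (intro pldo_sum pldo_term assms)

lemma pldo_mult:
  assumes "open U" "pldo U n L" "smooth_on U a"
  shows "pldo U n (\<lambda>\<mu> f x. a x * L \<mu> f x)"
proof -
  obtain S where S: "\<forall>j I. smooth_on U (S j I)" "\<forall>\<mu> f x. smooth_on U f \<longrightarrow> x \<in> U \<longrightarrow>
        L \<mu> f x = (\<Sum>(j, I)\<in>{(j, I). j + length I \<le> n}. S j I x * \<mu> ^ j * partials I f x)"
    using assms(2) unfolding pldo_def by (elim exE conjE)
  show ?thesis unfolding pldo_def
    by (rule exI[of _ "\<lambda>j I x. a x * S j I x"])
      (simp add: S smooth_on_mult[OF assms(1,3)] mult.assoc sum_distrib_left case_prod_unfold)
qed

lemma pldo_mono:
  assumes "open U" "pldo U n L" "n \<le> m" shows "pldo U m L"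
proof -
  obtain S where S: "\<forall>j I. smooth_on U (S j I)" "\<forall>\<mu> f x. smooth_on U f \<longrightarrow> x \<in> U \<longrightarrow>
        L \<mu> f x = (\<Sum>(j, I)\<in>{(j, I). j + length I \<le> n}. S j I x * \<mu> ^ j * partials I f x)"
    using assms(2) unfolding pldo_def by (elim exE conjE)
  have "pldo U m (\<lambda>\<mu> f x. \<Sum>q\<in>{(j, I). j + length I \<le> n}. S (fst q) (snd q) x * \<mu> ^ fst q * partials (snd q) f x)"
    using S(1) assms(3) by (intro pldo_sum_terms assms(1)) auto
  then show ?thesis by (rule pldo_cong) (simp add: S(2) case_prod_unfold)
qed

lemma pldo_weight:
  assumes "open U" "pldo U n L" shows "pldo U (Suc n) (\<lambda>\<mu> f x. \<mu> * L \<mu> f x)"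
proof -
  obtain S where S: "\<forall>j I. smooth_on U (S j I)" "\<forall>\<mu> f x. smooth_on U f \<longrightarrow> x \<in> U \<longrightarrow>
        L \<mu> f x = (\<Sum>(j, I)\<in>{(j, I). j + length I \<le> n}. S j I x * \<mu> ^ j * partials I f x)"
    using assms(2) unfolding pldo_def by (elim exE conjE)
  have "pldo U (Suc n) (\<lambda>\<mu> f x. \<Sum>q\<in>{(j, I). j + length I \<le> n}. S (fst q) (snd q) x * \<mu> ^ Suc (fst q) * partials (snd q) f x)"
    using S(1) by (intro pldo_sum_terms assms(1)) auto
  then show ?thesis by (rule pldo_cong) (simp add: S(2) case_prod_unfold sum_distrib_left algebra_simps)
qed

lemma pldo_partial:
  assumes "open U" "pldo U n L" shows "pldo U (Suc n) (\<lambda>\<mu> f. partial i (L \<mu> f))"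
proof -
  obtain S where S: "\<forall>j I. smooth_on U (S j I)" "\<forall>\<mu> f x. smooth_on U f \<longrightarrow> x \<in> U \<longrightarrow>
        L \<mu> f x = (\<Sum>(j, I)\<in>{(j, I). j + length I \<le> n}. S j I x * \<mu> ^ j * partials I f x)"
    using assms(2) unfolding pldo_def by (elim exE conjE)
  let ?B = "{(j, I :: 'a list). j + length I \<le> n}"
  have "pldo U (Suc n) (\<lambda>\<mu> f x. (\<Sum>q\<in>?B. S (fst q) (snd q) x * \<mu> ^ fst q * partials (i # snd q) f x)
      + (\<Sum>q\<in>?B. partial i (S (fst q) (snd q)) x * \<mu> ^ fst q * partials (snd q) f x))"
    using S(1) by (intro pldo_add pldo_sum_terms assms(1) smooth_on_partial) auto
  then show ?thesis
  proof (rule pldo_cong)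
    fix \<mu> and f :: "real^'a \<Rightarrow> real" and x assume f: "smooth_on U f" "x \<in> U"
    have d: "S j I differentiable (at x)" "partials I f differentiable (at x)" for j I
      using smooth_on_differentiable[OF S(1)[rule_format] f(2)] smooth_on_differentiable[OF smooth_on_partials[OF f(1)] f(2)] by auto
    have d1: "(\<lambda>x. \<mu> ^ j * S j I x) differentiable (at x)" for j I
      using differentiable_linear[OF bounded_linear_mult_right d(1)] .
    have d2: "(\<lambda>x. (\<mu> ^ j * S j I x) * partials I f x) differentiable (at x)" for j I
      by (rule differentiable_mult[OF d1 d(2)])
    have "partial i (L \<mu> f) x = partial i (\<lambda>x. \<Sum>q\<in>?B. (\<mu> ^ fst q * S (fst q) (snd q) x) * partials (snd q) f x) x"
      by (rule partial_cong_open[OF assms(1) f(2)]) (simp add: S(2) f(1) case_prod_unfold mult.commute)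
    also have "\<dots> = (\<Sum>q\<in>?B. partial i (\<lambda>x. (\<mu> ^ fst q * S (fst q) (snd q) x) * partials (snd q) f x) x)"
      using partial_sum[of ?B "\<lambda>q x. (\<mu> ^ fst q * S (fst q) (snd q) x) * partials (snd q) f x" x i] d2 by blast
    also have "\<dots> = (\<Sum>q\<in>?B. S (fst q) (snd q) x * \<mu> ^ fst q * partials (i # snd q) f x)
      + (\<Sum>q\<in>?B. partial i (S (fst q) (snd q)) x * \<mu> ^ fst q * partials (snd q) f x)"
      unfolding sum.distrib[symmetric]
    proof (rule sum.cong[OF refl])
      fix q :: "nat \<times> 'a list"
      show "partial i (\<lambda>x. \<mu> ^ fst q * S (fst q) (snd q) x * partials (snd q) f x) x =
         S (fst q) (snd q) x * \<mu> ^ fst q * partials (i # snd q) f x + partial i (S (fst q) (snd q)) x * \<mu> ^ fst q * partials (snd q) f x"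
        unfolding partial_mult[OF d1 d(2)] partial_linear[OF bounded_linear_mult_right d(1)] by simp
    qed
    finally show "partial i (L \<mu> f) x = (\<Sum>q\<in>?B. S (fst q) (snd q) x * \<mu> ^ fst q * partials (i # snd q) f x)
      + (\<Sum>q\<in>?B. partial i (S (fst q) (snd q)) x * \<mu> ^ fst q * partials (snd q) f x)" .
  qed
qed

text \<open>By \<open>powr_conjugation\<close> with exponent \<open>\<mu>\<close>, every derivative
  in the list contributes either itself or one factor of the weight, so the total degree is the
  length of the list.\<close>

lemma pldo_partials_conjugation:
  fixes r :: "real^'d::finite \<Rightarrow> real"
  assumes "open U" "smooth_on U r" "\<And>x. x \<in> U \<Longrightarrow> r x > 0"
  shows "pldo U (length I) (\<lambda>\<mu> f x. r x powr \<mu> * partials I (\<lambda>y. r y powr (- \<mu>) * f y) x)"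
proof (induction I)
  case Nil
  have "pldo U 0 (\<lambda>\<mu> f x. 1 * \<mu> ^ 0 * partials [] f x)" by (rule pldo_term) auto
  then show ?case unfolding list.size
    by (rule pldo_cong) (simp add: powr_inverse_cancel assms(3))
next
  case (Cons i I)
  let ?W = "\<lambda>\<mu> f x. r x powr \<mu> * partials I (\<lambda>y. r y powr (- \<mu>) * f y) x"
  have "pldo U (Suc (length I)) (\<lambda>\<mu> f x. partial i (?W \<mu> f) x + (- partial i (\<lambda>y. ln (r y)) x) * (\<mu> * ?W \<mu> f x))"
    by (intro pldo_add pldo_partial pldo_mult pldo_weight Cons assms smooth_on_partial smooth_on_ln smooth_on_minus)
  then show ?case unfolding list.size add_Suc_right add_0_right
    by (rule pldo_cong) (simp only: powr_conjugation[OF assms], simp)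
qed

lemma pldo_conjugation:
  fixes r :: "real^'d::finite \<Rightarrow> real"
  assumes "open U" "smooth_on U r" "\<And>x. x \<in> U \<Longrightarrow> r x > 0" "ldo U (Suc n) L"
  shows "pldo U n (\<lambda>\<mu> f x. r x powr \<mu> * L (\<lambda>y. r y powr (- \<mu>) * f y) x)"
proof -
  obtain S where S0: "ldo_rep U (Suc n) L S" using assms(4) unfolding ldo_def by blast
  note S = ldo_repD[OF S0]
  have "pldo U n (\<lambda>\<mu> f x. \<Sum>I | length I < Suc n. S I x * (r x powr \<mu> * partials I (\<lambda>y. r y powr (- \<mu>) * f y) x))"
    by (intro pldo_sum pldo_mult assms(1) S(1) pldo_mono[OF assms(1) pldo_partials_conjugation[OF assms(1-3)]]) auto
  then show ?thesis
  proof (rule pldo_cong)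
    fix \<mu> and f :: "real^'d \<Rightarrow> real" and x assume f: "smooth_on U f" "x \<in> U"
    have q: "smooth_on U (\<lambda>x. r x powr (- \<mu>))" by (rule smooth_on_powr[OF assms(1-3)])
    show "r x powr \<mu> * L (\<lambda>y. r y powr (- \<mu>) * f y) x = (\<Sum>I | length I < Suc n. S I x * (r x powr \<mu> * partials I (\<lambda>y. r y powr (- \<mu>) * f y) x))"
      unfolding S(2)[OF smooth_on_mult[OF assms(1) q f(1)] f(2)]
      by (simp add: sum_distrib_left algebra_simps)
  qed
qed

section \<open>The formal adjoint in one chart\<close>

text \<open>The adjoint for the measure with density \<open>r\<close>: integration by parts moves
  the derivatives onto the coefficient, the density and the other function together, and division by
  \<open>r\<close> restores the measure.\<close>

definition ladj :: "(real^'d::finite \<Rightarrow> real) \<Rightarrow> nat \<Rightarrow> ('d list \<Rightarrow> real^'d \<Rightarrow> real) \<Rightarrow> 'd lop" where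
  "ladj r k S f x = inverse (r x) *
     (\<Sum>I | length I < k. (-1) ^ length I * partials (rev I) (\<lambda>y. S I y * (r y * f y)) x)"

lemma ldo_id: "ldo U 1 (\<lambda>f. f)"
  using ldo_term[of U "\<lambda>_. 1" "[]" 1] by simp

lemma ldo_partials: "ldo U (Suc (length I)) (\<lambda>f. partials I f)"
  using ldo_term[of U "\<lambda>_. 1" I "Suc (length I)"] by simp

lemma ladj_ldo:
  assumes U: "open U" and r: "smooth_on U r" "\<And>x. x \<in> U \<Longrightarrow> r x > 0" and S: "\<And>I. smooth_on U (S I)"
  shows "ldo U k (ladj r k S)"
proof -
  have g: "smooth_on U (\<lambda>y. S I y * r y)" for I by (intro smooth_on_mult S r U)
  have inv: "smooth_on U (\<lambda>x. inverse (r x))" by (rule smooth_on_inverse[OF U r])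
  have "ldo U k (\<lambda>f x. inverse (r x) * (\<Sum>I | length I < k. (-1) ^ length I * partials (rev I) (\<lambda>y. (S I y * r y) * f y) x))"
  proof (rule ldo_mult[OF U _ inv], rule ldo_sum[OF U], rule ldo_cmult[OF U])
    fix I :: "'a list" assume "I \<in> {I. length I < k}"
    then have "Suc (length (rev I)) \<le> k" by simp
    with ldo_mono[OF U ldo_mult_pre[OF U ldo_partials g]]
    show "ldo U k (\<lambda>f. partials (rev I) (\<lambda>y. (S I y * r y) * f y))" by blast
  qed
  then show ?thesis by (rule ldo_cong) (simp add: ladj_def mult.assoc)
qed

text \<open>For a list of length \<open>n\<close> the two signs \<open>(-1) ^ n\<close> cancel, and
  what remains is the commutator of a derivative with a function, up to the reversal of the list.
  Shorter lists have lower order from the outset.\<close>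

lemma ladj_symbol:
  assumes U: "open U" and r: "smooth_on U r" "\<And>x. x \<in> U \<Longrightarrow> r x > 0" and L: "ldo_rep U (Suc n) L S"
  shows "ldo U n (\<lambda>f x. L f x - (-1) ^ n * ladj r (Suc n) S f x)"
proof -
  note S = ldo_repD[OF L]
  have g: "smooth_on U (\<lambda>y. S I y * r y)" for I by (intro smooth_on_mult S(1) r U)
  have inv: "smooth_on U (\<lambda>x. inverse (r x))" by (rule smooth_on_inverse[OF U r])
  let ?P = "\<lambda>I f x. partials (rev I) (\<lambda>y. (S I y * r y) * f y) x"
  let ?T = "\<lambda>I f x. S I x * partials I f x - ((-1) ^ (n + length I) * inverse (r x)) * ?P I f x"
  have "ldo U n (?T I)" if I: "length I < Suc n" for I
  proof (cases "length I = n")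
    case True
    have "ldo U (length (rev I)) (\<lambda>f x. (- inverse (r x)) * (?P I f x - (S I x * r x) * partials (rev I) f x))"
      by (rule ldo_mult[OF U ldo_partials_commutator[OF U g] smooth_on_minus[OF U inv]])
    then have "ldo U n (\<lambda>f x. (- inverse (r x)) * (?P I f x - (S I x * r x) * partials (rev I) f x))"
      using True by simp
    then show ?thesis
    proof (rule ldo_cong)
      fix f :: "real^'a \<Rightarrow> real" and x assume f: "smooth_on U f" "x \<in> U"
      have "(-1::real) ^ (n + length I) = 1" using True by simp
      then show "?T I f x = (- inverse (r x)) * (?P I f x - (S I x * r x) * partials (rev I) f x)"
        using r(2)[OF f(2)] partials_rev[OF U f, of I] by (simp add: right_diff_distrib)
    qed
  next
    case False
    then have "length I < n" using I by simp
    have "ldo U (Suc (length (rev I))) (?P I)" by (rule ldo_mult_pre[OF U ldo_partials g])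
    then have "ldo U n (?P I)" by (rule ldo_mono[OF U]) (use \<open>length I < n\<close> in simp)
    then show ?thesis
      by (rule ldo_diff[OF U ldo_term[OF S(1) \<open>length I < n\<close>] ldo_mult[OF U _ smooth_on_cmult[OF U inv]]])
  qed
  then have "ldo U n (\<lambda>f x. \<Sum>I | length I < Suc n. ?T I f x)" by (intro ldo_sum[OF U]) auto
  then show ?thesis
    by (rule ldo_cong) (simp add: S(2) ladj_def sum_subtractf sum_distrib_left power_add algebra_simps)
qed

text \<open>The integrals run over the whole space although \<open>L\<close> is controlled only on
  \<open>U\<close>: outside \<open>U\<close> the density \<open>r\<close> vanishes and removes the
  unknown values.\<close>

lemma ladj_integral:
  assumes U: "open U" and r: "smooth_on U r" "\<And>x. x \<in> U \<Longrightarrow> r x > 0" "\<And>x. x \<notin> U \<Longrightarrow> r x = 0"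
    and L: "ldo_rep U k L S" and f: "smooth_on U f" and g: "smooth_on U g"
    and K: "compact K" "K \<subseteq> U" "\<And>x. x \<notin> K \<Longrightarrow> f x = 0"
  shows "integral UNIV (\<lambda>x. r x * (L f x * g x)) = integral UNIV (\<lambda>x. r x * (f x * ladj r k S g x))"
proof -
  note S = ldo_repD[OF L]
  have cl: "closed K" using K(1) compact_imp_closed by blast
  have h: "smooth_on U (\<lambda>y. S I y * (r y * g y))" for I by (intro smooth_on_mult S(1) r g U)
  have pf: "partials I f x = 0" if "x \<notin> K" for I x by (rule partials_zero_outside[OF cl K(3) that])
  have int1: "(\<lambda>x. partials I f x * (S I x * (r x * g x))) integrable_on UNIV" for I
  proof (rule integrable_compact_support(2)[OF _ compact_imp_bounded[OF K(1)]])
    show "continuous_on UNIV (\<lambda>x. partials I f x * (S I x * (r x * g x)))"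
      using pf by (intro smooth_on_continuous smooth_on_extend_zero[OF U _ cl K(2)] smooth_on_mult[OF U] h smooth_on_partials f) simp
  qed (simp add: pf)
  have int2: "(\<lambda>x. (-1) ^ length I * (f x * partials (rev I) (\<lambda>y. S I y * (r y * g y)) x)) integrable_on UNIV" for I
  proof (rule integrable_compact_support(2)[OF _ compact_imp_bounded[OF K(1)]])
    show "continuous_on UNIV (\<lambda>x. (-1) ^ length I * (f x * partials (rev I) (\<lambda>y. S I y * (r y * g y)) x))"
      using K(3) by (intro smooth_on_continuous smooth_on_extend_zero[OF U _ cl K(2)] smooth_on_cmult[OF U] smooth_on_mult[OF U] smooth_on_partials h f) simp
  qed (simp add: K(3))
  have "(\<lambda>x. r x * (L f x * g x)) = (\<lambda>x. \<Sum>I | length I < k. partials I f x * (S I x * (r x * g x)))"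
  proof
    fix x show "r x * (L f x * g x) = (\<Sum>I | length I < k. partials I f x * (S I x * (r x * g x)))"
    proof (cases "x \<in> U")
      case True then show ?thesis by (simp add: S(2)[OF f] sum_distrib_left sum_distrib_right algebra_simps)
    next
      case False then show ?thesis using r(3) K(2) by (simp add: pf)
    qed
  qed
  then have "integral UNIV (\<lambda>x. r x * (L f x * g x)) = (\<Sum>I | length I < k. integral UNIV (\<lambda>x. partials I f x * (S I x * (r x * g x))))"
    by (simp add: integral_sum[OF _ int1])
  also have "\<dots> = (\<Sum>I | length I < k. integral UNIV (\<lambda>x. (-1) ^ length I * (f x * partials (rev I) (\<lambda>y. S I y * (r y * g y)) x)))"
    by (simp add: integration_by_parts_list[OF U f h K])
  also have "\<dots> = integral UNIV (\<lambda>x. \<Sum>I | length I < k. (-1) ^ length I * (f x * partials (rev I) (\<lambda>y. S I y * (r y * g y)) x))"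
    by (simp only: integral_sum[OF finite_lists_less int2])
  also have "(\<lambda>x. \<Sum>I | length I < k. (-1) ^ length I * (f x * partials (rev I) (\<lambda>y. S I y * (r y * g y)) x)) =
    (\<lambda>x. r x * (f x * ladj r k S g x))"
  proof
    fix x show "(\<Sum>I | length I < k. (-1) ^ length I * (f x * partials (rev I) (\<lambda>y. S I y * (r y * g y)) x)) = r x * (f x * ladj r k S g x)"
    proof (cases "x \<in> U")
      case True
      have "r x * (f x * (inverse (r x) * t)) = f x * t" for t using r(2)[OF True] by simp
      then show ?thesis unfolding ladj_def by (simp only: sum_distrib_left mult.left_commute[of _ "f x"])
    next
      case False then have "f x = 0" using K by blast
      then show ?thesis by simp
    qed
  qed
  finally show ?thesis .
qed

lemma integral_0_imp_0:
  fixes h :: "real^'d::finite \<Rightarrow> real"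
  assumes "continuous_on UNIV h" "\<And>x. 0 \<le> h x" "bounded B" "\<And>x. x \<notin> B \<Longrightarrow> h x = 0" "integral UNIV h = 0"
  shows "h x = 0"
proof -
  obtain a where a: "insert x B \<subseteq> box (-a) a" using bounded_subset_box_symmetric[of "insert x B"] assms(3) by auto
  have "(\<lambda>x. if x \<in> cbox (-a) a then h x else 0) = h"
    using a assms(4) box_subset_cbox[of "-a" a] by fastforce
  moreover have "(h has_integral 0) UNIV"
    using integrable_compact_support(2)[OF assms(1,3,4)] assms(5) by (metis integrable_integral)
  ultimately have "(h has_integral 0) (cbox (-a) a)"
    using has_integral_restrict_UNIV[of "cbox (-a) a" h 0] by simp
  then show ?thesis
    using a assms(1,2) box_subset_cbox[of "-a" a] by (intro has_integral_0_cbox_imp_0[of "-a" a h]) (auto intro: continuous_on_subset)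
qed

section \<open>From operators in charts to operators on the manifold\<close>

context volume_manifold begin

text \<open>Each chart has its own \<open>L\<close> and no compatibility on overlaps is imposed; it
  is implicit in \<open>E\<close> mapping functions to functions. Linearity and locality of
  \<open>E\<close> are consequences.\<close>

definition DO :: "nat \<Rightarrow> (('a, 'd) density \<Rightarrow> ('a, 'd) density) set" where
  "DO k = {E. (\<forall>f\<in>Fun. E f \<in> Fun) \<and>
     (\<forall>\<kappa>\<in>A. \<exists>L. ldo (target \<kappa>) k L \<and> (\<forall>f\<in>Fun. \<forall>x\<in>target \<kappa>. E f \<kappa> x = L (f \<kappa>) x))}"

lemma DO_I:
  assumes "\<And>f. f \<in> Fun \<Longrightarrow> E f \<in> Fun"
    and "\<And>\<kappa>. \<kappa> \<in> A \<Longrightarrow> \<exists>L. ldo (target \<kappa>) k L \<and> (\<forall>f\<in>Fun. \<forall>x\<in>target \<kappa>. E f \<kappa> x = L (f \<kappa>) x)"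
  shows "E \<in> DO k"
  using assms unfolding DO_def by blast

lemma DO_Fun: "E \<in> DO k \<Longrightarrow> f \<in> Fun \<Longrightarrow> E f \<in> Fun"
  unfolding DO_def by blast

lemma DO_local:
  assumes "E \<in> DO k" "\<kappa> \<in> A"
  shows "\<exists>L. ldo (target \<kappa>) k L \<and> (\<forall>f\<in>Fun. \<forall>x\<in>target \<kappa>. E f \<kappa> x = L (f \<kappa>) x)"
  using assms unfolding DO_def by blast

lemma DO_eqI:
  assumes "E f \<in> Fun" "E' f \<in> Fun" "\<And>\<kappa> x. \<kappa> \<in> A \<Longrightarrow> x \<in> target \<kappa> \<Longrightarrow> E f \<kappa> x = E' f \<kappa> x"
  shows "E f = E' f"
proof (intro ext)
  fix \<kappa> x show "E f \<kappa> x = E' f \<kappa> x"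
    using assms(3)[of \<kappa> x] densitiesD(3)[OF assms(1), of \<kappa> x] densitiesD(3)[OF assms(2), of \<kappa> x]
    by (cases "\<kappa> \<in> A \<and> x \<in> target \<kappa>") auto
qed

lemma DO_cong:
  assumes "E \<in> DO k" "\<And>f. f \<in> Fun \<Longrightarrow> E' f = E f" shows "E' \<in> DO k"
proof (rule DO_I)
  fix \<kappa> assume k: "\<kappa> \<in> A"
  obtain L where "ldo (target \<kappa>) k L \<and> (\<forall>f\<in>Fun. \<forall>x\<in>target \<kappa>. E f \<kappa> x = L (f \<kappa>) x)"
    using DO_local[OF assms(1) k] by blast
  then show "\<exists>L. ldo (target \<kappa>) k L \<and> (\<forall>f\<in>Fun. \<forall>x\<in>target \<kappa>. E' f \<kappa> x = L (f \<kappa>) x)"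
    by (intro exI[of _ L]) (simp add: assms(2))
qed (use assms DO_Fun in simp)

lemma fun_smooth: "f \<in> Fun \<Longrightarrow> \<kappa> \<in> A \<Longrightarrow> smooth_on (target \<kappa>) (f \<kappa>)"
  by (rule density_smooth)

lemma DO_mono:
  assumes "E \<in> DO k" "k \<le> k'" shows "E \<in> DO k'"
proof (rule DO_I)
  fix \<kappa> assume k: "\<kappa> \<in> A"
  obtain L where "ldo (target \<kappa>) k L \<and> (\<forall>f\<in>Fun. \<forall>x\<in>target \<kappa>. E f \<kappa> x = L (f \<kappa>) x)"
    using DO_local[OF assms(1) k] by blast
  then show "\<exists>L. ldo (target \<kappa>) k' L \<and> (\<forall>f\<in>Fun. \<forall>x\<in>target \<kappa>. E f \<kappa> x = L (f \<kappa>) x)"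
    using ldo_mono[OF open_target[OF k] _ assms(2)] by blast
qed (rule DO_Fun[OF assms(1)])

lemma Fun_add: "f \<in> Fun \<Longrightarrow> g \<in> Fun \<Longrightarrow> f + g \<in> Fun" by (rule add_density)
lemma Fun_diff: "f \<in> Fun \<Longrightarrow> g \<in> Fun \<Longrightarrow> f - g \<in> Fun" by (rule diff_density)
lemma Fun_mult: "f \<in> Fun \<Longrightarrow> g \<in> Fun \<Longrightarrow> f * g \<in> Fun" using mult_density[of f 0 g 0] by simp
lemma Fun_scale: "f \<in> Fun \<Longrightarrow> scale_density c f \<in> Fun" by (rule scale_density_in)

lemma DO_add:
  assumes "E \<in> DO k" "E' \<in> DO k" shows "(\<lambda>f. E f + E' f) \<in> DO k"
proof (rule DO_I)
  fix \<kappa> assume k: "\<kappa> \<in> A"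
  obtain L where L: "ldo (target \<kappa>) k L" "\<forall>f\<in>Fun. \<forall>x\<in>target \<kappa>. E f \<kappa> x = L (f \<kappa>) x"
    using DO_local[OF assms(1) k] by blast
  obtain L' where L': "ldo (target \<kappa>) k L'" "\<forall>f\<in>Fun. \<forall>x\<in>target \<kappa>. E' f \<kappa> x = L' (f \<kappa>) x"
    using DO_local[OF assms(2) k] by blast
  show "\<exists>L. ldo (target \<kappa>) k L \<and> (\<forall>f\<in>Fun. \<forall>x\<in>target \<kappa>. (E f + E' f) \<kappa> x = L (f \<kappa>) x)"
    using L(2) L'(2) by (intro exI[of _ "\<lambda>f x. L f x + L' f x"] conjI ldo_add[OF open_target[OF k] L(1) L'(1)]) simp
qed (intro Fun_add DO_Fun[OF assms(1)] DO_Fun[OF assms(2)])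

lemma DO_scale:
  assumes "E \<in> DO k" shows "(\<lambda>f. scale_density c (E f)) \<in> DO k"
proof (rule DO_I)
  fix \<kappa> assume k: "\<kappa> \<in> A"
  obtain L where L: "ldo (target \<kappa>) k L" "\<forall>f\<in>Fun. \<forall>x\<in>target \<kappa>. E f \<kappa> x = L (f \<kappa>) x"
    using DO_local[OF assms(1) k] by blast
  show "\<exists>L. ldo (target \<kappa>) k L \<and> (\<forall>f\<in>Fun. \<forall>x\<in>target \<kappa>. scale_density c (E f) \<kappa> x = L (f \<kappa>) x)"
    using L(2) by (intro exI[of _ "\<lambda>f x. c * L f x"] conjI ldo_cmult[OF open_target[OF k] L(1)]) (simp add: scale_density_def)
qed (intro Fun_scale DO_Fun[OF assms(1)])

lemma scale_minus: "scale_density (-1) f = - f"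
  by (simp add: scale_density_def fun_eq_iff)

lemma DO_diff:
  assumes "E \<in> DO k" "E' \<in> DO k" shows "(\<lambda>f. E f - E' f) \<in> DO k"
  using DO_add[OF assms(1) DO_scale[OF assms(2), of "-1"]] by (simp add: scale_minus)

lemma DO_mult:
  assumes "E \<in> DO k" "g \<in> Fun" shows "(\<lambda>f. g * E f) \<in> DO k"
proof (rule DO_I)
  fix \<kappa> assume k: "\<kappa> \<in> A"
  obtain L where L: "ldo (target \<kappa>) k L" "\<forall>f\<in>Fun. \<forall>x\<in>target \<kappa>. E f \<kappa> x = L (f \<kappa>) x"
    using DO_local[OF assms(1) k] by blast
  show "\<exists>L. ldo (target \<kappa>) k L \<and> (\<forall>f\<in>Fun. \<forall>x\<in>target \<kappa>. (g * E f) \<kappa> x = L (f \<kappa>) x)"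
    using L(2) by (intro exI[of _ "\<lambda>f x. g \<kappa> x * L f x"] conjI ldo_mult[OF open_target[OF k] L(1)] fun_smooth assms(2) k) simp
qed (intro Fun_mult DO_Fun[OF assms(1)] assms(2))

lemma DO_id: "(\<lambda>f. f) \<in> DO 1"
  by (rule DO_I, assumption) (rule exI[of _ "\<lambda>f. f"], simp add: ldo_id[simplified])

lemma DO_multop: "g \<in> Fun \<Longrightarrow> (\<lambda>f. g * f) \<in> DO 1"
  by (rule DO_mult[OF DO_id])

lemma mult_app: "(g * f) \<kappa> = (\<lambda>y. g \<kappa> y * f \<kappa> y)" for f g :: "('a, 'd) density"
  by (simp add: fun_eq_iff)

lemma DO_commutator:
  assumes "E \<in> DO k" "g \<in> Fun" shows "(\<lambda>f. E (g * f) - g * E f) \<in> DO (k - 1)"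
proof (rule DO_I)
  fix \<kappa> assume k: "\<kappa> \<in> A"
  obtain L where L: "ldo (target \<kappa>) k L" "\<forall>f\<in>Fun. \<forall>x\<in>target \<kappa>. E f \<kappa> x = L (f \<kappa>) x"
    using DO_local[OF assms(1) k] by blast
  show "\<exists>L. ldo (target \<kappa>) (k - 1) L \<and> (\<forall>f\<in>Fun. \<forall>x\<in>target \<kappa>. (E (g * f) - g * E f) \<kappa> x = L (f \<kappa>) x)"
    using L(2) Fun_mult[OF assms(2)]
    by (intro exI[of _ "\<lambda>f x. L (\<lambda>y. g \<kappa> y * f y) x - g \<kappa> x * L f x"] conjI
        ldo_commutator_mult[OF open_target[OF k] L(1)] fun_smooth assms(2) k) (simp add: times_fun_def)
qed (intro Fun_diff Fun_mult DO_Fun[OF assms(1)] assms(2))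

lemma DO_mult_pre:
  assumes "E \<in> DO k" "g \<in> Fun" shows "(\<lambda>f. E (g * f)) \<in> DO k"
  using DO_add[OF DO_mono[OF DO_commutator[OF assms]] DO_mult[OF assms]] by simp

lemma DO_linear:
  assumes "E \<in> DO k" "f \<in> Fun"
  shows "E (scale_density c f) = scale_density c (E f)"
    and "g \<in> Fun \<Longrightarrow> E (f + g) = E f + E g"
proof -
  show "E (scale_density c f) = scale_density c (E f)"
  proof (rule DO_eqI[of "\<lambda>f. E (scale_density c f)" f "\<lambda>f. scale_density c (E f)"])
    fix \<kappa> x assume k: "\<kappa> \<in> A" "x \<in> target \<kappa>"
    obtain L where L: "ldo (target \<kappa>) k L" "\<forall>f\<in>Fun. \<forall>x\<in>target \<kappa>. E f \<kappa> x = L (f \<kappa>) x"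
      using DO_local[OF assms(1) k(1)] by blast
    have "scale_density c f \<kappa> = (\<lambda>y. c * f \<kappa> y)" by (simp add: scale_density_def)
    then show "E (scale_density c f) \<kappa> x = scale_density c (E f) \<kappa> x"
      using L(2) k Fun_scale assms(2) ldo_linear(1)[OF open_target[OF k(1)] L(1) fun_smooth[OF assms(2) k(1)] k(2)]
      by (simp add: scale_density_def[of c "E f"])
  qed (intro Fun_scale DO_Fun[OF assms(1)] assms(2))+
  assume g: "g \<in> Fun"
  show "E (f + g) = E f + E g"
  proof (rule DO_eqI[of "\<lambda>f. E (f + g)" f "\<lambda>f. E f + E g"])
    fix \<kappa> x assume k: "\<kappa> \<in> A" "x \<in> target \<kappa>"
    obtain L where L: "ldo (target \<kappa>) k L" "\<forall>f\<in>Fun. \<forall>x\<in>target \<kappa>. E f \<kappa> x = L (f \<kappa>) x"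
      using DO_local[OF assms(1) k(1)] by blast
    have "(f + g) \<kappa> = (\<lambda>y. f \<kappa> y + g \<kappa> y)" by (simp add: fun_eq_iff)
    then show "E (f + g) \<kappa> x = (E f + E g) \<kappa> x"
      using L(2) k Fun_add assms(2) g
        ldo_linear(2)[OF open_target[OF k(1)] L(1) fun_smooth[OF assms(2) k(1)] k(2) fun_smooth[OF g k(1)]]
      by simp
  qed (intro Fun_add DO_Fun[OF assms(1)] assms(2) g)+
qed

lemma DO_linear_0: "E \<in> DO k \<Longrightarrow> E 0 = 0"
  using DO_linear(1)[of E k 0 0] zero_density by (simp add: scale_density_def zero_fun_def)

lemma DO_linear_diff: "E \<in> DO k \<Longrightarrow> f \<in> Fun \<Longrightarrow> g \<in> Fun \<Longrightarrow> E (f - g) = E f - E g"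
  using DO_linear(2)[of E k f "-g"] DO_linear(1)[of E k g "-1"] Fun_scale[of g "-1"] by (simp add: scale_minus)

lemma DO_linear_sum_list:
  assumes "E \<in> DO k" "\<And>f. f \<in> set fs \<Longrightarrow> f \<in> Fun"
  shows "sum_list fs \<in> Fun \<and> E (sum_list fs) = sum_list (map E fs)"
  using assms(2) by (induction fs) (auto simp: DO_linear_0[OF assms(1)] zero_density DO_linear(2)[OF assms(1)] Fun_add)

text \<open>Only derivatives at \<open>x\<close> enter the local formula. Arbitrary functions may
  thus be replaced by compactly supported ones when a value at a point is compared.\<close>

lemma DO_germ:
  assumes "E \<in> DO k" "f \<in> Fun" "g \<in> Fun" "\<kappa> \<in> A" "open V" "V \<subseteq> target \<kappa>" "x \<in> V" "\<And>y. y \<in> V \<Longrightarrow> f \<kappa> y = g \<kappa> y"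
  shows "E f \<kappa> x = E g \<kappa> x"
proof -
  obtain L where L: "ldo (target \<kappa>) k L" "\<forall>f\<in>Fun. \<forall>x\<in>target \<kappa>. E f \<kappa> x = L (f \<kappa>) x"
    using DO_local[OF assms(1,4)] by blast
  obtain S where S0: "ldo_rep (target \<kappa>) k L S" using L(1) unfolding ldo_def by blast
  have x: "x \<in> target \<kappa>" using assms by blast
  have "partials I (f \<kappa>) x = partials I (g \<kappa>) x" for I
    by (rule partials_cong_open[OF assms(5,7,8)])
  then have "L (f \<kappa>) x = L (g \<kappa>) x"
    using ldo_repD(2)[OF S0 fun_smooth[OF assms(2,4)] x] ldo_repD(2)[OF S0 fun_smooth[OF assms(3,4)] x] by simp
  then show ?thesis using L(2) assms(2,3) x by simp
qed

lemma off_support_open: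
  assumes "cpt s" "\<kappa> \<in> A" "x \<in> target \<kappa>" "pt \<kappa> x \<notin> supp T A s"
  obtains V where "open V" "V \<subseteq> target \<kappa>" "x \<in> V" "\<And>y. y \<in> V \<Longrightarrow> s \<kappa> y = 0"
proof
  let ?W = "topspace T - supp T A s"
  let ?V = "coord \<kappa> ` (chart_dom \<kappa> \<inter> ?W)"
  have "openin T ?W" unfolding supp_def by (intro openin_diff openin_topspace closedin_closure_of)
  then show "open ?V" using open_coord_image assms(2) by blast
  show "?V \<subseteq> target \<kappa>" by auto
  have "coord \<kappa> (pt \<kappa> x) \<in> ?V"
    using assms chart_topspace[OF assms(2)] by (intro imageI) auto
  then show "x \<in> ?V" using assms(3) by simp
  show "s \<kappa> y = 0" if "y \<in> ?V" for y
  proof (rule ccontr)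
    assume "s \<kappa> y \<noteq> 0"
    moreover have "y \<in> target \<kappa>" "pt \<kappa> y \<notin> supp T A s" using that assms(2) by auto
    ultimately show False using suppI[of \<kappa> y s] assms(2) by blast
  qed
qed

lemma DO_cpt:
  assumes "E \<in> DO k" "f \<in> Fun" "cpt f" shows "cpt (E f)" "supp T A (E f) \<subseteq> supp T A f"
proof -
  have "E f \<kappa> x = 0" if *: "\<kappa> \<in> A" "x \<in> target \<kappa>" "pt \<kappa> x \<notin> supp T A f" for \<kappa> x
  proof -
    obtain V where V: "open V" "V \<subseteq> target \<kappa>" "x \<in> V" "\<And>y. y \<in> V \<Longrightarrow> f \<kappa> y = 0"
      using off_support_open[OF assms(3) *] by blast
    then show ?thesis
      using DO_germ[OF assms(1,2) zero_density *(1) V(1-3)] DO_linear_0[OF assms(1)] by simp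
  qed
  note z = this
  show "cpt (E f)" "supp T A (E f) \<subseteq> supp T A f" by (rule cpt_smaller[OF assms(3) z]; assumption)+
qed

definition adjrel :: "(('a, 'd) density \<Rightarrow> ('a, 'd) density) \<Rightarrow> (('a, 'd) density \<Rightarrow> ('a, 'd) density) \<Rightarrow> bool" where
  "adjrel E E' \<longleftrightarrow> (\<forall>f\<in>Fun. \<forall>g\<in>Fun. cpt f \<longrightarrow> cpt g \<longrightarrow>
     density_integral T A (\<rho> * (E f * g)) = density_integral T A (\<rho> * (f * E' g)))"

lemma weighted_density: "f \<in> Fun \<Longrightarrow> \<rho> * f \<in> densities A 1"
  using mult_density[OF rho_density, of f 0] by simp

section \<open>Formal adjoints\<close>

text \<open>The coefficients are chosen separately in each chart, so it is not evident that the
  local formulas agree on overlaps; that is settled by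
  \<open>chart_adjoint_transition\<close>.\<close>

definition chart_adjoint :: "nat \<Rightarrow> (('a, 'd) chart \<Rightarrow> 'd list \<Rightarrow> real^'d \<Rightarrow> real) \<Rightarrow> ('a, 'd) density \<Rightarrow> ('a, 'd) density" where
  "chart_adjoint k S g = (\<lambda>\<kappa> x. if \<kappa> \<in> A \<and> x \<in> target \<kappa> then ladj (\<rho> \<kappa>) k (S \<kappa>) (g \<kappa>) x else 0)"

definition coeffs_of :: "nat \<Rightarrow> (('a, 'd) density \<Rightarrow> ('a, 'd) density) \<Rightarrow> (('a, 'd) chart \<Rightarrow> 'd list \<Rightarrow> real^'d \<Rightarrow> real) \<Rightarrow> bool" where
  "coeffs_of k E S \<longleftrightarrow> (\<forall>\<kappa>\<in>A. \<exists>L. ldo_rep (target \<kappa>) k L (S \<kappa>) \<and> (\<forall>f\<in>Fun. \<forall>x\<in>target \<kappa>. E f \<kappa> x = L (f \<kappa>) x))"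

lemma exists_coeffs:
  assumes "E \<in> DO k" shows "\<exists>S. coeffs_of k E S"
proof -
  have "\<exists>S L. ldo_rep (target \<kappa>) k L S \<and> (\<forall>f\<in>Fun. \<forall>x\<in>target \<kappa>. E f \<kappa> x = L (f \<kappa>) x)" if "\<kappa> \<in> A" for \<kappa>
    using DO_local[OF assms that] unfolding ldo_def by blast
  then have "\<exists>S. \<forall>\<kappa>\<in>A. \<exists>L. ldo_rep (target \<kappa>) k L (S \<kappa>) \<and> (\<forall>f\<in>Fun. \<forall>x\<in>target \<kappa>. E f \<kappa> x = L (f \<kappa>) x)"
    by (intro bchoice ballI) blast
  then show ?thesis unfolding coeffs_of_def .
qed

lemma coeffs_smooth:
  assumes "coeffs_of k E S" "\<kappa> \<in> A" shows "smooth_on (target \<kappa>) (S \<kappa> I)"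
proof -
  obtain L where "ldo_rep (target \<kappa>) k L (S \<kappa>)" using assms unfolding coeffs_of_def by blast
  then show ?thesis by (rule ldo_repD)
qed

lemma rho_smooth: "\<kappa> \<in> A \<Longrightarrow> smooth_on (target \<kappa>) (\<rho> \<kappa>)"
  by (rule density_smooth[OF rho_density])

lemma chart_adjoint_smooth:
  assumes "coeffs_of k E S" "g \<in> Fun" "\<kappa> \<in> A"
  shows "smooth_on (target \<kappa>) (chart_adjoint k S g \<kappa>)"
proof -
  have "ldo (target \<kappa>) k (ladj (\<rho> \<kappa>) k (S \<kappa>))"
    by (rule ladj_ldo[OF open_target rho_smooth rho_pos coeffs_smooth[OF assms(1)]]; (rule assms(3) | assumption))
  from ldo_smooth[OF open_target[OF assms(3)] this fun_smooth[OF assms(2,3)]]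
  show ?thesis by (rule smooth_on_cong[OF open_target[OF assms(3)], rotated]) (simp add: chart_adjoint_def assms(3))
qed

lemma chart_adjoint_integral:
  assumes "coeffs_of k E S" "\<kappa> \<in> A" "f \<in> Fun" "cpt f" "supp T A f \<subseteq> chart_dom \<kappa>" "g \<in> Fun"
  shows "integral UNIV (\<lambda>x. \<rho> \<kappa> x * (E f \<kappa> x * g \<kappa> x)) = integral UNIV (\<lambda>x. \<rho> \<kappa> x * (f \<kappa> x * chart_adjoint k S g \<kappa> x))"
proof -
  obtain L where L: "ldo_rep (target \<kappa>) k L (S \<kappa>)" "\<forall>f\<in>Fun. \<forall>x\<in>target \<kappa>. E f \<kappa> x = L (f \<kappa>) x"
    using assms(1,2) unfolding coeffs_of_def by blast
  obtain C where C: "compact C" "C \<subseteq> target \<kappa>" "\<And>x. x \<notin> C \<Longrightarrow> f \<kappa> x = 0"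
    using chart_support[OF assms(2,3,4,5)] by metis
  have z: "\<rho> \<kappa> x = 0" if "x \<notin> target \<kappa>" for x using density_zero[OF rho_density] that by blast
  have "integral UNIV (\<lambda>x. \<rho> \<kappa> x * (L (f \<kappa>) x * g \<kappa> x)) = integral UNIV (\<lambda>x. \<rho> \<kappa> x * (f \<kappa> x * ladj (\<rho> \<kappa>) k (S \<kappa>) (g \<kappa>) x))"
    by (rule ladj_integral[OF open_target[OF assms(2)] rho_smooth[OF assms(2)] rho_pos[OF assms(2)] z L(1)
          fun_smooth[OF assms(3,2)] fun_smooth[OF assms(6,2)] C])
  moreover have "(\<lambda>x. \<rho> \<kappa> x * (E f \<kappa> x * g \<kappa> x)) = (\<lambda>x. \<rho> \<kappa> x * (L (f \<kappa>) x * g \<kappa> x))"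
  proof
    fix x show "\<rho> \<kappa> x * (E f \<kappa> x * g \<kappa> x) = \<rho> \<kappa> x * (L (f \<kappa>) x * g \<kappa> x)"
      using L(2) assms(3) z[of x] by (cases "x \<in> target \<kappa>") auto
  qed
  moreover have "(\<lambda>x. \<rho> \<kappa> x * (f \<kappa> x * chart_adjoint k S g \<kappa> x)) = (\<lambda>x. \<rho> \<kappa> x * (f \<kappa> x * ladj (\<rho> \<kappa>) k (S \<kappa>) (g \<kappa>) x))"
  proof
    fix x show "\<rho> \<kappa> x * (f \<kappa> x * chart_adjoint k S g \<kappa> x) = \<rho> \<kappa> x * (f \<kappa> x * ladj (\<rho> \<kappa>) k (S \<kappa>) (g \<kappa>) x)"
      using assms(2) z[of x] by (cases "x \<in> target \<kappa>") (auto simp: chart_adjoint_def)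
  qed
  ultimately show ?thesis by simp
qed

text \<open>Test functions supported in the overlap of two charts show that the local formula for the
  adjoint does not depend on the chart.\<close>

lemma chart_adjoint_transition:
  assumes S: "coeffs_of k E S" and E: "E \<in> DO k" and g: "g \<in> Fun" and k: "\<kappa> \<in> A" "\<kappa>' \<in> A" and x0: "x0 \<in> overlap \<kappa> \<kappa>'"
  shows "chart_adjoint k S g \<kappa> x0 = chart_adjoint k S g \<kappa>' (transition \<kappa> \<kappa>' x0)"
proof -
  let ?G = "chart_adjoint k S g"
  define u where "u = (\<lambda>x. ?G \<kappa> x - ?G \<kappa>' (transition \<kappa> \<kappa>' x))"
  have su: "smooth_on (overlap \<kappa> \<kappa>') u" unfolding u_def
    by (rule smooth_on_diff[OF open_overlap[OF k] smooth_on_subset[OF chart_adjoint_smooth[OF S g k(1)] overlap_target]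
          smooth_on_compose[OF open_overlap[OF k] chart_adjoint_smooth[OF S g k(2)] smooth_transition[OF k] transition_into[OF k]]])
  have p: "pt \<kappa> x0 \<in> chart_dom \<kappa>" "pt \<kappa> x0 \<in> chart_dom \<kappa>'" "x0 \<in> target \<kappa>" using x0 k by (auto simp: overlap_iff)
  obtain \<phi> N K where \<phi>: "\<phi> \<in> Fun" "pt \<kappa> x0 \<in> N" "compactin T K" "K \<subseteq> chart_dom \<kappa> \<inter> chart_dom \<kappa>'"
    "\<And>\<kappa>' x. \<phi> \<kappa>' x \<ge> 0" "\<And>\<kappa>' x. \<kappa>' \<in> A \<Longrightarrow> x \<in> target \<kappa>' \<Longrightarrow> pt \<kappa>' x \<in> N \<Longrightarrow> \<phi> \<kappa>' x = 1"
    "\<And>\<kappa>' x. \<kappa>' \<in> A \<Longrightarrow> x \<in> target \<kappa>' \<Longrightarrow> \<phi> \<kappa>' x \<noteq> 0 \<Longrightarrow> pt \<kappa>' x \<in> K"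
    using exists_bump[OF k(1) p(1) openin_chart[OF k(2)] p(2)] by metis
  have inK: "x \<in> coord \<kappa> ` K" if "\<phi> \<kappa> x \<noteq> 0" for x
  proof -
    have "x \<in> target \<kappa>" using that densitiesD(3)[OF \<phi>(1)] by blast
    then show ?thesis using \<phi>(7)[OF k(1) _ that] by (metis coord_pt image_eqI)
  qed
  let ?C = "coord \<kappa> ` K" and ?C' = "coord \<kappa>' ` K"
  have C: "compact ?C" "?C \<subseteq> overlap \<kappa> \<kappa>'" "compact ?C'" "?C' \<subseteq> overlap \<kappa>' \<kappa>"
    using compact_coord_image[OF k(1) \<phi>(3)] compact_coord_image[OF k(2) \<phi>(3)] \<phi>(4) by (auto simp: overlap_def)
  have CT: "?C \<subseteq> target \<kappa>" "?C' \<subseteq> target \<kappa>'" using C overlap_target by blast+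
  \<comment> \<open>The test function is the bump times the discrepancy \<open>u\<close> itself,
    which makes the final integrand \<open>\<rho> \<phi> u\<^sup>2\<close> nonnegative.\<close>
  define \<sigma> where "\<sigma> = (\<lambda>x. if x \<in> overlap \<kappa> \<kappa>' then \<phi> \<kappa> x * u x else 0)"
  have \<sigma>C: "\<sigma> x = 0" if "x \<notin> ?C" for x using inK[of x] that by (auto simp: \<sigma>_def)
  have s\<sigma>: "smooth_on UNIV \<sigma>"
  proof (rule smooth_on_extend_zero[OF open_overlap[OF k] _ compact_imp_closed[OF C(1)] C(2) \<sigma>C])
    show "smooth_on (overlap \<kappa> \<kappa>') \<sigma>"
      by (rule smooth_on_cong[OF open_overlap[OF k] _ smooth_on_mult[OF open_overlap[OF k]
            smooth_on_subset[OF fun_smooth[OF \<phi>(1) k(1)] overlap_target] su]]) (simp add: \<sigma>_def)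
  qed
  define \<psi> where "\<psi> = fn (\<lambda>q. if q \<in> chart_dom \<kappa> then \<sigma> (coord \<kappa> q) else 0)"
  have \<psi>: "\<psi> \<in> Fun" unfolding \<psi>_def
    by (rule extend_fun[OF k(1) smooth_on_subset[OF s\<sigma>] C(1) CT(1) \<sigma>C]) auto
  have \<psi>\<kappa>: "\<psi> \<kappa> x = \<sigma> x" for x
    using \<sigma>C[of x] CT(1) k(1) by (cases "x \<in> target \<kappa>") (auto simp: \<psi>_def fn_def)
  have \<psi>K: "pt \<kappa>'' x \<in> K" if "\<kappa>'' \<in> A" "x \<in> target \<kappa>''" "\<psi> \<kappa>'' x \<noteq> 0" for \<kappa>'' x
  proof -
    have q: "pt \<kappa>'' x \<in> chart_dom \<kappa>" "\<sigma> (coord \<kappa> (pt \<kappa>'' x)) \<noteq> 0"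
      using that by (auto simp: \<psi>_def fn_def split: if_splits)
    then obtain q' where "q' \<in> K" "coord \<kappa> (pt \<kappa>'' x) = coord \<kappa> q'" using \<sigma>C by blast
    then show ?thesis using q(1) \<phi>(4) inj_coord[OF k(1)] by (metis Int_iff inj_onD subsetD)
  qed
  have \<psi>c: "cpt \<psi>" "supp T A \<psi> \<subseteq> K" using cptI[OF \<phi>(3) \<psi>K] by auto
  have E\<psi>: "E \<psi> \<in> Fun" "cpt (E \<psi>)" "supp T A (E \<psi>) \<subseteq> K"
    using DO_Fun[OF E \<psi>] DO_cpt[OF E \<psi> \<psi>c(1)] \<psi>c(2) by auto
  have d: "\<rho> * (E \<psi> * g) \<in> densities A 1" "cpt (\<rho> * (E \<psi> * g))" "supp T A (\<rho> * (E \<psi> * g)) \<subseteq> K"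
    using weighted_density[OF Fun_mult[OF E\<psi>(1) g]] cpt_mult(3,4)[OF cpt_mult(1)[OF E\<psi>(2)], of \<rho> g] cpt_mult(2)[OF E\<psi>(2), of g] E\<psi>(3)
    by blast+
  \<comment> \<open>One and the same integral of \<open>E \<psi> * g\<close> is computed in both
    charts; integrating by parts in each of them produces the two local adjoints.\<close>
  have A1: "integral UNIV (\<lambda>x. \<rho> \<kappa> x * (E \<psi> \<kappa> x * g \<kappa> x)) = integral UNIV (\<lambda>x. \<rho> \<kappa> x * (\<psi> \<kappa> x * ?G \<kappa> x))"
    using \<phi>(4) \<psi>c by (intro chart_adjoint_integral[OF S k(1) \<psi> _ _ g]) auto
  have A2: "integral UNIV (\<lambda>x. \<rho> \<kappa>' x * (E \<psi> \<kappa>' x * g \<kappa>' x)) = integral UNIV (\<lambda>x. \<rho> \<kappa>' x * (\<psi> \<kappa>' x * ?G \<kappa>' x))"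
    using \<phi>(4) \<psi>c by (intro chart_adjoint_integral[OF S k(2) \<psi> _ _ g]) auto
  have A3: "integral UNIV (\<lambda>x. \<rho> \<kappa> x * (E \<psi> \<kappa> x * g \<kappa> x)) = integral UNIV (\<lambda>x. \<rho> \<kappa>' x * (E \<psi> \<kappa>' x * g \<kappa>' x))"
    using chart_integral_change[OF k d(1,2) order_trans[OF d(3)] order_trans[OF d(3)]] \<phi>(4) by (simp add: times_fun_def)
  \<comment> \<open>The adjoint formula of \<open>\<kappa>'\<close>, cut off by
    \<open>\<psi>\<close>, is made a global function \<open>H\<close>; its integral can then be
    carried back to the chart \<open>\<kappa>\<close>.\<close>
  define \<tau> where "\<tau> = (\<lambda>y. \<psi> \<kappa>' y * ?G \<kappa>' y)"
  have \<tau>C: "\<tau> y = 0" if "y \<notin> ?C'" for y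
  proof (rule ccontr)
    assume "\<tau> y \<noteq> 0"
    then have "\<psi> \<kappa>' y \<noteq> 0" by (auto simp: \<tau>_def)
    then have "y \<in> target \<kappa>'" "pt \<kappa>' y \<in> K" using densitiesD(3)[OF \<psi>] \<psi>K[OF k(2)] by blast+
    then show False using that by (metis coord_pt image_eqI)
  qed
  define H where "H = fn (\<lambda>q. if q \<in> chart_dom \<kappa>' then \<tau> (coord \<kappa>' q) else 0)"
  have H: "H \<in> Fun" unfolding H_def
    by (rule extend_fun[OF k(2) _ C(3) CT(2) \<tau>C])
      (auto simp: \<tau>_def intro!: smooth_on_mult[OF open_target[OF k(2)]] fun_smooth[OF \<psi> k(2)] chart_adjoint_smooth[OF S g k(2)])
  have H\<kappa>': "H \<kappa>' y = \<tau> y" for y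
    using \<tau>C[of y] CT(2) k(2) by (cases "y \<in> target \<kappa>'") (auto simp: H_def fn_def)
  have HK: "pt \<kappa>'' x \<in> K" if "\<kappa>'' \<in> A" "x \<in> target \<kappa>''" "H \<kappa>'' x \<noteq> 0" for \<kappa>'' x
  proof -
    have q: "pt \<kappa>'' x \<in> chart_dom \<kappa>'" "\<tau> (coord \<kappa>' (pt \<kappa>'' x)) \<noteq> 0"
      using that by (auto simp: H_def fn_def split: if_splits)
    then obtain q' where "q' \<in> K" "coord \<kappa>' (pt \<kappa>'' x) = coord \<kappa>' q'" using \<tau>C by blast
    then show ?thesis using q(1) \<phi>(4) inj_coord[OF k(2)] by (metis Int_iff inj_onD subsetD)
  qed
  have Hc: "cpt H" "supp T A H \<subseteq> K" using cptI[OF \<phi>(3) HK] by auto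
  have dH: "\<rho> * H \<in> densities A 1" "cpt (\<rho> * H)" "supp T A (\<rho> * H) \<subseteq> K"
    using weighted_density[OF H] cpt_mult(3,4)[OF Hc(1), of \<rho>] Hc(2) by blast+
  have H\<kappa>: "H \<kappa> x = (if x \<in> overlap \<kappa> \<kappa>' then \<psi> \<kappa> x * ?G \<kappa>' (transition \<kappa> \<kappa>' x) else 0)" for x
  proof (cases "x \<in> overlap \<kappa> \<kappa>'")
    case True
    then show ?thesis using fun_transition[OF H k True] fun_transition[OF \<psi> k True] by (simp add: H\<kappa>' \<tau>_def)
  next
    case False
    have "H \<kappa> x = 0"
    proof (rule ccontr)
      assume "H \<kappa> x \<noteq> 0"
      then have "x \<in> target \<kappa>" "pt \<kappa> x \<in> K" using densitiesD(3)[OF H] HK[OF k(1)] by blast+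
      then show False using False \<phi>(4) k(1) by (auto simp: overlap_iff)
    qed
    then show ?thesis using False by simp
  qed
  have A4: "integral UNIV (\<lambda>x. \<rho> \<kappa>' x * (\<psi> \<kappa>' x * ?G \<kappa>' x)) = integral UNIV (\<lambda>x. \<rho> \<kappa> x * H \<kappa> x)"
    using chart_integral_change[OF k dH(1,2) order_trans[OF dH(3)] order_trans[OF dH(3)]] \<phi>(4) by (simp add: times_fun_def H\<kappa>' \<tau>_def)
  let ?h = "\<lambda>x. \<rho> \<kappa> x * (\<psi> \<kappa> x * u x)"
  have h: "?h x = \<rho> \<kappa> x * (\<psi> \<kappa> x * ?G \<kappa> x) - \<rho> \<kappa> x * H \<kappa> x" for x
    by (cases "x \<in> overlap \<kappa> \<kappa>'") (auto simp: H\<kappa> u_def right_diff_distrib \<psi>\<kappa> \<sigma>_def)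
  have s1: "smooth_on UNIV (\<lambda>x. \<rho> \<kappa> x * (\<psi> \<kappa> x * ?G \<kappa> x))"
  proof (rule smooth_on_extend_zero[OF open_target[OF k(1)] _ compact_imp_closed[OF C(1)] CT(1)])
    show "smooth_on (target \<kappa>) (\<lambda>x. \<rho> \<kappa> x * (\<psi> \<kappa> x * ?G \<kappa> x))"
      by (intro smooth_on_mult[OF open_target[OF k(1)]] rho_smooth k fun_smooth[OF \<psi>] chart_adjoint_smooth[OF S g])
  qed (simp add: \<psi>\<kappa> \<sigma>C)
  have s2: "smooth_on UNIV (\<lambda>x. \<rho> \<kappa> x * H \<kappa> x)"
  proof (rule smooth_on_extend_zero[OF open_target[OF k(1)] _ compact_imp_closed[OF C(1)] CT(1)])
    show "smooth_on (target \<kappa>) (\<lambda>x. \<rho> \<kappa> x * H \<kappa> x)"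
      by (intro smooth_on_mult[OF open_target[OF k(1)]] rho_smooth k fun_smooth[OF H])
  qed (simp add: H\<kappa> \<psi>\<kappa> \<sigma>C)
  have i1: "(\<lambda>x. \<rho> \<kappa> x * (\<psi> \<kappa> x * ?G \<kappa> x)) integrable_on UNIV"
    by (rule integrable_compact_support(2)[OF smooth_on_continuous[OF s1] compact_imp_bounded[OF C(1)]]) (simp add: \<psi>\<kappa> \<sigma>C)
  have i2: "(\<lambda>x. \<rho> \<kappa> x * H \<kappa> x) integrable_on UNIV"
    by (rule integrable_compact_support(2)[OF smooth_on_continuous[OF s2] compact_imp_bounded[OF C(1)]]) (simp add: H\<kappa> \<psi>\<kappa> \<sigma>C)
  \<comment> \<open>A continuous nonnegative function with integral zero vanishes, and at
    \<open>x0\<close> the bump is 1 and \<open>\<rho>\<close> is positive, so the discrepancy is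
    zero there.\<close>
  have "integral UNIV ?h = 0"
    unfolding h integral_diff[OF i1 i2] using A1 A2 A3 A4 by simp
  moreover have "continuous_on UNIV ?h"
    unfolding h by (rule smooth_on_continuous[OF smooth_on_diff[OF open_UNIV s1 s2]])
  moreover have "0 \<le> ?h x" for x
  proof (cases "x \<in> target \<kappa>")
    case True
    have "\<psi> \<kappa> x * u x \<ge> 0" using \<phi>(5)[of \<kappa> x] by (auto simp: \<psi>\<kappa> \<sigma>_def mult.assoc)
    then show ?thesis using rho_pos[OF k(1) True] by simp
  qed (simp add: densitiesD(3)[OF rho_density])
  moreover have "?h x = 0" if "x \<notin> ?C" for x using \<sigma>C[OF that] by (simp add: \<psi>\<kappa>)
  ultimately have "?h x0 = 0"
    using integral_0_imp_0[of ?h ?C x0] compact_imp_bounded[OF C(1)] by blast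
  moreover have "\<phi> \<kappa> x0 = 1" using \<phi>(6)[OF k(1) p(3) \<phi>(2)] .
  ultimately have "u x0 = 0" using rho_pos[OF k(1) p(3)] x0 by (auto simp: \<psi>\<kappa> \<sigma>_def)
  then show ?thesis by (simp add: u_def)
qed

lemma chart_adjoint_Fun:
  assumes "coeffs_of k E S" "E \<in> DO k" "g \<in> Fun"
  shows "chart_adjoint k S g \<in> Fun"
proof (rule funI)
  show "chart_adjoint k S g \<kappa> x = 0" if "\<kappa> \<notin> A \<or> x \<notin> target \<kappa>" for \<kappa> x
    using that by (auto simp: chart_adjoint_def)
qed (rule chart_adjoint_smooth[OF assms(1,3)] chart_adjoint_transition[OF assms]; assumption)+

lemma mult_sum_list: "(\<Sum>c\<leftarrow>cs. h c * f) = (\<Sum>c\<leftarrow>cs. h c) * (f :: ('a, 'd) density)"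
  by (rule sum_list_mult_const)

lemma DO_linear_sum_map:
  assumes "E \<in> DO k" "\<And>c. c \<in> set cs \<Longrightarrow> h c \<in> Fun"
  shows "E (\<Sum>c\<leftarrow>cs. h c) = (\<Sum>c\<leftarrow>cs. E (h c))"
proof -
  have "\<forall>f\<in>set (map h cs). f \<in> Fun" using assms(2) unfolding set_map by blast
  then have "E (sum_list (map h cs)) = sum_list (map E (map h cs))"
    using DO_linear_sum_list[OF assms(1)] by blast
  then show ?thesis by (simp add: o_def)
qed

lemma density_integral_sum_map:
  assumes "\<And>c. c \<in> set cs \<Longrightarrow> h c \<in> densities A 1 \<and> cpt (h c)"
  shows "density_integral T A (\<Sum>c\<leftarrow>cs. h c) = (\<Sum>c\<leftarrow>cs. density_integral T A (h c))"
proof -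
  have "\<forall>f\<in>set (map h cs). f \<in> densities A 1 \<and> cpt f" using assms unfolding set_map by blast
  then have "density_integral T A (sum_list (map h cs)) = sum_list (map (density_integral T A) (map h cs))"
    using density_integral_sum_list by blast
  then show ?thesis by (simp add: o_def)
qed

text \<open>The order bounds are checked chart by chart. \<open>chart_adjoint_integral\<close> asks
  for a function supported in a single chart, so a partition of unity on the support of
  \<open>f\<close> reduces the global adjoint relation to it.\<close>

lemma chart_adjoint_props:
  assumes E: "E \<in> DO (Suc n)" and S: "coeffs_of (Suc n) E S"
  shows "chart_adjoint (Suc n) S \<in> DO (Suc n)" "adjrel E (chart_adjoint (Suc n) S)"
    "(\<lambda>f. E f - scale_density ((-1) ^ n) (chart_adjoint (Suc n) S f)) \<in> DO n"
proof -
  let ?E' = "chart_adjoint (Suc n) S"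
  show 1: "?E' \<in> DO (Suc n)"
  proof (rule DO_I)
    fix \<kappa> assume k: "\<kappa> \<in> A"
    have "ldo (target \<kappa>) (Suc n) (ladj (\<rho> \<kappa>) (Suc n) (S \<kappa>))"
      by (rule ladj_ldo[OF open_target rho_smooth rho_pos coeffs_smooth[OF S]]; (rule k | assumption))
    then show "\<exists>L. ldo (target \<kappa>) (Suc n) L \<and> (\<forall>f\<in>Fun. \<forall>x\<in>target \<kappa>. ?E' f \<kappa> x = L (f \<kappa>) x)"
      by (intro exI[of _ "ladj (\<rho> \<kappa>) (Suc n) (S \<kappa>)"] conjI) (simp_all add: chart_adjoint_def k)
  qed (rule chart_adjoint_Fun[OF S E])
  show "(\<lambda>f. E f - scale_density ((-1) ^ n) (?E' f)) \<in> DO n"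
  proof (rule DO_I)
    fix \<kappa> assume k: "\<kappa> \<in> A"
    obtain L where L: "ldo_rep (target \<kappa>) (Suc n) L (S \<kappa>)" "\<forall>f\<in>Fun. \<forall>x\<in>target \<kappa>. E f \<kappa> x = L (f \<kappa>) x"
      using S k unfolding coeffs_of_def by blast
    have "ldo (target \<kappa>) n (\<lambda>f x. L f x - (-1) ^ n * ladj (\<rho> \<kappa>) (Suc n) (S \<kappa>) f x)"
      by (rule ladj_symbol[OF open_target rho_smooth rho_pos L(1)]; (rule k | assumption))
    then show "\<exists>L. ldo (target \<kappa>) n L \<and> (\<forall>f\<in>Fun. \<forall>x\<in>target \<kappa>. (E f - scale_density ((-1) ^ n) (?E' f)) \<kappa> x = L (f \<kappa>) x)"
      by (intro exI[of _ "\<lambda>f x. L f x - (-1) ^ n * ladj (\<rho> \<kappa>) (Suc n) (S \<kappa>) f x"] conjI)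
        (simp_all add: chart_adjoint_def scale_density_def k L(2))
  qed (intro Fun_diff Fun_scale DO_Fun[OF E] DO_Fun[OF 1])
  have "density_integral T A (\<rho> * (E f * g)) = density_integral T A (\<rho> * (f * ?E' g))"
    if f: "f \<in> Fun" "cpt f" and g: "g \<in> Fun" for f g
  proof -
    obtain cs where cs: "\<forall>c\<in>set cs. chart_cut c"
      "\<And>\<kappa> x. \<kappa> \<in> A \<Longrightarrow> x \<in> target \<kappa> \<Longrightarrow> pt \<kappa> x \<in> supp T A f \<Longrightarrow> (\<Sum>c\<leftarrow>cs. snd c \<kappa> x) = 1"
      using partition_of_unity f(2) unfolding cpt_def by blast
    have f_sum: "f = (\<Sum>c\<leftarrow>cs. snd c * f)"
    proof (intro ext)
      fix \<kappa> x
      show "f \<kappa> x = (\<Sum>c\<leftarrow>cs. snd c * f) \<kappa> x"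
      proof (cases "f \<kappa> x = 0")
        case False
        then have k: "\<kappa> \<in> A" "x \<in> target \<kappa>" using density_zero[OF f(1)] by blast+
        then show ?thesis using cs(2)[OF k suppI[of \<kappa> x f, OF k False]] by (simp add: mult_sum_list o_def)
      qed (simp add: mult_sum_list)
    qed
    have cf: "snd c * f \<in> Fun" "cpt (snd c * f)" "supp T A (snd c * f) \<subseteq> chart_dom (fst c)" "fst c \<in> A" if "c \<in> set cs" for c
      using cs(1) that Fun_mult[of "snd c" f] f(1) cpt_mult(1,2)[of "snd c" f] unfolding chart_cut_def by blast+
    have p1: "\<rho> * (E h * g) \<in> densities A 1 \<and> cpt (\<rho> * (E h * g)) \<and> supp T A (\<rho> * (E h * g)) \<subseteq> supp T A h"
      if "h \<in> Fun" "cpt h" for h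
      using weighted_density[OF Fun_mult[OF DO_Fun[OF E that(1)] g]] DO_cpt[OF E that] cpt_mult(1,2)[of "E h" g] cpt_mult(3,4)[of "E h * g" \<rho>]
      by blast
    have p2: "\<rho> * (h * ?E' g) \<in> densities A 1 \<and> cpt (\<rho> * (h * ?E' g)) \<and> supp T A (\<rho> * (h * ?E' g)) \<subseteq> supp T A h"
      if "h \<in> Fun" "cpt h" for h
      using weighted_density[OF Fun_mult[OF that(1) DO_Fun[OF 1 g]]] that(2) cpt_mult(1,2)[of h "?E' g"] cpt_mult(3,4)[of "h * ?E' g" \<rho>]
      by blast
    have "E f = (\<Sum>c\<leftarrow>cs. E (snd c * f))"
      using DO_linear_sum_map[OF E, of cs "\<lambda>c. snd c * f"] cf(1) f_sum by metis
    then have "\<rho> * (E f * g) = (\<Sum>c\<leftarrow>cs. \<rho> * (E (snd c * f) * g))"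
      by (simp add: mult_sum_list sum_list_const_mult)
    then have "density_integral T A (\<rho> * (E f * g)) = (\<Sum>c\<leftarrow>cs. density_integral T A (\<rho> * (E (snd c * f) * g)))"
      using density_integral_sum_map[of cs "\<lambda>c. \<rho> * (E (snd c * f) * g)"] p1 cf(1,2) by metis
    also have "\<dots> = (\<Sum>c\<leftarrow>cs. density_integral T A (\<rho> * (snd c * f * ?E' g)))"
    proof (intro arg_cong[where f = sum_list] map_cong refl)
      fix c assume c: "c \<in> set cs"
      note cf = cf[OF c]
      have a: "density_integral T A (\<rho> * (E (snd c * f) * g)) = integral UNIV ((\<rho> * (E (snd c * f) * g)) (fst c))"
        using p1[OF cf(1,2)] cf(3) by (intro density_integral_chart[OF cf(4)]) auto
      have b: "density_integral T A (\<rho> * (snd c * f * ?E' g)) = integral UNIV ((\<rho> * (snd c * f * ?E' g)) (fst c))"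
        using p2[OF cf(1,2)] cf(3) by (intro density_integral_chart[OF cf(4)]) auto
      show "density_integral T A (\<rho> * (E (snd c * f) * g)) = density_integral T A (\<rho> * (snd c * f * ?E' g))"
        unfolding a b using chart_adjoint_integral[OF S cf(4,1,2,3) g] by (simp add: times_fun_def)
    qed
    also have "\<dots> = density_integral T A (\<Sum>c\<leftarrow>cs. \<rho> * (snd c * f * ?E' g))"
      using density_integral_sum_map[of cs "\<lambda>c. \<rho> * (snd c * f * ?E' g)"] p2 cf(1,2) by metis
    also have "(\<Sum>c\<leftarrow>cs. \<rho> * (snd c * f * ?E' g)) = \<rho> * ((\<Sum>c\<leftarrow>cs. snd c * f) * ?E' g)"
      by (simp only: mult_sum_list sum_list_const_mult)
    also have "(\<Sum>c\<leftarrow>cs. snd c * f) = f" by (rule f_sum[symmetric])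
    finally show ?thesis .
  qed
  then show "adjrel E ?E'" unfolding adjrel_def by blast
qed

theorem exists_adjoint:
  assumes "E \<in> DO (Suc n)"
  obtains E' where "E' \<in> DO (Suc n)" "adjrel E E'" "(\<lambda>f. E f - scale_density ((-1) ^ n) (E' f)) \<in> DO n"
  using exists_coeffs[OF assms] chart_adjoint_props[OF assms] by blast

text \<open>Near a point, \<open>g\<close> is replaced by the compactly supported
  \<open>h = \<phi> * g\<close> with the same germ. Testing with \<open>\<phi>\<close> times the
  difference \<open>u\<close> of the two images of \<open>h\<close> gives a vanishing integral of
  \<open>\<rho> \<phi> u\<^sup>2\<close>. Different order bounds are allowed because nothing is
  known beforehand about the order of an adjoint obtained by choice.\<close>

lemma adjrel_unique:
  assumes adj: "adjrel E E'" "adjrel E E''" and E: "E' \<in> DO k" "E'' \<in> DO m" and g: "g \<in> Fun"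
  shows "E' g = E'' g"
proof (rule DO_eqI[OF DO_Fun[OF E(1) g] DO_Fun[OF E(2) g]])
  fix \<kappa> x0 assume k: "\<kappa> \<in> A" "x0 \<in> target \<kappa>"
  have p: "pt \<kappa> x0 \<in> chart_dom \<kappa>" using k by simp
  obtain \<phi> N K where \<phi>: "\<phi> \<in> Fun" "openin T N" "pt \<kappa> x0 \<in> N" "compactin T K" "K \<subseteq> chart_dom \<kappa> \<inter> chart_dom \<kappa>"
    "\<And>\<kappa>' x. \<phi> \<kappa>' x \<ge> 0" "\<And>\<kappa>' x. \<kappa>' \<in> A \<Longrightarrow> x \<in> target \<kappa>' \<Longrightarrow> pt \<kappa>' x \<in> N \<Longrightarrow> \<phi> \<kappa>' x = 1"
    "\<And>\<kappa>' x. \<kappa>' \<in> A \<Longrightarrow> x \<in> target \<kappa>' \<Longrightarrow> \<phi> \<kappa>' x \<noteq> 0 \<Longrightarrow> pt \<kappa>' x \<in> K"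
    using exists_bump[OF k(1) p openin_chart[OF k(1)] p] by metis
  have \<phi>c: "cpt \<phi>" "supp T A \<phi> \<subseteq> K" using cptI[OF \<phi>(4,8)] by auto
  define h where "h = \<phi> * g"
  have h: "h \<in> Fun" "cpt h" using Fun_mult[OF \<phi>(1) g] cpt_mult(1)[OF \<phi>c(1)] by (simp_all add: h_def)
  let ?V = "coord \<kappa> ` (chart_dom \<kappa> \<inter> N)"
  have V: "open ?V" "?V \<subseteq> target \<kappa>" "x0 \<in> ?V"
  proof -
    show "open ?V" by (rule open_coord_image[OF k(1) \<phi>(2)])
    show "?V \<subseteq> target \<kappa>" by (auto simp: target_def)
    have "coord \<kappa> (pt \<kappa> x0) \<in> ?V" using p \<phi>(3) by blast
    then show "x0 \<in> ?V" using k(2) by simp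
  qed
  have hg: "h \<kappa> y = g \<kappa> y" if "y \<in> ?V" for y
    using that \<phi>(7)[OF k(1), of y] k(1) by (auto simp: h_def)
  define u where "u = E' h - E'' h"
  have u: "u \<in> Fun" unfolding u_def by (intro Fun_diff DO_Fun[OF E(1)] DO_Fun[OF E(2)] h)
  define f where "f = \<phi> * u"
  have f: "f \<in> Fun" "cpt f" using Fun_mult[OF \<phi>(1) u] cpt_mult(1)[OF \<phi>c(1)] by (simp_all add: f_def)
  have fu: "cpt (f * v)" "supp T A (f * v) \<subseteq> K" for v
    using cpt_mult(1,2)[OF f(2), of v] cpt_mult(2)[OF \<phi>c(1), of u] \<phi>c(2) by (auto simp: f_def)
  have w: "\<rho> * (f * v) \<in> densities A 1" "cpt (\<rho> * (f * v))" "supp T A (\<rho> * (f * v)) \<subseteq> K" if "v \<in> Fun" for v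
    using weighted_density[OF Fun_mult[OF f(1) that]] cpt_mult(3,4)[OF fu(1), of \<rho> v] fu(2)[of v] by blast+
  have "density_integral T A (\<rho> * (f * E' h)) = density_integral T A (\<rho> * (f * E'' h))"
    using adj f h unfolding adjrel_def by metis
  moreover have "\<rho> * (f * E' h) = \<rho> * (f * u) + \<rho> * (f * E'' h)" by (simp add: u_def algebra_simps)
  ultimately have "density_integral T A (\<rho> * (f * u)) = 0"
    using density_integral_add[OF w(1,2)[OF u] w(1,2)[OF DO_Fun[OF E(2) h(1)]]] by simp
  then have int0: "integral UNIV ((\<rho> * (f * u)) \<kappa>) = 0"
    using density_integral_chart[OF k(1) w(1,2)[OF u]] w(3)[OF u] \<phi>(5) by auto
  have sub: "supp T A (\<rho> * (f * u)) \<subseteq> chart_dom \<kappa>" using w(3)[OF u] \<phi>(5) by blast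
  obtain C where C: "compact C" "\<And>x. x \<notin> C \<Longrightarrow> (\<rho> * (f * u)) \<kappa> x = 0"
    using chart_support[OF k(1) w(1,2)[OF u] sub] by metis
  have "(\<rho> * (f * u)) \<kappa> x0 = 0"
  proof (rule integral_0_imp_0[OF smooth_on_continuous[OF piece_smooth_UNIV(1)[OF k(1) w(1,2)[OF u] sub]] _ compact_imp_bounded[OF C(1)] C(2) int0])
    show "0 \<le> (\<rho> * (f * u)) \<kappa> x" for x
    proof (cases "x \<in> target \<kappa>")
      case True
      have "0 \<le> \<phi> \<kappa> x * (u \<kappa> x * u \<kappa> x)" using \<phi>(6) by simp
      then show ?thesis using rho_pos[OF k(1) True] by (simp add: f_def mult.assoc)
    qed (simp add: densitiesD(3)[OF rho_density])
  qed
  then have "u \<kappa> x0 = 0"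
    using rho_pos[OF k] \<phi>(7)[OF k \<phi>(3)] by (simp add: f_def)
  then show "E' g \<kappa> x0 = E'' g \<kappa> x0"
    using DO_germ[OF E(1) h(1) g k(1) V hg] DO_germ[OF E(2) h(1) g k(1) V hg] by (simp add: u_def)
qed

section \<open>Algebra of the adjoint relation\<close>

lemma adjrel_sym:
  assumes "adjrel E E'" shows "adjrel E' E"
  using assms unfolding adjrel_def by (metis mult.commute)

lemma adjrel_comp:
  assumes "adjrel E E'" "adjrel F F'" "E \<in> DO k" "E' \<in> DO k'" "F \<in> DO m" "F' \<in> DO m'"
  shows "adjrel (\<lambda>f. E (F f)) (\<lambda>f. F' (E' f))"
  unfolding adjrel_def
proof (intro ballI impI)
  fix f g assume *: "f \<in> Fun" "g \<in> Fun" "cpt f" "cpt g"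
  have "density_integral T A (\<rho> * (E (F f) * g)) = density_integral T A (\<rho> * (F f * E' g))"
    using assms(1) * DO_Fun[OF assms(5)] DO_cpt[OF assms(5)] unfolding adjrel_def by blast
  also have "\<dots> = density_integral T A (\<rho> * (f * F' (E' g)))"
    using assms(2) * DO_Fun[OF assms(4)] DO_cpt[OF assms(4)] unfolding adjrel_def by blast
  finally show "density_integral T A (\<rho> * (E (F f) * g)) = density_integral T A (\<rho> * (f * F' (E' g)))" .
qed

lemma weighted_cpt:
  assumes "f \<in> Fun" "cpt f" shows "\<rho> * f \<in> densities A 1" "cpt (\<rho> * f)"
  using weighted_density[OF assms(1)] cpt_mult(3)[OF assms(2)] by auto

lemma adjrel_add:
  assumes "adjrel E E'" "adjrel F F'" "E \<in> DO k" "E' \<in> DO k'" "F \<in> DO m" "F' \<in> DO m'"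
  shows "adjrel (\<lambda>f. E f + F f) (\<lambda>f. E' f + F' f)"
  unfolding adjrel_def
proof (intro ballI impI)
  fix f g assume *: "f \<in> Fun" "g \<in> Fun" "cpt f" "cpt g"
  have 1: "cpt (G h * v)" "G h * v \<in> Fun" if "G \<in> DO q" "h \<in> Fun" "cpt h" "v \<in> Fun" for G q h v
    using cpt_mult(1)[OF DO_cpt(1)[OF that(1-3)], of v] Fun_mult[OF DO_Fun[OF that(1,2)] that(4)] by auto
  have "density_integral T A (\<rho> * (E f * g) + \<rho> * (F f * g)) = density_integral T A (\<rho> * (f * E' g) + \<rho> * (f * F' g))"
    using assms(1,2) * density_integral_add[OF weighted_cpt[OF 1(2,1)[OF assms(3) *(1,3,2)]] weighted_cpt[OF 1(2,1)[OF assms(5) *(1,3,2)]]]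
      density_integral_add[OF weighted_cpt[OF 1(2,1)[OF assms(4) *(2,4,1)]] weighted_cpt[OF 1(2,1)[OF assms(6) *(2,4,1)]]]
    unfolding adjrel_def by (simp add: mult.commute[of f])
  then show "density_integral T A (\<rho> * ((E f + F f) * g)) = density_integral T A (\<rho> * (f * (E' g + F' g)))"
    by (simp add: distrib_left distrib_right)
qed

lemma density_integral_scale:
  assumes "f \<in> Fun" "cpt f"
  shows "density_integral T A (\<rho> * scale_density c f) = c * density_integral T A (\<rho> * f)"
proof -
  obtain es where es: "\<forall>e\<in>set es. chart_piece e" "\<rho> * f = (\<Sum>e\<leftarrow>es. snd e)"
    using exists_pieces[OF weighted_cpt[OF assms]] by blast
  have sc: "cpt (scale_density c s)" "supp T A (scale_density c s) \<subseteq> supp T A s" if "cpt s" for s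
  proof -
    have z: "scale_density c s \<kappa> x = 0" if "\<kappa> \<in> A" "x \<in> target \<kappa>" "pt \<kappa> x \<notin> supp T A s" for \<kappa> x
      using suppI[of \<kappa> x s] that by (auto simp: scale_density_def)
    show "cpt (scale_density c s)" "supp T A (scale_density c s) \<subseteq> supp T A s"
      by (rule cpt_smaller[OF that z]; assumption)+
  qed
  let ?ds = "map (\<lambda>e. (fst e, scale_density c (snd e))) es"
  have "\<forall>e\<in>set ?ds. chart_piece e"
  proof
    fix e assume "e \<in> set ?ds"
    then obtain e' where e': "e' \<in> set es" "e = (fst e', scale_density c (snd e'))" by auto
    then show "chart_piece e" using es(1) sc[of "snd e'"] scale_density_in[of "snd e'" 1 c] unfolding chart_piece_def by auto
  qed
  moreover have "\<rho> * scale_density c f = (\<Sum>e\<leftarrow>?ds. snd e)"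
  proof -
    have "\<rho> * scale_density c f = scale_density c (\<rho> * f)" by (simp add: scale_density_def fun_eq_iff)
    also have "\<dots> = scale_density c (\<Sum>e\<leftarrow>es. snd e)" by (simp only: es(2))
    also have "\<dots> = (\<Sum>e\<leftarrow>es. scale_density c (snd e))"
      by (simp add: scale_density_def fun_eq_iff sum_list_const_mult o_def)
    finally show ?thesis by (simp add: o_def)
  qed
  ultimately have "density_integral T A (\<rho> * scale_density c f) = (\<Sum>e\<leftarrow>?ds. chart_integral e)"
    by (rule density_integral_eq)
  also have "\<dots> = c * (\<Sum>e\<leftarrow>es. chart_integral e)"
    by (simp add: chart_integral_def scale_density_def o_def sum_list_const_mult)
  finally show ?thesis using density_integral_eq[OF es] by simp
qed

lemma adjrel_scale:
  assumes "adjrel E E'" "E \<in> DO k" "E' \<in> DO k'"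
  shows "adjrel (\<lambda>f. scale_density c (E f)) (\<lambda>f. scale_density c (E' f))"
  unfolding adjrel_def
proof (intro ballI impI)
  fix f g assume *: "f \<in> Fun" "g \<in> Fun" "cpt f" "cpt g"
  have 1: "cpt (G h * v)" "G h * v \<in> Fun" if "G \<in> DO q" "h \<in> Fun" "cpt h" "v \<in> Fun" for G q h v
    using cpt_mult(1)[OF DO_cpt(1)[OF that(1-3)], of v] Fun_mult[OF DO_Fun[OF that(1,2)] that(4)] by auto
  have m: "scale_density c s * t = scale_density c (s * t)" for s t :: "('a, 'd) density"
    by (simp add: scale_density_def fun_eq_iff)
  have "density_integral T A (\<rho> * (scale_density c (E f) * g)) = c * density_integral T A (\<rho> * (E f * g))"
    unfolding m by (rule density_integral_scale[OF 1(2,1)[OF assms(2) *(1,3,2)]])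
  also have "\<dots> = c * density_integral T A (\<rho> * (E' g * f))"
    using assms(1) * unfolding adjrel_def by (simp add: mult.commute[of f])
  also have "\<dots> = density_integral T A (\<rho> * (scale_density c (E' g) * f))"
    unfolding m by (rule density_integral_scale[OF 1(2,1)[OF assms(3) *(2,4,1)], symmetric])
  finally show "density_integral T A (\<rho> * (scale_density c (E f) * g)) = density_integral T A (\<rho> * (f * scale_density c (E' g)))"
    by (simp add: mult.commute[of f])
qed

lemma adjrel_multop: "adjrel (\<lambda>f. h * f) (\<lambda>f. h * f)"
  unfolding adjrel_def by (simp add: mult.left_commute mult.assoc)

lemma adjrel_cong:
  assumes "adjrel E E'" "\<And>f. f \<in> Fun \<Longrightarrow> F f = E f" "\<And>f. f \<in> Fun \<Longrightarrow> F' f = E' f"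
  shows "adjrel F F'"
  using assms unfolding adjrel_def by simp

section \<open>Vector fields, divergence and Lie derivatives\<close>

abbreviation vder :: "('a, 'd) vfield \<Rightarrow> ('a, 'd) density \<Rightarrow> ('a, 'd) density" where
  "vder K \<equiv> lie_density A K 0"

lemma field_smooth: "K \<in> vector_fields A \<Longrightarrow> \<kappa> \<in> A \<Longrightarrow> smooth_on (target \<kappa>) (K \<kappa>)"
  by (simp add: vector_fields_def)

lemma field_transition:
  "K \<in> vector_fields A \<Longrightarrow> \<kappa> \<in> A \<Longrightarrow> \<kappa>' \<in> A \<Longrightarrow> x \<in> overlap \<kappa> \<kappa>' \<Longrightarrow>
    K \<kappa>' (transition \<kappa> \<kappa>' x) = frechet_derivative (transition \<kappa> \<kappa>') (at x) (K \<kappa> x)"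
  by (simp add: vector_fields_def)

lemma vder_chart:
  "\<kappa> \<in> A \<Longrightarrow> x \<in> target \<kappa> \<Longrightarrow> vder K f \<kappa> x = (\<Sum>i\<in>UNIV. K \<kappa> x $ i * partial i (f \<kappa>) x)"
  by (simp add: lie_density_def)

lemma vder_frechet:
  assumes "f \<in> Fun" "\<kappa> \<in> A" "x \<in> target \<kappa>"
  shows "vder K f \<kappa> x = frechet_derivative (f \<kappa>) (at x) (K \<kappa> x)"
  using frechet_derivative_partial[OF smooth_on_differentiable[OF fun_smooth[OF assms(1,2)] assms(3)]] assms
  by (simp add: vder_chart)

lemma vder_local:
  assumes "K \<in> vector_fields A" "\<kappa> \<in> A"
  shows "ldo (target \<kappa>) 2 (\<lambda>f x. \<Sum>i\<in>UNIV. K \<kappa> x $ i * partial i f x)"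
  by (rule ldo_field[OF open_target[OF assms(2)] field_smooth[OF assms]])

lemma vder_Fun:
  assumes K: "K \<in> vector_fields A" and f: "f \<in> Fun" shows "vder K f \<in> Fun"
proof (rule funI)
  fix \<kappa> assume k: "\<kappa> \<in> A"
  show "smooth_on (target \<kappa>) (vder K f \<kappa>)"
    by (rule smooth_on_cong[OF open_target[OF k] _ ldo_smooth[OF open_target[OF k] vder_local[OF K k] fun_smooth[OF f k]]])
      (simp add: vder_chart k)
next
  fix \<kappa> \<kappa>' x assume k: "\<kappa> \<in> A" "\<kappa>' \<in> A" and x: "x \<in> overlap \<kappa> \<kappa>'"
  note y = transition_overlap[OF k x]
  have xt: "x \<in> target \<kappa>" using x overlap_target by blast
  have "((\<lambda>z. f \<kappa>' (transition \<kappa> \<kappa>' z)) has_derivative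
      (\<lambda>v. frechet_derivative (f \<kappa>') (at (transition \<kappa> \<kappa>' x)) (frechet_derivative (transition \<kappa> \<kappa>') (at x) v))) (at x)"
    using has_derivative_compose[OF has_derivative_transition[OF k x], of "f \<kappa>'"]
      smooth_on_differentiable[OF fun_smooth[OF f k(2)] y(4)] by (simp add: frechet_derivative_works)
  then have "(f \<kappa> has_derivative
      (\<lambda>v. frechet_derivative (f \<kappa>') (at (transition \<kappa> \<kappa>' x)) (frechet_derivative (transition \<kappa> \<kappa>') (at x) v))) (at x)"
    by (rule has_derivative_transform_within_open[OF _ open_overlap[OF k] x]) (simp add: fun_transition[OF f k])
  from frechet_derivative_at[OF this]
  show "vder K f \<kappa> x = vder K f \<kappa>' (transition \<kappa> \<kappa>' x)"
    unfolding vder_frechet[OF f k(1) xt] vder_frechet[OF f k(2) y(4)] field_transition[OF K k x] by metis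
next
  show "vder K f \<kappa> x = 0" if "\<kappa> \<notin> A \<or> x \<notin> target \<kappa>" for \<kappa> x
    using that by (auto simp: lie_density_def)
qed

lemma vder_DO: "K \<in> vector_fields A \<Longrightarrow> vder K \<in> DO 2"
proof (rule DO_I)
  fix \<kappa> assume "K \<in> vector_fields A" "\<kappa> \<in> A"
  from vder_local[OF this]
  show "\<exists>L. ldo (target \<kappa>) 2 L \<and> (\<forall>f\<in>Fun. \<forall>x\<in>target \<kappa>. vder K f \<kappa> x = L (f \<kappa>) x)"
    by (intro exI[of _ "\<lambda>f x. \<Sum>i\<in>UNIV. K \<kappa> x $ i * partial i f x"] conjI) (simp_all add: vder_chart \<open>\<kappa> \<in> A\<close>)
qed (rule vder_Fun)

lemma DO_commutator_vder:
  assumes E: "E \<in> DO k" and K: "K \<in> vector_fields A"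
  shows "(\<lambda>f. vder K (E f) - E (vder K f)) \<in> DO k"
proof (rule DO_I)
  fix \<kappa> assume k: "\<kappa> \<in> A"
  let ?V = "\<lambda>f x. \<Sum>i\<in>UNIV. K \<kappa> x $ i * partial i f x"
  obtain L where L: "ldo (target \<kappa>) k L" "\<forall>f\<in>Fun. \<forall>x\<in>target \<kappa>. E f \<kappa> x = L (f \<kappa>) x"
    using DO_local[OF E k] by blast
  show "\<exists>L. ldo (target \<kappa>) k L \<and> (\<forall>f\<in>Fun. \<forall>x\<in>target \<kappa>. (vder K (E f) - E (vder K f)) \<kappa> x = L (f \<kappa>) x)"
  proof (intro exI conjI ballI)
    show "ldo (target \<kappa>) k (\<lambda>f x. ?V (L f) x - L (?V f) x)"
      by (rule ldo_commutator_field[OF open_target[OF k] L(1) field_smooth[OF K k]])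
    fix f x assume f: "f \<in> Fun" and x: "x \<in> target \<kappa>"
    have "E (vder K f) \<kappa> x = L (vder K f \<kappa>) x" using L(2) vder_Fun[OF K f] x by blast
    also have "\<dots> = L (?V (f \<kappa>)) x"
      by (rule ldo_linear(3)[OF open_target[OF k] L(1) fun_smooth[OF vder_Fun[OF K f] k] x
            ldo_smooth[OF open_target[OF k] vder_local[OF K k] fun_smooth[OF f k]]]) (simp add: vder_chart k)
    finally have 1: "E (vder K f) \<kappa> x = L (?V (f \<kappa>)) x" .
    have "partial i (E f \<kappa>) x = partial i (L (f \<kappa>)) x" for i
      by (rule partial_cong_open[OF open_target[OF k] x]) (use L(2) f in blast)
    then show "(vder K (E f) - E (vder K f)) \<kappa> x = ?V (L (f \<kappa>)) x - L (?V (f \<kappa>)) x"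
      using 1 by (simp add: vder_chart[OF k x])
  qed
qed (intro Fun_diff vder_Fun[OF K] DO_Fun[OF E])

lemma vder_mult:
  assumes "K \<in> vector_fields A" "f \<in> Fun" "g \<in> Fun"
  shows "vder K (f * g) = vder K f * g + f * vder K g"
proof (rule DO_eqI[of "\<lambda>f. vder K (f * g)" f "\<lambda>f. vder K f * g + f * vder K g"])
  fix \<kappa> x assume k: "\<kappa> \<in> A" "x \<in> target \<kappa>"
  have "partial i ((f * g) \<kappa>) x = f \<kappa> x * partial i (g \<kappa>) x + partial i (f \<kappa>) x * g \<kappa> x" for i
    unfolding mult_app
    by (rule partial_mult[OF smooth_on_differentiable[OF fun_smooth[OF assms(2) k(1)] k(2)]
          smooth_on_differentiable[OF fun_smooth[OF assms(3) k(1)] k(2)]])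
  then show "vder K (f * g) \<kappa> x = (vder K f * g + f * vder K g) \<kappa> x"
    unfolding plus_fun_apply times_fun_apply[of "vder K f" g] times_fun_apply[of f "vder K g"] vder_chart[OF k]
    by (simp add: vder_chart[OF k] distrib_left sum.distrib sum_distrib_left sum_distrib_right mult.assoc mult.left_commute)
qed (intro Fun_add Fun_mult vder_Fun assms)+

text \<open>The divergence with respect to \<open>\<rho>\<close>; it vanishes for the fields in
  \<open>sdiff\<close>.\<close>

definition vdiv :: "('a, 'd) vfield \<Rightarrow> ('a, 'd) density" where
  "vdiv K = density_powr \<rho> (-1) * lie_density A K 1 \<rho>"

lemma vdiv_chart:
  assumes "\<kappa> \<in> A" "x \<in> target \<kappa>"
  shows "vdiv K \<kappa> x = inverse (\<rho> \<kappa> x) * ((\<Sum>i\<in>UNIV. K \<kappa> x $ i * partial i (\<rho> \<kappa>) x)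
    + (\<Sum>i\<in>UNIV. partial i (\<lambda>y. K \<kappa> y $ i) x) * \<rho> \<kappa> x)"
  using assms rho_pos[OF assms] by (simp add: vdiv_def lie_density_def density_powr_def powr_minus)

lemma lists_less_2: "{I :: 'd list. length I < 2} = insert [] (range (\<lambda>i. [i]))"
  by (auto simp: less_2_cases_iff length_Suc_conv)

text \<open>Applied to the coefficients of \<open>K\<close>, the adjoint formula gives minus
  \<open>K\<close> minus the divergence. Its value at the constant 1 is minus the divergence, and
  this is how the divergence is seen to be smooth and independent of the chart.\<close>

lemma vder_adjoint:
  assumes K: "K \<in> vector_fields A"
  shows "vdiv K \<in> Fun" "adjrel (vder K) (\<lambda>f. - vder K f - vdiv K * f)"
proof -
  \<comment> \<open>The field as an operator of first order: only lists of length one carry a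
    coefficient.\<close>
  define S :: "('a, 'd) chart \<Rightarrow> 'd list \<Rightarrow> real^'d \<Rightarrow> real" where
    "S = (\<lambda>\<kappa> I x. case I of [i] \<Rightarrow> K \<kappa> x $ i | _ \<Rightarrow> 0)"
  have sumS: "(\<Sum>I | length I < Suc 1. h I) = h [] + (\<Sum>i\<in>UNIV. h [i])" for h :: "'d list \<Rightarrow> real"
  proof -
    have "(\<Sum>I | length I < Suc 1. h I) = (\<Sum>I\<in>insert [] (range (\<lambda>i. [i])). h I)"
      using lists_less_2 by (simp add: numeral_2_eq_2)
    also have "\<dots> = h [] + (\<Sum>i\<in>UNIV. h [i])"
      by (subst sum.insert) (auto simp: sum.reindex inj_on_def)
    finally show ?thesis .
  qed
  have co: "coeffs_of (Suc 1) (vder K) S"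
    unfolding coeffs_of_def
  proof
    fix \<kappa> assume k: "\<kappa> \<in> A"
    have sm: "smooth_on (target \<kappa>) (S \<kappa> I)" for I
      using smooth_on_nth[OF open_target[OF k] field_smooth[OF K k]]
      by (cases I; cases "tl I") (auto simp: S_def)
    show "\<exists>L. ldo_rep (target \<kappa>) (Suc 1) L (S \<kappa>) \<and> (\<forall>f\<in>Fun. \<forall>x\<in>target \<kappa>. vder K f \<kappa> x = L (f \<kappa>) x)"
      unfolding ldo_rep_def sumS
      by (intro exI[of _ "\<lambda>f x. \<Sum>i\<in>UNIV. K \<kappa> x $ i * partial i f x"] conjI ballI allI impI)
        (simp_all add: sm vder_chart[OF k], simp_all add: S_def)
  qed
  have D: "vder K \<in> DO (Suc 1)" using vder_DO[OF K] by (simp add: numeral_2_eq_2)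
  note props = chart_adjoint_props[OF D co]
  have ca: "chart_adjoint (Suc 1) S g \<kappa> x = - vder K g \<kappa> x - vdiv K \<kappa> x * g \<kappa> x"
    if g: "g \<in> Fun" and k: "\<kappa> \<in> A" "x \<in> target \<kappa>" for g \<kappa> x
  proof -
    note d1 = smooth_on_differentiable[OF fun_smooth[OF g k(1)] k(2)] smooth_on_differentiable[OF rho_smooth[OF k(1)] k(2)]
    have d2: "(\<lambda>y. K \<kappa> y $ i) differentiable (at x)" for i
      by (rule smooth_on_differentiable[OF smooth_on_nth[OF open_target[OF k(1)] field_smooth[OF K k(1)]] k(2)])
    have p: "partial i (\<lambda>y. K \<kappa> y $ i * (\<rho> \<kappa> y * g \<kappa> y)) x =
      K \<kappa> x $ i * (\<rho> \<kappa> x * partial i (g \<kappa>) x + partial i (\<rho> \<kappa>) x * g \<kappa> x) + partial i (\<lambda>y. K \<kappa> y $ i) x * (\<rho> \<kappa> x * g \<kappa> x)" for i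
      using partial_mult[OF d2 differentiable_mult[OF d1(2,1)]] partial_mult[OF d1(2,1)] by simp
    have "chart_adjoint (Suc 1) S g \<kappa> x = inverse (\<rho> \<kappa> x) * (- (\<Sum>i\<in>UNIV. partial i (\<lambda>y. K \<kappa> y $ i * (\<rho> \<kappa> y * g \<kappa> y)) x))"
      unfolding chart_adjoint_def ladj_def sumS using k by (simp add: S_def sum_negf)
    also have "\<dots> = - (inverse (\<rho> \<kappa> x) * \<rho> \<kappa> x) * vder K g \<kappa> x - vdiv K \<kappa> x * g \<kappa> x"
      unfolding p vder_chart[OF k] vdiv_chart[OF k]
      by (simp add: sum.distrib sum_distrib_left sum_distrib_right algebra_simps sum_negf)
    finally show ?thesis using rho_pos[OF k] by simp
  qed
  have one: "vder K (one_density A) \<kappa> x = 0" if k: "\<kappa> \<in> A" "x \<in> target \<kappa>" for \<kappa> x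
  proof -
    have "partial i (one_density A \<kappa>) x = partial i (\<lambda>_. 1) x" for i
      by (rule partial_cong_open[OF open_target[OF k(1)] k(2)]) (simp add: one_density_def k(1))
    then show ?thesis by (simp add: vder_chart[OF k])
  qed
  have "vdiv K = - chart_adjoint (Suc 1) S (one_density A)"
  proof (intro ext)
    fix \<kappa> x
    show "vdiv K \<kappa> x = (- chart_adjoint (Suc 1) S (one_density A)) \<kappa> x"
    proof (cases "\<kappa> \<in> A \<and> x \<in> target \<kappa>")
      case True
      then have k: "\<kappa> \<in> A" "x \<in> target \<kappa>" by auto
      show ?thesis using ca[OF one_density_in k] one[OF k] k by (simp add: one_density_def)
    next
      case False then show ?thesis by (auto simp: vdiv_def lie_density_def chart_adjoint_def)
    qed
  qed
  then show "vdiv K \<in> Fun" using minus_density[OF DO_Fun[OF props(1) one_density_in]] by simp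
  note h = this
  show "adjrel (vder K) (\<lambda>f. - vder K f - vdiv K * f)"
  proof (rule adjrel_cong[OF props(2) refl])
    fix f assume f: "f \<in> Fun"
    show "- vder K f - vdiv K * f = chart_adjoint (Suc 1) S f"
    proof (rule DO_eqI[of "\<lambda>f. - vder K f - vdiv K * f" f "chart_adjoint (Suc 1) S"])
      show "(- vder K f - vdiv K * f) \<kappa> x = chart_adjoint (Suc 1) S f \<kappa> x" if "\<kappa> \<in> A" "x \<in> target \<kappa>" for \<kappa> x
        using ca[OF f that] by simp
    qed (intro Fun_diff minus_density vder_Fun K f Fun_mult h DO_Fun[OF props(1)])+
  qed
qed

text \<open>Differentiating the power of \<open>\<rho>\<close> gives \<open>\<mu>\<close> times the
  logarithmic derivative of \<open>\<rho>\<close> along \<open>K\<close>, which together with the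
  coordinate divergence makes up \<open>vdiv K\<close>.\<close>

lemma lie_density_rho:
  assumes K: "K \<in> vector_fields A" and f: "f \<in> Fun"
  shows "lie_density A K \<mu> (density_powr \<rho> \<mu> * f) = density_powr \<rho> \<mu> * (vder K f + scale_density \<mu> (vdiv K * f))"
proof (intro ext)
  fix \<kappa> x
  show "lie_density A K \<mu> (density_powr \<rho> \<mu> * f) \<kappa> x = (density_powr \<rho> \<mu> * (vder K f + scale_density \<mu> (vdiv K * f))) \<kappa> x"
  proof (cases "\<kappa> \<in> A \<and> x \<in> target \<kappa>")
    case True
    then have k: "\<kappa> \<in> A" "x \<in> target \<kappa>" by auto
    note d1 = smooth_on_differentiable[OF fun_smooth[OF f k(1)] k(2)]
    note d2 = smooth_on_differentiable[OF rho_smooth[OF k(1)] k(2)]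
    have d3: "(density_powr \<rho> \<mu> \<kappa>) differentiable (at x)"
      by (rule smooth_on_differentiable[OF density_smooth[OF rho_powr_density k(1)] k(2)])
    have l: "partial i (\<lambda>y. ln (\<rho> \<kappa> y)) x = inverse (\<rho> \<kappa> x) * partial i (\<rho> \<kappa>) x" for i
      by (rule partial_scalar_compose[OF d2])
        (use rho_pos[OF k] in \<open>auto intro!: derivative_eq_intros simp: field_simps\<close>)
    have "partial i (density_powr \<rho> \<mu> \<kappa>) x = \<mu> * \<rho> \<kappa> x powr \<mu> * (inverse (\<rho> \<kappa> x) * partial i (\<rho> \<kappa>) x)" for i
      using partial_powr[OF d2 rho_pos[OF k], of i \<mu>] by (simp add: density_powr_def l)
    then have p: "partial i ((density_powr \<rho> \<mu> * f) \<kappa>) x = \<rho> \<kappa> x powr \<mu> * partial i (f \<kappa>) x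
        + \<mu> * \<rho> \<kappa> x powr \<mu> * (inverse (\<rho> \<kappa> x) * partial i (\<rho> \<kappa>) x) * f \<kappa> x" for i
      unfolding mult_app partial_mult[OF d3 d1] by (simp add: density_powr_def)
    have "lie_density A K \<mu> (density_powr \<rho> \<mu> * f) \<kappa> x = \<rho> \<kappa> x powr \<mu> * ((\<Sum>i\<in>UNIV. K \<kappa> x $ i * partial i (f \<kappa>) x) +
       \<mu> * (inverse (\<rho> \<kappa> x) * (\<Sum>i\<in>UNIV. K \<kappa> x $ i * partial i (\<rho> \<kappa>) x) + (\<Sum>i\<in>UNIV. partial i (\<lambda>y. K \<kappa> y $ i) x)) * f \<kappa> x)"
      using k unfolding lie_density_def p
      by (simp add: density_powr_def distrib_left distrib_right sum.distrib sum_distrib_left sum_distrib_right mult.assoc mult.left_commute)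
    also have "inverse (\<rho> \<kappa> x) * (\<Sum>i\<in>UNIV. K \<kappa> x $ i * partial i (\<rho> \<kappa>) x) + (\<Sum>i\<in>UNIV. partial i (\<lambda>y. K \<kappa> y $ i) x) = vdiv K \<kappa> x"
      using rho_pos[OF k] unfolding vdiv_chart[OF k] by (simp add: field_simps)
    finally have *: "lie_density A K \<mu> (density_powr \<rho> \<mu> * f) \<kappa> x =
      \<rho> \<kappa> x powr \<mu> * ((\<Sum>i\<in>UNIV. K \<kappa> x $ i * partial i (f \<kappa>) x) + \<mu> * vdiv K \<kappa> x * f \<kappa> x)" .
    show ?thesis unfolding *
      by (simp add: vder_chart[OF k] scale_density_def density_powr_def mult.assoc)
  next
    case False
    then show ?thesis using densitiesD(3)[OF f] densitiesD(3)[OF vder_Fun[OF K f]] by (auto simp: lie_density_def scale_density_def)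
  qed
qed

end

section \<open>Operators on the algebra of densities as pencils\<close>

abbreviation lu :: "('x \<Rightarrow>\<^sub>0 'y::zero) \<Rightarrow> 'x \<Rightarrow> 'y" where "lu \<equiv> Poly_Mapping.lookup"
abbreviation sg :: "'x \<Rightarrow> 'y \<Rightarrow> ('x \<Rightarrow>\<^sub>0 'y::zero)" where "sg \<equiv> Poly_Mapping.single"

lemma lookup_sum_pm: "lu (\<Sum>a\<in>B. h a) k = (\<Sum>a\<in>B. lu (h a) k)"
  by (induction B rule: infinite_finite_induct) (auto simp: lookup_add)

lemma sum_singles: "(\<Sum>\<nu>\<in>Poly_Mapping.keys s. sg \<nu> (lu s \<nu>)) = (s :: 'x \<Rightarrow>\<^sub>0 'y::ab_group_add)"
proof (rule poly_mapping_eqI)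
  fix k
  have "lu (\<Sum>\<nu>\<in>Poly_Mapping.keys s. sg \<nu> (lu s \<nu>)) k = (\<Sum>\<nu>\<in>Poly_Mapping.keys s. if \<nu> = k then lu s \<nu> else 0)"
    unfolding lookup_sum_pm by (intro sum.cong) (auto simp: lookup_single when_def)
  also have "\<dots> = lu s k" by (simp add: in_keys_iff)
  finally show "lu (\<Sum>\<nu>\<in>Poly_Mapping.keys s. sg \<nu> (lu s \<nu>)) k = lu s k" .
qed

lemma single_induct:
  fixes s :: "'x \<Rightarrow>\<^sub>0 'y::ab_group_add"
  assumes "P 0" "\<And>\<nu>. P (sg \<nu> (lu s \<nu>))" "\<And>a b. P a \<Longrightarrow> P b \<Longrightarrow> P (a + b)"
  shows "P s"
proof -
  have "P (\<Sum>\<nu>\<in>B. sg \<nu> (lu s \<nu>))" for B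
    by (induction B rule: infinite_finite_induct) (auto intro: assms)
  then show ?thesis by (metis sum_singles)
qed

lemma lookup_single_mult:
  fixes t :: "real \<Rightarrow>\<^sub>0 'y::ring"
  shows "lu (sg \<nu> d * t) \<mu> = d * lu t (\<mu> - \<nu>)"
proof -
  have "lu (sg \<nu> d * t) \<mu> = lu (sg \<nu> d * (\<Sum>\<mu>\<in>Poly_Mapping.keys t. sg \<mu> (lu t \<mu>))) \<mu>" by (simp add: sum_singles)
  also have "\<dots> = (\<Sum>k\<in>Poly_Mapping.keys t. if k = \<mu> - \<nu> then d * lu t k else 0)"
    unfolding sum_distrib_left mult_single lookup_sum_pm by (intro sum.cong) (auto simp: lookup_single when_def)
  also have "\<dots> = d * lu t (\<mu> - \<nu>)" by (auto simp: in_keys_iff)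
  finally show ?thesis .
qed

lemma lookup_weight_fun: "lu (weight_fun a s) \<mu> = scale_density (a \<mu>) (lu s \<mu>)"
  by (auto simp: weight_fun_def lookup_mapp when_def in_keys_iff scale_density_def zero_fun_def)

text \<open>\<open>mapp\<close> acts only on the weights in the support; this agrees with acting at
  every weight as soon as \<open>D \<mu>\<close> fixes zero.\<close>

lemma lookup_of_pencil: "D \<mu> 0 = 0 \<Longrightarrow> lu (of_pencil D s) \<mu> = D \<mu> (lu s \<mu>)"
  by (auto simp: of_pencil_def lookup_mapp when_def in_keys_iff)

lemma scale_density_simps:
  "scale_density r (s + t) = scale_density r s + scale_density r t"
  "scale_density r s * t = scale_density r (s * t)" "s * scale_density r t = scale_density r (s * t)"
  "scale_density r (scale_density q s) = scale_density (r * q) s" "scale_density 1 s = s" "scale_density 0 s = 0"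
  "scale_density r 0 = 0" "scale_density r (s - t) = scale_density r s - scale_density r t"
  "scale_density r (- t) = - scale_density r t"
  "scale_density (r + q) s = scale_density r s + scale_density q s" "scale_density (r - q) s = scale_density r s - scale_density q s"
  "scale_density (- r) s = - scale_density r s"
  for s t :: "('a, 'd::finite) density"
  by (auto simp: scale_density_def fun_eq_iff algebra_simps)

abbreviation "W \<equiv> weight_fun (\<lambda>\<mu>. \<mu>)"

lemma weight_fun_add: "weight_fun a (s + t) = weight_fun a s + weight_fun a t"
  by (rule poly_mapping_eqI) (simp add: lookup_weight_fun lookup_add scale_density_simps)

lemma weight_fun_diff: "weight_fun a (s - t) = weight_fun a s - weight_fun a t"
  by (rule poly_mapping_eqI) (simp add: lookup_weight_fun lookup_minus scale_density_simps)

lemma weight_fun_single: "weight_fun a (sg \<mu> d) = sg \<mu> (scale_density (a \<mu>) d)"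
  by (rule poly_mapping_eqI) (auto simp: lookup_weight_fun lookup_single when_def scale_density_simps)

text \<open>Weights add under multiplication, so the weight operator is a derivation; this is the
  reason why it counts as an operator of order 1.\<close>

lemma weight_derivation:
  fixes s t :: "('a, 'b::finite) densum"
  shows "W (s * t) = W s * t + s * W t"
proof (induction rule: single_induct[of _ s])
  case (2 \<nu>)
  show ?case
    by (rule poly_mapping_eqI)
      (simp add: lookup_weight_fun lookup_add weight_fun_single lookup_single_mult scale_density_simps right_diff_distrib add_diff_eq)
next
  case 1
  have "W (0 :: ('a, 'b) densum) = 0"
    by (rule poly_mapping_eqI) (simp add: lookup_weight_fun scale_density_simps)
  then show ?case by simp
qed (simp_all add: weight_fun_add distrib_right)

context volume_manifold begin

section \<open>The algebra of densities and the filtration by order\<close>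

abbreviation "Alg \<equiv> density_algebra A"

lemma Alg_iff: "s \<in> Alg \<longleftrightarrow> (\<forall>\<mu>. lu s \<mu> \<in> densities A \<mu>)"
  by (simp add: density_algebra_def)

lemma Alg_lookup: "s \<in> Alg \<Longrightarrow> lu s \<mu> \<in> densities A \<mu>" by (simp add: Alg_iff)

lemma Alg_single: "d \<in> densities A \<mu> \<Longrightarrow> sg \<mu> d \<in> Alg"
  by (auto simp: Alg_iff lookup_single when_def zero_density)

lemma Alg_0: "0 \<in> Alg" by (simp add: Alg_iff zero_density)

lemma Alg_add: "s \<in> Alg \<Longrightarrow> t \<in> Alg \<Longrightarrow> s + t \<in> Alg" by (simp add: Alg_iff lookup_add add_density)

lemma Alg_diff: "s \<in> Alg \<Longrightarrow> t \<in> Alg \<Longrightarrow> s - t \<in> Alg" by (simp add: Alg_iff lookup_minus diff_density)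

lemma Alg_weight_fun: "s \<in> Alg \<Longrightarrow> weight_fun a s \<in> Alg"
  by (simp add: Alg_iff lookup_weight_fun scale_density_in)

lemma Alg_induct:
  assumes "s \<in> Alg" "P 0" "\<And>\<nu> d. d \<in> densities A \<nu> \<Longrightarrow> P (sg \<nu> d)"
    "\<And>a b. a \<in> Alg \<Longrightarrow> b \<in> Alg \<Longrightarrow> P a \<Longrightarrow> P b \<Longrightarrow> P (a + b)"
  shows "P s"
proof -
  have "s \<in> Alg \<and> P s"
  proof (rule single_induct[of "\<lambda>s. s \<in> Alg \<and> P s"])
    show "sg \<nu> (lu s \<nu>) \<in> Alg \<and> P (sg \<nu> (lu s \<nu>))" for \<nu>
      using assms(3)[OF Alg_lookup[OF assms(1)]] Alg_single[OF Alg_lookup[OF assms(1)]] by blast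
  qed (use assms(2,4) Alg_0 Alg_add in auto)
  then show ?thesis ..
qed

lemma Alg_mult:
  assumes "s \<in> Alg" "t \<in> Alg" shows "s * t \<in> Alg"
  using assms(1)
proof (rule Alg_induct)
  fix \<nu> d assume d: "d \<in> densities A \<nu>"
  show "sg \<nu> d * t \<in> Alg"
    unfolding Alg_iff lookup_single_mult using mult_density[OF d Alg_lookup[OF assms(2)], of "_ - \<nu>"] by simp
qed (simp_all add: Alg_0 distrib_right Alg_add)

lemma order_le_cong:
  assumes "op_eq A L L'" "order_le A n L" shows "order_le A n L'"
  using assms
proof (induction n arbitrary: L L')
  case 0 then show ?case by (auto simp: op_eq_def)
next
  case (Suc n)
  show ?case unfolding order_le.simps
  proof
    fix s assume s: "s \<in> Alg"
    have "op_eq A (comm_mult L s) (comm_mult L' s)"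
      using Suc.prems(1) Alg_mult[OF s] by (simp add: op_eq_def comm_mult_def)
    then show "order_le A n (comm_mult L' s)" using Suc s by auto
  qed
qed

lemma order_le_0: "order_le A n (\<lambda>_. 0)"
proof (induction n)
  case 0 show ?case using Alg_0 by (auto simp: op_eq_def intro: bexI[of _ 0])
next
  case (Suc n) then show ?case by (simp add: comm_mult_def)
qed

lemma order_le_mono_Suc: "order_le A n L \<Longrightarrow> order_le A (Suc n) L"
proof (induction n arbitrary: L)
  case 0
  then obtain u where u: "u \<in> Alg" "op_eq A L (\<lambda>t. u * t)" by auto
  show ?case unfolding order_le.simps(2)
  proof
    fix s assume s: "s \<in> Alg"
    have "op_eq A (\<lambda>_. 0) (comm_mult L s)"
      using u(2) Alg_mult[OF s] by (simp add: op_eq_def comm_mult_def mult.left_commute)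
    then show "order_le A 0 (comm_mult L s)" using order_le_cong order_le_0 by blast
  qed
qed (metis order_le.simps(2))

lemma order_le_mono: "order_le A n L \<Longrightarrow> n \<le> m \<Longrightarrow> order_le A m L"
  by (induction m) (auto simp: le_Suc_eq simp del: order_le.simps intro: order_le_mono_Suc)

lemma order_le_add:
  assumes "order_le A n L" "order_le A n L'" shows "order_le A n (\<lambda>t. L t + L' t)"
  using assms
proof (induction n arbitrary: L L')
  case 0
  then obtain u v where "u \<in> Alg" "op_eq A L (\<lambda>t. u * t)" "v \<in> Alg" "op_eq A L' (\<lambda>t. v * t)" by auto
  then show ?case unfolding order_le.simps
    by (intro bexI[of _ "u + v"] Alg_add) (auto simp: op_eq_def distrib_right)
next
  case (Suc n)
  have "comm_mult (\<lambda>t. L t + L' t) s = (\<lambda>t. comm_mult L s t + comm_mult L' s t)" for s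
    by (simp add: comm_mult_def fun_eq_iff distrib_left)
  then show ?case using Suc by simp
qed

lemma order_le_lmult:
  assumes "order_le A n L" "u \<in> Alg" shows "order_le A n (\<lambda>t. u * L t)"
  using assms(1)
proof (induction n arbitrary: L)
  case 0
  then obtain v where "v \<in> Alg" "op_eq A L (\<lambda>t. v * t)" by auto
  then show ?case unfolding order_le.simps
    by (intro bexI[of _ "u * v"] Alg_mult assms(2)) (auto simp: op_eq_def mult.assoc)
next
  case (Suc n)
  have "comm_mult (\<lambda>t. u * L t) s = (\<lambda>t. u * comm_mult L s t)" for s
    by (simp add: comm_mult_def fun_eq_iff right_diff_distrib mult.left_commute)
  then show ?case using Suc by simp
qed

text \<open>The commutator of \<open>W\<close> after \<open>L\<close> with \<open>s\<close> is
  \<open>W\<close> after the commutator of \<open>L\<close>, plus \<open>W s\<close> times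
  \<open>L\<close>. The first term is covered by induction, and the second has the order of
  \<open>L\<close>.\<close>

lemma order_le_weight:
  assumes "order_le A n L" shows "order_le A (Suc n) (\<lambda>t. W (L t))"
  using assms
proof (induction n arbitrary: L)
  case 0
  have *: "comm_mult (\<lambda>t. W (L t)) s = (\<lambda>t. W (comm_mult L s t) + W s * L t)" for s L
    by (simp add: comm_mult_def fun_eq_iff weight_fun_diff weight_derivation)
  obtain u where u: "u \<in> Alg" "op_eq A L (\<lambda>t. u * t)" using 0 by auto
  show ?case unfolding order_le.simps(2)
  proof
    fix s assume s: "s \<in> Alg"
    have w0: "W (0 :: ('a, 'd) densum) = 0" by (rule poly_mapping_eqI) (simp add: lookup_weight_fun scale_density_simps)
    have "op_eq A (\<lambda>t. W s * (u * t)) (comm_mult (\<lambda>t. W (L t)) s)"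
      unfolding * using u(2) Alg_mult[OF s] by (simp add: op_eq_def comm_mult_def mult.left_commute w0)
    moreover have "order_le A 0 (\<lambda>t. W s * (u * t))"
      using Alg_mult[OF Alg_weight_fun[OF s] u(1)] by (auto simp: op_eq_def mult.assoc intro!: bexI[of _ "W s * u"])
    ultimately show "order_le A 0 (comm_mult (\<lambda>t. W (L t)) s)" using order_le_cong by blast
  qed
next
  case (Suc n)
  have *: "comm_mult (\<lambda>t. W (L t)) s = (\<lambda>t. W (comm_mult L s t) + W s * L t)" for s
    by (simp add: comm_mult_def fun_eq_iff weight_fun_diff weight_derivation)
  show ?case unfolding order_le.simps(2)[of _ "Suc n"] *
  proof
    fix s assume s: "s \<in> Alg"
    have "order_le A (Suc n) (\<lambda>t. W (comm_mult L s t))" using Suc.prems s by (intro Suc.IH) auto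
    then show "order_le A (Suc n) (\<lambda>t. W (comm_mult L s t) + W s * L t)"
      by (rule order_le_add[OF _ order_le_lmult[OF Suc.prems Alg_weight_fun[OF s]]])
  qed
qed

lemma weight_const_mult:
  "weight_fun (\<lambda>_. r) (s * t) = weight_fun (\<lambda>_. r) s * t" "weight_fun (\<lambda>_. r) (s * t) = s * weight_fun (\<lambda>_. r) t"
  for s t :: "('a, 'd) densum"
proof -
  have 1: "weight_fun (\<lambda>_. r) (s * t) = weight_fun (\<lambda>_. r) s * t" for s t :: "('a, 'd) densum"
  proof (induction rule: single_induct[of _ s])
    case (2 \<nu>)
    show ?case
      by (rule poly_mapping_eqI)
        (simp add: lookup_weight_fun weight_fun_single lookup_single_mult scale_density_simps)
  next
    case 1
    have "weight_fun (\<lambda>_. r) (0 :: ('a, 'd) densum) = 0"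
      by (rule poly_mapping_eqI) (simp add: lookup_weight_fun scale_density_simps)
    then show ?case by simp
  qed (simp_all add: weight_fun_add distrib_right)
  show "weight_fun (\<lambda>_. r) (s * t) = weight_fun (\<lambda>_. r) s * t" by (rule 1)
  show "weight_fun (\<lambda>_. r) (s * t) = s * weight_fun (\<lambda>_. r) t" using 1[of t s] by (simp add: mult.commute)
qed

lemma order_le_const:
  assumes "order_le A n L" shows "order_le A n (\<lambda>t. weight_fun (\<lambda>_. r) (L t))"
  using assms
proof (induction n arbitrary: L)
  case 0
  then obtain v where "v \<in> Alg" "op_eq A L (\<lambda>t. v * t)" by auto
  then show ?case unfolding order_le.simps
    by (intro bexI[of _ "weight_fun (\<lambda>_. r) v"] Alg_weight_fun) (auto simp: op_eq_def weight_const_mult(1))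
next
  case (Suc n)
  have "comm_mult (\<lambda>t. weight_fun (\<lambda>_. r) (L t)) s = (\<lambda>t. weight_fun (\<lambda>_. r) (comm_mult L s t))" for s
    by (simp add: comm_mult_def fun_eq_iff weight_fun_diff weight_const_mult(2))
  then show ?case using Suc by simp
qed

abbreviation "rp \<equiv> density_powr \<rho>"

lemma rp_mult_Fun: "d \<in> densities A \<mu> \<Longrightarrow> rp (- \<mu>) * d \<in> Fun"
  using mult_density[OF rho_powr_density, of d \<mu> "- \<mu>"] by simp

lemma rp_Fun_mult: "f \<in> Fun \<Longrightarrow> rp \<mu> * f \<in> densities A \<mu>"
  using mult_density[OF rho_powr_density, of f 0 \<mu>] by simp

lemma rp_cancel:
  "d \<in> densities A \<nu> \<Longrightarrow> rp \<mu> * (rp (- \<mu>) * d) = d" "d \<in> densities A \<nu> \<Longrightarrow> rp (- \<mu>) * (rp \<mu> * d) = d"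
  using rho_powr_cancel[of d \<nu> \<mu>] rho_powr_cancel[of d \<nu> "- \<mu>"] by simp_all

lemma rp_add: "rp a * (rp b * d) = rp (a + b) * d"
  by (simp add: mult.assoc[symmetric] rho_powr_mult)

lemma rp_shift: "(rp a * g) * (rp b * d) = rp (a + b) * (g * d)"
  and rp_shift': "rp b * ((rp a * g) * d) = g * (rp (b + a) * d)"
  by (simp_all add: fun_eq_iff density_powr_def powr_add)

text \<open>The volume form identifies densities of weight \<open>\<mu>\<close> with functions; \<open>F \<mu>\<close> is the operator on
  functions that corresponds to the restriction of \<open>L\<close> to densities of weight \<open>\<mu>\<close>.\<close>

definition rep :: "('a, 'd) operator \<Rightarrow> (real \<Rightarrow> ('a, 'd) density \<Rightarrow> ('a, 'd) density) \<Rightarrow> bool" where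
  "rep L F \<longleftrightarrow> (\<forall>s\<in>Alg. \<forall>\<mu>. lu (L s) \<mu> = rp \<mu> * F \<mu> (rp (- \<mu>) * lu s \<mu>))"

text \<open>The order may vary with the weight: linearity and the preservation of the algebra are
  matters of each single weight.\<close>

definition pencil :: "(real \<Rightarrow> ('a, 'd) density \<Rightarrow> ('a, 'd) density) \<Rightarrow> bool" where
  "pencil F \<longleftrightarrow> (\<forall>\<mu>. \<exists>k. F \<mu> \<in> DO k)"

lemma repD: "rep L F \<Longrightarrow> s \<in> Alg \<Longrightarrow> lu (L s) \<mu> = rp \<mu> * F \<mu> (rp (- \<mu>) * lu s \<mu>)"
  by (simp add: rep_def)

lemma pencilI: "(\<And>\<mu>. F \<mu> \<in> DO k) \<Longrightarrow> pencil F" unfolding pencil_def by blast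

lemma rep_cong:
  assumes "rep L F" "\<And>\<mu> f. f \<in> Fun \<Longrightarrow> G \<mu> f = F \<mu> f" shows "rep L G"
  using assms rp_mult_Fun[OF Alg_lookup] by (simp add: rep_def)

lemma rep_op_eq: "rep L F \<Longrightarrow> rep L' F \<Longrightarrow> op_eq A L L'"
  unfolding op_eq_def by (intro ballI poly_mapping_eqI) (simp add: repD)

lemma rep_Alg:
  assumes "rep L F" "pencil F" "s \<in> Alg" shows "L s \<in> Alg"
  unfolding Alg_iff
proof
  fix \<mu>
  obtain k where k: "F \<mu> \<in> DO k" using assms(2) unfolding pencil_def by blast
  show "lu (L s) \<mu> \<in> densities A \<mu>"
    unfolding repD[OF assms(1,3)] by (rule rp_Fun_mult[OF DO_Fun[OF k rp_mult_Fun[OF Alg_lookup[OF assms(3)]]]])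
qed

lemma rep_restrict: "rep L F \<Longrightarrow> d \<in> densities A \<mu> \<Longrightarrow> restrict_weight L \<mu> d = rp \<mu> * F \<mu> (rp (- \<mu>) * d)"
  using repD[of L F "sg \<mu> d" \<mu>] Alg_single by (simp add: restrict_weight_def)

lemma rep_linear:
  assumes "rep L F" "pencil F"
  shows rep_L_add: "s \<in> Alg \<Longrightarrow> t \<in> Alg \<Longrightarrow> L (s + t) = L s + L t"
    and rep_L_diff: "s \<in> Alg \<Longrightarrow> t \<in> Alg \<Longrightarrow> L (s - t) = L s - L t"
    and rep_L_scale: "s \<in> Alg \<Longrightarrow> L (weight_fun (\<lambda>_. r) s) = weight_fun (\<lambda>_. r) (L s)"
    and rep_L_0: "L 0 = 0"
proof -
  have F: "F \<mu> (f + g) = F \<mu> f + F \<mu> g" "F \<mu> (f - g) = F \<mu> f - F \<mu> g" "F \<mu> (scale_density r f) = scale_density r (F \<mu> f)" "F \<mu> 0 = 0"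
    if "f \<in> Fun" "g \<in> Fun" for f g \<mu> r
  proof -
    obtain k where k: "F \<mu> \<in> DO k" using assms(2) unfolding pencil_def by blast
    show "F \<mu> (f + g) = F \<mu> f + F \<mu> g" "F \<mu> (f - g) = F \<mu> f - F \<mu> g" "F \<mu> (scale_density r f) = scale_density r (F \<mu> f)" "F \<mu> 0 = 0"
      using DO_linear[OF k that(1)] DO_linear_diff[OF k that] DO_linear_0[OF k] that(2) by auto
  qed
  note w = rp_mult_Fun[OF Alg_lookup]
  show "L (s + t) = L s + L t" if st: "s \<in> Alg" "t \<in> Alg"
    by (rule poly_mapping_eqI)
      (simp add: repD[OF assms(1)] st Alg_add lookup_add distrib_left F(1)[OF w[OF st(1)] w[OF st(2)]])
  show "L (s - t) = L s - L t" if st: "s \<in> Alg" "t \<in> Alg"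
    by (rule poly_mapping_eqI)
      (simp add: repD[OF assms(1)] st Alg_diff lookup_minus right_diff_distrib F(2)[OF w[OF st(1)] w[OF st(2)]])
  show "L (weight_fun (\<lambda>_. r) s) = weight_fun (\<lambda>_. r) (L s)" if s: "s \<in> Alg"
    by (rule poly_mapping_eqI)
      (simp add: repD[OF assms(1)] s Alg_weight_fun lookup_weight_fun scale_density_simps F(3)[OF w[OF s] w[OF s]])
  show "L 0 = 0"
    by (rule poly_mapping_eqI) (simp add: repD[OF assms(1) Alg_0] F(4)[OF zero_density zero_density])
qed

lemma rep_weight_zero:
  assumes "rep L F" "pencil F" shows "L \<in> weight_zero_operators A"
  unfolding weight_zero_operators_def linear_operators_def
proof (intro CollectI conjI ballI allI)
  fix \<mu> d assume d: "d \<in> densities A \<mu>"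
  have "L (sg \<mu> d) = sg \<mu> (rp \<mu> * F \<mu> (rp (- \<mu>) * d))"
  proof (rule poly_mapping_eqI)
    fix \<nu>
    obtain k where "F \<nu> \<in> DO k" using assms(2) unfolding pencil_def by blast
    then have "F \<nu> 0 = 0" by (rule DO_linear_0)
    then show "lu (L (sg \<mu> d)) \<nu> = lu (sg \<mu> (rp \<mu> * F \<mu> (rp (- \<mu>) * d))) \<nu>"
      unfolding repD[OF assms(1) Alg_single[OF d]] by (auto simp: lookup_single when_def)
  qed
  moreover obtain k where k: "F \<mu> \<in> DO k" using assms(2) unfolding pencil_def by blast
  have "rp \<mu> * F \<mu> (rp (- \<mu>) * d) \<in> densities A \<mu>"
    by (rule rp_Fun_mult[OF DO_Fun[OF k rp_mult_Fun[OF d]]])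
  ultimately show "\<exists>e\<in>densities A \<mu>. L (sg \<mu> d) = sg \<mu> e" by blast
qed (use rep_Alg[OF assms] rep_linear[OF assms] in auto)

lemma rep_add: "rep L F \<Longrightarrow> rep L' F' \<Longrightarrow> rep (\<lambda>s. L s + L' s) (\<lambda>\<mu> f. F \<mu> f + F' \<mu> f)"
  by (simp add: rep_def lookup_add distrib_left)

lemma rep_diff: "rep L F \<Longrightarrow> rep L' F' \<Longrightarrow> rep (\<lambda>s. L s - L' s) (\<lambda>\<mu> f. F \<mu> f - F' \<mu> f)"
  by (simp add: rep_def lookup_minus right_diff_distrib)

lemma rep_weight_fun: "rep L F \<Longrightarrow> rep (\<lambda>s. weight_fun a (L s)) (\<lambda>\<mu> f. scale_density (a \<mu>) (F \<mu> f))"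
  by (simp add: rep_def lookup_weight_fun scale_density_simps)

lemma rep_mult: "rep (\<lambda>s. sg 0 h * s) (\<lambda>_ f. h * f)"
  unfolding rep_def lookup_single_mult
proof (intro ballI allI)
  fix s \<mu> assume "s \<in> Alg"
  from rp_cancel(1)[OF Alg_lookup[OF this, of \<mu>], of \<mu>]
  show "h * lu s (\<mu> - 0) = rp \<mu> * (h * (rp (- \<mu>) * lu s \<mu>))" by (simp add: mult.left_commute[of _ h])
qed

lemma rep_comm_fun:
  assumes "rep L F" "h \<in> Fun"
  shows "rep (comm_mult L (sg 0 h)) (\<lambda>\<mu> f. F \<mu> (h * f) - h * F \<mu> f)"
  unfolding rep_def
proof (intro ballI allI)
  fix s \<mu> assume s: "s \<in> Alg"
  have hs: "sg 0 h * s \<in> Alg" by (intro Alg_mult Alg_single assms(2) s)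
  show "lu (comm_mult L (sg 0 h) s) \<mu> = rp \<mu> * (F \<mu> (h * (rp (- \<mu>) * lu s \<mu>)) - h * F \<mu> (rp (- \<mu>) * lu s \<mu>))"
    by (simp add: comm_mult_def lookup_minus lookup_single_mult repD[OF assms(1) s] repD[OF assms(1) hs]
        right_diff_distrib mult.left_commute[of _ h])
qed

text \<open>The operator whose pencil is \<open>E\<close> at every weight. Members of the family are
  assembled from such operators with coefficients polynomial in the weight.\<close>

definition Q :: "(('a, 'd) density \<Rightarrow> ('a, 'd) density) \<Rightarrow> ('a, 'd) operator" where
  "Q E = of_pencil (\<lambda>\<mu> d. rp \<mu> * E (rp (- \<mu>) * d))"

lemma rep_Q: "E \<in> DO k \<Longrightarrow> rep (Q E) (\<lambda>_. E)"
  unfolding rep_def Q_def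
proof (intro ballI allI)
  fix s :: "('a, 'd) densum" and \<mu> assume "E \<in> DO k"
  from DO_linear_0[OF this] have "rp \<mu> * E (rp (- \<mu>) * 0) = 0" by (simp only: mult_zero_right)
  then show "lu (of_pencil (\<lambda>\<mu> d. rp \<mu> * E (rp (- \<mu>) * d)) s) \<mu> = rp \<mu> * E (rp (- \<mu>) * lu s \<mu>)"
    by (rule lookup_of_pencil)
qed

lemma pencil_const: "E \<in> DO k \<Longrightarrow> pencil (\<lambda>_. E)" by (rule pencilI)

lemma DO_0_zero:
  assumes "E \<in> DO 0" "f \<in> Fun" shows "E f = 0"
proof (rule DO_eqI[of E f "\<lambda>_. 0"])
  show "E f \<kappa> x = 0 \<kappa> x" if k: "\<kappa> \<in> A" "x \<in> target \<kappa>" for \<kappa> x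
  proof -
    obtain L where "ldo (target \<kappa>) 0 L" "\<forall>f\<in>Fun. \<forall>x\<in>target \<kappa>. E f \<kappa> x = L (f \<kappa>) x"
      using DO_local[OF assms(1) k(1)] by blast
    then show ?thesis using fun_smooth[OF assms(2) k(1)] k(2) assms(2) by (simp add: ldo_at_0)
  qed
qed (use assms DO_Fun zero_density in auto)

lemma DO_1_mult:
  assumes "E \<in> DO 1" "f \<in> Fun" shows "E f = E (one_density A) * f"
proof -
  have "(\<lambda>g. E (f * g) - f * E g) \<in> DO 0" using DO_commutator[OF assms] by simp
  from DO_0_zero[OF this one_density_in]
  show ?thesis using density_one_mult[OF assms(2)] by (simp add: mult.commute)
qed

text \<open>Verticality is tested by functions, which act within each weight. A bound on the order
  at every weight therefore suffices, whatever the dependence on the weight.\<close>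

lemma rep_vertical:
  assumes "rep L F" "\<And>\<mu>. F \<mu> \<in> DO (Suc k)" shows "vertical_order A k L"
  using assms
proof (induction k arbitrary: L F)
  case 0
  show ?case unfolding vertical_order.simps
  proof
    fix h assume h: "h \<in> Fun"
    have "rep (comm_mult L (sg 0 h)) (\<lambda>_ _. 0)"
    proof (rule rep_cong[OF rep_comm_fun[OF 0(1) h]])
      show "0 = F \<mu> (h * f) - h * F \<mu> f" if f: "f \<in> Fun" for \<mu> f
      proof -
        have "(\<lambda>f. F \<mu> (h * f) - h * F \<mu> f) \<in> DO 0"
          using DO_commutator[OF 0(2) h, of \<mu>] unfolding diff_Suc_1 .
        from DO_0_zero[OF this f] show ?thesis by (rule sym)
      qed
    qed
    then show "op_eq A (comm_mult L (sg 0 h)) (\<lambda>_. 0)"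
      unfolding op_eq_def by (intro ballI poly_mapping_eqI) (simp add: repD)
  qed
next
  case (Suc k)
  show ?case unfolding vertical_order.simps
  proof
    fix h assume h: "h \<in> Fun"
    show "vertical_order A k (comm_mult L (sg 0 h))"
    proof (rule Suc.IH[OF rep_comm_fun[OF Suc.prems(1) h]])
      show "(\<lambda>f. F \<mu> (h * f) - h * F \<mu> f) \<in> DO (Suc k)" for \<mu>
        using DO_commutator[OF Suc.prems(2) h, of \<mu>] unfolding diff_Suc_1 .
    qed
  qed
qed

definition adf :: "('a, 'd) density \<Rightarrow> (('a, 'd) density \<Rightarrow> ('a, 'd) density) \<Rightarrow> ('a, 'd) density \<Rightarrow> ('a, 'd) density" where
  "adf h E f = E (h * f) - h * E f"

text \<open>The converse at a single weight: evaluated on densities of weight \<open>\<mu>\<close>,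
  verticality of order \<open>k\<close> says that the commutator with \<open>h\<close>, taken
  \<open>k + 1\<close> times, vanishes. The determination of \<open>b\<close> uses verticality only
  in this form.\<close>

lemma vertical_adf:
  assumes "vertical_order A k L" "rep L F" "h \<in> Fun" "f \<in> Fun" "\<And>f. f \<in> Fun \<Longrightarrow> F \<mu> f \<in> Fun"
  shows "((adf h ^^ Suc k) (F \<mu>)) f = 0"
  using assms(1,2,5)
proof (induction k arbitrary: L F)
  case 0
  have "op_eq A (comm_mult L (sg 0 h)) (\<lambda>_. 0)" using 0(1) assms(3) by auto
  then have "comm_mult L (sg 0 h) (sg \<mu> (rp \<mu> * f)) = 0"
    using Alg_single[OF rp_Fun_mult[OF assms(4)]] unfolding op_eq_def by blast
  then have "rp \<mu> * (F \<mu> (h * (rp (- \<mu>) * (rp \<mu> * f))) - h * F \<mu> (rp (- \<mu>) * (rp \<mu> * f))) = 0"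
    using repD[OF rep_comm_fun[OF 0(2) assms(3)] Alg_single[OF rp_Fun_mult[OF assms(4)]], of \<mu> \<mu>]
    unfolding lookup_single_eq by (metis lookup_zero)
  then have z: "rp \<mu> * adf h (F \<mu>) f = 0" by (simp add: rp_cancel(2)[OF assms(4)] adf_def)
  have "adf h (F \<mu>) f \<in> Fun" unfolding adf_def by (intro Fun_diff Fun_mult assms(3,4) 0(3))
  from rp_cancel(2)[OF this, of \<mu>] show ?case using z by simp
next
  case (Suc k)
  have "vertical_order A k (comm_mult L (sg 0 h))" using Suc.prems(1) assms(3) by simp
  moreover have "F \<mu> (h * f) - h * F \<mu> f \<in> Fun" if "f \<in> Fun" for f
    using that by (intro Fun_diff Fun_mult assms(3) Suc.prems(3))
  ultimately have "((adf h ^^ Suc k) (\<lambda>f. F \<mu> (h * f) - h * F \<mu> f)) f = 0"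
    using Suc.IH[OF _ rep_comm_fun[OF Suc.prems(2) assms(3)]] by blast
  then have "((adf h ^^ Suc k) (adf h (F \<mu>))) f = 0" by (simp add: adf_def[abs_def])
  then show ?case by (simp only: funpow_Suc_right o_apply)
qed

text \<open>A density of weight \<open>\<nu>\<close> is a power of \<open>\<rho>\<close> times a
  function \<open>g\<close>, and an operator with constant pencil commutes with the powers of
  \<open>\<rho>\<close>, so only the commutator with \<open>g\<close> remains.\<close>

lemma comm_mult_Q:
  assumes E: "E \<in> DO k" and g: "g \<in> Fun"
  shows "op_eq A (\<lambda>t. sg \<nu> (rp \<nu>) * Q (\<lambda>f. E (g * f) - g * E f) t) (comm_mult (Q E) (sg \<nu> (rp \<nu> * g)))"
  unfolding op_eq_def
proof (intro ballI poly_mapping_eqI)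
  fix t \<mu> assume t: "t \<in> Alg"
  let ?f = "rp (- (\<mu> - \<nu>)) * lu t (\<mu> - \<nu>)"
  have f: "?f \<in> Fun" by (rule rp_mult_Fun[OF Alg_lookup[OF t]])
  have st: "sg \<nu> (rp \<nu> * g) * t \<in> Alg" by (intro Alg_mult Alg_single rp_Fun_mult g t)
  have "lu (sg \<nu> (rp \<nu>) * Q (\<lambda>f. E (g * f) - g * E f) t) \<mu> = rp \<nu> * (rp (\<mu> - \<nu>) * (E (g * ?f) - g * E ?f))"
    unfolding lookup_single_mult repD[OF rep_Q[OF DO_commutator[OF E g]] t] ..
  also have "\<dots> = rp \<mu> * (E (g * ?f) - g * E ?f)" by (simp add: rp_add)
  also have "\<dots> = rp \<mu> * E (g * ?f) - (rp \<nu> * g) * (rp (\<mu> - \<nu>) * E ?f)"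
    by (simp only: right_diff_distrib rp_shift) simp
  also have "g * ?f = rp (- \<mu>) * lu (sg \<nu> (rp \<nu> * g) * t) \<mu>"
    unfolding lookup_single_mult rp_shift' by (simp only: minus_diff_eq) simp
  finally have *: "lu (sg \<nu> (rp \<nu>) * Q (\<lambda>f. E (g * f) - g * E f) t) \<mu> =
    rp \<mu> * E (rp (- \<mu>) * lu (sg \<nu> (rp \<nu> * g) * t) \<mu>) - (rp \<nu> * g) * (rp (\<mu> - \<nu>) * E ?f)" .
  show "lu (sg \<nu> (rp \<nu>) * Q (\<lambda>f. E (g * f) - g * E f) t) \<mu> = lu (comm_mult (Q E) (sg \<nu> (rp \<nu> * g)) t) \<mu>"
    unfolding comm_mult_def lookup_minus repD[OF rep_Q[OF E] st] lookup_single_mult[of \<nu> "rp \<nu> * g" "Q E t"]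
      repD[OF rep_Q[OF E] t] by (rule *)
qed

text \<open>For a homogeneous density, \<open>comm_mult_Q\<close> turns the commutator into a
  density times an operator with constant pencil of lower order; an element of the algebra is a
  finite sum of homogeneous ones.\<close>

lemma order_le_Q: "E \<in> DO (Suc n) \<Longrightarrow> order_le A n (Q E)"
proof (induction n arbitrary: E)
  case 0
  have one: "E \<in> DO 1" using 0 by simp
  have "op_eq A (Q E) (\<lambda>t. sg 0 (E (one_density A)) * t)"
    by (rule rep_op_eq[OF rep_cong[OF rep_Q[OF 0]] rep_mult]) (rule DO_1_mult[OF one, symmetric])
  then show ?case using Alg_single[OF DO_Fun[OF 0 one_density_in]] by auto
next
  case (Suc n)
  show ?case unfolding order_le.simps(2)
  proof
    fix s assume "s \<in> Alg"
    then show "order_le A n (comm_mult (Q E) s)"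
    proof (rule Alg_induct)
      have "op_eq A (\<lambda>_. 0) (comm_mult (Q E) 0)"
        using rep_L_0[OF rep_Q[OF Suc.prems] pencil_const[OF Suc.prems]] by (simp add: op_eq_def comm_mult_def)
      then show "order_le A n (comm_mult (Q E) 0)" using order_le_cong order_le_0 by blast
    next
      fix \<nu> d assume d: "d \<in> densities A \<nu>"
      have g: "rp (- \<nu>) * d \<in> Fun" by (rule rp_mult_Fun[OF d])
      have "order_le A n (Q (\<lambda>f. E ((rp (- \<nu>) * d) * f) - (rp (- \<nu>) * d) * E f))"
        using DO_commutator[OF Suc.prems g] unfolding diff_Suc_1 by (rule Suc.IH)
      from order_le_cong[OF comm_mult_Q[OF Suc.prems g, of \<nu>] order_le_lmult[OF this Alg_single[OF rho_powr_density]]]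
      show "order_le A n (comm_mult (Q E) (sg \<nu> d))" by (simp only: rp_cancel(1)[OF d])
    next
      fix a b assume ab: "a \<in> Alg" "b \<in> Alg" "order_le A n (comm_mult (Q E) a)" "order_le A n (comm_mult (Q E) b)"
      have "op_eq A (\<lambda>t. comm_mult (Q E) a t + comm_mult (Q E) b t) (comm_mult (Q E) (a + b))"
        unfolding op_eq_def comm_mult_def
        using rep_L_add[OF rep_Q[OF Suc.prems] pencil_const[OF Suc.prems]] Alg_mult ab(1,2)
        by (simp add: distrib_right algebra_simps)
      then show "order_le A n (comm_mult (Q E) (a + b))" using order_le_cong order_le_add[OF ab(3,4)] by blast
    qed
  qed
qed

section \<open>Differential operators of bounded total degree on the algebra\<close>

lemma locally_polynomialI:
  assumes "\<And>\<kappa>. \<kappa> \<in> A \<Longrightarrow> \<exists>P. pldo (target \<kappa>) n P \<and>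
    (\<forall>\<mu>. \<forall>d\<in>densities A \<mu>. \<forall>x\<in>target \<kappa>. restrict_weight L \<mu> d \<kappa> x = P \<mu> (d \<kappa>) x)"
  shows "locally_polynomial A n L"
  unfolding locally_polynomial_def
proof
  fix \<kappa> assume k: "\<kappa> \<in> A"
  obtain P where P: "pldo (target \<kappa>) n P"
    "\<forall>\<mu>. \<forall>d\<in>densities A \<mu>. \<forall>x\<in>target \<kappa>. restrict_weight L \<mu> d \<kappa> x = P \<mu> (d \<kappa>) x" using assms[OF k] by blast
  obtain S where S: "\<forall>j I. smooth_on (target \<kappa>) (S j I)" "\<forall>\<mu> f x. smooth_on (target \<kappa>) f \<longrightarrow> x \<in> target \<kappa> \<longrightarrow>
        P \<mu> f x = (\<Sum>(j, I)\<in>{(j, I). j + length I \<le> n}. S j I x * \<mu> ^ j * partials I f x)"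
    using P(1) unfolding pldo_def by (elim exE conjE)
  show "\<exists>S. (\<forall>j I. smooth_on (target \<kappa>) (S j I)) \<and>
     (\<forall>\<mu>. \<forall>d\<in>densities A \<mu>. \<forall>x\<in>target \<kappa>. restrict_weight L \<mu> d \<kappa> x =
        (\<Sum>(j, I)\<in>{(j, I). j + length I \<le> n}. S j I x * \<mu> ^ j * partials I (d \<kappa>) x))"
    using S P(2) density_smooth[OF _ k] by (intro exI[of _ S] conjI allI ballI) simp_all
qed

lemma locally_polynomialD:
  assumes "locally_polynomial A n L" "\<kappa> \<in> A"
  shows "\<exists>P. pldo (target \<kappa>) n P \<and> (\<forall>\<mu>. \<forall>d\<in>densities A \<mu>. \<forall>x\<in>target \<kappa>. restrict_weight L \<mu> d \<kappa> x = P \<mu> (d \<kappa>) x)"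
proof -
  obtain S where S: "\<forall>j I. smooth_on (target \<kappa>) (S j I)"
     "\<forall>\<mu>. \<forall>d\<in>densities A \<mu>. \<forall>x\<in>target \<kappa>. restrict_weight L \<mu> d \<kappa> x =
        (\<Sum>(j, I)\<in>{(j, I). j + length I \<le> n}. S j I x * \<mu> ^ j * partials I (d \<kappa>) x)"
    using assms unfolding locally_polynomial_def by blast
  show ?thesis
    using S by (intro exI[of _ "\<lambda>\<mu> f x. (\<Sum>(j, I)\<in>{(j, I). j + length I \<le> n}. S j I x * \<mu> ^ j * partials I f x)"] conjI)
      (auto simp: pldo_def)
qed

text \<open>On densities of weight \<open>\<mu>\<close> the constant pencil is conjugated by the
  power \<open>\<mu>\<close> of \<open>\<rho>\<close>; by \<open>pldo_conjugation\<close> this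
  replaces derivatives by factors of the weight without raising the total degree.\<close>

lemma hat_Q:
  assumes E: "E \<in> DO (Suc n)" shows "Q E \<in> hat_diff_ops A n"
  unfolding hat_diff_ops_def
proof (intro CollectI conjI order_le_Q[OF E] rep_weight_zero[OF rep_Q[OF E] pencil_const[OF E]] locally_polynomialI)
  fix \<kappa> assume k: "\<kappa> \<in> A"
  obtain L where L: "ldo (target \<kappa>) (Suc n) L" "\<forall>f\<in>Fun. \<forall>x\<in>target \<kappa>. E f \<kappa> x = L (f \<kappa>) x"
    using DO_local[OF E k] by blast
  show "\<exists>P. pldo (target \<kappa>) n P \<and> (\<forall>\<mu>. \<forall>d\<in>densities A \<mu>. \<forall>x\<in>target \<kappa>. restrict_weight (Q E) \<mu> d \<kappa> x = P \<mu> (d \<kappa>) x)"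
  proof (intro exI conjI allI ballI)
    show "pldo (target \<kappa>) n (\<lambda>\<mu> f x. \<rho> \<kappa> x powr \<mu> * L (\<lambda>y. \<rho> \<kappa> y powr (- \<mu>) * f y) x)"
      by (rule pldo_conjugation[OF open_target[OF k] rho_smooth[OF k] rho_pos[OF k] L(1)])
    fix \<mu> d x assume d: "d \<in> densities A \<mu>" and x: "x \<in> target \<kappa>"
    have "(rp (- \<mu>) * d) \<kappa> = (\<lambda>y. \<rho> \<kappa> y powr (- \<mu>) * d \<kappa> y)" by (simp add: times_fun_def density_powr_def)
    then show "restrict_weight (Q E) \<mu> d \<kappa> x = \<rho> \<kappa> x powr \<mu> * L (\<lambda>y. \<rho> \<kappa> y powr (- \<mu>) * d \<kappa> y) x"
      using L(2) rp_mult_Fun[OF d] x unfolding rep_restrict[OF rep_Q[OF E] d] times_fun_apply[of "rp \<mu>"]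
      by (simp add: density_powr_def[of \<rho> \<mu>])
  qed
qed

lemma hat_cong:
  assumes L: "L \<in> hat_diff_ops A n" and eq: "op_eq A L L'" shows "L' \<in> hat_diff_ops A n"
proof -
  have e: "L' s = L s" if "s \<in> Alg" for s using eq that by (simp add: op_eq_def)
  have r: "restrict_weight L' \<mu> d = restrict_weight L \<mu> d" if "d \<in> densities A \<mu>" for \<mu> d
    using e[OF Alg_single[OF that]] by (simp add: restrict_weight_def)
  have 1: "L' \<in> weight_zero_operators A"
    using L unfolding hat_diff_ops_def weight_zero_operators_def linear_operators_def
    by (simp add: e Alg_add Alg_weight_fun Alg_single)
  have 2: "order_le A n L'" using L order_le_cong[OF eq] by (simp add: hat_diff_ops_def)
  have 3: "locally_polynomial A n L'"
    using L unfolding hat_diff_ops_def locally_polynomial_def by (simp add: r)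
  show ?thesis using 1 2 3 by (simp add: hat_diff_ops_def)
qed

text \<open>This applies to operators known only to belong to \<open>hat_diff_ops\<close>, such as
  an adjoint obtained by choice. Weight zero and additivity reduce them to their restrictions to
  single weights, and there the local polynomial is an ordinary differential operator.\<close>

lemma hat_rep:
  assumes L: "L \<in> hat_diff_ops A n"
  shows "\<exists>F. rep L F \<and> (\<forall>\<mu>. F \<mu> \<in> DO (Suc n))"
proof -
  have wz: "\<exists>e\<in>densities A \<mu>. L (sg \<mu> d) = sg \<mu> e" if "d \<in> densities A \<mu>" for \<mu> d
    using L that unfolding hat_diff_ops_def weight_zero_operators_def by blast
  have add: "L (s + t) = L s + L t" if "s \<in> Alg" "t \<in> Alg" for s t
    using L that unfolding hat_diff_ops_def weight_zero_operators_def linear_operators_def by blast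
  have rw: "restrict_weight L \<mu> d \<in> densities A \<mu>" "L (sg \<mu> d) = sg \<mu> (restrict_weight L \<mu> d)" if "d \<in> densities A \<mu>" for \<mu> d
    using wz[OF that] by (auto simp: restrict_weight_def)
  have L0: "L 0 = 0" using add[OF Alg_0 Alg_0] by simp
  have rw0: "restrict_weight L \<mu> 0 = 0" for \<mu> by (simp add: restrict_weight_def L0)
  have lookL: "lu (L s) \<mu> = restrict_weight L \<mu> (lu s \<mu>)" if "s \<in> Alg" for s \<mu>
    using that
  proof (rule Alg_induct)
    show "lu (L 0) \<mu> = restrict_weight L \<mu> (lu 0 \<mu>)" by (simp add: L0 rw0)
    show "lu (L (sg \<nu> d)) \<mu> = restrict_weight L \<mu> (lu (sg \<nu> d) \<mu>)" if "d \<in> densities A \<nu>" for \<nu> d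
      unfolding rw(2)[OF that] by (auto simp: lookup_single when_def rw0)
    fix a b assume ab: "a \<in> Alg" "b \<in> Alg" "lu (L a) \<mu> = restrict_weight L \<mu> (lu a \<mu>)" "lu (L b) \<mu> = restrict_weight L \<mu> (lu b \<mu>)"
    have "restrict_weight L \<mu> (lu a \<mu> + lu b \<mu>) = restrict_weight L \<mu> (lu a \<mu>) + restrict_weight L \<mu> (lu b \<mu>)"
      using add[OF Alg_single[OF Alg_lookup[OF ab(1)]] Alg_single[OF Alg_lookup[OF ab(2)]], of \<mu> \<mu>]
      by (simp add: restrict_weight_def single_add lookup_add)
    then show "lu (L (a + b)) \<mu> = restrict_weight L \<mu> (lu (a + b) \<mu>)"
      using ab by (simp add: add lookup_add)
  qed
  define F where "F = (\<lambda>\<mu> f. rp (- \<mu>) * restrict_weight L \<mu> (rp \<mu> * f))"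
  have "rep L F" unfolding rep_def
  proof (intro ballI allI)
    fix s \<mu> assume s: "s \<in> Alg"
    show "lu (L s) \<mu> = rp \<mu> * F \<mu> (rp (- \<mu>) * lu s \<mu>)"
      unfolding F_def rp_cancel(1)[OF Alg_lookup[OF s]] rp_cancel(1)[OF rw(1)[OF Alg_lookup[OF s]]] by (rule lookL[OF s])
  qed
  moreover have "F \<mu> \<in> DO (Suc n)" for \<mu>
  proof (rule DO_I)
    fix \<kappa> assume k: "\<kappa> \<in> A"
    have lp: "locally_polynomial A n L" using L by (simp add: hat_diff_ops_def)
    obtain S where S: "\<forall>j I. smooth_on (target \<kappa>) (S j I)"
      "\<forall>\<mu>. \<forall>d\<in>densities A \<mu>. \<forall>x\<in>target \<kappa>. restrict_weight L \<mu> d \<kappa> x =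
        (\<Sum>(j, I)\<in>{(j, I). j + length I \<le> n}. S j I x * \<mu> ^ j * partials I (d \<kappa>) x)"
      using lp k unfolding locally_polynomial_def by blast
    define M where "M = (\<lambda>f x. \<Sum>q\<in>{(j, I). j + length I \<le> n}. (\<mu> ^ fst q * S (fst q) (snd q) x) * partials (snd q) f x)"
    have M0: "ldo (target \<kappa>) (Suc n) M" unfolding M_def
    proof (rule ldo_sum[OF open_target[OF k]])
      fix q :: "nat \<times> 'd list" assume "q \<in> {(j, I). j + length I \<le> n}"
      then have "length (snd q) < Suc n" by auto
      then show "ldo (target \<kappa>) (Suc n) (\<lambda>f x. (\<mu> ^ fst q * S (fst q) (snd q) x) * partials (snd q) f x)"
        using S(1) by (intro ldo_term smooth_on_cmult[OF open_target[OF k]]) auto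
    qed
    have "ldo (target \<kappa>) (Suc n) (\<lambda>f x. \<rho> \<kappa> x powr (- \<mu>) * M (\<lambda>y. \<rho> \<kappa> y powr (- (- \<mu>)) * f y) x)"
      by (rule ldo_powr_conjugation[OF open_target[OF k] rho_smooth[OF k] rho_pos[OF k] M0])
    moreover have "F \<mu> f \<kappa> x = \<rho> \<kappa> x powr (- \<mu>) * M (\<lambda>y. \<rho> \<kappa> y powr (- (- \<mu>)) * f \<kappa> y) x"
      if f: "f \<in> Fun" and x: "x \<in> target \<kappa>" for f x
    proof -
      have e: "(rp \<mu> * f) \<kappa> = (\<lambda>y. \<rho> \<kappa> y powr (- (- \<mu>)) * f \<kappa> y)" by (simp add: times_fun_def density_powr_def)
      have "restrict_weight L \<mu> (rp \<mu> * f) \<kappa> x = M ((rp \<mu> * f) \<kappa>) x"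
        using S(2) rp_Fun_mult[OF f] x by (simp add: M_def case_prod_unfold mult.commute)
      then show ?thesis unfolding F_def times_fun_apply[of "rp (- \<mu>)"] e by (simp add: density_powr_def[of \<rho> "- \<mu>"])
    qed
    ultimately show "\<exists>L. ldo (target \<kappa>) (Suc n) L \<and> (\<forall>f\<in>Fun. \<forall>x\<in>target \<kappa>. F \<mu> f \<kappa> x = L (f \<kappa>) x)"
      by blast
  qed (simp only: F_def, rule rp_mult_Fun[OF rw(1)[OF rp_Fun_mult]])
  ultimately show ?thesis by blast
qed

lemma hat_add:
  assumes "L \<in> hat_diff_ops A n" "L' \<in> hat_diff_ops A n" shows "(\<lambda>s. L s + L' s) \<in> hat_diff_ops A n"
proof -
  obtain F F' where F: "rep L F" "\<And>\<mu>. F \<mu> \<in> DO (Suc n)" "rep L' F'" "\<And>\<mu>. F' \<mu> \<in> DO (Suc n)"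
    using hat_rep[OF assms(1)] hat_rep[OF assms(2)] by metis
  have 1: "(\<lambda>s. L s + L' s) \<in> weight_zero_operators A"
    by (rule rep_weight_zero[OF rep_add[OF F(1,3)] pencilI[OF DO_add[OF F(2,4)]]])
  have 2: "order_le A n (\<lambda>s. L s + L' s)" using assms order_le_add by (simp add: hat_diff_ops_def)
  have 3: "locally_polynomial A n (\<lambda>s. L s + L' s)"
  proof (rule locally_polynomialI)
    fix \<kappa> assume k: "\<kappa> \<in> A"
    obtain P where P: "pldo (target \<kappa>) n P" "\<forall>\<mu>. \<forall>d\<in>densities A \<mu>. \<forall>x\<in>target \<kappa>. restrict_weight L \<mu> d \<kappa> x = P \<mu> (d \<kappa>) x"
      using locally_polynomialD[OF _ k, of n L] assms(1) unfolding hat_diff_ops_def by blast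
    obtain P' where P': "pldo (target \<kappa>) n P'" "\<forall>\<mu>. \<forall>d\<in>densities A \<mu>. \<forall>x\<in>target \<kappa>. restrict_weight L' \<mu> d \<kappa> x = P' \<mu> (d \<kappa>) x"
      using locally_polynomialD[OF _ k, of n L'] assms(2) unfolding hat_diff_ops_def by blast
    show "\<exists>P. pldo (target \<kappa>) n P \<and> (\<forall>\<mu>. \<forall>d\<in>densities A \<mu>. \<forall>x\<in>target \<kappa>. restrict_weight (\<lambda>s. L s + L' s) \<mu> d \<kappa> x = P \<mu> (d \<kappa>) x)"
      using P(2) P'(2) unfolding restrict_weight_def
      by (intro exI[of _ "\<lambda>\<mu> f x. P \<mu> f x + P' \<mu> f x"] conjI pldo_add[OF open_target[OF k] P(1) P'(1)]) (simp add: lookup_add)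
  qed
  show ?thesis using 1 2 3 by (simp add: hat_diff_ops_def)
qed

lemma hat_const:
  assumes "L \<in> hat_diff_ops A n" shows "(\<lambda>s. weight_fun (\<lambda>_. r) (L s)) \<in> hat_diff_ops A n"
proof -
  obtain F where F: "rep L F" "\<And>\<mu>. F \<mu> \<in> DO (Suc n)" using hat_rep[OF assms] by blast
  have 1: "(\<lambda>s. weight_fun (\<lambda>_. r) (L s)) \<in> weight_zero_operators A"
    by (rule rep_weight_zero[OF rep_weight_fun[OF F(1)] pencilI[OF DO_scale[OF F(2)]]])
  have 2: "order_le A n (\<lambda>s. weight_fun (\<lambda>_. r) (L s))" using assms order_le_const by (simp add: hat_diff_ops_def)
  have 3: "locally_polynomial A n (\<lambda>s. weight_fun (\<lambda>_. r) (L s))"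
  proof (rule locally_polynomialI)
    fix \<kappa> assume k: "\<kappa> \<in> A"
    obtain P where P: "pldo (target \<kappa>) n P" "\<forall>\<mu>. \<forall>d\<in>densities A \<mu>. \<forall>x\<in>target \<kappa>. restrict_weight L \<mu> d \<kappa> x = P \<mu> (d \<kappa>) x"
      using locally_polynomialD[OF _ k, of n L] assms(1) unfolding hat_diff_ops_def by blast
    show "\<exists>P. pldo (target \<kappa>) n P \<and> (\<forall>\<mu>. \<forall>d\<in>densities A \<mu>. \<forall>x\<in>target \<kappa>. restrict_weight (\<lambda>s. weight_fun (\<lambda>_. r) (L s)) \<mu> d \<kappa> x = P \<mu> (d \<kappa>) x)"
      using P(2) unfolding restrict_weight_def
      by (intro exI[of _ "\<lambda>\<mu> f x. r * P \<mu> f x"] conjI pldo_mult[OF open_target[OF k] P(1) smooth_on_const])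
        (simp add: lookup_weight_fun scale_density_def)
  qed
  show ?thesis using 1 2 3 by (simp add: hat_diff_ops_def)
qed

lemma hat_W:
  assumes "L \<in> hat_diff_ops A n" shows "(\<lambda>s. W (L s)) \<in> hat_diff_ops A (Suc n)"
proof -
  obtain F where F: "rep L F" "\<And>\<mu>. F \<mu> \<in> DO (Suc n)" using hat_rep[OF assms] by blast
  have 1: "(\<lambda>s. W (L s)) \<in> weight_zero_operators A"
    by (rule rep_weight_zero[OF rep_weight_fun[OF F(1)] pencilI[OF DO_scale[OF F(2)]]])
  have 2: "order_le A (Suc n) (\<lambda>s. W (L s))" using assms order_le_weight by (simp add: hat_diff_ops_def del: order_le.simps)
  have 3: "locally_polynomial A (Suc n) (\<lambda>s. W (L s))"
  proof (rule locally_polynomialI)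
    fix \<kappa> assume k: "\<kappa> \<in> A"
    obtain P where P: "pldo (target \<kappa>) n P" "\<forall>\<mu>. \<forall>d\<in>densities A \<mu>. \<forall>x\<in>target \<kappa>. restrict_weight L \<mu> d \<kappa> x = P \<mu> (d \<kappa>) x"
      using locally_polynomialD[OF _ k, of n L] assms(1) unfolding hat_diff_ops_def by blast
    show "\<exists>P. pldo (target \<kappa>) (Suc n) P \<and> (\<forall>\<mu>. \<forall>d\<in>densities A \<mu>. \<forall>x\<in>target \<kappa>. restrict_weight (\<lambda>s. W (L s)) \<mu> d \<kappa> x = P \<mu> (d \<kappa>) x)"
      using P(2) unfolding restrict_weight_def
      by (intro exI[of _ "\<lambda>\<mu> f x. \<mu> * P \<mu> f x"] conjI pldo_weight[OF open_target[OF k] P(1)])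
        (simp add: lookup_weight_fun scale_density_def)
  qed
  show ?thesis using 1 2 3 unfolding hat_diff_ops_def by blast
qed

lemma hat_mono:
  assumes "L \<in> hat_diff_ops A n" "n \<le> m" shows "L \<in> hat_diff_ops A m"
proof -
  have "locally_polynomial A m L"
  proof (rule locally_polynomialI)
    fix \<kappa> assume k: "\<kappa> \<in> A"
    obtain P where P: "pldo (target \<kappa>) n P" "\<forall>\<mu>. \<forall>d\<in>densities A \<mu>. \<forall>x\<in>target \<kappa>. restrict_weight L \<mu> d \<kappa> x = P \<mu> (d \<kappa>) x"
      using locally_polynomialD[OF _ k, of n L] assms(1) unfolding hat_diff_ops_def by blast
    show "\<exists>P. pldo (target \<kappa>) m P \<and> (\<forall>\<mu>. \<forall>d\<in>densities A \<mu>. \<forall>x\<in>target \<kappa>. restrict_weight L \<mu> d \<kappa> x = P \<mu> (d \<kappa>) x)"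
      using P(2) pldo_mono[OF open_target[OF k] P(1) assms(2)] by blast
  qed
  then show ?thesis using assms order_le_mono unfolding hat_diff_ops_def by blast
qed

lemma hat_diff: "L \<in> hat_diff_ops A n \<Longrightarrow> L' \<in> hat_diff_ops A n \<Longrightarrow> (\<lambda>s. L s - L' s) \<in> hat_diff_ops A n"
proof -
  assume "L \<in> hat_diff_ops A n" "L' \<in> hat_diff_ops A n"
  then have "(\<lambda>s. L s + weight_fun (\<lambda>_. -1) (L' s)) \<in> hat_diff_ops A n" by (intro hat_add hat_const)
  moreover have "weight_fun (\<lambda>_. -1) t = - t" for t :: "('a, 'd) densum"
    by (rule poly_mapping_eqI) (simp add: lookup_weight_fun scale_density_simps lookup_uminus)
  ultimately show ?thesis by simp
qed

lemma hat_shift: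
  assumes "L \<in> hat_diff_ops A n" shows "(\<lambda>s. weight_fun (\<lambda>\<mu>. \<mu> - c) (L s)) \<in> hat_diff_ops A (Suc n)"
proof -
  have "(\<lambda>s. W (L s) - weight_fun (\<lambda>_. c) (L s)) \<in> hat_diff_ops A (Suc n)"
    by (rule hat_diff[OF hat_W[OF assms] hat_mono[OF hat_const[OF assms]]]) simp
  moreover have "(\<lambda>s. W (L s) - weight_fun (\<lambda>_. c) (L s)) = (\<lambda>s. weight_fun (\<lambda>\<mu>. \<mu> - c) (L s))"
    by (rule ext, rule poly_mapping_eqI) (simp add: lookup_weight_fun lookup_minus scale_density_simps)
  ultimately show ?thesis by simp
qed

lemma weight_fun_compose: "weight_fun a (weight_fun b s) = weight_fun (\<lambda>\<mu>. a \<mu> * b \<mu>) s" for s :: "('a, 'd) densum"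
  by (rule poly_mapping_eqI) (simp add: lookup_weight_fun scale_density_simps)

lemma hat_power:
  assumes "L \<in> hat_diff_ops A n" shows "(\<lambda>s. weight_fun (\<lambda>\<mu>. (\<mu> - c) ^ k) (L s)) \<in> hat_diff_ops A (n + k)"
proof (induction k)
  case 0
  show ?case using hat_const[OF assms, of 1] by simp
next
  case (Suc k)
  then show ?case using hat_shift[OF Suc, of c] by (simp add: weight_fun_compose)
qed

lemma hat_0: "(\<lambda>_. 0) \<in> hat_diff_ops A n"
proof -
  have "(\<lambda>_. 0) \<in> DO (Suc n)" by (rule DO_I) (auto intro: zero_density exI[of _ "\<lambda>_ _. 0"] ldo_0)
  from hat_cong[OF hat_Q[OF this] rep_op_eq[OF rep_Q[OF this]]] show ?thesis by (simp add: rep_def)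
qed

text \<open>The operator starts at degree 0, so each power of the shifted weight up to
  \<open>n\<close> stays within total degree \<open>n\<close>.\<close>

lemma hat_poly:
  assumes "L \<in> hat_diff_ops A 0" shows "(\<lambda>s. weight_fun (\<lambda>\<mu>. \<Sum>k=1..n. a k * (\<mu> - c) ^ k) (L s)) \<in> hat_diff_ops A n"
proof -
  have "(\<lambda>s. weight_fun (\<lambda>\<mu>. \<Sum>k\<in>B. a k * (\<mu> - c) ^ k) (L s)) \<in> hat_diff_ops A n" if "finite B" "B \<subseteq> {1..n}" for B
    using that
  proof (induction B)
    case empty
    have "weight_fun (\<lambda>_. 0) t = 0" for t :: "('a, 'd) densum"
      by (rule poly_mapping_eqI) (simp add: lookup_weight_fun scale_density_simps)
    then show ?case using hat_0 by simp
  next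
    case (insert k B)
    have "(\<lambda>s. weight_fun (\<lambda>_. a k) (weight_fun (\<lambda>\<mu>. (\<mu> - c) ^ k) (L s))) \<in> hat_diff_ops A n"
      using insert.prems by (intro hat_const hat_mono[OF hat_power[OF assms]]) auto
    then have "(\<lambda>s. weight_fun (\<lambda>_. a k) (weight_fun (\<lambda>\<mu>. (\<mu> - c) ^ k) (L s)) + weight_fun (\<lambda>\<mu>. \<Sum>k\<in>B. a k * (\<mu> - c) ^ k) (L s)) \<in> hat_diff_ops A n"
      using insert by (intro hat_add) auto
    moreover have "weight_fun (\<lambda>_. a k) (weight_fun (\<lambda>\<mu>. (\<mu> - c) ^ k) t) + weight_fun (\<lambda>\<mu>. \<Sum>k\<in>B. a k * (\<mu> - c) ^ k) t
      = weight_fun (\<lambda>\<mu>. \<Sum>k\<in>insert k B. a k * (\<mu> - c) ^ k) t" for t :: "('a, 'd) densum"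
      by (rule poly_mapping_eqI) (simp add: lookup_weight_fun lookup_add scale_density_simps insert.hyps)
    ultimately show ?case by simp
  qed
  then show ?thesis by simp
qed

section \<open>The pairing and adjoints on the algebra\<close>

abbreviation "CAlg \<equiv> compact_density_algebra T A"

lemma CAlg_iff: "s \<in> CAlg \<longleftrightarrow> s \<in> Alg \<and> (\<forall>\<mu>. cpt (lu s \<mu>))"
  by (simp add: compact_density_algebra_def cpt_def)

lemma rp_1: "rp 1 = \<rho>"
proof (intro ext)
  fix \<kappa> x show "rp 1 \<kappa> x = \<rho> \<kappa> x"
    using rho_pos[of \<kappa> x] densitiesD(3)[OF rho_density, of \<kappa> x]
    by (cases "\<kappa> \<in> A \<and> x \<in> target \<kappa>") (auto simp: density_powr_def)
qed

lemma rho_split: "(rp \<mu> * a) * (rp (1 - \<mu>) * b) = \<rho> * (a * b)"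
  unfolding rp_shift by (simp add: rp_1)

text \<open>An operator that acts within each weight creates no new weights, so any finite set
  containing the weights of \<open>s\<close> can index the sum.\<close>

lemma pairing_rep_left:
  assumes L: "rep L F" "pencil F" and s: "s \<in> Alg" and t: "t \<in> Alg" and B: "finite B" "Poly_Mapping.keys s \<subseteq> B"
  shows "pairing T A (L s) t = (\<Sum>\<mu>\<in>B. density_integral T A (\<rho> * (F \<mu> (rp (- \<mu>) * lu s \<mu>) * (rp (- (1 - \<mu>)) * lu t (1 - \<mu>)))))"
proof -
  have F0: "F \<mu> 0 = 0" for \<mu>
  proof -
    obtain k where "F \<mu> \<in> DO k" using L(2) unfolding pencil_def by blast
    then show ?thesis by (rule DO_linear_0)
  qed
  have look: "lu (L s) \<mu> * lu t (1 - \<mu>) = \<rho> * (F \<mu> (rp (- \<mu>) * lu s \<mu>) * (rp (- (1 - \<mu>)) * lu t (1 - \<mu>)))" for \<mu>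
    using rho_split[of \<mu> "F \<mu> (rp (- \<mu>) * lu s \<mu>)" "rp (- (1 - \<mu>)) * lu t (1 - \<mu>)"]
    unfolding rp_cancel(1)[OF Alg_lookup[OF t]] repD[OF L(1) s, symmetric] .
  have "Poly_Mapping.keys (L s) \<subseteq> B"
  proof
    fix \<mu> assume "\<mu> \<in> Poly_Mapping.keys (L s)"
    then have "lu s \<mu> \<noteq> 0" using F0 by (auto simp: in_keys_iff repD[OF L(1) s])
    then show "\<mu> \<in> B" using B(2) by (auto simp: in_keys_iff)
  qed
  then have "pairing T A (L s) t = (\<Sum>\<mu>\<in>B. density_integral T A (lu (L s) \<mu> * lu t (1 - \<mu>)))"
    unfolding pairing_def by (intro sum.mono_neutral_left B(1)) (auto simp: in_keys_iff density_integral_0)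
  then show ?thesis by (simp only: look)
qed

lemma pairing_rep_right:
  assumes L: "rep L F" and s: "s \<in> Alg" and t: "t \<in> Alg" and B: "finite B" "Poly_Mapping.keys s \<subseteq> B"
  shows "pairing T A s (L t) = (\<Sum>\<mu>\<in>B. density_integral T A (\<rho> * ((rp (- \<mu>) * lu s \<mu>) * F (1 - \<mu>) (rp (- (1 - \<mu>)) * lu t (1 - \<mu>)))))"
proof -
  have look: "lu s \<mu> * lu (L t) (1 - \<mu>) = \<rho> * ((rp (- \<mu>) * lu s \<mu>) * F (1 - \<mu>) (rp (- (1 - \<mu>)) * lu t (1 - \<mu>)))" for \<mu>
    using rho_split[of \<mu> "rp (- \<mu>) * lu s \<mu>" "F (1 - \<mu>) (rp (- (1 - \<mu>)) * lu t (1 - \<mu>))"]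
    unfolding rp_cancel(1)[OF Alg_lookup[OF s]] repD[OF L t, symmetric] .
  have "pairing T A s (L t) = (\<Sum>\<mu>\<in>B. density_integral T A (lu s \<mu> * lu (L t) (1 - \<mu>)))"
    unfolding pairing_def using B(2) by (intro sum.mono_neutral_left B(1)) (auto simp: in_keys_iff density_integral_0)
  then show ?thesis by (simp only: look)
qed

lemma CAlg_single:
  assumes "f \<in> Fun" "cpt f" shows "sg \<mu> (rp \<mu> * f) \<in> CAlg"
  unfolding CAlg_iff using Alg_single[OF rp_Fun_mult[OF assms(1)]] cpt_mult(3)[OF assms(2)] cpt_0
  by (auto simp: lookup_single when_def)

text \<open>One explicit candidate shows that the choice in \<open>adjoint_op\<close> is made from a
  nonempty set, so the chosen operator has the adjoint property; \<open>adjrel_unique\<close> then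
  identifies it with the candidate at every weight. The weight \<open>1 - \<mu>\<close> appears
  because the pairing joins complementary weights.\<close>

lemma adjoint_rep:
  assumes L: "rep L F" "pencil F" and L': "rep L' F'" "pencil F'" "L' \<in> hat_diff_ops A m"
    and adj: "\<And>\<mu>. adjrel (F \<mu>) (F' (1 - \<mu>))"
  shows "rep (adjoint_op T A L) F'"
proof -
  define P where "P = (\<lambda>L'. (\<exists>m. L' \<in> hat_diff_ops A m) \<and> (\<forall>s\<in>CAlg. \<forall>t\<in>CAlg. pairing T A (L s) t = pairing T A s (L' t)))"
  have "pairing T A (L s) t = pairing T A s (L' t)" if st: "s \<in> CAlg" "t \<in> CAlg" for s t
  proof -
    have a: "s \<in> Alg" "t \<in> Alg" and c: "cpt (lu s \<mu>)" "cpt (lu t \<mu>)" for \<mu> using st by (auto simp: CAlg_iff)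
    have "density_integral T A (\<rho> * (F \<mu> (rp (- \<mu>) * lu s \<mu>) * (rp (- (1 - \<mu>)) * lu t (1 - \<mu>)))) =
       density_integral T A (\<rho> * ((rp (- \<mu>) * lu s \<mu>) * F' (1 - \<mu>) (rp (- (1 - \<mu>)) * lu t (1 - \<mu>))))" for \<mu>
      using adj[of \<mu>] rp_mult_Fun[OF Alg_lookup[OF a(1)]] rp_mult_Fun[OF Alg_lookup[OF a(2)]] cpt_mult(3)[OF c(1)] cpt_mult(3)[OF c(2)]
      unfolding adjrel_def by blast
    then show ?thesis
      unfolding pairing_rep_left[OF L a finite_keys subset_refl] pairing_rep_right[OF L'(1) a finite_keys subset_refl] by simp
  qed
  then have "P L'" using L'(3) unfolding P_def by blast
  moreover have "adjoint_op T A L = (SOME L'. P L')" unfolding adjoint_op_def P_def ..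
  ultimately have "P (adjoint_op T A L)" by (metis someI)
  then obtain m' where hat: "adjoint_op T A L \<in> hat_diff_ops A m'"
    and pair: "\<forall>s\<in>CAlg. \<forall>t\<in>CAlg. pairing T A (L s) t = pairing T A s (adjoint_op T A L t)" unfolding P_def by blast
  obtain G where G: "rep (adjoint_op T A L) G" "\<And>\<mu>. G \<mu> \<in> DO (Suc m')" using hat_rep[OF hat] by blast
  \<comment> \<open>Homogeneous densities of weights \<open>\<mu>\<close> and
    \<open>1 - \<mu>\<close> isolate a single summand of the pairing.\<close>
  have adjG: "adjrel (F \<mu>) (G (1 - \<mu>))" for \<mu>
    unfolding adjrel_def
  proof (intro ballI impI)
    fix f g assume fg: "f \<in> Fun" "g \<in> Fun" "cpt f" "cpt g"
    let ?s = "sg \<mu> (rp \<mu> * f)" and ?t = "sg (1 - \<mu>) (rp (1 - \<mu>) * g)"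
    have c: "?s \<in> CAlg" "?t \<in> CAlg" using CAlg_single fg by auto
    then have a: "?s \<in> Alg" "?t \<in> Alg" by (auto simp: CAlg_iff)
    have k: "Poly_Mapping.keys ?s \<subseteq> {\<mu>}" by simp
    have "pairing T A (L ?s) ?t = density_integral T A (\<rho> * (F \<mu> f * g))"
      unfolding pairing_rep_left[OF L a _ k, simplified lookup_single_eq, OF finite.insertI[OF finite.emptyI]]
      by (simp only: sum.insert finite.emptyI empty_iff not_False_eq_True sum.empty add_0_right lookup_single_eq rp_cancel(2)[OF fg(1)] rp_cancel(2)[OF fg(2)])
    moreover have "pairing T A ?s (adjoint_op T A L ?t) = density_integral T A (\<rho> * (f * G (1 - \<mu>) g))"
      unfolding pairing_rep_right[OF G(1) a _ k, simplified lookup_single_eq, OF finite.insertI[OF finite.emptyI]]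
      by (simp only: sum.insert finite.emptyI empty_iff not_False_eq_True sum.empty add_0_right lookup_single_eq rp_cancel(2)[OF fg(1)] rp_cancel(2)[OF fg(2)])
    ultimately show "density_integral T A (\<rho> * (F \<mu> f * g)) = density_integral T A (\<rho> * (f * G (1 - \<mu>) g))"
      using pair c by simp
  qed
  show ?thesis
  proof (rule rep_cong[OF G(1)])
    fix \<nu> f assume f: "f \<in> Fun"
    obtain k where k: "F' (1 - (1 - \<nu>)) \<in> DO k" using L'(2) unfolding pencil_def by blast
    from adjrel_unique[OF adj adjG k G(2) f] show "F' \<nu> f = G \<nu> f" by simp
  qed
qed

section \<open>Operators on densities of fixed weight and on functions\<close>

text \<open>Conjugation by the power \<open>lam\<close> of \<open>\<rho>\<close> takes operators on
  densities of weight \<open>lam\<close> to operators on functions; \<open>dop\<close> is the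
  inverse passage.\<close>

definition fop :: "real \<Rightarrow> (('a, 'd) density \<Rightarrow> ('a, 'd) density) \<Rightarrow> ('a, 'd) density \<Rightarrow> ('a, 'd) density" where
  "fop lam D = (\<lambda>f. rp (- lam) * D (rp lam * f))"

definition dop :: "real \<Rightarrow> (('a, 'd) density \<Rightarrow> ('a, 'd) density) \<Rightarrow> ('a, 'd) density \<Rightarrow> ('a, 'd) density" where
  "dop lam E = (\<lambda>d. rp lam * E (rp (- lam) * d))"

lemma fop_dop: "E \<in> DO k \<Longrightarrow> f \<in> Fun \<Longrightarrow> fop lam (dop lam E) f = E f"
  unfolding fop_def dop_def using rp_cancel(2)[of f 0 lam] rp_cancel(2)[of "E f" 0 lam] DO_Fun[of E k f] by simp

lemma diff_ops_in: "D \<in> diff_ops A n lam \<Longrightarrow> d \<in> densities A lam \<Longrightarrow> D d \<in> densities A lam"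
  unfolding diff_ops_def by blast

lemma dop_fop:
  assumes "D \<in> diff_ops A n lam" "d \<in> densities A lam" shows "dop lam (fop lam D) d = D d"
  unfolding fop_def dop_def rp_cancel(1)[OF assms(2)] rp_cancel(1)[OF diff_ops_in[OF assms]] ..

lemma fop_DO:
  assumes D: "D \<in> diff_ops A n lam" shows "fop lam D \<in> DO (Suc n)"
proof (rule DO_I)
  show "fop lam D f \<in> Fun" if "f \<in> Fun" for f
    unfolding fop_def by (rule rp_mult_Fun[OF diff_ops_in[OF D rp_Fun_mult[OF that]]])
  fix \<kappa> assume k: "\<kappa> \<in> A"
  obtain S where S: "\<forall>I. smooth_on (target \<kappa>) (S I)"
    "\<forall>d\<in>densities A lam. \<forall>x\<in>target \<kappa>. D d \<kappa> x = (\<Sum>I | length I \<le> n. S I x * partials I (d \<kappa>) x)"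
    using D k unfolding diff_ops_def by blast
  define M where "M = (\<lambda>f x. \<Sum>I | length I < Suc n. S I x * partials I f x)"
  have M0: "ldo (target \<kappa>) (Suc n) M" unfolding M_def
    by (rule ldo_intro[of _ S]) (use S(1) in auto)
  have "ldo (target \<kappa>) (Suc n) (\<lambda>f x. \<rho> \<kappa> x powr (- lam) * M (\<lambda>y. \<rho> \<kappa> y powr (- (- lam)) * f y) x)"
    by (rule ldo_powr_conjugation[OF open_target[OF k] rho_smooth[OF k] rho_pos[OF k] M0])
  moreover have "fop lam D f \<kappa> x = \<rho> \<kappa> x powr (- lam) * M (\<lambda>y. \<rho> \<kappa> y powr (- (- lam)) * f \<kappa> y) x"
    if f: "f \<in> Fun" and x: "x \<in> target \<kappa>" for f x
  proof -
    have e: "(rp lam * f) \<kappa> = (\<lambda>y. \<rho> \<kappa> y powr (- (- lam)) * f \<kappa> y)" by (simp add: times_fun_def density_powr_def)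
    have "D (rp lam * f) \<kappa> x = M ((rp lam * f) \<kappa>) x"
      using S(2) rp_Fun_mult[OF f] x by (simp add: M_def less_Suc_eq_le)
    then show ?thesis unfolding fop_def times_fun_apply[of "rp (- lam)"] e by (simp add: density_powr_def[of \<rho> "- lam"])
  qed
  ultimately show "\<exists>L. ldo (target \<kappa>) (Suc n) L \<and> (\<forall>f\<in>Fun. \<forall>x\<in>target \<kappa>. fop lam D f \<kappa> x = L (f \<kappa>) x)"
    by blast
qed

lemma diff_ops_cong:
  assumes "D \<in> diff_ops A n lam" "\<And>d. d \<in> densities A lam \<Longrightarrow> D' d = D d" shows "D' \<in> diff_ops A n lam"
  using assms unfolding diff_ops_def by simp

lemma dop_diff_ops:
  assumes E: "E \<in> DO (Suc n)" shows "dop lam E \<in> diff_ops A n lam"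
  unfolding diff_ops_def
proof (intro CollectI conjI ballI)
  show "dop lam E d \<in> densities A lam" if "d \<in> densities A lam" for d
    unfolding dop_def by (rule rp_Fun_mult[OF DO_Fun[OF E rp_mult_Fun[OF that]]])
  fix \<kappa> assume k: "\<kappa> \<in> A"
  obtain L where L: "ldo (target \<kappa>) (Suc n) L" "\<forall>f\<in>Fun. \<forall>x\<in>target \<kappa>. E f \<kappa> x = L (f \<kappa>) x"
    using DO_local[OF E k] by blast
  have "ldo (target \<kappa>) (Suc n) (\<lambda>f x. \<rho> \<kappa> x powr lam * L (\<lambda>y. \<rho> \<kappa> y powr (- lam) * f y) x)"
    by (rule ldo_powr_conjugation[OF open_target[OF k] rho_smooth[OF k] rho_pos[OF k] L(1)])
  then obtain S where S0: "ldo_rep (target \<kappa>) (Suc n) (\<lambda>f x. \<rho> \<kappa> x powr lam * L (\<lambda>y. \<rho> \<kappa> y powr (- lam) * f y) x) S"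
    unfolding ldo_def by blast
  note S = ldo_repD[OF S0]
  show "\<exists>S. (\<forall>I. smooth_on (target \<kappa>) (S I)) \<and> (\<forall>d\<in>densities A lam. \<forall>x\<in>target \<kappa>.
      dop lam E d \<kappa> x = (\<Sum>I | length I \<le> n. S I x * partials I (d \<kappa>) x))"
  proof (intro exI conjI allI ballI)
    show "smooth_on (target \<kappa>) (S I)" for I by (rule S(1))
    fix d x assume d: "d \<in> densities A lam" and x: "x \<in> target \<kappa>"
    have e: "(rp (- lam) * d) \<kappa> = (\<lambda>y. \<rho> \<kappa> y powr (- lam) * d \<kappa> y)" by (simp add: times_fun_def density_powr_def)
    have "dop lam E d \<kappa> x = \<rho> \<kappa> x powr lam * L (\<lambda>y. \<rho> \<kappa> y powr (- lam) * d \<kappa> y) x"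
      using L(2) rp_mult_Fun[OF d] x unfolding dop_def times_fun_apply[of "rp lam"] e[symmetric] by (simp add: density_powr_def[of \<rho> lam])
    then show "dop lam E d \<kappa> x = (\<Sum>I | length I \<le> n. S I x * partials I (d \<kappa>) x)"
      using S(2)[OF density_smooth[OF d k] x] by (simp add: less_Suc_eq_le)
  qed
qed

lemma rep_P_lift:
  assumes D: "D \<in> diff_ops A n lam" shows "rep (P_lift \<rho> lam D) (\<lambda>_. fop lam D)"
  unfolding rep_def P_lift_def
proof (intro ballI allI)
  fix s \<mu> assume s: "s \<in> Alg"
  have D_eq: "rp (\<mu> - lam) * D (rp (lam - \<mu>) * d) = rp \<mu> * fop lam D (rp (- \<mu>) * d)" for d
    unfolding fop_def by (simp add: rp_add)
  have "rp (\<mu> - lam) * D (rp (lam - \<mu>) * 0) = 0"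
    unfolding D_eq using DO_linear_0[OF fop_DO[OF D]] by (simp only: mult_zero_right)
  then show "lu (of_pencil (\<lambda>\<mu> d. rp (\<mu> - lam) * D (rp (lam - \<mu>) * d)) s) \<mu> = rp \<mu> * fop lam D (rp (- \<mu>) * lu s \<mu>)"
    unfolding D_eq[symmetric] by (rule lookup_of_pencil)
qed

definition lieX :: "('a, 'd) vfield \<Rightarrow> real \<Rightarrow> ('a, 'd) density \<Rightarrow> ('a, 'd) density" where
  "lieX K \<mu> f = vder K f + scale_density \<mu> (vdiv K * f)"

lemma lieX_DO: "K \<in> vector_fields A \<Longrightarrow> lieX K \<mu> \<in> DO 2"
  unfolding lieX_def[abs_def]
  by (rule DO_add[OF vder_DO DO_mono[OF DO_scale[OF DO_multop[OF vder_adjoint(1)]]]]) simp_all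

lemma lie_density_lieX:
  assumes "K \<in> vector_fields A" "d \<in> densities A \<mu>"
  shows "lie_density A K \<mu> d = rp \<mu> * lieX K \<mu> (rp (- \<mu>) * d)"
  using lie_density_rho[OF assms(1) rp_mult_Fun[OF assms(2)], of \<mu>] unfolding lieX_def rp_cancel(1)[OF assms(2)] .

lemma rep_lie_op:
  assumes K: "K \<in> vector_fields A" shows "rep (lie_op A K) (lieX K)"
  unfolding rep_def lie_op_def
proof (intro ballI allI)
  fix s \<mu> assume s: "s \<in> Alg"
  have "lie_density A K \<mu> 0 = 0"
    unfolding lie_density_lieX[OF K zero_density] using DO_linear_0[OF lieX_DO[OF K]] by (simp only: mult_zero_right)
  then show "lu (of_pencil (lie_density A K) s) \<mu> = rp \<mu> * lieX K \<mu> (rp (- \<mu>) * lu s \<mu>)"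
    unfolding lie_density_lieX[OF K Alg_lookup[OF s], symmetric] by (rule lookup_of_pencil)
qed

lemma rep_ad_op:
  assumes K: "K \<in> vector_fields A" and L: "rep L F" "pencil F"
  shows "rep (ad_op A K L) (\<lambda>\<mu> f. lieX K \<mu> (F \<mu> f) - F \<mu> (lieX K \<mu> f))"
  unfolding rep_def ad_op_def
proof (intro ballI allI)
  fix s \<mu> assume s: "s \<in> Alg"
  have Ls: "L s \<in> Alg" by (rule rep_Alg[OF L s])
  have ls: "lie_op A K s \<in> Alg" by (rule rep_Alg[OF rep_lie_op[OF K] pencilI[OF lieX_DO[OF K]] s])
  obtain k where k: "F \<mu> \<in> DO k" using L(2) unfolding pencil_def by blast
  let ?f = "rp (- \<mu>) * lu s \<mu>"
  have f: "?f \<in> Fun" by (rule rp_mult_Fun[OF Alg_lookup[OF s]])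
  show "lu (lie_op A K (L s) - L (lie_op A K s)) \<mu> = rp \<mu> * (lieX K \<mu> (F \<mu> ?f) - F \<mu> (lieX K \<mu> ?f))"
    unfolding lookup_minus repD[OF rep_lie_op[OF K] Ls] repD[OF L(1) ls] repD[OF L(1) s] repD[OF rep_lie_op[OF K] s]
      rp_cancel(2)[OF DO_Fun[OF k f]] rp_cancel(2)[OF DO_Fun[OF lieX_DO[OF K] f]] right_diff_distrib ..
qed

lemma fop_ad_weight:
  assumes K: "K \<in> vector_fields A" and D: "D \<in> diff_ops A n lam" and f: "f \<in> Fun"
  shows "fop lam (ad_weight A K lam D) f = lieX K lam (fop lam D f) - fop lam D (lieX K lam f)"
proof -
  have d: "rp lam * f \<in> densities A lam" by (rule rp_Fun_mult[OF f])
  have Dd: "D (rp lam * f) \<in> densities A lam" by (rule diff_ops_in[OF D d])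
  have X: "rp (- lam) * lie_density A K lam e = lieX K lam (rp (- lam) * e)" if "e \<in> densities A lam" for e
    unfolding lie_density_lieX[OF K that] by (rule rp_cancel(2)[OF DO_Fun[OF lieX_DO[OF K] rp_mult_Fun[OF that]]])
  show ?thesis
    unfolding fop_def ad_weight_def right_diff_distrib X[OF Dd] lie_density_lieX[OF K d] rp_cancel(2)[OF f] ..
qed

end

section \<open>The family of liftings\<close>

lemma density_eqI: "(\<And>\<kappa> x. f \<kappa> x = g \<kappa> x) \<Longrightarrow> f = g" for f g :: "('a, 'd::finite) density"
  by blast

context volume_manifold begin

definition Ffam where
  "Ffam a b C D E E' \<mu> f = scale_density (a \<mu>) (E f) + scale_density (b \<mu>) (E' f)
     + scale_density (C \<mu>) (E (one_density A) * f) + scale_density (D \<mu>) (E' (one_density A) * f)"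

text \<open>An explicit adjoint \<open>E'\<close> on functions is carried along with
  \<open>D\<close>; it stands in for the choice in \<open>adjoint_op\<close> and has a known
  order.\<close>

definition adjoint_pair :: "nat \<Rightarrow> real \<Rightarrow> (('a, 'd) density \<Rightarrow> ('a, 'd) density) \<Rightarrow> (('a, 'd) density \<Rightarrow> ('a, 'd) density) \<Rightarrow> bool" where
  "adjoint_pair n lam D E' \<longleftrightarrow> D \<in> diff_ops A n lam \<and> E' \<in> DO (Suc n) \<and> adjrel (fop lam D) E'"

lemma exists_adjoint_pair:
  assumes "D \<in> diff_ops A n lam"
  obtains E' where "adjoint_pair n lam D E'" "(\<lambda>f. fop lam D f - scale_density ((-1) ^ n) (E' f)) \<in> DO n"
  using exists_adjoint[OF fop_DO[OF assms]] assms unfolding adjoint_pair_def by blast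

text \<open>The lower order of the difference is proved for the constructed adjoint, and uniqueness
  transfers it to any other.\<close>

lemma adjoint_pair_symbol:
  assumes "adjoint_pair n lam D E'" shows "(\<lambda>f. fop lam D f - scale_density ((-1) ^ n) (E' f)) \<in> DO n"
proof -
  note p = assms[unfolded adjoint_pair_def]
  obtain E'' where E'': "adjoint_pair n lam D E''" "(\<lambda>f. fop lam D f - scale_density ((-1) ^ n) (E'' f)) \<in> DO n"
    using exists_adjoint_pair p by blast
  note p' = E''(1)[unfolded adjoint_pair_def]
  show ?thesis
    by (rule DO_cong[OF E''(2)])
      (use adjrel_unique[of "fop lam D" E' E'' "Suc n" "Suc n"] p p' in auto)
qed

lemma rep_adjoint_P:
  assumes "adjoint_pair n lam D E'" shows "rep (adjoint_op T A (P_lift \<rho> lam D)) (\<lambda>_. E')"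
proof -
  note p = assms[unfolded adjoint_pair_def]
  show ?thesis
    by (rule adjoint_rep[OF rep_P_lift pencil_const[OF fop_DO] rep_Q pencil_const hat_Q]) (use p in blast)+
qed

text \<open>The constant 1 has weight 0, where the identification by powers of \<open>\<rho>\<close>
  changes nothing.\<close>

lemma value_at_one_rep:
  assumes "rep L (\<lambda>_. E)" "E \<in> DO k" shows "value_at_one A L = sg 0 (E (one_density A))"
proof (rule poly_mapping_eqI)
  fix \<mu>
  have a: "sg 0 (one_density A) \<in> Alg" by (rule Alg_single[OF one_density_in])
  show "lu (value_at_one A L) \<mu> = lu (sg 0 (E (one_density A))) \<mu>"
  proof (cases "\<mu> = 0")
    case True
    have "rp 0 * E (rp (- 0) * one_density A) = E (one_density A)"
      unfolding minus_zero one_eq_rho_powr density_one_mult[OF one_density_in] density_one_mult[OF DO_Fun[OF assms(2) one_density_in]] ..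
    then show ?thesis unfolding value_at_one_def repD[OF assms(1) a] True lookup_single_eq .
  next
    case False
    then have z: "lu (sg 0 (one_density A)) \<mu> = 0" "lu (sg 0 (E (one_density A))) \<mu> = 0" by (auto simp: lookup_single when_def)
    show ?thesis unfolding value_at_one_def repD[OF assms(1) a] z mult_zero_right DO_linear_0[OF assms(2)] ..
  qed
qed

lemma rep_family:
  assumes "adjoint_pair n lam D E'"
  shows "rep (family_lift T A \<rho> lam n b c d D)
    (Ffam (\<lambda>\<mu>. 1 - b * (\<mu> - lam)) (\<lambda>\<mu>. (-1) ^ n * b * (\<mu> - lam)) (\<lambda>\<mu>. \<Sum>k=1..n. c k * (\<mu> - lam) ^ k)
       (\<lambda>\<mu>. \<Sum>k=1..n. d k * (\<mu> - lam) ^ k) (fop lam D) E')"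
proof -
  note p = assms[unfolded adjoint_pair_def]
  have P: "rep (P_lift \<rho> lam D) (\<lambda>_. fop lam D)" using rep_P_lift p by blast
  note P' = rep_adjoint_P[OF assms]
  have E: "fop lam D \<in> DO (Suc n)" "E' \<in> DO (Suc n)" using fop_DO p by blast+
  show ?thesis
    unfolding family_lift_def Ffam_def[abs_def] value_at_one_rep[OF P E(1)] value_at_one_rep[OF P' E(2)]
    by (intro rep_add rep_weight_fun P P' rep_mult)
qed

lemma rep_disting:
  assumes "adjoint_pair n lam D E'"
  shows "rep (disting_lift T A \<rho> lam n D)
    (\<lambda>\<mu> f. scale_density ((\<mu> + lam - 1) / (2 * lam - 1)) (fop lam D f) + scale_density ((-1) ^ n * ((lam - \<mu>) / (2 * lam - 1))) (E' f))"
proof -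
  have P: "rep (P_lift \<rho> lam D) (\<lambda>_. fop lam D)" using rep_P_lift assms unfolding adjoint_pair_def by blast
  show ?thesis unfolding disting_lift_def by (intro rep_add rep_weight_fun P rep_adjoint_P[OF assms])
qed

lemma Ffam_DO:
  assumes "E \<in> DO (Suc n)" "E' \<in> DO (Suc n)" shows "Ffam a b C D E E' \<mu> \<in> DO (Suc n)"
  unfolding Ffam_def[abs_def]
  by (intro DO_add DO_scale assms DO_mono[OF DO_scale[OF DO_multop]] DO_Fun[OF assms(1)] DO_Fun[OF assms(2)] one_density_in) auto

lemma hat_mult: "h \<in> Fun \<Longrightarrow> (\<lambda>s. sg 0 h * s) \<in> hat_diff_ops A 0"
proof -
  assume h: "h \<in> Fun"
  have m: "(\<lambda>f. h * f) \<in> DO (Suc 0)" using DO_multop[OF h] by simp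
  show ?thesis by (rule hat_cong[OF hat_Q[OF m] rep_op_eq[OF rep_Q[OF m] rep_mult]])
qed

text \<open>For \<open>b \<noteq> 0\<close> neither of the first two terms need have total degree
  \<open>n\<close>. Their sum is the lifting by \<open>\<rho>\<close> minus
  \<open>b (w - lam) Z\<close>, where \<open>Z\<close> is that lifting minus
  \<open>(-1)\<^sup>n\<close> times its adjoint; as \<open>Z\<close> has order at most
  \<open>n - 1\<close>, the degree is \<open>n\<close>. For this cancellation both coefficients
  share the constant \<open>b\<close>.\<close>

lemma family_hat:
  assumes p: "adjoint_pair n lam D E'" and n: "n \<ge> 1"
  shows "family_lift T A \<rho> lam n b c d D \<in> hat_diff_ops A n"
proof -
  obtain m where m: "n = Suc m" using n by (cases n) auto
  have E: "fop lam D \<in> DO (Suc n)" "E' \<in> DO (Suc n)" using fop_DO p unfolding adjoint_pair_def by blast+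
  let ?Z = "\<lambda>f. fop lam D f - scale_density ((-1) ^ n) (E' f)"
  have Z: "?Z \<in> DO (Suc m)" using adjoint_pair_symbol[OF p] unfolding m .
  let ?C = "\<lambda>\<mu>. \<Sum>k=1..n. c k * (\<mu> - lam) ^ k" and ?D = "\<lambda>\<mu>. \<Sum>k=1..n. d k * (\<mu> - lam) ^ k"
  let ?L = "\<lambda>s. Q (fop lam D) s + weight_fun (\<lambda>_. - b) (weight_fun (\<lambda>\<mu>. \<mu> - lam) (Q ?Z s))
    + weight_fun ?C (sg 0 (fop lam D (one_density A)) * s) + weight_fun ?D (sg 0 (E' (one_density A)) * s)"
  have 1: "?L \<in> hat_diff_ops A n"
    using hat_shift[OF hat_Q[OF Z], of lam] unfolding m[symmetric]
    by (intro hat_add hat_const hat_poly hat_mult hat_Q E DO_Fun[OF E(1)] DO_Fun[OF E(2)] one_density_in)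
  have 2: "rep ?L (\<lambda>\<mu> f. fop lam D f + scale_density (- b) (scale_density (\<mu> - lam) (?Z f))
     + scale_density (?C \<mu>) (fop lam D (one_density A) * f) + scale_density (?D \<mu>) (E' (one_density A) * f))"
    by (intro rep_add rep_weight_fun[where a = "\<lambda>_. - b"] rep_weight_fun rep_Q[OF E(1)] rep_Q[OF Z] rep_mult)
  have "rep (family_lift T A \<rho> lam n b c d D) (\<lambda>\<mu> f. fop lam D f + scale_density (- b) (scale_density (\<mu> - lam) (?Z f))
     + scale_density (?C \<mu>) (fop lam D (one_density A) * f) + scale_density (?D \<mu>) (E' (one_density A) * f))"
    by (rule rep_cong[OF rep_family[OF p, of b c d]])
      (rule density_eqI, simp add: Ffam_def scale_density_def algebra_simps)
  from hat_cong[OF 1 rep_op_eq[OF 2 this]] show ?thesis .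
qed

text \<open>At weight \<open>lam\<close> every correction has a factor \<open>\<mu> - lam\<close>
  and disappears. Linearity comes from uniqueness of the adjoint: the combination of two adjoints is
  an adjoint of the combination.\<close>

lemma family_pencil_lifting:
  assumes n: "n \<ge> 1" shows "regular_lifting A n lam (family_lift T A \<rho> lam n b c d)"
  unfolding regular_lifting_def pencil_lifting_def
proof (intro conjI ballI allI impI)
  fix D assume D: "D \<in> diff_ops A n lam"
  obtain E' where p: "adjoint_pair n lam D E'" using exists_adjoint_pair[OF D] by blast
  show h: "family_lift T A \<rho> lam n b c d D \<in> hat_diff_ops A n" by (rule family_hat[OF p n])
  then show "family_lift T A \<rho> lam n b c d D \<in> weight_zero_operators A" by (simp add: hat_diff_ops_def)
  fix e assume e: "e \<in> densities A lam"
  \<comment> \<open>The sum starts at \<open>k = 1\<close>, so no term \<open>0 ^ 0 = 1\<close>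
    occurs.\<close>
  have z: "(\<Sum>k=1..n. g k * (lam - lam) ^ k) = 0" for g :: "nat \<Rightarrow> real"
    by (rule sum.neutral) (auto simp: power_0_left)
  have "restrict_weight (family_lift T A \<rho> lam n b c d D) lam e = dop lam (fop lam D) e"
    unfolding rep_restrict[OF rep_family[OF p] e] dop_def Ffam_def z by (simp add: scale_density_simps)
  then show "restrict_weight (family_lift T A \<rho> lam n b c d D) lam e = D e" using dop_fop[OF D e] by simp
next
  fix D1 D2 D3 r assume D: "D1 \<in> diff_ops A n lam" "D2 \<in> diff_ops A n lam" "D3 \<in> diff_ops A n lam"
    and eq: "\<forall>d\<in>densities A lam. D3 d = scale_density r (D1 d) + D2 d"
  obtain E1 where p1: "adjoint_pair n lam D1 E1" using exists_adjoint_pair[OF D(1)] by blast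
  obtain E2 where p2: "adjoint_pair n lam D2 E2" using exists_adjoint_pair[OF D(2)] by blast
  define E3 where "E3 = (\<lambda>f. scale_density r (E1 f) + E2 f)"
  have f3: "fop lam D3 f = scale_density r (fop lam D1 f) + fop lam D2 f" if "f \<in> Fun" for f
    unfolding fop_def using eq rp_Fun_mult[OF that, of lam] by (simp add: distrib_left scale_density_simps)
  have 1: "E1 \<in> DO (Suc n)" "E2 \<in> DO (Suc n)" "fop lam D1 \<in> DO (Suc n)" "fop lam D2 \<in> DO (Suc n)"
    "adjrel (fop lam D1) E1" "adjrel (fop lam D2) E2"
    using p1 p2 fop_DO unfolding adjoint_pair_def by blast+
  have "adjrel (\<lambda>f. scale_density r (fop lam D1 f) + fop lam D2 f) E3"
    unfolding E3_def
    by (rule adjrel_add[OF adjrel_scale[OF 1(5,3,1)] 1(6) DO_scale[OF 1(3)] DO_scale[OF 1(1)] 1(4,2)])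
  then have "adjrel (fop lam D3) E3" by (rule adjrel_cong) (use f3 in auto)
  then have p3: "adjoint_pair n lam D3 E3"
    using D(3) DO_add[OF DO_scale[OF 1(1), of r] 1(2)] unfolding adjoint_pair_def E3_def by blast
  let ?F = "family_lift T A \<rho> lam n b c d"
  show "op_eq A (?F D3) (\<lambda>s. weight_fun (\<lambda>_. r) (?F D1 s) + ?F D2 s)"
  proof (rule rep_op_eq[OF rep_family[OF p3] rep_cong[OF rep_add[OF rep_weight_fun[OF rep_family[OF p1]] rep_family[OF p2]]]])
    fix \<mu> f assume f: "f \<in> Fun"
    show "Ffam (\<lambda>\<mu>. 1 - b * (\<mu> - lam)) (\<lambda>\<mu>. (-1) ^ n * b * (\<mu> - lam)) (\<lambda>\<mu>. \<Sum>k=1..n. c k * (\<mu> - lam) ^ k)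
       (\<lambda>\<mu>. \<Sum>k=1..n. d k * (\<mu> - lam) ^ k) (fop lam D3) E3 \<mu> f =
      scale_density r (Ffam (\<lambda>\<mu>. 1 - b * (\<mu> - lam)) (\<lambda>\<mu>. (-1) ^ n * b * (\<mu> - lam)) (\<lambda>\<mu>. \<Sum>k=1..n. c k * (\<mu> - lam) ^ k)
       (\<lambda>\<mu>. \<Sum>k=1..n. d k * (\<mu> - lam) ^ k) (fop lam D1) E1 \<mu> f) +
      Ffam (\<lambda>\<mu>. 1 - b * (\<mu> - lam)) (\<lambda>\<mu>. (-1) ^ n * b * (\<mu> - lam)) (\<lambda>\<mu>. \<Sum>k=1..n. c k * (\<mu> - lam) ^ k)
       (\<lambda>\<mu>. \<Sum>k=1..n. d k * (\<mu> - lam) ^ k) (fop lam D2) E2 \<mu> f"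
      unfolding Ffam_def f3[OF f] f3[OF one_density_in] E3_def
      by (rule density_eqI) (simp add: scale_density_def algebra_simps)
  qed
qed

text \<open>The constant \<open>b\<close> solves
  \<open>1 - b * (\<mu> - lam) = (\<mu> + lam - 1) / (2 * lam - 1)\<close> for all
  \<open>\<mu>\<close>, and the coefficient of the adjoint then comes out right as well.\<close>

lemma family_disting:
  assumes "lam \<noteq> 1 / 2" "D \<in> diff_ops A n lam"
  shows "op_eq A (family_lift T A \<rho> lam n (- 1 / (2 * lam - 1)) (\<lambda>_. 0) (\<lambda>_. 0) D) (disting_lift T A \<rho> lam n D)"
proof -
  obtain E' where p: "adjoint_pair n lam D E'" using exists_adjoint_pair[OF assms(2)] by blast
  have nz: "2 * lam - 1 \<noteq> 0" using assms(1) by auto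
  have 1: "1 - - 1 / (2 * lam - 1) * (\<mu> - lam) = (\<mu> + lam - 1) / (2 * lam - 1)" for \<mu>
    using nz by (simp add: field_simps)
  have 2: "(-1) ^ n * (- 1 / (2 * lam - 1)) * (\<mu> - lam) = (-1) ^ n * ((lam - \<mu>) / (2 * lam - 1))" for \<mu>
    using nz by (simp add: field_simps)
  show ?thesis
    by (rule rep_op_eq[OF rep_family[OF p] rep_cong[OF rep_disting[OF p]]])
      (simp only: Ffam_def 1 2 mult_zero_left sum.neutral_const scale_density_simps add_0_right)
qed

lemma disting_hat:
  assumes "lam \<noteq> 1 / 2" "D \<in> diff_ops A n lam" "n \<ge> 1"
  shows "disting_lift T A \<rho> lam n D \<in> hat_diff_ops A n"
proof -
  obtain E' where p: "adjoint_pair n lam D E'" using exists_adjoint_pair[OF assms(2)] by blast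
  show ?thesis by (rule hat_cong[OF family_hat[OF p assms(3)] family_disting[OF assms(1,2)]])
qed

text \<open>Taking adjoints exchanges \<open>E\<close> with \<open>E'\<close> and
  \<open>\<mu>\<close> with \<open>1 - \<mu>\<close>. Since
  \<open>(1 - \<mu>) + lam - 1 = lam - \<mu>\<close>, the substitution exchanges the two
  coefficients too, up to the sign \<open>(-1)\<^sup>n\<close>.\<close>

lemma disting_selfadjoint:
  assumes lam: "lam \<noteq> 1 / 2" and D: "D \<in> diff_ops A n lam" and n: "n \<ge> 1"
  shows "op_eq A (adjoint_op T A (disting_lift T A \<rho> lam n D)) (\<lambda>s. weight_fun (\<lambda>_. (-1) ^ n) (disting_lift T A \<rho> lam n D s))"
proof -
  obtain E' where p: "adjoint_pair n lam D E'" using exists_adjoint_pair[OF D] by blast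
  define E where "E = fop lam D"
  have E: "E \<in> DO (Suc n)" "E' \<in> DO (Suc n)" "adjrel E E'" "adjrel E' E"
    using p fop_DO adjrel_sym unfolding adjoint_pair_def E_def by blast+
  have nz: "2 * lam - 1 \<noteq> 0" using lam by auto
  let ?a = "\<lambda>\<mu>. (\<mu> + lam - 1) / (2 * lam - 1)" and ?e = "\<lambda>\<mu>. (-1) ^ n * ((lam - \<mu>) / (2 * lam - 1))"
  let ?F = "\<lambda>\<mu> f. scale_density (?a \<mu>) (E f) + scale_density (?e \<mu>) (E' f)"
  have F: "rep (disting_lift T A \<rho> lam n D) ?F" using rep_disting[OF p] unfolding E_def .
  have FD: "?F \<mu> \<in> DO (Suc n)" for \<mu> by (rule DO_add[OF DO_scale[OF E(1)] DO_scale[OF E(2)]])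
  have sq: "(-1::real) ^ n * ((-1) ^ n * t) = t" for t by (simp flip: mult.assoc power_add)
  show ?thesis
  proof (rule rep_op_eq[OF adjoint_rep[OF F pencilI[OF FD] _ _ hat_const[OF disting_hat[OF lam D n]]] rep_weight_fun[OF F]])
    show "rep (\<lambda>s. weight_fun (\<lambda>_. (- 1) ^ n) (disting_lift T A \<rho> lam n D s)) (\<lambda>\<mu> f. scale_density ((-1) ^ n) (?F \<mu> f))"
      by (rule rep_weight_fun[OF F])
    show "pencil (\<lambda>\<mu> f. scale_density ((-1) ^ n) (?F \<mu> f))" by (rule pencilI[OF DO_scale[OF FD]])
    fix \<mu>
    show "adjrel (?F \<mu>) (\<lambda>f. scale_density ((-1) ^ n) (?F (1 - \<mu>) f))"
    proof (rule adjrel_cong[OF adjrel_add[OF adjrel_scale[OF E(3,1,2)] adjrel_scale[OF E(4,2,1)] DO_scale[OF E(1)] DO_scale[OF E(2)] DO_scale[OF E(2)] DO_scale[OF E(1)]] refl])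
      fix f
      have 1: "(lam - (1 - \<mu>)) / (2 * lam - 1) = ?a \<mu>" "?a (1 - \<mu>) = (lam - \<mu>) / (2 * lam - 1)" by (simp_all add: algebra_simps)
      show "scale_density ((-1) ^ n) (?F (1 - \<mu>) f) = scale_density (?a \<mu>) (E' f) + scale_density (?e \<mu>) (E f)"
        unfolding 1 scale_density_simps(1,4) sq by (simp add: add.commute)
    qed
  qed
qed

section \<open>Lie derivatives, adjoints and equivariance\<close>

lemma DO_comm_lieX:
  assumes "E \<in> DO k" "K \<in> vector_fields A" shows "(\<lambda>f. lieX K \<mu> (E f) - E (lieX K \<mu> f)) \<in> DO k"
proof -
  note h = vder_adjoint(1)[OF assms(2)]
  have "(\<lambda>f. (vder K (E f) - E (vder K f)) + scale_density \<mu> (vdiv K * E f - E (vdiv K * f))) \<in> DO k"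
    by (rule DO_add[OF DO_commutator_vder[OF assms] DO_scale[OF DO_diff[OF DO_mult[OF assms(1) h] DO_mult_pre[OF assms(1) h]]]])
  then show ?thesis
  proof (rule DO_cong)
    fix f assume f: "f \<in> Fun"
    have "E (lieX K \<mu> f) = E (vder K f) + scale_density \<mu> (E (vdiv K * f))"
      unfolding lieX_def
      by (simp only: DO_linear(2)[OF assms(1) vder_Fun[OF assms(2) f] Fun_scale[OF Fun_mult[OF h f]]] DO_linear(1)[OF assms(1) Fun_mult[OF h f]])
    then show "lieX K \<mu> (E f) - E (lieX K \<mu> f) = (vder K (E f) - E (vder K f)) + scale_density \<mu> (vdiv K * E f - E (vdiv K * f))"
      by (simp add: lieX_def scale_density_simps)
  qed
qed

text \<open>With \<open>h = vdiv K\<close>, the adjoint of \<open>K + \<mu> h\<close> is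
  \<open>- K - h + \<mu> h\<close>, the negative of \<open>K + (1 - \<mu>) h\<close>.\<close>

lemma adjrel_lieX:
  assumes K: "K \<in> vector_fields A" shows "adjrel (lieX K \<mu>) (\<lambda>f. scale_density (-1) (lieX K (1 - \<mu>) f))"
proof -
  note h = vder_adjoint[OF K]
  have d: "(\<lambda>f. - vder K f - vdiv K * f) \<in> DO 2"
    using DO_diff[OF DO_scale[OF vder_DO[OF K], of "-1"] DO_mono[OF DO_multop[OF h(1)]]] by (simp add: scale_density_simps)
  show ?thesis
    by (rule adjrel_cong[OF adjrel_add[OF h(2) adjrel_scale[OF adjrel_multop DO_multop[OF h(1)] DO_multop[OF h(1)], of \<mu>]
          vder_DO[OF K] d DO_scale[OF DO_multop[OF h(1)]] DO_scale[OF DO_multop[OF h(1)]]]])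
      (simp_all add: lieX_def, rule density_eqI, simp add: scale_density_def algebra_simps)
qed

end

lemma ldo_partials_pre:
  assumes "open U" "ldo U m L" shows "ldo U (m + length I) (\<lambda>f. partials I (L f))"
proof (induction I)
  case (Cons i I)
  from ldo_partial[OF assms(1) this] show ?case by simp
qed (use assms(2) in simp)

lemma ldo_compose:
  assumes "open U" "ldo U k L" "ldo U m M" shows "ldo U (k + m) (\<lambda>f. L (M f))"
proof -
  obtain S where S0: "ldo_rep U k L S" using assms(2) unfolding ldo_def by blast
  note S = ldo_repD[OF S0]
  have "ldo U (k + m) (\<lambda>f x. \<Sum>I | length I < k. S I x * partials I (M f) x)"
    by (intro ldo_sum[OF assms(1)] ldo_mult[OF assms(1)] S(1) ldo_mono[OF assms(1) ldo_partials_pre[OF assms(1,3)]]) auto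
  then show ?thesis by (rule ldo_cong) (rule S(2)[OF ldo_smooth[OF assms(1,3)]])
qed

context volume_manifold begin

lemma DO_compose:
  assumes "E \<in> DO k" "H \<in> DO m" shows "(\<lambda>f. E (H f)) \<in> DO (k + m)"
proof (rule DO_I)
  fix \<kappa> assume k: "\<kappa> \<in> A"
  obtain L where L: "ldo (target \<kappa>) k L" "\<forall>f\<in>Fun. \<forall>x\<in>target \<kappa>. E f \<kappa> x = L (f \<kappa>) x"
    using DO_local[OF assms(1) k] by blast
  obtain M where M: "ldo (target \<kappa>) m M" "\<forall>f\<in>Fun. \<forall>x\<in>target \<kappa>. H f \<kappa> x = M (f \<kappa>) x"
    using DO_local[OF assms(2) k] by blast
  show "\<exists>L. ldo (target \<kappa>) (k + m) L \<and> (\<forall>f\<in>Fun. \<forall>x\<in>target \<kappa>. E (H f) \<kappa> x = L (f \<kappa>) x)"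
  proof (intro exI conjI ballI)
    show "ldo (target \<kappa>) (k + m) (\<lambda>f. L (M f))" by (rule ldo_compose[OF open_target[OF k] L(1) M(1)])
    fix f x assume f: "f \<in> Fun" and x: "x \<in> target \<kappa>"
    have "E (H f) \<kappa> x = L (H f \<kappa>) x" using L(2) DO_Fun[OF assms(2) f] x by blast
    also have "\<dots> = L (M (f \<kappa>)) x"
      by (rule ldo_linear(3)[OF open_target[OF k] L(1) fun_smooth[OF DO_Fun[OF assms(2) f] k] x
            ldo_smooth[OF open_target[OF k] M(1) fun_smooth[OF f k]]]) (use M(2) f in blast)
    finally show "E (H f) \<kappa> x = L (M (f \<kappa>)) x" .
  qed
qed (rule DO_Fun[OF assms(1) DO_Fun[OF assms(2)]])

lemma adjrel_comm_lieX:
  assumes K: "K \<in> vector_fields A" and E: "E \<in> DO k" "E' \<in> DO k" "adjrel E E'"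
  shows "adjrel (\<lambda>f. lieX K \<mu> (E f) - E (lieX K \<mu> f)) (\<lambda>f. lieX K (1 - \<mu>) (E' f) - E' (lieX K (1 - \<mu>) f))"
proof -
  note X = lieX_DO[OF K]
  let ?X' = "\<lambda>f. scale_density (-1) (lieX K (1 - \<mu>) f)"
  have X': "?X' \<in> DO 2" by (rule DO_scale[OF X])
  note a1 = adjrel_comp[OF adjrel_lieX[OF K] E(3) X X' E(1,2)]
  note a2 = adjrel_scale[OF adjrel_comp[OF E(3) adjrel_lieX[OF K] E(1,2) X X'] DO_compose[OF E(1) X] DO_compose[OF X' E(2)], of "-1"]
  note a3 = adjrel_add[OF a1 a2 DO_compose[OF X E(1)] DO_compose[OF E(2) X'] DO_scale[OF DO_compose[OF E(1) X]] DO_scale[OF DO_compose[OF X' E(2)]]]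
  show ?thesis
  proof (rule adjrel_cong[OF a3])
    fix f assume f: "f \<in> Fun"
    show "lieX K \<mu> (E f) - E (lieX K \<mu> f) = lieX K \<mu> (E f) + scale_density (- 1) (E (lieX K \<mu> f))"
      by (simp add: scale_density_simps)
    show "lieX K (1 - \<mu>) (E' f) - E' (lieX K (1 - \<mu>) f) = E' (?X' f) + scale_density (- 1) (?X' (E' f))"
      unfolding DO_linear(1)[OF E(2) DO_Fun[OF X f]] by (simp add: scale_density_simps)
  qed
qed

text \<open>Lie derivatives of complementary weights are adjoint up to sign, so the adjoint of a
  commutator at weight \<open>lam\<close> is the commutator of \<open>E'\<close> at weight
  \<open>1 - lam\<close>. This is where the factor \<open>\<mu> - (1 - lam)\<close> of the defects
  comes from.\<close>

lemma ad_weight_pair: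
  assumes K: "K \<in> vector_fields A" and p: "adjoint_pair n lam D E'"
  shows "adjoint_pair n lam (ad_weight A K lam D) (\<lambda>f. lieX K (1 - lam) (E' f) - E' (lieX K (1 - lam) f))"
proof -
  note p' = p[unfolded adjoint_pair_def]
  then have D: "D \<in> diff_ops A n lam" and E': "E' \<in> DO (Suc n)" "adjrel (fop lam D) E'" by blast+
  note E = fop_DO[OF D]
  let ?E2 = "\<lambda>f. lieX K lam (fop lam D f) - fop lam D (lieX K lam f)"
  have E2: "?E2 \<in> DO (Suc n)" by (rule DO_comm_lieX[OF E K])
  have ld: "lie_density A K lam d \<in> densities A lam" if "d \<in> densities A lam" for d
    unfolding lie_density_lieX[OF K that] by (rule rp_Fun_mult[OF DO_Fun[OF lieX_DO[OF K] rp_mult_Fun[OF that]]])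
  have "ad_weight A K lam D \<in> diff_ops A n lam"
  proof (rule diff_ops_cong[OF dop_diff_ops[OF E2]])
    fix d assume d: "d \<in> densities A lam"
    have ad: "ad_weight A K lam D d \<in> densities A lam" unfolding ad_weight_def
      by (rule diff_density[OF ld[OF diff_ops_in[OF D d]] diff_ops_in[OF D ld[OF d]]])
    have "dop lam ?E2 d = dop lam (fop lam (ad_weight A K lam D)) d"
      unfolding dop_def fop_ad_weight[OF K D rp_mult_Fun[OF d]] ..
    also have "\<dots> = ad_weight A K lam D d"
      unfolding dop_def fop_def rp_cancel(1)[OF d] by (rule rp_cancel(1)[OF ad])
    finally show "ad_weight A K lam D d = dop lam ?E2 d" by simp
  qed
  moreover have "adjrel (fop lam (ad_weight A K lam D)) (\<lambda>f. lieX K (1 - lam) (E' f) - E' (lieX K (1 - lam) f))"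
    by (rule adjrel_cong[OF adjrel_comm_lieX[OF K E E']]) (auto simp: fop_ad_weight[OF K D])
  ultimately show ?thesis unfolding adjoint_pair_def using DO_comm_lieX[OF E'(1) K] by blast
qed

lemma lieX_mult:
  assumes K: "K \<in> vector_fields A" and "f \<in> Fun" "g \<in> Fun"
  shows "lieX K \<mu> (f * g) - f * lieX K \<mu> g = vder K f * g"
  unfolding lieX_def vder_mult[OF assms] by (rule density_eqI) (simp add: scale_density_def algebra_simps)

lemma vder_one: "K \<in> vector_fields A \<Longrightarrow> vder K (one_density A) = 0"
  using vder_mult[of K "one_density A" "one_density A"] vder_Fun one_density_in density_one_mult[OF one_density_in]
    density_one_mult[OF vder_Fun[of K "one_density A"]] by (simp add: mult.commute)

text \<open>Only the divergence term of the Lie derivative depends on the weight.\<close>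

lemma comm_lieX_diff:
  assumes E: "E \<in> DO k" and K: "K \<in> vector_fields A" and f: "f \<in> Fun"
  shows "lieX K \<mu> (E f) - E (lieX K \<mu> f) = lieX K \<nu> (E f) - E (lieX K \<nu> f) + scale_density (\<mu> - \<nu>) (vdiv K * E f - E (vdiv K * f))"
proof -
  note h = vder_adjoint(1)[OF K]
  have "E (lieX K \<mu> f) = E (vder K f) + scale_density \<mu> (E (vdiv K * f))" for \<mu>
    unfolding lieX_def
    by (simp only: DO_linear(2)[OF E vder_Fun[OF K f] Fun_scale[OF Fun_mult[OF h f]]] DO_linear(1)[OF E Fun_mult[OF h f]])
  then show ?thesis by (simp add: lieX_def scale_density_simps algebra_simps)
qed

text \<open>Without divergence the Lie derivative is the same derivation \<open>K\<close> at every
  weight and passes through the coefficients in the weight. For the last two terms, \<open>K\<close>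
  kills the constant 1, so the commutator at 1 is \<open>K\<close> of the value at 1, which matches
  the Leibniz rule.\<close>

lemma family_sdiff_equivariant: "equivariant A n lam (sdiff A \<rho>) (family_lift T A \<rho> lam n b c d)"
  unfolding equivariant_def
proof (intro ballI)
  fix K D assume KK: "K \<in> sdiff A \<rho>" and D: "D \<in> diff_ops A n lam"
  have K: "K \<in> vector_fields A" and h0: "vdiv K = 0" using KK by (auto simp: sdiff_def vdiv_def)
  obtain E' where p: "adjoint_pair n lam D E'" using exists_adjoint_pair[OF D] by blast
  define E where "E = fop lam D"
  have E: "E \<in> DO (Suc n)" "E' \<in> DO (Suc n)" using p fop_DO unfolding adjoint_pair_def E_def by blast+
  have X: "lieX K \<mu> f = vder K f" for \<mu> f by (simp add: lieX_def h0 scale_density_simps)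
  note V = vder_Fun[OF K]
  note lin = DO_linear[OF vder_DO[OF K]]
  have F: "Ffam a b C Dd E E' \<mu> \<in> DO (Suc n)" for a b C Dd \<mu> by (rule Ffam_DO[OF E])
  show "op_eq A (ad_op A K (family_lift T A \<rho> lam n b c d D)) (family_lift T A \<rho> lam n b c d (ad_weight A K lam D))"
  proof (rule rep_op_eq[OF rep_cong[OF rep_ad_op[OF K rep_family[OF p, folded E_def] pencilI[OF F]]] rep_family[OF ad_weight_pair[OF K p]]])
    fix \<mu> f assume f: "f \<in> Fun"
    let ?o = "one_density A"
    have fo: "fop lam (ad_weight A K lam D) g = vder K (E g) - E (vder K g)" if "g \<in> Fun" for g
      using fop_ad_weight[OF K D that] unfolding X E_def .
    have v1: "vder K ?o = 0" by (rule vder_one[OF K])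
    have E0: "E 0 = 0" "E' 0 = 0" using DO_linear_0 E by blast+
    have m: "E f \<in> Fun" "E' f \<in> Fun" "E ?o \<in> Fun" "E' ?o \<in> Fun" using DO_Fun E f one_density_in by blast+
    have L: "vder K (scale_density r u + scale_density s v + scale_density t w + scale_density q z)
       = scale_density r (vder K u) + scale_density s (vder K v) + scale_density t (vder K w) + scale_density q (vder K z)"
      if "u \<in> Fun" "v \<in> Fun" "w \<in> Fun" "z \<in> Fun" for r s t q u v w z
      using that by (simp add: lin Fun_add Fun_scale)
    show "Ffam (\<lambda>\<mu>. 1 - b * (\<mu> - lam)) (\<lambda>\<mu>. (-1) ^ n * b * (\<mu> - lam)) (\<lambda>\<mu>. \<Sum>k=1..n. c k * (\<mu> - lam) ^ k)
       (\<lambda>\<mu>. \<Sum>k=1..n. d k * (\<mu> - lam) ^ k) (fop lam (ad_weight A K lam D)) (\<lambda>f. lieX K (1 - lam) (E' f) - E' (lieX K (1 - lam) f)) \<mu> f =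
      lieX K \<mu> (Ffam (\<lambda>\<mu>. 1 - b * (\<mu> - lam)) (\<lambda>\<mu>. (-1) ^ n * b * (\<mu> - lam)) (\<lambda>\<mu>. \<Sum>k=1..n. c k * (\<mu> - lam) ^ k)
       (\<lambda>\<mu>. \<Sum>k=1..n. d k * (\<mu> - lam) ^ k) E E' \<mu> f) -
      Ffam (\<lambda>\<mu>. 1 - b * (\<mu> - lam)) (\<lambda>\<mu>. (-1) ^ n * b * (\<mu> - lam)) (\<lambda>\<mu>. \<Sum>k=1..n. c k * (\<mu> - lam) ^ k)
       (\<lambda>\<mu>. \<Sum>k=1..n. d k * (\<mu> - lam) ^ k) E E' \<mu> (lieX K \<mu> f)"
      unfolding X Ffam_def fo[OF f] fo[OF one_density_in] v1 E0 L[OF m(1,2) Fun_mult[OF m(3) f] Fun_mult[OF m(4) f]]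
        vder_mult[OF K m(3) f] vder_mult[OF K m(4) f]
      by (rule density_eqI) (simp add: scale_density_def algebra_simps)
  qed
qed

lemma eq_modulo_verticalI:
  assumes "L \<in> hat_diff_ops A n" "L' \<in> hat_diff_ops A n" "rep (\<lambda>s. L s - L' s) F" "\<And>\<mu>. F \<mu> \<in> DO (Suc k)"
  shows "eq_modulo_vertical A n k L L'"
  using assms(1,2) hat_diff[OF assms(1,2)] rep_vertical[OF assms(3,4)]
  unfolding eq_modulo_vertical_def vertical_ops_def hat_diff_ops_def weight_zero_operators_def by blast

text \<open>The weight \<open>\<mu>\<close> is compared with \<open>lam\<close> for \<open>E\<close>
  and with \<open>1 - lam\<close> for \<open>E'\<close>. The coefficient of each contains the linear
  factor produced by the comparison for the other, so both acquire the same quadratic factor, and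
  the signs assemble the combination of \<open>E\<close> and \<open>E'\<close> that has lower
  order.\<close>

lemma disting_equivariance_defect:
  assumes lam: "lam \<noteq> 1 / 2" and K: "K \<in> vector_fields A" and p: "adjoint_pair n lam D E'"
  shows "rep (\<lambda>s. ad_op A K (disting_lift T A \<rho> lam n D) s - disting_lift T A \<rho> lam n (ad_weight A K lam D) s)
    (\<lambda>\<mu> f. scale_density ((\<mu> - lam) * (\<mu> + lam - 1) / (2 * lam - 1))
      (vdiv K * (fop lam D f - scale_density ((-1) ^ n) (E' f)) - (fop lam D (vdiv K * f) - scale_density ((-1) ^ n) (E' (vdiv K * f)))))"
proof -
  define E where "E = fop lam D"
  have D: "D \<in> diff_ops A n lam" using p unfolding adjoint_pair_def by blast
  have E: "E \<in> DO (Suc n)" "E' \<in> DO (Suc n)" using p fop_DO unfolding adjoint_pair_def E_def by blast+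
  have nz: "2 * lam - 1 \<noteq> 0" using lam by auto
  define a where "a \<mu> = (\<mu> + lam - 1) / (2 * lam - 1)" for \<mu>
  define e where "e \<mu> = (-1) ^ n * ((lam - \<mu>) / (2 * lam - 1))" for \<mu>
  let ?F = "\<lambda>\<mu> f. scale_density (a \<mu>) (E f) + scale_density (e \<mu>) (E' f)"
  have F: "rep (disting_lift T A \<rho> lam n D) ?F" using rep_disting[OF p] unfolding E_def a_def e_def .
  have FD: "?F \<mu> \<in> DO (Suc n)" for \<mu> by (rule DO_add[OF DO_scale[OF E(1)] DO_scale[OF E(2)]])
  note F2 = rep_disting[OF ad_weight_pair[OF K p], folded a_def e_def]
  show ?thesis
  proof (rule rep_cong[OF rep_diff[OF rep_ad_op[OF K F pencilI[OF FD]] F2]], fold E_def)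
    fix \<mu> f assume f: "f \<in> Fun"
    have fo: "fop lam (ad_weight A K lam D) f = lieX K lam (E f) - E (lieX K lam f)"
      using fop_ad_weight[OF K D f] unfolding E_def .
    have m: "E f \<in> Fun" "E' f \<in> Fun" using DO_Fun E f by blast+
    have L: "lieX K \<mu> (scale_density r u + scale_density s v) = scale_density r (lieX K \<mu> u) + scale_density s (lieX K \<mu> v)"
      if "u \<in> Fun" "v \<in> Fun" for r s u v
      using that by (simp add: DO_linear[OF lieX_DO[OF K]] Fun_scale)
    have c: "lieX K \<mu> (?F \<mu> f) - ?F \<mu> (lieX K \<mu> f) = scale_density (a \<mu>) (lieX K \<mu> (E f) - E (lieX K \<mu> f)) + scale_density (e \<mu>) (lieX K \<mu> (E' f) - E' (lieX K \<mu> f))"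
      unfolding L[OF m] by (simp add: scale_density_simps algebra_simps)
    have q: "a \<mu> * (\<mu> - lam) = (\<mu> - lam) * (\<mu> + lam - 1) / (2 * lam - 1)"
      "e \<mu> * (\<mu> - (1 - lam)) = - ((\<mu> - lam) * (\<mu> + lam - 1) / (2 * lam - 1) * (-1) ^ n)"
      using nz by (simp_all add: a_def e_def field_simps)
    have "lieX K \<mu> (?F \<mu> f) - ?F \<mu> (lieX K \<mu> f) - (scale_density (a \<mu>) (fop lam (ad_weight A K lam D) f) + scale_density (e \<mu>) (lieX K (1 - lam) (E' f) - E' (lieX K (1 - lam) f)))
      = scale_density (a \<mu> * (\<mu> - lam)) (vdiv K * E f - E (vdiv K * f)) + scale_density (e \<mu> * (\<mu> - (1 - lam))) (vdiv K * E' f - E' (vdiv K * f))"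
      unfolding c fo comm_lieX_diff[OF E(1) K f, of \<mu> lam] comm_lieX_diff[OF E(2) K f, of \<mu> "1 - lam"]
      by (simp add: scale_density_simps(1,4))
    note * = this[unfolded q, symmetric]
    have gen: "scale_density t (h * (u - scale_density s v) - (x - scale_density s y)) =
        scale_density t (h * u - x) + scale_density (- (t * s)) (h * v - y)" for t s and h u v x y :: "('a, 'd) density"
      by (rule density_eqI) (simp add: scale_density_def algebra_simps)
    show "scale_density ((\<mu> - lam) * (\<mu> + lam - 1) / (2 * lam - 1))
      (vdiv K * (E f - scale_density ((-1) ^ n) (E' f)) - (E (vdiv K * f) - scale_density ((-1) ^ n) (E' (vdiv K * f)))) =
      lieX K \<mu> (?F \<mu> f) - ?F \<mu> (lieX K \<mu> f) - (scale_density (a \<mu>) (fop lam (ad_weight A K lam D) f) + scale_density (e \<mu>) (lieX K (1 - lam) (E' f) - E' (lieX K (1 - lam) f)))"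
      unfolding gen by (rule *)
  qed
qed

text \<open>Apart from verticality, both sides must have total degree at most \<open>n\<close>. The
  commutator has order at most \<open>n - 2\<close>, so with its quadratic factor in the weight the
  defect has degree \<open>n\<close>; \<open>ad_op\<close> inherits the bound as the lifting of
  \<open>ad_weight\<close> plus the defect.\<close>

lemma disting_equivariant_mod:
  assumes lam: "lam \<noteq> 1 / 2" and n: "n \<ge> 2"
  shows "equivariant_modulo_vertical A n (n - 2) lam (vector_fields A) (disting_lift T A \<rho> lam n)"
  unfolding equivariant_modulo_vertical_def
proof (intro ballI)
  fix K D assume K: "K \<in> vector_fields A" and D: "D \<in> diff_ops A n lam"
  obtain m where m: "n = Suc (Suc m)" using n by (metis Suc_1 Suc_n_not_le_n not0_implies_Suc le_Suc_eq not_less_eq_eq numeral_2_eq_2 zero_le)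
  obtain E' where p: "adjoint_pair n lam D E'" using exists_adjoint_pair[OF D] by blast
  let ?Z = "\<lambda>f. fop lam D f - scale_density ((-1) ^ n) (E' f)"
  let ?C = "\<lambda>f. vdiv K * ?Z f - ?Z (vdiv K * f)"
  have Z: "?Z \<in> DO (Suc (Suc m))" using adjoint_pair_symbol[OF p] unfolding m .
  have "(\<lambda>f. scale_density (-1) (?Z (vdiv K * f) - vdiv K * ?Z f)) \<in> DO (Suc m)"
    using DO_scale[OF DO_commutator[OF Z vder_adjoint(1)[OF K]], of "-1"] unfolding diff_Suc_1 .
  then have C: "?C \<in> DO (Suc m)"
    by (rule DO_cong) (rule density_eqI, simp add: scale_density_def)
  note defect = disting_equivariance_defect[OF lam K p]
  let ?q = "\<lambda>\<mu>. (\<mu> - lam) * (\<mu> + lam - 1) / (2 * lam - 1)"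
  let ?L = "disting_lift T A \<rho> lam n"
  have h2: "?L (ad_weight A K lam D) \<in> hat_diff_ops A n"
    using ad_weight_pair[OF K p] n unfolding adjoint_pair_def by (intro disting_hat[OF lam]) auto
  have "(\<lambda>s. weight_fun (\<lambda>_. 1 / (2 * lam - 1)) (weight_fun (\<lambda>\<mu>. \<mu> - lam) (weight_fun (\<lambda>\<mu>. \<mu> - (1 - lam)) (Q ?C s)))) \<in> hat_diff_ops A (Suc (Suc m))"
    by (intro hat_const hat_shift hat_Q C)
  moreover have "weight_fun (\<lambda>_. 1 / (2 * lam - 1)) (weight_fun (\<lambda>\<mu>. \<mu> - lam) (weight_fun (\<lambda>\<mu>. \<mu> - (1 - lam)) t)) = weight_fun ?q t" for t :: "('a, 'd) densum"
    unfolding weight_fun_compose by (rule arg_cong[where f = "\<lambda>a. weight_fun a t"]) (simp add: fun_eq_iff algebra_simps add_divide_distrib diff_divide_distrib)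
  ultimately have hq: "(\<lambda>s. weight_fun ?q (Q ?C s)) \<in> hat_diff_ops A n" unfolding m[symmetric] by simp
  have h1: "ad_op A K (?L D) \<in> hat_diff_ops A n"
  proof (rule hat_cong[OF hat_add[OF h2 hq]])
    have "op_eq A (\<lambda>s. weight_fun ?q (Q ?C s)) (\<lambda>s. ad_op A K (?L D) s - ?L (ad_weight A K lam D) s)"
      by (rule rep_op_eq[OF rep_weight_fun[OF rep_Q[OF C]] defect])
    then show "op_eq A (\<lambda>s. ?L (ad_weight A K lam D) s + weight_fun ?q (Q ?C s)) (ad_op A K (?L D))"
      by (simp add: op_eq_def)
  qed
  show "eq_modulo_vertical A n (n - 2) (ad_op A K (?L D)) (?L (ad_weight A K lam D))"
  proof (rule eq_modulo_verticalI[OF h1 h2 defect DO_scale])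
    have "Suc (n - 2) = Suc m" using m by simp
    then show "?C \<in> DO (Suc (n - 2))" using C by (simp only:)
  qed
qed

section \<open>Iterated commutators with a function\<close>

lemma adf_lin: "adf h (\<lambda>f. scale_density c (E f) + R f) = (\<lambda>f. scale_density c (adf h E f) + adf h R f)"
  by (rule ext, rule density_eqI) (simp add: adf_def scale_density_def algebra_simps)

lemma adf_pow_lin: "(adf h ^^ k) (\<lambda>f. scale_density c (E f) + R f) = (\<lambda>f. scale_density c ((adf h ^^ k) E f) + (adf h ^^ k) R f)"
proof (induction k)
  case (Suc k)
  show ?case unfolding funpow.simps o_apply Suc.IH adf_lin ..
qed simp

lemma adf_pow_DO: "R \<in> DO m \<Longrightarrow> h \<in> Fun \<Longrightarrow> (adf h ^^ k) R \<in> DO (m - k)"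
proof (induction k)
  case (Suc k)
  have "adf h ((adf h ^^ k) R) \<in> DO (m - k - 1)"
    using DO_commutator[OF Suc.IH[OF Suc.prems] Suc.prems(2)] unfolding adf_def[abs_def] .
  then show ?case by simp
qed simp

lemma adf_pow_zero: "R \<in> DO k \<Longrightarrow> h \<in> Fun \<Longrightarrow> f \<in> Fun \<Longrightarrow> (adf h ^^ k) R f = 0"
  using DO_0_zero[OF adf_pow_DO[of R k h k, unfolded diff_self_eq_0]] by blast

lemma adf_cong:
  assumes "\<And>f. f \<in> Fun \<Longrightarrow> E f = F f" "h \<in> Fun"
  shows "f \<in> Fun \<Longrightarrow> (adf h ^^ k) E f = (adf h ^^ k) F f"
proof (induction k arbitrary: f)
  case (Suc k)
  show ?case unfolding funpow.simps o_apply adf_def[of h "(adf h ^^ k) _"] Suc.IH[OF Suc.prems] Suc.IH[OF Fun_mult[OF assms(2) Suc.prems]] ..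
qed (simp add: assms(1))

text \<open>The commutator of \<open>K\<close> with \<open>h\<close> is the function
  \<open>K h\<close>, which commutes with \<open>h\<close>, so the higher Leibniz rule has only two
  terms. At \<open>k = 0\<close> the truncated \<open>k - 1\<close> is harmless, as its coefficient
  is 0.\<close>

lemma adf_pow_vder:
  assumes K: "K \<in> vector_fields A" and h: "h \<in> Fun" and E: "E \<in> DO m" and f: "f \<in> Fun"
  shows "(adf h ^^ k) (\<lambda>f. vder K (E f)) f = vder K ((adf h ^^ k) E f) + scale_density (real k) (vder K h * (adf h ^^ (k - 1)) E f)"
  using f
proof (induction k arbitrary: f)
  case 0 show ?case by (simp add: scale_density_simps)
next
  case (Suc k)
  note f = Suc.prems
  let ?B = "\<lambda>j. (adf h ^^ j) E"
  have B: "?B j u \<in> Fun" if "u \<in> Fun" for j u using DO_Fun[OF adf_pow_DO[OF E h] that] .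
  have V: "vder K (u - v) = vder K u - vder K v" if "u \<in> Fun" "v \<in> Fun" for u v
    by (rule DO_linear_diff[OF vder_DO[OF K] that])
  have hf: "h * f \<in> Fun" by (rule Fun_mult[OF h f])
  have 1: "(adf h ^^ Suc k) (\<lambda>f. vder K (E f)) f =
     (vder K (?B k (h * f)) + scale_density (real k) (vder K h * ?B (k - 1) (h * f)))
     - h * (vder K (?B k f) + scale_density (real k) (vder K h * ?B (k - 1) f))"
    unfolding funpow.simps o_apply adf_def[of h "(adf h ^^ k) _"] Suc.IH[OF hf] Suc.IH[OF f] ..
  have 2: "vder K (?B (Suc k) f) = vder K (?B k (h * f)) - (vder K h * ?B k f + h * vder K (?B k f))"
    unfolding funpow.simps o_apply adf_def[of h "(adf h ^^ k) _"] V[OF B[OF hf] Fun_mult[OF h B[OF f]]] vder_mult[OF K h B[OF f]] ..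
  show ?case
  proof (cases k)
    case 0
    show ?thesis unfolding 1 2 unfolding 0 by (rule density_eqI) (simp add: scale_density_def algebra_simps)
  next
    case (Suc j)
    have 3: "?B k f = ?B j (h * f) - h * ?B j f" unfolding Suc by (simp add: adf_def)
    show ?thesis unfolding 1 2 diff_Suc_1
      unfolding 3[unfolded Suc] Suc diff_Suc_1
      by (rule density_eqI) (simp add: scale_density_def algebra_simps)
  qed
qed

text \<open>\<open>DO_compose\<close> adds strict bounds and would raise the index by 2 with each
  factor; adding one derivative to the local formula gives the sharp index.\<close>

lemma vder_pow_DO: "K \<in> vector_fields A \<Longrightarrow> (vder K ^^ k) \<in> DO (Suc k)"
proof (induction k)
  case 0 show ?case using DO_id by (simp add: id_def)
next
  case (Suc k)
  have "(\<lambda>f. vder K ((vder K ^^ k) f)) \<in> DO (Suc (Suc k))"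
  proof (rule DO_I)
    fix \<kappa> assume k: "\<kappa> \<in> A"
    obtain L where L: "ldo (target \<kappa>) (Suc k) L" "\<forall>f\<in>Fun. \<forall>x\<in>target \<kappa>. (vder K ^^ k) f \<kappa> x = L (f \<kappa>) x"
      using DO_local[OF Suc.IH[OF Suc.prems] k] by blast
    show "\<exists>L. ldo (target \<kappa>) (Suc (Suc k)) L \<and> (\<forall>f\<in>Fun. \<forall>x\<in>target \<kappa>. vder K ((vder K ^^ k) f) \<kappa> x = L (f \<kappa>) x)"
    proof (intro exI conjI ballI)
      show "ldo (target \<kappa>) (Suc (Suc k)) (\<lambda>f x. \<Sum>i\<in>UNIV. K \<kappa> x $ i * partial i (L f) x)"
        by (rule ldo_sum[OF open_target[OF k] ldo_mult[OF open_target[OF k] ldo_partial[OF open_target[OF k] L(1)]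
              smooth_on_nth[OF open_target[OF k] field_smooth[OF Suc.prems k]]]])
      fix f x assume f: "f \<in> Fun" and x: "x \<in> target \<kappa>"
      have "partial i ((vder K ^^ k) f \<kappa>) x = partial i (L (f \<kappa>)) x" for i
        by (rule partial_cong_open[OF open_target[OF k] x]) (use L(2) f in blast)
      then show "vder K ((vder K ^^ k) f) \<kappa> x = (\<Sum>i\<in>UNIV. K \<kappa> x $ i * partial i (L (f \<kappa>)) x)"
        by (simp add: vder_chart[OF k x])
    qed
  qed (rule vder_Fun[OF Suc.prems DO_Fun[OF Suc.IH[OF Suc.prems]]])
  then show ?case by (simp add: o_def)
qed

text \<open>In \<open>adf_pow_vder\<close> the first term commutes an operator of order
  \<open>k\<close> with \<open>h\<close> for \<open>k + 1\<close> times and vanishes; the second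
  contributes the next factor of the factorial and one more \<open>K h\<close>.\<close>

lemma adf_pow_vder_pow:
  assumes K: "K \<in> vector_fields A" and h: "h \<in> Fun" and f: "f \<in> Fun"
  shows "(adf h ^^ k) (vder K ^^ k) f \<kappa> x = fact k * (vder K h \<kappa> x) ^ k * f \<kappa> x"
proof (induction k)
  case 0 show ?case by simp
next
  case (Suc k)
  have e: "(vder K ^^ Suc k) = (\<lambda>f. vder K ((vder K ^^ k) f))" by (simp add: o_def)
  have z: "(adf h ^^ Suc k) (vder K ^^ k) f = 0" by (rule adf_pow_zero[OF vder_pow_DO[OF K] h f])
  have v0: "vder K 0 = 0" by (rule DO_linear_0[OF vder_DO[OF K]])
  have "(adf h ^^ Suc k) (vder K ^^ Suc k) f = scale_density (real (Suc k)) (vder K h * (adf h ^^ k) (vder K ^^ k) f)"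
    unfolding e adf_pow_vder[OF K h vder_pow_DO[OF K] f] z v0 diff_Suc_1 by (rule add_0_left)
  then have "(adf h ^^ Suc k) (vder K ^^ Suc k) f \<kappa> x = real (Suc k) * (vder K h \<kappa> x * (adf h ^^ k) (vder K ^^ k) f \<kappa> x)"
    by (simp only: scale_density_def times_fun_def)
  then show ?case unfolding Suc.IH by (simp only: fact_Suc power_Suc of_nat_mult mult.assoc mult.left_commute)
qed

text \<open>The terms with \<open>c\<close> and \<open>d\<close> are multiplications by functions
  and go into \<open>R\<close>, as \<open>n \<ge> 2\<close>. Writing the commutator of
  \<open>E'\<close> in terms of those of \<open>E\<close> and of \<open>E - (-1)\<^sup>n E'\<close>
  leaves for \<open>E\<close> the factor
  \<open>1 - b * (\<mu> - lam) + b * (\<mu> - (1 - lam))\<close>, in which \<open>\<mu>\<close>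
  cancels.\<close>

lemma family_equivariance_defect:
  assumes K: "K \<in> vector_fields A" and p: "adjoint_pair n lam D E'" and n: "n \<ge> 2"
  shows "\<exists>R\<in>DO (n - 1). \<exists>F.
    rep (\<lambda>s. ad_op A K (family_lift T A \<rho> lam n b c d D) s - family_lift T A \<rho> lam n b c d (ad_weight A K lam D) s) F
    \<and> (\<forall>f\<in>Fun. F \<mu> f = scale_density ((lam - \<mu>) * (1 + b * (2 * lam - 1))) (adf (vdiv K) (fop lam D) f) + R f)"
proof -
  define E where "E = fop lam D"
  define h where "h = vdiv K"
  have h: "h \<in> Fun" unfolding h_def by (rule vder_adjoint(1)[OF K])
  have D: "D \<in> diff_ops A n lam" using p unfolding adjoint_pair_def by blast
  have E: "E \<in> DO (Suc n)" "E' \<in> DO (Suc n)" using p fop_DO unfolding adjoint_pair_def E_def by blast+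
  let ?o = "one_density A"
  have m0: "E ?o \<in> Fun" "E' ?o \<in> Fun" using DO_Fun E one_density_in by blast+
  let ?E2 = "\<lambda>f. lieX K lam (E f) - E (lieX K lam f)" and ?E2' = "\<lambda>f. lieX K (1 - lam) (E' f) - E' (lieX K (1 - lam) f)"
  have E2: "?E2 \<in> DO (Suc n)" "?E2' \<in> DO (Suc n)" by (rule DO_comm_lieX[OF E(1) K], rule DO_comm_lieX[OF E(2) K])
  let ?a = "\<lambda>\<mu>. 1 - b * (\<mu> - lam)" and ?e = "\<lambda>\<mu>. (-1) ^ n * b * (\<mu> - lam)"
  let ?c = "\<lambda>\<mu>. \<Sum>k=1..n. c k * (\<mu> - lam) ^ k" and ?d = "\<lambda>\<mu>. \<Sum>k=1..n. d k * (\<mu> - lam) ^ k"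
  let ?Z = "\<lambda>f. E f - scale_density ((-1) ^ n) (E' f)"
  have Z: "?Z \<in> DO n" using adjoint_pair_symbol[OF p] unfolding E_def .
  let ?R = "\<lambda>f. scale_density ((\<mu> - lam) * b * (\<mu> - (1 - lam))) (?Z (h * f) - h * ?Z f)
     + (scale_density (?c \<mu>) (vder K (E ?o) * f) + scale_density (?d \<mu>) (vder K (E' ?o) * f)
     - (scale_density (?c \<mu>) (?E2 ?o * f) + scale_density (?d \<mu>) (?E2' ?o * f)))"
  have n1: "1 \<le> n - 1" using n by simp
  note M = DO_scale[OF DO_mono[OF DO_multop n1]]
  have R: "?R \<in> DO (n - 1)"
    by (rule DO_add[OF DO_scale[OF DO_commutator[OF Z h]] DO_diff[OF
      DO_add[OF M[OF vder_Fun[OF K m0(1)]] M[OF vder_Fun[OF K m0(2)]]]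
      DO_add[OF M[OF DO_Fun[OF E2(1) one_density_in]] M[OF DO_Fun[OF E2(2) one_density_in]]]]])
  let ?F = "Ffam ?a ?e ?c ?d E E'"
  have F: "rep (family_lift T A \<rho> lam n b c d D) ?F" using rep_family[OF p] unfolding E_def .
  have FD: "?F \<mu> \<in> DO (Suc n)" for \<mu> by (rule Ffam_DO[OF E])
  note rd = rep_diff[OF rep_ad_op[OF K F pencilI[OF FD]] rep_family[OF ad_weight_pair[OF K p], of b c d]]
  have eq: "lieX K \<mu> (?F \<mu> f) - ?F \<mu> (lieX K \<mu> f) - Ffam ?a ?e ?c ?d (fop lam (ad_weight A K lam D)) ?E2' \<mu> f
     = scale_density ((lam - \<mu>) * (1 + b * (2 * lam - 1))) (adf h E f) + ?R f" if f: "f \<in> Fun" for f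
  proof -
    have m: "E f \<in> Fun" "E' f \<in> Fun" using DO_Fun E f by blast+
    have fo: "fop lam (ad_weight A K lam D) g = ?E2 g" if "g \<in> Fun" for g
      using fop_ad_weight[OF K D that] unfolding E_def .
    have L: "lieX K \<mu> (scale_density r u + scale_density s v + scale_density t w + scale_density q z)
       = scale_density r (lieX K \<mu> u) + scale_density s (lieX K \<mu> v) + scale_density t (lieX K \<mu> w) + scale_density q (lieX K \<mu> z)"
      if "u \<in> Fun" "v \<in> Fun" "w \<in> Fun" "z \<in> Fun" for r s t q u v w z
      using that by (simp add: DO_linear[OF lieX_DO[OF K]] Fun_add Fun_scale)
    have lm: "lieX K \<mu> (u * f) = u * lieX K \<mu> f + vder K u * f" if "u \<in> Fun" for u
      using lieX_mult[OF K that f, of \<mu>] unfolding diff_eq_eq add.commute[of "vder K u * f"] .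
    have x1: "lieX K \<mu> (E f) = E (lieX K \<mu> f) + (?E2 f + scale_density (\<mu> - lam) (h * E f - E (h * f)))"
      using comm_lieX_diff[OF E(1) K f, of \<mu> lam] unfolding h_def diff_eq_eq by (simp only: add.commute)
    have x2: "lieX K \<mu> (E' f) = E' (lieX K \<mu> f) + (?E2' f + scale_density (\<mu> - (1 - lam)) (h * E' f - E' (h * f)))"
      using comm_lieX_diff[OF E(2) K f, of \<mu> "1 - lam"] unfolding h_def diff_eq_eq by (simp only: add.commute)
    \<comment> \<open>Here \<open>r\<close> and \<open>s * b * t\<close> are the coefficients of
      \<open>E\<close> and \<open>E'\<close>, with the sign \<open>s = (-1) ^ n\<close>,
      \<open>t = \<mu> - lam\<close> and \<open>q = \<mu> - (1 - lam)\<close>. The \<open>u\<close>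
      have the Lie derivative inside, the \<open>v\<close> come from \<open>ad_weight\<close>, and
      the \<open>m\<close> and \<open>z\<close> are the two parts of the commutators with
      \<open>h\<close>.\<close>
    have gen: "scale_density r (u1 + (v1 + scale_density t (h * m1 - z1))) + scale_density (s * b * t) (u2 + (v2 + scale_density q (h * m2 - z2)))
        + scale_density C1 (o1 * g + w1) + scale_density C2 (o2 * g + w2)
        - (scale_density r u1 + scale_density (s * b * t) u2 + scale_density C1 (o1 * g) + scale_density C2 (o2 * g))
        - (scale_density r v1 + scale_density (s * b * t) v2 + scale_density C1 p1 + scale_density C2 p2)
      = scale_density (- t * (r + b * q)) (z1 - h * m1) + (scale_density (t * b * q) ((z1 - scale_density s z2) - h * (m1 - scale_density s m2))
         + (scale_density C1 w1 + scale_density C2 w2 - (scale_density C1 p1 + scale_density C2 p2)))"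
      for r s t q C1 C2 and u1 u2 v1 v2 w1 w2 m1 m2 z1 z2 o1 o2 p1 p2 g :: "('a, 'd) density"
      by (rule density_eqI) (simp add: scale_density_def algebra_simps)
    have q: "(lam - \<mu>) * (1 + b * (2 * lam - 1)) = - (\<mu> - lam) * (?a \<mu> + b * (\<mu> - (1 - lam)))"
      by (simp add: algebra_simps)
    show ?thesis
      unfolding Ffam_def fo[OF f] fo[OF one_density_in] L[OF m(1,2) Fun_mult[OF m0(1) f] Fun_mult[OF m0(2) f]]
        lm[OF m0(1)] lm[OF m0(2)] x1 x2 q adf_def[of h E] by (rule gen)
  qed
  show ?thesis unfolding E_def[symmetric] h_def[symmetric]
    by (rule bexI[OF _ R], rule exI, rule conjI, rule rd, rule ballI, rule eq)
qed

section \<open>A vector field whose divergence varies along it\<close>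

text \<open>The field is carried to the other charts by the derivatives of the transition maps and
  is zero off the chart \<open>\<kappa>0\<close>. Compatibility of two such images is the chain rule
  on a triple overlap, and smoothness follows as in \<open>extend_fun\<close>.\<close>

lemma extend_field:
  assumes k0: "\<kappa>0 \<in> A" and g: "smooth_on (target \<kappa>0) g" and C: "compact C" "C \<subseteq> target \<kappa>0"
    and z: "\<And>x. x \<in> target \<kappa>0 \<Longrightarrow> x \<notin> C \<Longrightarrow> g x = 0"
  obtains K where "K \<in> vector_fields A" "\<And>x. x \<in> target \<kappa>0 \<Longrightarrow> K \<kappa>0 x = g x *\<^sub>R axis i 1"
proof -
  define y where "y \<kappa> x = coord \<kappa>0 (pt \<kappa> x)" for \<kappa> :: "('a, 'd) chart" and x
  define K where "K = (\<lambda>\<kappa> x. if \<kappa> \<in> A \<and> x \<in> target \<kappa> \<and> pt \<kappa> x \<in> chart_dom \<kappa>0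
    then g (y \<kappa> x) *\<^sub>R partial i (transition \<kappa>0 \<kappa>) (y \<kappa> x) else 0)"
  have K0: "K \<kappa>0 x = g x *\<^sub>R axis i 1" if x: "x \<in> target \<kappa>0" for x
  proof -
    have "partial i (transition \<kappa>0 \<kappa>0) x = partial i (\<lambda>z. z) x"
      by (rule partial_cong_open[OF open_target[OF k0] x]) (simp add: transition_pt k0)
    also have "\<dots> = axis i 1" by (subst partial_eqI[OF has_derivative_ident]) simp
    finally show ?thesis using x k0 by (simp add: K_def y_def)
  qed
  have "K \<in> vector_fields A"
    unfolding vector_fields_def
  proof (intro CollectI conjI ballI)
    fix \<kappa> assume k: "\<kappa> \<in> A"
    have "compactin T (pt \<kappa>0 ` C)" using compactin_pt_image k0 C by blast
    then have "closedin T (pt \<kappa>0 ` C)" using compactin_imp_closedin hausdorff by blast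
    then have "openin T (topspace T - pt \<kappa>0 ` C)" by blast
    then have o: "open (coord \<kappa> ` (chart_dom \<kappa> \<inter> (topspace T - pt \<kappa>0 ` C)))" (is "open ?O")
      using open_coord_image k by blast
    show "smooth_on (target \<kappa>) (K \<kappa>)"
    proof (rule smooth_on_vecI[OF open_target[OF k]])
      fix j
      have "smooth_on (overlap \<kappa> \<kappa>0) (\<lambda>x. K \<kappa> x $ j)"
      proof (rule smooth_on_cong[OF open_overlap[OF k k0]])
        show "smooth_on (overlap \<kappa> \<kappa>0) (\<lambda>x. g (transition \<kappa> \<kappa>0 x) * (partial i (transition \<kappa>0 \<kappa>) (transition \<kappa> \<kappa>0 x) $ j))"
          by (rule smooth_on_mult[OF open_overlap[OF k k0]
                smooth_on_compose[OF open_overlap[OF k k0] g smooth_transition[OF k k0] transition_into[OF k k0]]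
                smooth_on_compose[OF open_overlap[OF k k0] smooth_on_nth[OF open_overlap[OF k0 k] smooth_on_partial[OF smooth_transition[OF k0 k]]]
                  smooth_transition[OF k k0] equalityD1[OF transition_image[OF k k0]]]])
        fix x assume "x \<in> overlap \<kappa> \<kappa>0"
        then show "g (transition \<kappa> \<kappa>0 x) * (partial i (transition \<kappa>0 \<kappa>) (transition \<kappa> \<kappa>0 x) $ j) = K \<kappa> x $ j"
          using k by (simp add: K_def y_def overlap_iff transition_pt)
      qed
      moreover have "smooth_on ?O (\<lambda>x. K \<kappa> x $ j)"
      proof (rule smooth_on_cong[OF o])
        show "0 = K \<kappa> x $ j" if xO: "x \<in> ?O" for x
        proof -
          obtain p where p: "x = coord \<kappa> p" "p \<in> chart_dom \<kappa>" "p \<notin> pt \<kappa>0 ` C" using xO by blast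
          have "coord \<kappa>0 p \<notin> C" if "p \<in> chart_dom \<kappa>0" using p(3) that k0 by (metis image_eqI pt_coord)
          moreover have "coord \<kappa>0 p \<in> target \<kappa>0" if "p \<in> chart_dom \<kappa>0" using that by (simp add: target_def)
          ultimately show ?thesis using p k z by (auto simp: K_def y_def)
        qed
      qed simp
      ultimately have "smooth_on (overlap \<kappa> \<kappa>0 \<union> ?O) (\<lambda>x. K \<kappa> x $ j)"
        using smooth_on_Un open_overlap k0 k o by blast
      moreover have "target \<kappa> \<subseteq> overlap \<kappa> \<kappa>0 \<union> ?O"
      proof
        fix x assume x: "x \<in> target \<kappa>"
        show "x \<in> overlap \<kappa> \<kappa>0 \<union> ?O"
        proof (cases "pt \<kappa> x \<in> chart_dom \<kappa>0")
          case True then show ?thesis using x k by (simp add: overlap_iff)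
        next
          case False
          then have "pt \<kappa> x \<notin> pt \<kappa>0 ` C" using C k0 by (auto simp: subset_iff)
          then have "coord \<kappa> (pt \<kappa> x) \<in> ?O" using x k chart_topspace by (intro imageI) (auto simp: subset_iff)
          then show ?thesis using x k by simp
        qed
      qed
      ultimately show "smooth_on (target \<kappa>) (\<lambda>x. K \<kappa> x $ j)" using smooth_on_subset by blast
    qed
  next
    fix \<kappa> \<kappa>' x assume k: "\<kappa> \<in> A" and k': "\<kappa>' \<in> A" and x: "x \<in> overlap \<kappa> \<kappa>'"
    note t = transition_overlap[OF k k' x]
    have xt: "x \<in> target \<kappa>" using x overlap_target by blast
    have lin: "linear (frechet_derivative (transition \<kappa> \<kappa>') (at x))"
      by (rule has_derivative_linear[OF has_derivative_transition[OF k k' x]])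
    show "K \<kappa>' (transition \<kappa> \<kappa>' x) = frechet_derivative (transition \<kappa> \<kappa>') (at x) (K \<kappa> x)"
    proof (cases "pt \<kappa> x \<in> chart_dom \<kappa>0")
      case False then show ?thesis unfolding K_def using t(2) by (simp add: linear_0[OF lin])
    next
      case True
      let ?y = "coord \<kappa>0 (pt \<kappa> x)"
      have px: "pt \<kappa> x \<in> chart_dom \<kappa>" "pt \<kappa> x \<in> chart_dom \<kappa>'" using x k by (simp_all add: overlap_iff)
      have yo: "?y \<in> overlap \<kappa>0 \<kappa>" unfolding overlap_def using True px by blast
      have ty: "transition \<kappa>0 \<kappa> ?y = x" using True k k0 xt by (simp add: transition_pt)
      let ?U = "coord \<kappa>0 ` (chart_dom \<kappa>0 \<inter> (chart_dom \<kappa> \<inter> chart_dom \<kappa>'))"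
      have U: "open ?U" using open_coord_image[OF k0] openin_Int[OF openin_chart[OF k] openin_chart[OF k']] by blast
      have "((\<lambda>z. transition \<kappa> \<kappa>' (transition \<kappa>0 \<kappa> z)) has_derivative
        (\<lambda>v. frechet_derivative (transition \<kappa> \<kappa>') (at x) (frechet_derivative (transition \<kappa>0 \<kappa>) (at ?y) v))) (at ?y)"
        using has_derivative_compose[OF has_derivative_transition[OF k0 k yo]] has_derivative_transition[OF k k' x] unfolding ty by blast
      then have "(transition \<kappa>0 \<kappa>' has_derivative
        (\<lambda>v. frechet_derivative (transition \<kappa> \<kappa>') (at x) (frechet_derivative (transition \<kappa>0 \<kappa>) (at ?y) v))) (at ?y)"
      proof (rule has_derivative_transform_within_open[OF _ U])
        show "?y \<in> ?U" using True px by blast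
        fix z assume "z \<in> ?U"
        then obtain p where "z = coord \<kappa>0 p" "p \<in> chart_dom \<kappa>0" "p \<in> chart_dom \<kappa>" "p \<in> chart_dom \<kappa>'" by blast
        then show "transition \<kappa> \<kappa>' (transition \<kappa>0 \<kappa> z) = transition \<kappa>0 \<kappa>' z" using k k0 k' by (simp add: transition_pt)
      qed
      from partial_eqI[OF this]
      show ?thesis using True t k k' xt by (simp add: K_def y_def partial_def linear_scale[OF lin])
    qed
  qed
  then show thesis using K0 by (rule that)
qed

text \<open>The field is \<open>\<rho>\<^sup>-\<^sup>1 (1 + (x\<^sub>i - a\<^sub>i)\<^sup>2 / 2) \<partial>\<^sub>i\<close> near the point \<open>a\<close>, so its divergence is \<open>\<rho>\<^sup>-\<^sup>1 (x\<^sub>i - a\<^sub>i)\<close> there.\<close>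

lemma exists_field_vder_vdiv_nonzero:
  assumes k0: "\<kappa>0 \<in> A" and a: "a \<in> target \<kappa>0"
  obtains K where "K \<in> vector_fields A" "vder K (vdiv K) \<kappa>0 a \<noteq> 0"
proof -
  fix i :: 'd
  note ot = open_target[OF k0]
  have pa: "pt \<kappa>0 a \<in> chart_dom \<kappa>0" "pt \<kappa>0 a \<in> topspace T" using a k0 chart_topspace[OF k0] by auto
  obtain \<phi> N Kc where b: "\<phi> \<in> Fun" "openin T N" "pt \<kappa>0 a \<in> N" "N \<subseteq> Kc" "compactin T Kc" "Kc \<subseteq> chart_dom \<kappa>0 \<inter> topspace T"
    and "\<And>\<kappa>' x. \<phi> \<kappa>' x \<ge> 0"
    and one: "\<And>\<kappa>' x. \<kappa>' \<in> A \<Longrightarrow> x \<in> target \<kappa>' \<Longrightarrow> pt \<kappa>' x \<in> N \<Longrightarrow> \<phi> \<kappa>' x = 1"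
    and supp: "\<And>\<kappa>' x. \<kappa>' \<in> A \<Longrightarrow> x \<in> target \<kappa>' \<Longrightarrow> \<phi> \<kappa>' x \<noteq> 0 \<Longrightarrow> pt \<kappa>' x \<in> Kc"
    by (rule exists_bump[OF k0 pa(1) openin_topspace pa(2)], rule that) (assumption | blast)+
  \<comment> \<open>A constant factor would make the divergence zero near \<open>a\<close>; the
    quadratic term gives it a nonzero derivative there, while the field itself does not vanish at
    \<open>a\<close>.\<close>
  define u where "u x = 1 + (x $ i - a $ i) * (x $ i - a $ i) * (1 / 2)" for x :: "real^'d"
  define g where "g x = \<phi> \<kappa>0 x * (u x * inverse (\<rho> \<kappa>0 x))" for x
  have lin: "smooth_on U (\<lambda>x::real^'d. x $ i - a $ i)" if "open U" for U
    by (intro smooth_on_diff smooth_on_coordinate smooth_on_const that)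
  have su: "smooth_on (target \<kappa>0) u" unfolding u_def[abs_def]
    by (rule smooth_on_add[OF ot smooth_on_const smooth_on_mult[OF ot smooth_on_mult[OF ot lin[OF ot] lin[OF ot]] smooth_on_const]])
  have sr: "smooth_on (target \<kappa>0) (\<rho> \<kappa>0)" using rho_density k0 by (simp add: densities_def)
  have sg: "smooth_on (target \<kappa>0) g" unfolding g_def[abs_def]
    by (rule smooth_on_mult[OF ot fun_smooth[OF b(1) k0] smooth_on_mult[OF ot su smooth_on_inverse[OF ot sr rho_pos[OF k0]]]])
  have C: "compact (coord \<kappa>0 ` Kc)" "coord \<kappa>0 ` Kc \<subseteq> target \<kappa>0"
    using compact_coord_image[OF k0 b(5)] b(6) unfolding target_def by blast+
  have z: "g x = 0" if "x \<in> target \<kappa>0" "x \<notin> coord \<kappa>0 ` Kc" for x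
  proof (rule ccontr)
    assume "g x \<noteq> 0"
    then have "pt \<kappa>0 x \<in> Kc" using supp[OF k0 that(1)] by (auto simp: g_def)
    then have "coord \<kappa>0 (pt \<kappa>0 x) \<in> coord \<kappa>0 ` Kc" by blast
    then show False using that k0 by simp
  qed
  obtain K where K: "K \<in> vector_fields A" and Kx: "\<And>x. x \<in> target \<kappa>0 \<Longrightarrow> K \<kappa>0 x = g x *\<^sub>R axis i 1"
    using extend_field[OF k0 sg C z, of i] by blast
  let ?V = "coord \<kappa>0 ` (chart_dom \<kappa>0 \<inter> N)"
  have V: "open ?V" using open_coord_image[OF k0 b(2)] .
  have aV: "a \<in> ?V" using a b(3) k0 by (intro image_eqI[of _ _ "pt \<kappa>0 a"]) simp_all
  have Vt: "x \<in> target \<kappa>0" if "x \<in> ?V" for x using that by (auto simp: target_def)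
  have gr: "g x * \<rho> \<kappa>0 x = u x" if "x \<in> ?V" for x
  proof -
    have "\<phi> \<kappa>0 x = 1" using one[OF k0 Vt[OF that]] that k0 by auto
    then show ?thesis using rho_pos[OF k0 Vt[OF that]] by (simp add: g_def)
  qed
  have dr: "\<rho> \<kappa>0 differentiable (at x)" if "x \<in> target \<kappa>0" for x by (rule smooth_on_differentiable[OF sr that])
  have dl: "(\<lambda>x::real^'d. x $ i - a $ i) differentiable (at x)" for x
    by (rule smooth_on_differentiable[OF lin[OF open_UNIV] UNIV_I])
  have pl: "partial i (\<lambda>x::real^'d. x $ i - a $ i) x = 1" for x
    by (subst partial_diff) (auto simp: partial_nth smooth_on_differentiable[OF smooth_on_coordinate UNIV_I])
  have pu: "partial i u x = x $ i - a $ i" if "x \<in> target \<kappa>0" for x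
    unfolding u_def[abs_def]
    by (subst partial_add, simp, rule smooth_on_differentiable[OF smooth_on_mult[OF ot smooth_on_mult[OF ot lin[OF ot] lin[OF ot]] smooth_on_const] that],
        subst partial_mult, rule smooth_on_differentiable[OF smooth_on_mult[OF ot lin[OF ot] lin[OF ot]] that], simp,
        subst partial_mult[OF dl dl]) (simp add: pl)
  \<comment> \<open>For a field in direction \<open>i\<close>, the divergence times
    \<open>\<rho>\<close> is the derivative of \<open>g * \<rho>\<close>, which is \<open>u\<close>
    where the bump equals 1.\<close>
  have h: "vdiv K \<kappa>0 x * \<rho> \<kappa>0 x = x $ i - a $ i" if x: "x \<in> ?V" for x
  proof -
    note xt = Vt[OF x]
    have dg: "g differentiable (at x)" by (rule smooth_on_differentiable[OF sg xt])
    have "partial j (\<lambda>y. K \<kappa>0 y $ j) x = (if j = i then partial i g x else 0)" for j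
    proof -
      have "partial j (\<lambda>y. K \<kappa>0 y $ j) x = partial j (\<lambda>y. if j = i then g y else 0) x"
        by (rule partial_cong_open[OF ot xt]) (auto simp: Kx axis_def)
      then show ?thesis by simp
    qed
    then have "(\<Sum>j\<in>UNIV. partial j (\<lambda>y. K \<kappa>0 y $ j) x) = partial i g x" by simp
    moreover have "(\<Sum>j\<in>UNIV. K \<kappa>0 x $ j * partial j (\<rho> \<kappa>0) x) = g x * partial i (\<rho> \<kappa>0) x"
      by (simp add: Kx[OF xt] axis_def if_distrib if_distribR cong: if_cong)
    ultimately have "vdiv K \<kappa>0 x * \<rho> \<kappa>0 x = g x * partial i (\<rho> \<kappa>0) x + partial i g x * \<rho> \<kappa>0 x"
      using rho_pos[OF k0 xt] by (simp add: vdiv_chart[OF k0 xt])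
    also have "\<dots> = partial i (\<lambda>y. g y * \<rho> \<kappa>0 y) x" by (rule partial_mult[OF dg dr[OF xt], symmetric])
    also have "\<dots> = partial i u x" by (rule partial_cong_open[OF V x gr])
    finally show ?thesis using pu[OF xt] by simp
  qed
  have dh: "vdiv K \<kappa>0 differentiable (at a)" by (rule smooth_on_differentiable[OF fun_smooth[OF vder_adjoint(1)[OF K] k0] a])
  have "partial i (\<lambda>y. vdiv K \<kappa>0 y * \<rho> \<kappa>0 y) a = partial i (\<lambda>x. x $ i - a $ i) a"
    by (rule partial_cong_open[OF V aV h])
  \<comment> \<open>With the divergence zero at \<open>a\<close>, the derivative of
    \<open>\<rho>\<close> drops out of the product rule.\<close>
  moreover have "vdiv K \<kappa>0 a = 0" using h[OF aV] rho_pos[OF k0 a] by simp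
  ultimately have 1: "partial i (vdiv K \<kappa>0) a * \<rho> \<kappa>0 a = 1"
    unfolding partial_mult[OF dh dr[OF a]] pl by simp
  have "vder K (vdiv K) \<kappa>0 a = g a * partial i (vdiv K \<kappa>0) a"
    unfolding vder_chart[OF k0 a] by (simp add: Kx[OF a] axis_def if_distrib if_distribR cong: if_cong)
  moreover have "g a \<noteq> 0" using gr[OF aV] by (auto simp: u_def)
  moreover have "partial i (vdiv K \<kappa>0) a \<noteq> 0" using 1 by auto
  ultimately show thesis using that K by simp
qed

lemma family_equivariant_parameter:
  assumes n: "n \<ge> 2" and eq: "equivariant_modulo_vertical A n (n - 2) lam (vector_fields A) (family_lift T A \<rho> lam n b c d)"
    and k0: "\<kappa>0 \<in> A" and a: "a \<in> target \<kappa>0"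
  shows "1 + b * (2 * lam - 1) = 0"
proof -
  obtain K where K: "K \<in> vector_fields A" and nz: "vder K (vdiv K) \<kappa>0 a \<noteq> 0"
    using exists_field_vder_vdiv_nonzero[OF k0 a] .
  define h where "h = vdiv K"
  have h: "h \<in> Fun" unfolding h_def by (rule vder_adjoint(1)[OF K])
  define E where "E = vder K ^^ n"
  have E: "E \<in> DO (Suc n)" unfolding E_def by (rule vder_pow_DO[OF K])
  have D: "dop lam E \<in> diff_ops A n lam" by (rule dop_diff_ops[OF E])
  obtain E' where p: "adjoint_pair n lam (dop lam E) E'" using exists_adjoint_pair[OF D] by blast
  \<comment> \<open>Any weight other than \<open>lam\<close> serves; here
    \<open>lam - \<mu> = -1\<close>.\<close>
  define \<mu> where "\<mu> = lam + 1"
  define q where "q = (lam - \<mu>) * (1 + b * (2 * lam - 1))"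
  let ?L = "\<lambda>s. ad_op A K (family_lift T A \<rho> lam n b c d (dop lam E)) s - family_lift T A \<rho> lam n b c d (ad_weight A K lam (dop lam E)) s"
  obtain R F where R: "R \<in> DO (n - 1)" and F: "rep ?L F"
    "\<And>f. f \<in> Fun \<Longrightarrow> F \<mu> f = scale_density q (adf h (fop lam (dop lam E)) f) + R f"
    using family_equivariance_defect[OF K p n] unfolding h_def q_def by blast
  have Ff: "F \<mu> f = scale_density q (adf h E f) + R f" if f: "f \<in> Fun" for f
    unfolding F(2)[OF f] unfolding adf_def[of h] fop_dop[OF E f] fop_dop[OF E Fun_mult[OF h f]] ..
  have aE: "adf h E f \<in> Fun" if "f \<in> Fun" for f
    unfolding adf_def[of h] by (intro Fun_diff Fun_mult h DO_Fun[OF E] that)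
  have FF: "F \<mu> f \<in> Fun" if "f \<in> Fun" for f
    unfolding Ff[OF that] by (rule Fun_add[OF Fun_scale[OF aE[OF that]] DO_Fun[OF R that]])
  have "vertical_order A (n - 2) ?L"
    using eq K D unfolding equivariant_modulo_vertical_def eq_modulo_vertical_def vertical_ops_def by blast
  \<comment> \<open>Verticality supplies \<open>n - 1\<close> commutators with \<open>h\<close>, and
    the one in the defect is the \<open>n\<close>-th, which leaves a function of \<open>E\<close>.
    The same \<open>n - 1\<close> commutators annihilate \<open>R\<close>.\<close>
  note v = vertical_adf[OF this F(1) h one_density_in FF]
  have m: "Suc (n - 2) = n - 1" "Suc (n - 1) = n" using n by auto
  have "0 = (adf h ^^ (n - 1)) (F \<mu>) (one_density A)" using v unfolding m by simp
  also have "\<dots> = (adf h ^^ (n - 1)) (\<lambda>f. scale_density q (adf h E f) + R f) (one_density A)"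
    by (rule adf_cong[OF Ff h one_density_in])
  also have "\<dots> = scale_density q ((adf h ^^ (n - 1)) (adf h E) (one_density A)) + (adf h ^^ (n - 1)) R (one_density A)"
    unfolding adf_pow_lin ..
  also have "(adf h ^^ (n - 1)) (adf h E) = (adf h ^^ n) E"
    using fun_cong[OF funpow_Suc_right[of "n - 1" "adf h"], of E] unfolding m o_apply by (rule sym)
  also have "(adf h ^^ (n - 1)) R (one_density A) = 0" by (rule adf_pow_zero[OF R h one_density_in])
  finally have "0 = scale_density q ((adf h ^^ n) E (one_density A))" unfolding add_0_right .
  from fun_cong[OF fun_cong[OF this], of \<kappa>0 a]
  have "0 = q * (fact n * (vder K h \<kappa>0 a) ^ n * one_density A \<kappa>0 a)"
    unfolding E_def scale_density_def adf_pow_vder_pow[OF K h one_density_in] zero_fun_apply .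
  then show ?thesis using nz k0 a unfolding h_def q_def \<mu>_def one_density_def by simp
qed

text \<open>Equivariance determines \<open>b\<close> alone; the terms with \<open>c\<close> and
  \<open>d\<close> remain free, but they multiply by functions and are vertical of order 0, which is
  at most \<open>n - 2\<close>.\<close>

lemma family_equivariant_mod_unique:
  assumes lam: "lam \<noteq> 1 / 2" and n: "n \<ge> 2"
    and eq: "equivariant_modulo_vertical A n (n - 2) lam (vector_fields A) (family_lift T A \<rho> lam n b c d)"
  shows "same_modulo_vertical A n (n - 2) lam (family_lift T A \<rho> lam n b c d) (disting_lift T A \<rho> lam n)"
  unfolding same_modulo_vertical_def
proof
  fix D assume D: "D \<in> diff_ops A n lam"
  obtain E' where p: "adjoint_pair n lam D E'" using exists_adjoint_pair[OF D] by blast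
  define E where "E = fop lam D"
  have E: "E \<in> DO (Suc n)" "E' \<in> DO (Suc n)" using p fop_DO unfolding adjoint_pair_def E_def by blast+
  have n1: "n \<ge> 1" using n by simp
  let ?C = "\<lambda>\<mu>. \<Sum>k=1..n. c k * (\<mu> - lam) ^ k" and ?D = "\<lambda>\<mu>. \<Sum>k=1..n. d k * (\<mu> - lam) ^ k"
  note rd = rep_diff[OF rep_family[OF p, of b c d] rep_disting[OF p], folded E_def]
  show "eq_modulo_vertical A n (n - 2) (family_lift T A \<rho> lam n b c d D) (disting_lift T A \<rho> lam n D)"
  proof (rule eq_modulo_verticalI[OF family_hat[OF p n1] disting_hat[OF lam D n1] rd])
    fix \<mu>
    let ?F = "\<lambda>f. Ffam (\<lambda>\<mu>. 1 - b * (\<mu> - lam)) (\<lambda>\<mu>. (-1) ^ n * b * (\<mu> - lam)) ?C ?D E E' \<mu> f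
      - (scale_density ((\<mu> + lam - 1) / (2 * lam - 1)) (E f) + scale_density ((-1) ^ n * ((lam - \<mu>) / (2 * lam - 1))) (E' f))"
    show "?F \<in> DO (Suc (n - 2))"
    proof (cases "\<exists>\<kappa>\<in>A. target \<kappa> \<noteq> {}")
      case True
      then obtain \<kappa>0 a where "\<kappa>0 \<in> A" "a \<in> target \<kappa>0" by blast
      from family_equivariant_parameter[OF n eq this] have b: "b = - 1 / (2 * lam - 1)"
        using lam by (simp add: field_simps)
      have nz: "2 * lam - 1 \<noteq> 0" using lam by auto
      have 1: "1 - b * (\<mu> - lam) = (\<mu> + lam - 1) / (2 * lam - 1)" "(-1) ^ n * b * (\<mu> - lam) = (-1) ^ n * ((lam - \<mu>) / (2 * lam - 1))"
        using nz by (simp_all add: b field_simps)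
      let ?M = "\<lambda>f. scale_density (?C \<mu>) (E (one_density A) * f) + scale_density (?D \<mu>) (E' (one_density A) * f)"
      have "?M \<in> DO 1"
        by (intro DO_add DO_scale DO_multop DO_Fun[OF E(1)] DO_Fun[OF E(2)] one_density_in)
      then have "?M \<in> DO (Suc (n - 2))" by (rule DO_mono) simp
      then show ?thesis
      proof (rule DO_cong)
        fix f
        have gen: "v + w = x + y + v + w - (x + y)" for x y v w :: "('a, 'd) density" by simp
        show "?F f = ?M f" unfolding Ffam_def 1 by (rule gen[symmetric])
      qed
    next
      \<comment> \<open>If all chart targets are empty, no value of \<open>b\<close> is forced, but
        the local condition on the order is void.\<close>
      case False
      have F: "?F \<in> DO (Suc n)" by (rule DO_diff[OF Ffam_DO[OF E] DO_add[OF DO_scale[OF E(1)] DO_scale[OF E(2)]]])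
      show ?thesis
      proof (rule DO_I)
        fix \<kappa> assume k: "\<kappa> \<in> A"
        have "target \<kappa> = {}" using False k by blast
        moreover have "ldo (target \<kappa>) (Suc (n - 2)) (\<lambda>f x. 0)" by (rule ldo_0)
        ultimately show "\<exists>L. ldo (target \<kappa>) (Suc (n - 2)) L \<and> (\<forall>f\<in>Fun. \<forall>x\<in>target \<kappa>. ?F f \<kappa> x = L (f \<kappa>) x)" by blast
      qed (rule DO_Fun[OF F])
    qed
  qed
qed

section \<open>Change of the volume form\<close>

lemma positive_powr_Fun:
  assumes u: "u \<in> Fun" "\<And>\<kappa> x. \<kappa> \<in> A \<Longrightarrow> x \<in> target \<kappa> \<Longrightarrow> u \<kappa> x > 0"
  shows "density_powr u a \<in> Fun"
proof (rule funI)
  fix \<kappa> assume k: "\<kappa> \<in> A"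
  show "smooth_on (target \<kappa>) (density_powr u a \<kappa>)"
    unfolding density_powr_def by (rule smooth_on_powr[OF open_target[OF k] fun_smooth[OF u(1) k] u(2)[OF k]])
next
  show "density_powr u a \<kappa> x = density_powr u a \<kappa>' (transition \<kappa> \<kappa>' x)"
    if "\<kappa> \<in> A" "\<kappa>' \<in> A" "x \<in> overlap \<kappa> \<kappa>'" for \<kappa> \<kappa>' x
    unfolding density_powr_def fun_transition[OF u(1) that] ..
next
  show "density_powr u a \<kappa> x = 0" if "\<kappa> \<notin> A \<or> x \<notin> target \<kappa>" for \<kappa> x
    using densitiesD(3)[OF u(1) that] by (simp add: density_powr_def)
qed

lemma positive_ln_Fun:
  assumes u: "u \<in> Fun" "\<And>\<kappa> x. \<kappa> \<in> A \<Longrightarrow> x \<in> target \<kappa> \<Longrightarrow> u \<kappa> x > 0"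
  shows "(\<lambda>\<kappa> x. ln (u \<kappa> x)) \<in> Fun"
proof (rule funI)
  fix \<kappa> assume k: "\<kappa> \<in> A"
  show "smooth_on (target \<kappa>) (\<lambda>x. ln (u \<kappa> x))"
    by (rule smooth_on_ln[OF open_target[OF k] fun_smooth[OF u(1) k] u(2)[OF k]])
next
  show "ln (u \<kappa> x) = ln (u \<kappa>' (transition \<kappa> \<kappa>' x))"
    if "\<kappa> \<in> A" "\<kappa>' \<in> A" "x \<in> overlap \<kappa> \<kappa>'" for \<kappa> \<kappa>' x
    unfolding fun_transition[OF u(1) that] ..
next
  show "ln (u \<kappa> x) = 0" if "\<kappa> \<notin> A \<or> x \<notin> target \<kappa>" for \<kappa> x
    using densitiesD(3)[OF u(1) that] by simp
qed

lemma DO_conjugation_second_order: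
  assumes u: "u \<in> Fun" "\<And>\<kappa> x. \<kappa> \<in> A \<Longrightarrow> x \<in> target \<kappa> \<Longrightarrow> u \<kappa> x > 0" and E: "E \<in> DO k"
  shows "(\<lambda>f. (density_powr u a * E (density_powr u (- a) * f) - E f)
    + scale_density a (E ((\<lambda>\<kappa> x. ln (u \<kappa> x)) * f) - (\<lambda>\<kappa> x. ln (u \<kappa> x)) * E f)) \<in> DO (k - 2)" (is "?T \<in> _")
proof (rule DO_I)
  note g = positive_powr_Fun[OF u] and l = positive_ln_Fun[OF u]
  show "?T f \<in> Fun" if f: "f \<in> Fun" for f
    by (intro Fun_add Fun_diff Fun_scale Fun_mult g l DO_Fun[OF E] f)
  fix \<kappa> assume k: "\<kappa> \<in> A"
  obtain L where L: "ldo (target \<kappa>) k L" "\<forall>f\<in>Fun. \<forall>x\<in>target \<kappa>. E f \<kappa> x = L (f \<kappa>) x"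
    using DO_local[OF E k] by blast
  show "\<exists>L. ldo (target \<kappa>) (k - 2) L \<and> (\<forall>f\<in>Fun. \<forall>x\<in>target \<kappa>. ?T f \<kappa> x = L (f \<kappa>) x)"
  proof (intro exI conjI ballI)
    show "ldo (target \<kappa>) (k - 2) (\<lambda>f x. (u \<kappa> x powr a * L (\<lambda>y. u \<kappa> y powr (- a) * f y) x - L f x)
      + a * (L (\<lambda>y. ln (u \<kappa> y) * f y) x - ln (u \<kappa> x) * L f x))"
      by (rule ldo_conjugation_second_order[OF open_target[OF k] fun_smooth[OF u(1) k] u(2)[OF k] L(1)])
    fix f x assume f: "f \<in> Fun" and x: "x \<in> target \<kappa>"
    have 1: "E (density_powr u (- a) * f) \<kappa> x = L (\<lambda>y. u \<kappa> y powr (- a) * f \<kappa> y) x"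
      using L(2) Fun_mult[OF g f] x unfolding mult_app density_powr_def by fastforce
    have 2: "E ((\<lambda>\<kappa> x. ln (u \<kappa> x)) * f) \<kappa> x = L (\<lambda>y. ln (u \<kappa> y) * f \<kappa> y) x"
      using L(2) Fun_mult[OF l f] x unfolding mult_app by fastforce
    have 3: "E f \<kappa> x = L (f \<kappa>) x" using L(2) f x by blast
    have gen: "((w * v - z) + scale_density a (c - m * z)) \<kappa> x = (w \<kappa> x * v \<kappa> x - z \<kappa> x) + a * (c \<kappa> x - m \<kappa> x * z \<kappa> x)"
      for w v z c m :: "('a, 'd) density" by (simp add: scale_density_def)
    show "?T f \<kappa> x = (u \<kappa> x powr a * L (\<lambda>y. u \<kappa> y powr (- a) * f \<kappa> y) x - L (f \<kappa>) x)
      + a * (L (\<lambda>y. ln (u \<kappa> y) * f \<kappa> y) x - ln (u \<kappa> x) * L (f \<kappa>) x)"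
      unfolding gen 1 2 3 by (simp only: density_powr_def)
  qed
qed

lemma disting_volume_independent:
  assumes lam: "lam \<noteq> 1 / 2" and n: "n \<ge> 2" and rho': "volume_form A \<rho>'"
  shows "same_modulo_vertical A n (n - 2) lam (disting_lift T A \<rho> lam n) (disting_lift T A \<rho>' lam n)"
  unfolding same_modulo_vertical_def
proof
  fix D assume D: "D \<in> diff_ops A n lam"
  interpret V: volume_manifold T A \<rho>' by unfold_locales (rule manifold, rule rho')
  let ?rp = "density_powr \<rho>'"
  \<comment> \<open>The positive function \<open>\<rho>' / \<rho>\<close>; the two identifications
    of densities with functions differ by its powers.\<close>
  define u where "u = ?rp 1 * rp (- 1)"
  define g where "g = density_powr u"
  define l where "l = (\<lambda>\<kappa> x. ln (u \<kappa> x))"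
  have u: "u \<in> Fun" unfolding u_def using mult_density[OF V.rho_powr_density[of 1] rho_powr_density[of "- 1"]] by simp
  have up: "u \<kappa> x > 0" if "\<kappa> \<in> A" "x \<in> target \<kappa>" for \<kappa> x
    using rho_pos[OF that] V.rho_pos[OF that] by (simp add: u_def density_powr_def)
  have gF: "g a \<in> Fun" for a unfolding g_def by (rule positive_powr_Fun[OF u up])
  have lF: "l \<in> Fun" unfolding l_def by (rule positive_ln_Fun[OF u up])
  have g_mult: "g a * (g b * f) = g (a + b) * f" for a b f
    by (rule density_eqI) (simp add: g_def density_powr_def powr_add)
  have g0: "g 0 * f = f" if "f \<in> Fun" for f
  proof (rule density_eqI)
    show "(g 0 * f) \<kappa> x = f \<kappa> x" for \<kappa> x
      using up[of \<kappa> x] densitiesD(3)[OF that, of \<kappa> x]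
      by (cases "\<kappa> \<in> A \<and> x \<in> target \<kappa>") (auto simp: g_def density_powr_def)
  qed
  have rg: "?rp a = g a * rp a" for a
  proof (rule density_eqI)
    show "?rp a \<kappa> x = (g a * rp a) \<kappa> x" for \<kappa> x
      using rho_pos[of \<kappa> x] V.rho_pos[of \<kappa> x] densitiesD(3)[OF rho_density, of \<kappa> x] densitiesD(3)[OF V.rho_density, of \<kappa> x]
      by (cases "\<kappa> \<in> A \<and> x \<in> target \<kappa>") (auto simp: g_def u_def density_powr_def powr_minus mult.assoc simp flip: powr_mult)
  qed
  obtain E' where p: "adjoint_pair n lam D E'" using exists_adjoint_pair[OF D] by blast
  define E where "E = fop lam D"
  have E: "E \<in> DO (Suc n)" "E' \<in> DO (Suc n)" using p fop_DO unfolding adjoint_pair_def E_def by blast+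
  have adj: "adjrel E E'" using p unfolding adjoint_pair_def E_def by blast
  let ?Z = "\<lambda>f. E f - scale_density ((-1) ^ n) (E' f)"
  have Z: "?Z \<in> DO n" using adjoint_pair_symbol[OF p] unfolding E_def .
  \<comment> \<open>With \<open>\<rho>'\<close> in place of \<open>\<rho>\<close>, the operator
    \<open>E\<close> becomes its conjugate with \<open>u\<close> to the power \<open>- lam\<close>
    outside and \<open>lam\<close> inside, and the measure gains a factor \<open>u\<close>. Moving
    these powers through the integral leaves \<open>lam - 1\<close> outside and
    \<open>1 - lam\<close> inside the adjoint.\<close>
  define Y where "Y = (\<lambda>f. g (lam - 1) * E' (g (1 - lam) * f))"
  have Vfop: "V.fop lam D f = g (- lam) * E (g lam * f)" for f
    unfolding V.fop_def E_def fop_def rg by (simp only: mult.assoc mult.left_commute[of "rp lam"])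
  have rho'_eq: "\<rho>' = g 1 * \<rho>" using rg[of 1] unfolding V.rp_1 rp_1 .
  have Vp: "V.adjoint_pair n lam D Y"
    unfolding V.adjoint_pair_def
  proof (intro conjI D)
    show "Y \<in> DO (Suc n)" unfolding Y_def by (rule DO_mult[OF DO_mult_pre[OF E(2) gF] gF])
    show "V.adjrel (V.fop lam D) Y"
      unfolding V.adjrel_def
    proof (intro ballI impI)
      fix f h assume f: "f \<in> Fun" "cpt f" and h: "h \<in> Fun" "cpt h"
      have "\<rho>' * (V.fop lam D f * h) = \<rho> * (E (g lam * f) * (g (1 + - lam) * h))"
        unfolding Vfop unfolding rho'_eq g_mult[symmetric] by (simp only: mult.assoc mult.left_commute)
      moreover have "\<rho>' * (f * Y h) = \<rho> * ((g lam * f) * E' (g (1 + - lam) * h))"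
      proof -
        have "g lam * E'' = g 1 * (g (lam - 1) * E'')" for E'' unfolding g_mult by simp
        then have "g lam * (f * E'') = g 1 * (f * (g (lam - 1) * E''))" for E''
          unfolding mult.left_commute[of "g lam" f] mult.left_commute[of "g 1" f] by (rule arg_cong)
        then show ?thesis unfolding Y_def rho'_eq mult.assoc add_uminus_conv_diff by (simp only: mult.left_commute[of \<rho>])
      qed
      moreover have "density_integral T A (\<rho> * (E (g lam * f) * (g (1 + - lam) * h))) = density_integral T A (\<rho> * ((g lam * f) * E' (g (1 + - lam) * h)))"
        using adj Fun_mult[OF gF f(1)] Fun_mult[OF gF h(1)] cpt_mult(3)[OF f(2)] cpt_mult(3)[OF h(2)] unfolding adjrel_def by blast
      ultimately show "density_integral T A (\<rho>' * (V.fop lam D f * h)) = density_integral T A (\<rho>' * (f * Y h))" by simp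
    qed
  qed
  define a where "a \<mu> = (\<mu> + lam - 1) / (2 * lam - 1)" for \<mu>
  define e where "e \<mu> = (-1) ^ n * ((lam - \<mu>) / (2 * lam - 1))" for \<mu>
  define t where "t \<mu> = (\<mu> - lam) * (\<mu> + lam - 1) / (2 * lam - 1)" for \<mu>
  have nz: "2 * lam - 1 \<noteq> 0" using lam by auto
  \<comment> \<open>Coefficient times exponent is the same for \<open>E\<close> and
    \<open>E'\<close> up to the sign \<open>- (-1)\<^sup>n\<close>, so the first-order terms combine
    into the commutator of \<open>E - (-1)\<^sup>n E'\<close> with \<open>l\<close>.\<close>
  have at: "a \<mu> * (\<mu> - lam) = t \<mu>" "e \<mu> * (\<mu> + lam - 1) = - (t \<mu> * (-1) ^ n)" for \<mu>
    using nz by (simp_all add: a_def e_def t_def field_simps)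
  \<comment> \<open>Read through \<open>\<rho>\<close>, the operators at weight \<open>\<mu>\<close>
    are conjugated once more, by \<open>u\<close> to the power \<open>\<mu>\<close>; added to
    \<open>- lam\<close> and \<open>lam - 1\<close> this gives the two exponents.\<close>
  let ?H = "\<lambda>\<mu> f. scale_density (a \<mu>) (g (\<mu> - lam) * E (g (- (\<mu> - lam)) * f))
    + scale_density (e \<mu>) (g (\<mu> + lam - 1) * E' (g (- (\<mu> + lam - 1)) * f))"
  have R': "rep (disting_lift T A \<rho>' lam n D) ?H"
    unfolding rep_def
  proof (intro ballI allI)
    fix s \<mu> assume s: "s \<in> Alg"
    have c: "g \<mu> * scale_density x v = scale_density x (g \<mu> * v)" for x v
      by (rule density_eqI) (simp add: scale_density_def)
    have r: "?rp \<mu> * v = rp \<mu> * (g \<mu> * v)" for v \<mu> unfolding rg by (simp only: mult.assoc mult.left_commute)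
    have q: "- (\<mu> + - lam) = lam + - \<mu>" "\<mu> - lam = \<mu> + - lam" "\<mu> + lam - 1 = \<mu> + (lam - 1)" "- (\<mu> + (lam - 1)) = (1 - lam) + - \<mu>" by simp_all
    have m: "rp (- \<mu>) * (g (- \<mu>) * v) = g (- \<mu>) * (rp (- \<mu>) * v)" for v by (rule mult.left_commute)
    show "lu (disting_lift T A \<rho>' lam n D s) \<mu> = rp \<mu> * ?H \<mu> (rp (- \<mu>) * lu s \<mu>)"
      unfolding V.repD[OF V.rep_disting[OF Vp] s] r Vfop Y_def distrib_left[of "g \<mu>"] c m a_def[symmetric] e_def[symmetric]
      unfolding g_mult q ..
  qed
  note rd = rep_diff[OF rep_disting[OF p, folded E_def a_def e_def] R']
  have n1: "n \<ge> 1" using n by simp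
  show "eq_modulo_vertical A n (n - 2) (disting_lift T A \<rho> lam n D) (disting_lift T A \<rho>' lam n D)"
  proof (rule eq_modulo_verticalI[OF disting_hat[OF lam D n1] V.disting_hat[OF lam D n1] rd])
    fix \<mu>
    let ?T = "\<lambda>E b f. (g b * E (g (- b) * f) - E f) + scale_density b (E (l * f) - l * E f)"
    \<comment> \<open>As \<open>DO\<close> bounds the order strictly, \<open>Suc (n - 2)\<close>
      stands for order at most \<open>n - 2\<close>. The second-order remainders of \<open>E\<close>
      and \<open>E'\<close> and the single commutator of \<open>?Z\<close> all reach this
      index.\<close>
    have m: "Suc n - 2 = Suc (n - 2)" "n - 1 = Suc (n - 2)" using n by auto
    have T: "?T E b \<in> DO (Suc (n - 2))" "?T E' b \<in> DO (Suc (n - 2))" for b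
      using DO_conjugation_second_order[OF u up E(1)] DO_conjugation_second_order[OF u up E(2)] unfolding g_def l_def m by blast+
    have C: "(\<lambda>f. ?Z (l * f) - l * ?Z f) \<in> DO (Suc (n - 2))" using DO_commutator[OF Z lF] unfolding m .
    have gen1: "scale_density a x + scale_density e y - (scale_density a x' + scale_density e y')
      = scale_density (- a) (x' - x + scale_density b (c - l * x)) + scale_density (- e) (y' - y + scale_density b' (c' - l * y))
        + (scale_density (a * b) (c - l * x) + scale_density (e * b') (c' - l * y))" for a e b b' and x y x' y' c c' :: "('a, 'd) density"
      by (rule density_eqI) (simp add: scale_density_def algebra_simps)
    have gen2: "scale_density t (c - l * x) + scale_density (- (t * s)) (c' - l * y)
      = scale_density t ((c - scale_density s c') - l * (x - scale_density s y))" for t s and c c' x y :: "('a, 'd) density"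
      by (rule density_eqI) (simp add: scale_density_def algebra_simps)
    let ?F = "\<lambda>f. scale_density (- a \<mu>) (?T E (\<mu> - lam) f) + scale_density (- e \<mu>) (?T E' (\<mu> + lam - 1) f)
      + scale_density (t \<mu>) (?Z (l * f) - l * ?Z f)"
    have F: "?F \<in> DO (Suc (n - 2))"
      by (rule DO_add[OF DO_add[OF DO_scale[OF T(1)] DO_scale[OF T(2)]] DO_scale[OF C]])
    show "(\<lambda>f. scale_density (a \<mu>) (E f) + scale_density (e \<mu>) (E' f) - ?H \<mu> f) \<in> DO (Suc (n - 2))"
    proof (rule DO_cong[OF F])
      fix f
      show "scale_density (a \<mu>) (E f) + scale_density (e \<mu>) (E' f) - ?H \<mu> f = ?F f"
        unfolding gen1[of "a \<mu>" "E f" "e \<mu>" "E' f" _ _ "\<mu> - lam" "E (l * f)" "\<mu> + lam - 1" "E' (l * f)"] at gen2 ..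
    qed
  qed
qed

end

theorem proposition2:
  fixes T :: "'a topology" and A :: "('a, 'd::finite) chart set"
    and \<rho> :: "('a, 'd) density" and lam :: real and n :: nat
  assumes "smooth_manifold T A"
    and "volume_form A \<rho>"
    and "lam \<noteq> 1 / 2"
    and "n \<ge> 1"
  shows
    "(\<forall>b c d. regular_lifting A n lam (family_lift T A \<rho> lam n b c d) \<and>
        equivariant A n lam (sdiff A \<rho>) (family_lift T A \<rho> lam n b c d))
   \<and> (\<exists>b c d. \<forall>D\<in>diff_ops A n lam.
        op_eq A (family_lift T A \<rho> lam n b c d D) (disting_lift T A \<rho> lam n D))
   \<and> (\<forall>D\<in>diff_ops A n lam.
        op_eq A (adjoint_op T A (disting_lift T A \<rho> lam n D))
          (\<lambda>s. weight_fun (\<lambda>_. (-1) ^ n) (disting_lift T A \<rho> lam n D s)))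
   \<and> (n \<ge> 2 \<longrightarrow>
        (\<forall>\<rho>'. volume_form A \<rho>' \<longrightarrow>
          same_modulo_vertical A n (n - 2) lam
            (disting_lift T A \<rho> lam n) (disting_lift T A \<rho>' lam n))
      \<and> equivariant_modulo_vertical A n (n - 2) lam (vector_fields A) (disting_lift T A \<rho> lam n)
      \<and> (\<forall>b c d.
          equivariant_modulo_vertical A n (n - 2) lam (vector_fields A)
            (family_lift T A \<rho> lam n b c d) \<longrightarrow>
          same_modulo_vertical A n (n - 2) lam
            (family_lift T A \<rho> lam n b c d) (disting_lift T A \<rho> lam n)))"
proof -
  interpret volume_manifold T A \<rho> by unfold_locales (rule assms)+
  show ?thesis
  proof (intro conjI allI impI)
    show "regular_lifting A n lam (family_lift T A \<rho> lam n b c d)" for b c d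
      by (rule family_pencil_lifting[OF assms(4)])
    show "equivariant A n lam (sdiff A \<rho>) (family_lift T A \<rho> lam n b c d)" for b c d
      by (rule family_sdiff_equivariant)
    show "\<exists>b c d. \<forall>D\<in>diff_ops A n lam. op_eq A (family_lift T A \<rho> lam n b c d D) (disting_lift T A \<rho> lam n D)"
      using family_disting[OF assms(3)] by blast
    show "\<forall>D\<in>diff_ops A n lam. op_eq A (adjoint_op T A (disting_lift T A \<rho> lam n D))
        (\<lambda>s. weight_fun (\<lambda>_. (-1) ^ n) (disting_lift T A \<rho> lam n D s))"
      using disting_selfadjoint[OF assms(3)] assms(4) by blast
  next
    assume n: "n \<ge> 2"
    show "same_modulo_vertical A n (n - 2) lam (disting_lift T A \<rho> lam n) (disting_lift T A \<rho>' lam n)"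
      if "volume_form A \<rho>'" for \<rho>' by (rule disting_volume_independent[OF assms(3) n that])
    show "equivariant_modulo_vertical A n (n - 2) lam (vector_fields A) (disting_lift T A \<rho> lam n)"
      by (rule disting_equivariant_mod[OF assms(3) n])
    show "same_modulo_vertical A n (n - 2) lam (family_lift T A \<rho> lam n b c d) (disting_lift T A \<rho> lam n)"
      if "equivariant_modulo_vertical A n (n - 2) lam (vector_fields A) (family_lift T A \<rho> lam n b c d)" for b c d
      by (rule family_equivariant_mod_unique[OF assms(3) n that])
  qed
qed

end
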